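(* Let $\mathfrak{n}$ be a (finite-dimensional) complex nilpotent Lie algebra, let $U$ be the corresponding unipotent algebraic group, and let $n\ge 1$. Then the correspondence $\rho\mapsto \mathbb{M}_{\alpha_\rho}$ induces an identification (a bijection on points) $$\operatorname{Hom}_{\text{Lie alg}}(\mathfrak{n}, \mathfrak{gl}_n(\mathbb{C}))/\!\!/\operatorname{GL}_n(\mathbb{C}) = \{\text{invariant } D\text{-modules of rank } n \text{ over } U\}/\sim,$$ where $\sim$ denotes isomorphism of $D(U)$-modules. Moreover, the fibers of the quotient map $$\operatorname{Hom}_{\text{Lie alg}}(\mathfrak{n}, \mathfrak{gl}_n(\mathbb{C})) \twoheadrightarrow \operatorname{Hom}_{\text{Lie alg}}(\mathfrak{n}, \mathfrak{gl}_n(\mathbb{C}))/\!\!/\operatorname{GL}_n(\mathbb{C})$$ are exactly the isomorphism classes of invariant $D$-modules of rank $n$ on $U$; that is, $\rho_1,\rho_2$ lie in the same fiber if and only if $\mathbb{M}_{\alpha_{\rho_1}}\cong\mathbb{M}_{\alpha_{\rho_2}}$ as $D(U)$-modules.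
   Context: Everything is over $\mathbb{C}$. $\operatorname{Hom}_{\text{Lie alg}}(\mathfrak{n},\mathfrak{gl}_n(\mathbb{C}))$ is the affine variety of Lie algebra homomorphisms $\mathfrak{n}\to\mathfrak{gl}_n(\mathbb{C})$, with $\operatorname{GL}_n(\mathbb{C})$ acting by conjugation, and $\operatorname{Hom}_{\text{Lie alg}}(\mathfrak{n},\mathfrak{gl}_n(\mathbb{C}))/\!\!/\operatorname{GL}_n(\mathbb{C}) := \operatorname{Spec}\big(\mathbb{C}[\operatorname{Hom}_{\text{Lie alg}}(\mathfrak{n},\mathfrak{gl}_n(\mathbb{C}))]^{\operatorname{GL}_n(\mathbb{C})}\big)$. $D(U)$ is the algebra of algebraic differential operators on $U$, generated by $\mathbb{C}[U]$ and the Lie algebra $\operatorname{Der}_{\mathbb{C}}(\mathbb{C}[U])$ of vector fields. A matrix-valued 1-form $\alpha\in M_n(\Omega_{\mathbb{C}[U]})$ is flat if $d\alpha+\alpha\wedge\alpha=0$. For flat $\alpha$, $\mathbb{M}_\alpha$ is the $D(U)$-module structure on $\mathbb{C}[U]^{\oplus n}$ extending the $\mathbb{C}[U]$-module structure with $v(e_1,\dots,e_n)=(e_1,\dots,e_n)\alpha(v)$ for $v\in\operatorname{Der}_{\mathbb{C}}(\mathbb{C}[U])$, where $e_1,\dots,e_n$ is the standard basis; its rank is $n$. An invariant $D$-module of rank $n$ over $U$ is a module $\mathbb{M}_\alpha$ with $\alpha$ flat and invariant under the action of $U$ on itself by left multiplication. Identify $\mathfrak{n}$ with left-invariant vector fields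 on $U$ and $\mathfrak{n}^*$ with left-invariant 1-forms. For a representation $\rho:\mathfrak{n}\to\mathfrak{gl}_n(\mathbb{C})$, a basis $x_1,\dots,x_l$ of $\mathfrak{n}$ and its dual basis $x^1,\dots,x^l$, put $\alpha_\rho=\sum_i\rho(x_i)x^i$. The map $\rho\mapsto\alpha_\rho$ is a bijection from $n$-dimensional representations of $\mathfrak{n}$ to flat invariant 1-forms in $M_n(\Omega_{\mathbb{C}[U]})$. *)

theory Defs
  imports
    "HOL-Analysis.Analysis"
    "HOL-Algebra.Module"
    "HOL-Algebra.Ideal"
    "HOL-Library.Function_Algebras"
begin

text \<open>
  Sums, differences and products of functions (and of operators on functions) are pointwise,
  by the instances of \<open>HOL-Library.Function_Algebras\<close>; in particular \<open>*\<close> is never composition.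
  A function on a set \<open>X\<close> is represented by a total function that is \<open>0\<close> outside \<open>X\<close>, so the unit
  of a ring of functions on \<open>X\<close> is the indicator function of \<open>X\<close>.
\<close>

section \<open>Nilpotent Lie algebras\<close>

locale complex_lie_algebra = finite_dimensional_vector_space smul B
  for smul :: "complex \<Rightarrow> 'a::ab_group_add \<Rightarrow> 'a" and B :: "'a set" +
  fixes bracket :: "'a \<Rightarrow> 'a \<Rightarrow> 'a"
  assumes bracket_add_left: "bracket (x + y) z = bracket x z + bracket y z"
    and bracket_add_right: "bracket x (y + z) = bracket x y + bracket x z"
    and bracket_scale_left: "bracket (smul c x) y = smul c (bracket x y)"
    and bracket_scale_right: "bracket x (smul c y) = smul c (bracket x y)"
    and bracket_self: "bracket x x = 0"
    and jacobi: "bracket x (bracket y z) + bracket y (bracket z x) + bracket z (bracket x y) = 0"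
begin

primrec lower_central :: "nat \<Rightarrow> 'a set" where
  "lower_central 0 = UNIV"
| "lower_central (Suc k) = span {bracket x y | x y. y \<in> lower_central k}"

end

locale nilpotent_lie_algebra = complex_lie_algebra +
  assumes nilpotent: "\<exists>k. lower_central k = {0}"


section \<open>Rings of regular functions\<close>

inductive_set generated_algebra :: "('x \<Rightarrow> complex) set \<Rightarrow> ('x \<Rightarrow> complex) set"
  for G :: "('x \<Rightarrow> complex) set" where
  const: "(\<lambda>_. c) \<in> generated_algebra G"
| gen: "f \<in> G \<Longrightarrow> f \<in> generated_algebra G"
| add: "f \<in> generated_algebra G \<Longrightarrow> g \<in> generated_algebra G \<Longrightarrow> f + g \<in> generated_algebra G"
| mult: "f \<in> generated_algebra G \<Longrightarrow> g \<in> generated_algebra G \<Longrightarrow> f * g \<in> generated_algebra G"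

definition on_set :: "'x set \<Rightarrow> ('x \<Rightarrow> complex) \<Rightarrow> 'x \<Rightarrow> complex" where
  "on_set X f = (\<lambda>x. if x \<in> X then f x else 0)"

definition fun_ring :: "'x set \<Rightarrow> ('x \<Rightarrow> complex) set \<Rightarrow> ('x \<Rightarrow> complex) ring" where
  "fun_ring X A = \<lparr>carrier = A, mult = (*), one = on_set X (\<lambda>_. 1), zero = 0, add = (+)\<rparr>"


section \<open>Unipotent algebraic groups\<close>

type_synonym 'm fn = "complex^'m^'m \<Rightarrow> complex"
type_synonym 'm operator = "'m fn \<Rightarrow> 'm fn"

definition entry_functions :: "('m::finite) fn set" where
  "entry_functions = {\<lambda>A. A $ i $ j | i j. True}"

text \<open>
  Affine algebraic groups are taken embedded, as Zariski closed subgroups of \<open>GL\<^sub>m(\<complex>)\<close> with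
  \<open>m = CARD('m)\<close>.
\<close>

definition linear_algebraic_group :: "(complex^'m^'m) set \<Rightarrow> bool" where
  "linear_algebraic_group U \<longleftrightarrow>
     mat 1 \<in> U \<and> (\<forall>g\<in>U. \<forall>h\<in>U. g ** h \<in> U) \<and> (\<forall>g\<in>U. matrix_inv g \<in> U) \<and>
     (\<exists>P \<subseteq> generated_algebra entry_functions. U = {g. invertible g \<and> (\<forall>p\<in>P. p g = 0)})"

text \<open>The iterated map is used because \<open>^\<close> is not the matrix power on \<open>complex^'m^'m\<close>.\<close>

definition unipotent_group :: "(complex^'m^'m) set \<Rightarrow> bool" where
  "unipotent_group U \<longleftrightarrow> linear_algebraic_group U \<and>
     (\<forall>g\<in>U. \<exists>k. (((\<lambda>A. (g - mat 1) ** A) ^^ k) (mat 1)) = 0)"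

definition regular_functions :: "(complex^'m^'m) set \<Rightarrow> ('m::finite) fn set" where
  "regular_functions U =
     on_set U ` generated_algebra (entry_functions \<union> {\<lambda>A. inverse (det A)})"

text \<open>Operators on \<open>\<complex>[U]\<close> are extended by \<open>0\<close> outside \<open>\<complex>[U]\<close>.\<close>

definition derivations :: "(complex^'m^'m) set \<Rightarrow> ('m::finite) operator set" where
  "derivations U = {v.
     (\<forall>f. f \<notin> regular_functions U \<longrightarrow> v f = 0) \<and>
     (\<forall>f \<in> regular_functions U. v f \<in> regular_functions U) \<and>
     (\<forall>f \<in> regular_functions U. \<forall>g \<in> regular_functions U. v (f + g) = v f + v g) \<and>
     (\<forall>c. \<forall>f \<in> regular_functions U. v (\<lambda>x. c * f x) = (\<lambda>x. c * v f x)) \<and>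
     (\<forall>f \<in> regular_functions U. \<forall>g \<in> regular_functions U. v (f * g) = f * v g + v f * g)}"

definition commutator :: "('m::finite) operator \<Rightarrow> 'm operator \<Rightarrow> 'm operator" where
  "commutator v w = (\<lambda>f. v (w f) - w (v f))"

text \<open>For \<open>g \<in> U\<close>, pullback and pushforward along the left translation \<open>x \<mapsto> g x\<close> of \<open>U\<close>.\<close>

definition pullback :: "complex^'m^'m \<Rightarrow> ('m::finite) operator" where
  "pullback g f = (\<lambda>x. f (g ** x))"

definition pushforward :: "complex^'m^'m \<Rightarrow> ('m::finite) operator \<Rightarrow> 'm operator" where
  "pushforward g v = (\<lambda>f. pullback (matrix_inv g) (v (pullback g f)))"

definition left_invariant_fields :: "(complex^'m^'m) set \<Rightarrow> ('m::finite) operator set" where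
  "left_invariant_fields U = {v \<in> derivations U. \<forall>g\<in>U. pushforward g v = v}"

text \<open>
  \<open>U\<close> is the group corresponding to the Lie algebra: \<open>\<theta>\<close> identifies the latter with the Lie
  algebra of left-invariant vector fields on \<open>U\<close>.
\<close>

definition lie_algebra_identification ::
  "(complex \<Rightarrow> 'a::ab_group_add \<Rightarrow> 'a) \<Rightarrow> ('a \<Rightarrow> 'a \<Rightarrow> 'a) \<Rightarrow> (complex^'m^'m) set \<Rightarrow>
     ('a \<Rightarrow> ('m::finite) operator) \<Rightarrow> bool" where
  "lie_algebra_identification smul bracket U \<theta> \<longleftrightarrow>
     bij_betw \<theta> UNIV (left_invariant_fields U) \<and>
     (\<forall>x y. \<theta> (x + y) = \<theta> x + \<theta> y) \<and>
     (\<forall>c x. \<theta> (smul c x) = (\<lambda>f u. c * \<theta> x f u)) \<and>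
     (\<forall>x y. \<theta> (bracket x y) = commutator (\<theta> x) (\<theta> y))"


section \<open>Differential forms\<close>

text \<open>
  Since \<open>U\<close> is smooth, a Kaehler differential is determined by its values on vector fields, and
  \<open>\<Omega>\<close> is identified with the \<open>\<complex>[U]\<close>-module of functionals on vector fields generated by the
  differentials of regular functions.
\<close>

definition differential :: "(complex^'m^'m) set \<Rightarrow> ('m::finite) fn \<Rightarrow> 'm operator \<Rightarrow> 'm fn" where
  "differential U f = (\<lambda>v. if v \<in> derivations U then v f else 0)"

inductive_set one_forms :: "(complex^'m^'m) set \<Rightarrow> (('m::finite) operator \<Rightarrow> 'm fn) set"
  for U :: "(complex^'m^'m) set" where
  zero: "0 \<in> one_forms U"
| add_term: "\<omega> \<in> one_forms U \<Longrightarrow> f \<in> regular_functions U \<Longrightarrow> h \<in> regular_functions U \<Longrightarrow>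
    \<omega> + (\<lambda>v. f * differential U h v) \<in> one_forms U"

definition left_invariant_form ::
  "(complex^'m^'m) set \<Rightarrow> (('m::finite) operator \<Rightarrow> 'm fn) \<Rightarrow> bool" where
  "left_invariant_form U \<omega> \<longleftrightarrow>
     (\<forall>g\<in>U. \<forall>v\<in>derivations U. pullback g (\<omega> (pushforward g v)) = \<omega> v)"

text \<open>
  The exterior derivative is given by Cartan's formula
  \<open>d\<omega>(v, w) = v(\<omega>(w)) - w(\<omega>(v)) - \<omega>([v, w])\<close>; 2-forms are identified with their values on pairs of
  vector fields. The wedge product of matrix forms uses the matrix product of the coefficients.
\<close>

type_synonym ('m, 'n) matrix_form = "('m operator \<Rightarrow> 'm fn)^'n^'n"

definition matrix_forms :: "(complex^'m^'m) set \<Rightarrow> ('m::finite, 'n::finite) matrix_form set" where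
  "matrix_forms U = {\<alpha>. \<forall>i j. \<alpha> $ i $ j \<in> one_forms U}"

definition form_value :: "('m::finite, 'n::finite) matrix_form \<Rightarrow> 'm operator \<Rightarrow> 'm fn^'n^'n" where
  "form_value \<alpha> v = (\<chi> i j. (\<alpha> $ i $ j) v)"

definition exterior_derivative ::
  "('m::finite, 'n::finite) matrix_form \<Rightarrow> 'm operator \<Rightarrow> 'm operator \<Rightarrow> 'm fn^'n^'n" where
  "exterior_derivative \<alpha> v w =
     (\<chi> i j. v ((\<alpha> $ i $ j) w) - w ((\<alpha> $ i $ j) v) - (\<alpha> $ i $ j) (commutator v w))"

definition wedge ::
  "('m::finite, 'n::finite) matrix_form \<Rightarrow> ('m, 'n) matrix_form \<Rightarrow>
     'm operator \<Rightarrow> 'm operator \<Rightarrow> 'm fn^'n^'n" where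
  "wedge \<alpha> \<beta> v w = form_value \<alpha> v ** form_value \<beta> w - form_value \<alpha> w ** form_value \<beta> v"

definition flat :: "(complex^'m^'m) set \<Rightarrow> ('m::finite, 'n::finite) matrix_form \<Rightarrow> bool" where
  "flat U \<alpha> \<longleftrightarrow>
     (\<forall>v\<in>derivations U. \<forall>w\<in>derivations U. exterior_derivative \<alpha> v w + wedge \<alpha> \<alpha> v w = 0)"


section \<open>D-modules\<close>

definition multiplication :: "(complex^'m^'m) set \<Rightarrow> ('m::finite) fn \<Rightarrow> 'm operator" where
  "multiplication U f = (\<lambda>h. if h \<in> regular_functions U then f * h else 0)"

inductive_set differential_operators :: "(complex^'m^'m) set \<Rightarrow> ('m::finite) operator set"
  for U :: "(complex^'m^'m) set" where
  mult: "f \<in> regular_functions U \<Longrightarrow> multiplication U f \<in> differential_operators U"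
| deriv: "v \<in> derivations U \<Longrightarrow> v \<in> differential_operators U"
| add: "P \<in> differential_operators U \<Longrightarrow> Q \<in> differential_operators U \<Longrightarrow>
    P + Q \<in> differential_operators U"
| comp: "P \<in> differential_operators U \<Longrightarrow> Q \<in> differential_operators U \<Longrightarrow>
    P \<circ> Q \<in> differential_operators U"

definition diff_op_ring :: "(complex^'m^'m) set \<Rightarrow> ('m::finite) operator ring" where
  "diff_op_ring U = \<lparr>carrier = differential_operators U, mult = (\<circ>),
          one = multiplication U (on_set U (\<lambda>_. 1)), zero = 0, add = (+)\<rparr>"

text \<open>The locale \<open>module\<close> of \<open>HOL-Algebra\<close> is restricted to commutative rings.\<close>

locale left_module = R?: ring R + M?: abelian_group M
  for R (structure) and M :: "('a, 'b, 'c) module_scheme" (structure) +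
  assumes smult_closed:
      "\<lbrakk>a \<in> carrier R; x \<in> carrier M\<rbrakk> \<Longrightarrow> a \<odot>\<^bsub>M\<^esub> x \<in> carrier M"
    and smult_l_distr:
      "\<lbrakk>a \<in> carrier R; b \<in> carrier R; x \<in> carrier M\<rbrakk> \<Longrightarrow>
        (a \<oplus>\<^bsub>R\<^esub> b) \<odot>\<^bsub>M\<^esub> x = a \<odot>\<^bsub>M\<^esub> x \<oplus>\<^bsub>M\<^esub> b \<odot>\<^bsub>M\<^esub> x"
    and smult_r_distr:
      "\<lbrakk>a \<in> carrier R; x \<in> carrier M; y \<in> carrier M\<rbrakk> \<Longrightarrow>
        a \<odot>\<^bsub>M\<^esub> (x \<oplus>\<^bsub>M\<^esub> y) = a \<odot>\<^bsub>M\<^esub> x \<oplus>\<^bsub>M\<^esub> a \<odot>\<^bsub>M\<^esub> y"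
    and smult_assoc:
      "\<lbrakk>a \<in> carrier R; b \<in> carrier R; x \<in> carrier M\<rbrakk> \<Longrightarrow>
        (a \<otimes>\<^bsub>R\<^esub> b) \<odot>\<^bsub>M\<^esub> x = a \<odot>\<^bsub>M\<^esub> (b \<odot>\<^bsub>M\<^esub> x)"
    and smult_one: "x \<in> carrier M \<Longrightarrow> \<one>\<^bsub>R\<^esub> \<odot>\<^bsub>M\<^esub> x = x"

definition left_module_iso ::
  "('r, 's) ring_scheme \<Rightarrow> ('r, 'x, 'c) module_scheme \<Rightarrow> ('r, 'y, 'd) module_scheme \<Rightarrow> bool" where
  "left_module_iso R M N \<longleftrightarrow> (\<exists>\<phi>. bij_betw \<phi> (carrier M) (carrier N) \<and>
     (\<forall>x\<in>carrier M. \<forall>y\<in>carrier M. \<phi> (x \<oplus>\<^bsub>M\<^esub> y) = \<phi> x \<oplus>\<^bsub>N\<^esub> \<phi> y) \<and>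
     (\<forall>a\<in>carrier R. \<forall>x\<in>carrier M. \<phi> (a \<odot>\<^bsub>M\<^esub> x) = a \<odot>\<^bsub>N\<^esub> \<phi> x))"

text \<open>
  The additive group \<open>\<complex>[U]\<^sup>n\<close> with a given scalar multiplication; the fields \<open>mult\<close> and \<open>one\<close>, which
  the record type of \<open>HOL-Algebra\<close> carries along, play no role in a module.
\<close>

definition free_module ::
  "(complex^'m^'m) set \<Rightarrow> (('m::finite) operator \<Rightarrow> 'm fn^'n \<Rightarrow> 'm fn^'n) \<Rightarrow>
     ('m operator, 'm fn^'n::finite) module" where
  "free_module U act = \<lparr>carrier = {x. \<forall>i. x $ i \<in> regular_functions U},
     mult = undefined, one = undefined, zero = 0, add = (+), smult = act\<rparr>"

definition basis_vector :: "(complex^'m^'m) set \<Rightarrow> 'n \<Rightarrow> ('m::finite) fn^'n::finite" where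
  "basis_vector U j = (\<chi> i. if i = j then on_set U (\<lambda>_. 1) else 0)"

text \<open>
  The condition on \<open>v\<close> is \<open>v(e\<^sub>1, \<dots>, e\<^sub>n) = (e\<^sub>1, \<dots>, e\<^sub>n) \<alpha>(v)\<close>: the coordinates of \<open>v e\<^sub>j\<close> are the
  \<open>j\<close>-th column of \<open>\<alpha>(v)\<close>. The last condition fixes the junk values, to make \<open>act\<close> unique.
\<close>

definition connection_action ::
  "(complex^'m^'m) set \<Rightarrow> ('m::finite, 'n::finite) matrix_form \<Rightarrow>
     ('m operator \<Rightarrow> 'm fn^'n \<Rightarrow> 'm fn^'n) \<Rightarrow> bool" where
  "connection_action U \<alpha> act \<longleftrightarrow>
     left_module (diff_op_ring U) (free_module U act) \<and>
     (\<forall>f \<in> regular_functions U. \<forall>x \<in> carrier (free_module U act).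
        act (multiplication U f) x = (\<chi> i. f * x $ i)) \<and>
     (\<forall>v \<in> derivations U. \<forall>j. act v (basis_vector U j) = column j (form_value \<alpha> v)) \<and>
     (\<forall>P x. P \<notin> carrier (diff_op_ring U) \<or> x \<notin> carrier (free_module U act) \<longrightarrow> act P x = 0)"

definition connection_module ::
  "(complex^'m^'m) set \<Rightarrow> ('m::finite, 'n::finite) matrix_form \<Rightarrow>
     ('m operator, 'm fn^'n) module" where
  "connection_module U \<alpha> = free_module U (THE act. connection_action U \<alpha> act)"

definition invariant_D_modules ::
  "(complex^'m^'m) set \<Rightarrow> (('m::finite) operator, 'm fn^'n::finite) module set" where
  "invariant_D_modules U = {connection_module U \<alpha> | \<alpha>.
     \<alpha> \<in> matrix_forms U \<and> flat U \<alpha> \<and> (\<forall>i j. left_invariant_form U (\<alpha> $ i $ j))}"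

definition D_module_iso_rel ::
  "(complex^'m^'m) set \<Rightarrow> (('m::finite) operator, 'm fn^'n::finite) module rel" where
  "D_module_iso_rel U = {(M, N). M \<in> invariant_D_modules U \<and> N \<in> invariant_D_modules U \<and>
     left_module_iso (diff_op_ring U) M N}"


section \<open>The representation variety and its quotient\<close>

definition lie_homs ::
  "(complex \<Rightarrow> 'a::ab_group_add \<Rightarrow> 'a) \<Rightarrow> ('a \<Rightarrow> 'a \<Rightarrow> 'a) \<Rightarrow> ('a \<Rightarrow> complex^'n^'n::finite) set" where
  "lie_homs smul bracket = {\<rho>.
     (\<forall>x y. \<rho> (x + y) = \<rho> x + \<rho> y) \<and>
     (\<forall>c x. \<rho> (smul c x) = (\<chi> i j. c * \<rho> x $ i $ j)) \<and>
     (\<forall>x y. \<rho> (bracket x y) = \<rho> x ** \<rho> y - \<rho> y ** \<rho> x)}"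

definition hom_coordinates :: "(('a \<Rightarrow> complex^'n^'n::finite) \<Rightarrow> complex) set" where
  "hom_coordinates = {\<lambda>\<rho>. \<rho> x $ i $ j | x i j. True}"

definition conjugate :: "complex^'n^'n \<Rightarrow> ('a \<Rightarrow> complex^'n^'n) \<Rightarrow> 'a \<Rightarrow> complex^'n^'n::finite" where
  "conjugate g \<rho> = (\<lambda>x. g ** \<rho> x ** matrix_inv g)"

definition invariants :: "('a \<Rightarrow> complex^'n^'n::finite) set \<Rightarrow> (('a \<Rightarrow> complex^'n^'n) \<Rightarrow> complex) set" where
  "invariants H = {f \<in> on_set H ` generated_algebra hom_coordinates.
     \<forall>g. invertible g \<longrightarrow> (\<forall>\<rho>\<in>H. f (conjugate g \<rho>) = f \<rho>)}"

text \<open>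
  The (closed) points of \<open>H // GL\<^sub>n = Spec(\<complex>[H]\<^bsup>GL\<^esup>)\<close> are the maximal ideals of the ring of
  invariants; the quotient map sends \<open>\<rho>\<close> to the ideal of the invariants vanishing at \<open>\<rho>\<close>.
\<close>

definition git_quotient_points ::
  "('a \<Rightarrow> complex^'n^'n::finite) set \<Rightarrow> (('a \<Rightarrow> complex^'n^'n) \<Rightarrow> complex) set set" where
  "git_quotient_points H = {I. maximalideal I (fun_ring H (invariants H))}"

definition git_quotient_map ::
  "('a \<Rightarrow> complex^'n^'n::finite) set \<Rightarrow> ('a \<Rightarrow> complex^'n^'n) \<Rightarrow> (('a \<Rightarrow> complex^'n^'n) \<Rightarrow> complex) set" where
  "git_quotient_map H \<rho> = {f \<in> invariants H. f \<rho> = 0}"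


section \<open>The invariant form of a representation\<close>

text \<open>
  A linear functional \<open>\<xi>\<close> on the Lie algebra is identified with the left-invariant 1-form that takes
  the constant value \<open>\<xi>(x)\<close> on the left-invariant vector field of \<open>x\<close>.
\<close>

definition form_of_functional ::
  "(complex^'m^'m) set \<Rightarrow> ('a \<Rightarrow> ('m::finite) operator) \<Rightarrow> ('a \<Rightarrow> complex) \<Rightarrow> 'm operator \<Rightarrow> 'm fn" where
  "form_of_functional U \<theta> \<xi> = (THE \<omega>. \<omega> \<in> one_forms U \<and> left_invariant_form U \<omega> \<and>
     (\<forall>x. \<omega> (\<theta> x) = on_set U (\<lambda>_. \<xi> x)))"

text \<open>
  \<open>\<alpha>\<^sub>\<rho> = \<Sum>\<^sub>i \<rho>(x\<^sub>i) x\<^sup>i\<close>, where the \<open>x\<^sub>i\<close> run through \<open>B\<close>; the functional of the dual basis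
  belonging to \<open>b \<in> B\<close> gives the coordinate at \<open>b\<close>.
\<close>

definition rep_form ::
  "(complex \<Rightarrow> 'a::ab_group_add \<Rightarrow> 'a) \<Rightarrow> 'a set \<Rightarrow> (complex^'m^'m) set \<Rightarrow> ('a \<Rightarrow> ('m::finite) operator) \<Rightarrow>
     ('a \<Rightarrow> complex^'n^'n) \<Rightarrow> ('m, 'n::finite) matrix_form" where
  "rep_form smul B U \<theta> \<rho> = (\<chi> i j. \<Sum>b\<in>B.
     (\<lambda>v u. \<rho> b $ i $ j *
        form_of_functional U \<theta> (\<lambda>x. module.representation smul B x b) v u))"

end

theory Submission
  imports
    Defs
    "HOL-Computational_Algebra.Computational_Algebra"
    "HOL-Combinatorics.Combinatorics"
begin

text \<open>
  By the nilpotency of the Lie algebra, a representation is conjugate to a triangular one in which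
  nonzero off-diagonal entries connect only equal weights, and the weights are characters
  \<open>w\<^sub>1, \<dots>, w\<^sub>n\<close>. A one-parameter group of diagonal matrices degenerates it to its diagonal, so
  invariants depend only on the multiset of weights; conversely the norms \<open>\<Prod>\<^sub>i f(w\<^sub>i)\<close> of
  polynomials \<open>f\<close>, which extend to invariants as determinants, separate such multisets.

  On the side of \<open>D\<close>-modules, the strictly triangular part integrates to a regular gauge
  transformation, because the exponential map of \<open>U\<close> is polynomial. So the module is a direct sum
  of the modules of rank one with connection form \<open>w\<^sub>i\<close>, and modules of rank one with different
  characters are not isomorphic since a regular function has no nonzero logarithmic derivative that
  is constant along a one-parameter subgroup. Hence the isomorphism class is again the multiset of
  weights.

  A maximal ideal of the ring of invariants is a point: its pullback to \<open>n\<close>-tuples of characters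
  generates a proper ideal, since averaging over the symmetric group retracts it onto invariants
  (by Ryser's formula for the permanent, averages are combinations of norms), and the
  Nullstellensatz yields a common zero.
\<close>

text \<open>The ring \<open>differential_operators U\<close> is given by generators inside the ring
  of all operators, without a presentation, so an action of it on C[U]^n cannot be defined by
  checking relations between functions and fields. This obstacle shapes the proof: even the
  existence of the module of a flat form is obtained from the gauge transformation. In the gauge an
  operator P acts on each coordinate by exp(- \<kappa>) P exp \<kappa>, where \<kappa> is a
  character composed with the logarithm, and compositions are respected because conjugation respects
  them. Uniqueness of the action, which involves only generators, then identifies the module.

  The geometry of U is reduced to matrices in two ways. The logarithm is a polynomial map from U
  into the tangent space at the identity. Every vector field agrees at a given point with some
  left-invariant one, so equations between forms, flatness and the gauge equation are checked on the
  Lie algebra alone.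

  The Nullstellensatz rests on the uncountability of the complex numbers: the algebras in question
  have countable dimension.\<close>

unbundle no fps_syntax

text \<open>A copy of the type of square matrices on which \<open>*\<close> and \<open>^\<close> are the matrix product and the
  matrix power.\<close>

typedef ('n::finite) cmat = "UNIV :: (complex^'n^'n) set"
  morphisms vec_of mat_of by simp

declare mat_of_inverse [simplified, simp] vec_of_inverse [simp]

lemma cmat_eqI: "vec_of A = vec_of B \<Longrightarrow> A = B"
  by (simp add: vec_of_inject)

lemma matrix_add_rdistrib: "((B + C) ** A) = (B ** A) + (C ** (A :: 'a::semiring_1^'n^'m))"
  by (vector matrix_matrix_mult_def sum.distrib[symmetric] distrib_right)

instantiation cmat :: (finite) ring_1
begin

definition "0 = mat_of 0"
definition "1 = mat_of (mat 1)"
definition "A + B = mat_of (vec_of A + vec_of B)"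
definition "A - B = mat_of (vec_of A - vec_of B)"
definition "- A = mat_of (- vec_of A)"
definition "A * B = mat_of (vec_of A ** vec_of B)"

instance
proof
  show "(0::'a cmat) \<noteq> 1"
  proof
    assume "(0::'a cmat) = 1"
    then have "vec_of (0::'a cmat) $ undefined $ undefined = vec_of (1::'a cmat) $ undefined $ undefined"
      by simp
    then show False
      by (simp add: zero_cmat_def one_cmat_def mat_def)
  qed
qed (simp_all add: zero_cmat_def one_cmat_def plus_cmat_def minus_cmat_def uminus_cmat_def
    times_cmat_def matrix_mul_assoc matrix_add_ldistrib matrix_add_rdistrib algebra_simps)

end

lemma vec_of_simps [simp]:
  "vec_of 0 = 0" "vec_of 1 = mat 1" "vec_of (A + B) = vec_of A + vec_of B"
  "vec_of (A - B) = vec_of A - vec_of B" "vec_of (- A) = - vec_of A"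
  "vec_of (A * B) = vec_of A ** vec_of B"
  by (simp_all add: zero_cmat_def one_cmat_def plus_cmat_def minus_cmat_def uminus_cmat_def
    times_cmat_def)

lemma vec_of_sum: "vec_of (\<Sum>i\<in>I. f i) = (\<Sum>i\<in>I. vec_of (f i))"
  by (induction I rule: infinite_finite_induct) auto

text \<open>Scaling is multiplication by a scalar matrix, so power series in a matrix can be handled
  with ring operations alone.\<close>

definition sc :: "complex \<Rightarrow> 'n::finite cmat" where
  "sc c = mat_of (mat c)"

lemma mat_mult_left: "(mat c :: complex^'n^'n) ** A = (\<chi> i j. c * A $ i $ j)"
  by (simp add: matrix_matrix_mult_def mat_def vec_eq_iff if_distrib[of "\<lambda>x. x * _"] cong: if_cong)

lemma mat_mult_right: "A ** (mat c :: complex^'n^'n) = (\<chi> i j. c * A $ i $ j)"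
  by (simp add: matrix_matrix_mult_def mat_def vec_eq_iff if_distrib[of "\<lambda>x. _ * x"] mult.commute cong: if_cong)

lemma sc_simps [simp]: "sc 0 = 0" "sc 1 = 1" 
  by (auto intro!: cmat_eqI simp: sc_def mat_def vec_eq_iff)

lemma sc_add: "sc (a + b) = sc a + sc b"
  by (rule cmat_eqI) (simp add: sc_def mat_def vec_eq_iff)

lemma sc_uminus: "sc (- a) = - sc a"
  by (rule cmat_eqI) (simp add: sc_def mat_def vec_eq_iff)

lemma sc_mult: "sc (a * b) = sc a * sc b"
  by (rule cmat_eqI) (simp add: sc_def mat_mult_left, simp add: mat_def vec_eq_iff)

lemma sc_sum: "sc (\<Sum>i\<in>I. f i) = (\<Sum>i\<in>I. sc (f i))"
  by (induction I rule: infinite_finite_induct) (auto simp: sc_add)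

lemma sc_commute: "sc c * A = A * sc c"
  by (rule cmat_eqI) (simp add: sc_def mat_mult_left mat_mult_right)

lemma sc_left_commute: "A * (sc c * B) = sc c * (A * B)"
  by (metis mult.assoc sc_commute)

lemma sc_mult_sc_mult: "sc a * A * (sc b * B) = sc (a * b) * (A * B)"
  by (metis mult.assoc sc_mult sc_commute)

lemma sc_mult_sc: "sc a * (sc b * B) = sc (a * b) * B"
  by (simp add: mult.assoc sc_mult)

lemma of_nat_cmat: "of_nat k = sc (of_nat k)"
  by (induction k) (auto simp: sc_add)

lemma vec_of_sc_mult: "vec_of (sc c * A) = (\<chi> i j. c * vec_of A $ i $ j)"
  by (simp add: sc_def mat_mult_left)

lemma sc_mult_power: "(sc c * A) ^ k = sc (c ^ k) * A ^ k"
  by (induction k) (simp_all add: sc_mult_sc_mult)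


section \<open>Formal power series at a nilpotent matrix\<close>

lemma power_eq_0_mono: "(N::'a::ring_1) ^ K = 0 \<Longrightarrow> K \<le> k \<Longrightarrow> N ^ k = 0"
  by (metis le_add_diff_inverse mult_zero_left power_add)

text \<open>Evaluation of a power series at a matrix. If N^K = 0, nothing is lost by the truncation
  and f \<mapsto> \<open>ev K N f\<close> is a ring homomorphism, which turns identities of formal
  series into identities of matrices.\<close>

definition ev :: "nat \<Rightarrow> 'n::finite cmat \<Rightarrow> complex fps \<Rightarrow> 'n cmat" where
  "ev K N f = (\<Sum>k<K. sc (fps_nth f k) * N ^ k)"

lemma ev_add: "ev K N (f + g) = ev K N f + ev K N g"
  by (simp add: ev_def sc_add ring_distribs sum.distrib)

lemma ev_const: "K > 0 \<Longrightarrow> ev K N (fps_const c) = sc c"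
proof -
  assume "K > 0"
  then have "ev K N (fps_const c) = (\<Sum>k<K. if k = 0 then sc c else 0)"
    unfolding ev_def by (intro sum.cong) auto
  then show ?thesis using \<open>K > 0\<close> by simp
qed

lemma ev_1: "K > 0 \<Longrightarrow> ev K N 1 = 1"
  using ev_const[of K N 1] by simp

lemma ev_X:
  assumes "N ^ K = 0" "K > 0"
  shows "ev K N fps_X = N"
proof (cases "K = 1")
  \<comment> \<open>Truncation at 1 drops the linear term of the series, but then N itself is
    0.\<close>
  case True
  then show ?thesis using assms by (simp add: ev_def)
next
  case False
  have "ev K N fps_X = (\<Sum>k<K. if k = 1 then N else 0)"
    unfolding ev_def by (intro sum.cong) (auto simp: fps_X_def)
  moreover have "1 < K" using False assms(2) by simp
  ultimately show ?thesis by simp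
qed

lemma ev_mono:
  assumes "N ^ K = 0" "K \<le> K'"
  shows "ev K' N f = ev K N f"
  unfolding ev_def
  by (intro sum.mono_neutral_right) (use assms in \<open>auto simp: power_eq_0_mono\<close>)

text \<open>The product of the two sums runs over a square of exponents. Pairs with i + j \<ge> K
  contribute a vanishing power of N, and the remaining triangle is the Cauchy product.\<close>

lemma ev_mult:
  assumes "N ^ K = 0"
  shows "ev K N (f * g) = ev K N f * ev K N g"
proof -
  have "ev K N f * ev K N g = (\<Sum>i<K. \<Sum>j<K. sc (fps_nth f i * fps_nth g j) * N ^ (i + j))"
    unfolding ev_def sum_product
    by (intro sum.cong refl) (simp add: sc_mult_sc_mult power_add)
  also have "\<dots> = (\<Sum>(i,j)\<in>{..<K} \<times> {..<K}. sc (fps_nth f i * fps_nth g j) * N ^ (i + j))"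
    by (simp add: sum.cartesian_product)
  also have "\<dots> = (\<Sum>(i,j)\<in>{(i,j). i + j < K}. sc (fps_nth f i * fps_nth g j) * N ^ (i + j))"
    by (intro sum.mono_neutral_right)
      (auto, metis power_eq_0_mono[OF assms] mult_zero_right not_less)
  also have "\<dots> = (\<Sum>k<K. \<Sum>i\<le>k. sc (fps_nth f i * fps_nth g (k - i)) * N ^ (i + (k - i)))"
    by (rule sum.triangle_reindex)
  also have "\<dots> = ev K N (f * g)"
    unfolding ev_def
    by (intro sum.cong refl) (simp add: fps_mult_nth sc_sum sum_distrib_right atLeast0AtMost)
  finally show ?thesis by simp
qed

lemma ev_power:
  assumes "N ^ K = 0" "K > 0"
  shows "ev K N (f ^ k) = ev K N f ^ k"
  by (induction k) (simp_all add: ev_1 ev_mult assms)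

lemma ev_cong: "(\<And>k. k < K \<Longrightarrow> fps_nth f k = fps_nth g k) \<Longrightarrow> ev K N f = ev K N g"
  by (simp add: ev_def)

lemma ev_sum: "ev K N (\<Sum>i\<in>I. f i) = (\<Sum>i\<in>I. ev K N (f i))"
  by (induction I rule: infinite_finite_induct) (auto simp: ev_add, simp_all add: ev_def)

text \<open>If g has no constant term, g^k starts in degree k. Hence g evaluated at N is nilpotent
  again, and below degree K only the powers g^k with k < K enter the composition.\<close>

lemma ev_compose:
  assumes N: "N ^ K = 0" "K > 0" and g: "fps_nth g 0 = 0"
  shows "ev K N g ^ K = 0" and "ev K (ev K N g) f = ev K N (f oo g)"
proof -
  have low: "fps_nth (g ^ k) n = 0" if "n < k" for n k
    using g that startsby_zero_power_prefix by blast
  have "ev K N (g ^ K) = ev K N 0"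
    by (rule ev_cong) (simp add: low)
  then show "ev K N g ^ K = 0"
    using ev_power[OF N, of g K] by (simp add: ev_def)
  have "ev K (ev K N g) f = (\<Sum>k<K. ev K N (fps_const (fps_nth f k) * g ^ k))"
    unfolding ev_def[of K "ev K N g"]
    by (intro sum.cong refl) (simp add: ev_mult N ev_const ev_power)
  also have "\<dots> = ev K N (\<Sum>k<K. fps_const (fps_nth f k) * g ^ k)"
    by (simp add: ev_sum)
  also have "\<dots> = ev K N (f oo g)"
  proof (rule ev_cong)
    fix n assume "n < K"
    have "fps_nth (\<Sum>k<K. fps_const (fps_nth f k) * g ^ k) n = (\<Sum>k<K. fps_nth f k * fps_nth (g ^ k) n)"
      by (simp add: fps_sum_nth)
    also have "\<dots> = (\<Sum>k=0..n. fps_nth f k * fps_nth (g ^ k) n)"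
      using \<open>n < K\<close> by (intro sum.mono_neutral_right) (auto simp: low)
    finally show "fps_nth (\<Sum>k<K. fps_const (fps_nth f k) * g ^ k) n = fps_nth (f oo g) n"
      by (simp add: fps_compose_nth)
  qed
  finally show "ev K (ev K N g) f = ev K N (f oo g)" .
qed


section \<open>Exponential and logarithm of nilpotent matrices\<close>

definition nexp :: "'n::finite cmat \<Rightarrow> 'n cmat" where
  "nexp N = ev CARD('n) N (fps_exp 1)"

definition nlog :: "'n::finite cmat \<Rightarrow> 'n cmat" where
  "nlog A = ev CARD('n) (A - 1) (fps_ln 1)"

text \<open>The exponent is the size of the matrix, which by \<open>nilp_iff\<close> suffices for
  every nilpotent matrix; it is also the fixed truncation of the exponential and logarithmic
  series.\<close>

definition nilp :: "'n::finite cmat \<Rightarrow> bool" where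
  "nilp N \<longleftrightarrow> N ^ CARD('n) = 0"

text \<open>With the scalar moved into the series, the whole one-parameter group of N consists of
  evaluations at the same N, and the addition law of \<open>fps_exp\<close> can be transported by
  \<open>ev_mult\<close>.\<close>

lemma nexp_sc:
  "nexp (sc c * N) = ev CARD('n) (N::'n::finite cmat) (fps_exp c)"
  unfolding nexp_def ev_def
  by (intro sum.cong refl) (simp add: sc_mult_power sc_mult [symmetric] flip: mult.assoc)

lemma nexp_sc_add:
  assumes "nilp N"
  shows "nexp (sc (a + b) * N) = nexp (sc a * N) * nexp (sc b * N)"
  using assms unfolding nexp_sc nilp_def
  by (simp add: fps_exp_add_mult ev_mult)

lemma nexp_zero [simp]: "nexp 0 = 1"
  using nexp_sc[of 0 0] by (simp add: ev_1)

lemma nilp_sc: "nilp N \<Longrightarrow> nilp (sc c * N)"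
  by (simp add: nilp_def sc_mult_power)

lemma nilp_uminus: "nilp N \<Longrightarrow> nilp (- N)"
  using nilp_sc[of N "-1"] by (simp add: sc_uminus)

lemma nexp_minus:
  assumes "nilp N"
  shows "nexp (- N) * nexp N = 1" "nexp N * nexp (- N) = 1"
  using nexp_sc_add[OF assms, of "-1" 1] nexp_sc_add[OF assms, of 1 "-1"] by (auto simp: sc_uminus)

lemma nexp_of_nat:
  assumes "nilp N"
  shows "nexp (sc (of_nat k) * N) = nexp N ^ k"
proof (induction k)
  case (Suc k)
  then show ?case
    using nexp_sc_add[OF assms, of 1 "of_nat k"] by simp
qed simp

text \<open>\<open>fps_ln 1\<close> is the series log(1 + X), the compositional inverse of exp X -
  1. Evaluation at A - 1 carries this over to matrices.\<close>

lemma nlog: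
  assumes "nilp (A - 1)"
  shows "nilp (nlog A)" "nexp (nlog A) = A"
proof -
  have N: "(A - 1) ^ CARD('a) = 0" "CARD('a) > 0" using assms by (auto simp: nilp_def)
  show "nilp (nlog A)"
    unfolding nilp_def nlog_def by (rule ev_compose(1)[OF N]) simp
  have "fps_exp 1 - 1 oo fps_ln (1::complex) = fps_X"
    unfolding fps_ln_fps_exp_inv[OF one_neq_zero]
    by (rule fps_inv_right) auto
  then have eq: "fps_exp 1 oo fps_ln (1::complex) = 1 + fps_X"
    by (simp add: fps_compose_sub_distrib algebra_simps)
  show "nexp (nlog A) = A"
    unfolding nexp_def nlog_def using N
    by (subst ev_compose(2)[OF N]) (simp_all add: eq ev_add ev_1 ev_X)
qed


section \<open>Nilpotency index\<close>

lemma linear_dependence: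
  fixes w :: "nat \<Rightarrow> complex^'n"
  assumes "m > CARD('n)"
  shows "\<exists>c. (\<exists>j<m. c j \<noteq> 0) \<and> (\<Sum>j<m. c j *s w j) = 0"
proof (cases "inj_on w {..<m}")
  case True
  have "vec.dependent (w ` {..<m})"
  proof (rule ccontr)
    assume "\<not> ?thesis"
    then have "card (w ` {..<m}) \<le> vec.dim (UNIV :: (complex^'n) set)"
      by (intro vec.independent_card_le_dim) auto
    then show False using True assms unfolding vec_dim_card by (simp add: card_image)
  qed
  then obtain u where u: "(\<Sum>v\<in>w ` {..<m}. u v *s v) = 0" "\<exists>v\<in>w ` {..<m}. u v \<noteq> 0"
    by (subst (asm) vec.dependent_finite) auto
  then show ?thesis
    by (intro exI[of _ "u \<circ> w"]) (auto simp: sum.reindex[OF True])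
next
  case False
  then obtain i j where ij: "i < m" "j < m" "i \<noteq> j" "w i = w j"
    by (auto simp: inj_on_def)
  \<comment> \<open>A repetition in the family is a dependence too: the relation is
    \<open>w i - w j = 0\<close>.\<close>
  have "(\<Sum>k<m. ((if k = i then 1 else 0) - (if k = j then 1 else 0)) *s w k) = 0"
    using ij by (simp add: vec.scale_left_diff_distrib sum_subtractf
        if_distrib[of "\<lambda>c. c *s _"] cong: if_cong)
  then show ?thesis
    using ij by (intro exI[of _ "\<lambda>k. (if k = i then 1 else 0) - (if k = j then 1 else 0)"]) auto
qed

text \<open>Let k0 be the least exponent with T^k0 v = 0. If k0 exceeded the dimension, v, T v, ...,
  T^(k0 - 1) v would be dependent; a suitable power of T isolates the lowest term of the relation.
  Only the orbit of one vector matters, so this also serves for operators that are nilpotent on a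
  subspace.\<close>

lemma nilpotency_bound_vector:
  fixes T :: "complex^'n \<Rightarrow> complex^'n"
  assumes lin: "Vector_Spaces.linear (*s) (*s) T" and "(T ^^ k) v = 0"
  shows "(T ^^ CARD('n)) v = 0"
proof (rule ccontr)
  assume nz: "(T ^^ CARD('n)) v \<noteq> 0"
  have T0: "(T ^^ i) 0 = 0" for i
    by (induction i) (auto simp: vec.linear_0[OF lin])
  define k0 where "k0 = (LEAST k. (T ^^ k) v = 0)"
  have k0: "(T ^^ k0) v = 0" unfolding k0_def by (rule LeastI) (rule assms)
  have Tk0: "(T ^^ k) v = 0" if "k \<ge> k0" for k
  proof -
    have "(T ^^ k) v = (T ^^ (k - k0 + k0)) v" using that by simp
    then show ?thesis by (simp only: funpow_add o_apply k0 T0)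
  qed
  have less: "(T ^^ k) v \<noteq> 0" if "k < k0" for k
    using that not_less_Least unfolding k0_def by blast
  have "k0 > CARD('n)" using Tk0 nz by (meson not_le)
  from linear_dependence[OF this, of "\<lambda>j. (T ^^ j) v"] obtain c where
    c: "\<exists>j<k0. c j \<noteq> 0" "(\<Sum>j<k0. c j *s (T ^^ j) v) = 0" by blast
  define j where "j = (LEAST j. j < k0 \<and> c j \<noteq> 0)"
  have j: "j < k0" "c j \<noteq> 0" using LeastI_ex[of "\<lambda>j. j < k0 \<and> c j \<noteq> 0"] c(1) unfolding j_def by auto
  have jl: "c i = 0" if "i < j" for i
    using that j(1) not_less_Least[of i "\<lambda>j. j < k0 \<and> c j \<noteq> 0"] unfolding j_def by force
  \<comment> \<open>This shift moves the lowest term of the relation to a multiple of T^(k0 - 1) v,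
    which is nonzero, and all later terms to 0.\<close>
  define p where "p = k0 - 1 - j"
  have Tp: "(T ^^ p) (\<Sum>i<k0. c i *s w i) = (\<Sum>i<k0. c i *s (T ^^ p) (w i))" for w p
    by (induction p) (simp_all add: vec.linear_sum[OF lin] vec.linear_scale[OF lin])
  have "0 = (T ^^ p) (\<Sum>j<k0. c j *s (T ^^ j) v)" by (simp add: c T0)
  also have "\<dots> = (\<Sum>i<k0. c i *s (T ^^ (p + i)) v)"
    by (simp add: Tp funpow_add)
  also have "\<dots> = (\<Sum>i<k0. if i = j then c j *s (T ^^ (p + j)) v else 0)"
  proof (rule sum.cong, goal_cases)
    case (2 i)
    consider "i < j" | "i = j" | "i > j" by linarith
    then show ?case
    proof cases
      case 3
      then have "p + i \<ge> k0" using j by (simp add: p_def)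
      then show ?thesis using 3 by (simp add: Tk0)
    qed (auto simp: jl)
  qed simp
  also have "\<dots> = c j *s (T ^^ (p + j)) v" using j by simp
  finally show False using j less[of "p + j"] by (simp add: p_def)
qed

lemma vec_of_power_mult: "vec_of (A ^ k) *v x = (((*v) (vec_of A)) ^^ k) x"
  by (induction k) (simp_all add: matrix_vector_mul_assoc [symmetric])

lemma nilp_iff: "nilp N \<longleftrightarrow> (\<exists>k. N ^ k = 0)"
proof
  assume "\<exists>k. N ^ k = 0"
  then obtain k where k: "N ^ k = 0" by blast
  have "(((*v) (vec_of N)) ^^ k) x = 0" for x
    using vec_of_power_mult[of N k x] k by simp
  then have "vec_of (N ^ CARD('a)) *v x = 0" for x
    unfolding vec_of_power_mult
    by (rule nilpotency_bound_vector[rotated]) (rule matrix_vector_mul_linear_gen)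
  then have "vec_of (N ^ CARD('a)) = 0"
    by (metis matrix_eq matrix_vector_mult_0)
  then show "nilp N" unfolding nilp_def by (intro cmat_eqI) simp
qed (auto simp: nilp_def)


section \<open>The derivative of the exponential\<close>

text \<open>Pascal's rule, in the form that drives the inductions on binomial sums in a
  noncommutative ring.\<close>

lemma sum_choose_Suc:
  fixes f :: "nat \<Rightarrow> 'r::semiring_1"
  shows "(\<Sum>j\<le>Suc k. of_nat (Suc k choose j) * f j) =
    (\<Sum>j\<le>k. of_nat (k choose j) * f j) + (\<Sum>j\<le>k. of_nat (k choose j) * f (Suc j))"
proof -
  have "(\<Sum>j\<le>Suc k. of_nat (k choose j) * f j) = f 0 + (\<Sum>j\<le>k. of_nat (k choose Suc j) * f (Suc j))"
    by (subst sum.atMost_Suc_shift) (simp only: binomial_n_0 of_nat_1 mult_1)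
  moreover have "(\<Sum>j\<le>Suc k. of_nat (k choose j) * f j) = (\<Sum>j\<le>k. of_nat (k choose j) * f j)"
    by (simp add: binomial_eq_0)
  ultimately have 1: "(\<Sum>j\<le>k. of_nat (k choose j) * f j) = f 0 + (\<Sum>j\<le>k. of_nat (k choose Suc j) * f (Suc j))"
    by (rule trans[OF sym, rotated])
  have 2: "(\<Sum>j\<le>Suc k. of_nat (Suc k choose j) * f j) =
      f 0 + (\<Sum>j\<le>k. of_nat (k choose Suc j) * f (Suc j) + of_nat (k choose j) * f (Suc j))"
    by (subst sum.atMost_Suc_shift)
      (simp only: binomial_n_0 binomial_Suc_Suc of_nat_add of_nat_1 mult_1 distrib_right add.commute)
  show ?thesis
    unfolding 1 2 sum.distrib by (simp only: add.assoc)
qed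

text \<open>The Leibniz rule for powers of an element that need not commute with its derivative:
  \<open>e j\<close> plays the part of the derivative of \<open>W ^ j\<close>.\<close>

locale power_derivation =
  fixes W dW :: "'r::ring_1" and e :: "nat \<Rightarrow> 'r"
  assumes e_0: "e 0 = 0" and e_Suc: "e (Suc j) = e j * W + W ^ j * dW"
begin

text \<open>The coefficient of 1 / k! in exp(- W) d(exp W). By \<open>b_1\<close> and
  \<open>b_Suc\<close> it arises for k \<ge> 1 from \<open>dW\<close> by applying k - 1 times the
  map A \<mapsto> A W - W A, which is - ad W.\<close>

definition b :: "nat \<Rightarrow> 'r" where
  "b k = (\<Sum>j\<le>k. of_nat (k choose j) * ((- W) ^ (k - j) * e j))"

lemma b_0: "b 0 = 0"
  by (simp add: b_def e_0)

text \<open>The binomial expansion of (- W + W)^k.\<close>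

lemma binomial_uminus: "(\<Sum>j\<le>k. of_nat (k choose j) * ((- W) ^ (k - j) * W ^ j)) = (if k = 0 then 1 else 0)"
proof (induction k)
  case (Suc k)
  let ?s = "\<lambda>k. \<Sum>j\<le>k. of_nat (k choose j) * ((- W) ^ (k - j) * W ^ j)"
  have "?s (Suc k) = (\<Sum>j\<le>k. of_nat (k choose j) * ((- W) ^ (Suc k - j) * W ^ j))
      + (\<Sum>j\<le>k. of_nat (k choose j) * ((- W) ^ (Suc k - Suc j) * W ^ Suc j))"
    by (rule sum_choose_Suc)
  also have "(\<Sum>j\<le>k. of_nat (k choose j) * ((- W) ^ (Suc k - j) * W ^ j)) = - W * ?s k"
    unfolding sum_distrib_left
    by (intro sum.cong refl) (simp add: Suc_diff_le mult_of_nat_commute mult.assoc)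
  also have "(\<Sum>j\<le>k. of_nat (k choose j) * ((- W) ^ (Suc k - Suc j) * W ^ Suc j)) = ?s k * W"
    unfolding sum_distrib_right
    by (intro sum.cong refl) (simp add: mult.assoc power_commutes)
  finally show ?case
    using Suc by (cases k) auto
qed simp

text \<open>Pascal's rule splits the sum. One half is - W times \<open>b k\<close>; in the other the
  Leibniz rule for \<open>e (Suc j)\<close> produces \<open>b k * W\<close> and a binomial sum in
  front of \<open>dW\<close> that survives only for k = 0.\<close>

lemma b_Suc: "b (Suc k) = b k * W - W * b k + (if k = 0 then dW else 0)"
proof -
  have "b (Suc k) = (\<Sum>j\<le>k. of_nat (k choose j) * ((- W) ^ (Suc k - j) * e j))
      + (\<Sum>j\<le>k. of_nat (k choose j) * ((- W) ^ (Suc k - Suc j) * e (Suc j)))"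
    unfolding b_def by (rule sum_choose_Suc)
  also have "(\<Sum>j\<le>k. of_nat (k choose j) * ((- W) ^ (Suc k - j) * e j)) = - W * b k"
    unfolding b_def sum_distrib_left
    by (intro sum.cong refl) (simp add: Suc_diff_le mult_of_nat_commute mult.assoc)
  also have "(\<Sum>j\<le>k. of_nat (k choose j) * ((- W) ^ (Suc k - Suc j) * e (Suc j))) =
      b k * W + (\<Sum>j\<le>k. of_nat (k choose j) * ((- W) ^ (k - j) * W ^ j)) * dW"
    unfolding b_def sum_distrib_right sum.distrib[symmetric]
    by (intro sum.cong refl) (simp add: e_Suc mult.assoc distrib_left)
  finally show ?thesis
    by (simp add: binomial_uminus)
qed

lemma b_1: "b 1 = dW"
  using b_Suc[of 0] by (simp add: b_0)

lemma e_vanish: "W ^ K = 0 \<Longrightarrow> e K = 0 \<Longrightarrow> K \<le> j \<Longrightarrow> e j = 0"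
proof (induction j)
  case (Suc j)
  then show ?case
    by (cases "K \<le> j") (auto simp: e_Suc power_eq_0_mono le_Suc_eq)
qed auto

end

text \<open>The classical differential of the exponential, as a finite sum. The product of the two
  truncated series is sorted by total degree k; each part is the binomial sum \<open>b k\<close>
  divided by k!. Both factors stop before K, so the total degree stays below 2 K.\<close>

lemma exp_times_derivative:
  fixes W dW :: "'n::finite cmat"
  assumes "power_derivation W dW e" and W: "W ^ K = 0" and eK: "e K = 0"
  shows "ev K (- W) (fps_exp 1) * (\<Sum>j<K. sc (1 / fact j) * e j) =
    (\<Sum>k<2*K. sc (1 / fact k) * power_derivation.b W e k)"
proof -
  interpret power_derivation W dW e by fact
  have e0: "e j = 0" if "K \<le> j" for j using e_vanish W eK that by blast
  have W0: "(- W) ^ j = 0" if "K \<le> j" for j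
    using power_eq_0_mono[OF W that] by (simp add: power_minus[of W])
  have "ev K (- W) (fps_exp 1) * (\<Sum>j<K. sc (1 / fact j) * e j) =
      (\<Sum>(i,j)\<in>{..<K} \<times> {..<K}. sc (1 / (fact i * fact j)) * ((- W) ^ i * e j))"
    unfolding ev_def sum_product sum.cartesian_product[symmetric]
    by (intro sum.cong refl) (simp add: sc_mult_sc_mult)
  also have "\<dots> = (\<Sum>(i,j)\<in>{(i,j). i + j < 2 * K}. sc (1 / (fact i * fact j)) * ((- W) ^ i * e j))"
  proof (rule sum.mono_neutral_left)
    have "{(i, j). i + j < 2 * K} \<subseteq> {..<2*K} \<times> {..<2*K}" by auto
    then show "finite {(i, j). i + j < 2 * K}" by (rule finite_subset) auto
    have *: "(- W) ^ i * e j = 0" if "\<not> (i < K \<and> j < K)" for i j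
      using that e0[of j] W0[of i] by (auto simp: not_less)
    show "\<forall>x\<in>{(i, j). i + j < 2 * K} - {..<K} \<times> {..<K}.
        (case x of (i, j) \<Rightarrow> sc (1 / (fact i * fact j)) * ((- W) ^ i * e j)) = 0"
    proof
      fix x assume "x \<in> {(i, j). i + j < 2 * K} - {..<K} \<times> {..<K}"
      then show "(case x of (i, j) \<Rightarrow> sc (1 / (fact i * fact j)) * ((- W) ^ i * e j)) = 0"
        using *[of "fst x" "snd x"] by (cases x) auto
    qed
  qed auto
  also have "\<dots> = (\<Sum>k<2*K. \<Sum>i\<le>k. sc (1 / (fact i * fact (k - i))) * ((- W) ^ i * e (k - i)))"
    by (rule sum.triangle_reindex)
  also have "\<dots> = (\<Sum>k<2*K. sc (1 / fact k) * b k)"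
  proof (rule sum.cong[OF refl])
    fix k
    have "sc (1 / fact k) * b k = (\<Sum>j\<le>k. sc (1 / (fact (k - j) * fact j)) * ((- W) ^ (k - j) * e j))"
      unfolding b_def sum_distrib_left
    proof (intro sum.cong refl)
      fix j assume "j \<in> {..k}"
      then have "of_nat (k choose j) = (fact k / (fact j * fact (k - j)) :: complex)"
        by (intro binomial_fact) auto
      then show "sc (1 / fact k) * (of_nat (k choose j) * ((- W) ^ (k - j) * e j)) =
         sc (1 / (fact (k - j) * fact j)) * ((- W) ^ (k - j) * e j)"
        unfolding of_nat_cmat sc_mult_sc by (simp add: mult.commute)
    qed
    also have "\<dots> = (\<Sum>i\<le>k. sc (1 / (fact i * fact (k - i))) * ((- W) ^ i * e (k - i)))"
      by (subst sum.nat_diff_reindex[symmetric, where n = "Suc k", simplified lessThan_Suc_atMost]) simp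
    finally show "(\<Sum>i\<le>k. sc (1 / (fact i * fact (k - i))) * ((- W) ^ i * e (k - i))) = sc (1 / fact k) * b k"
      by simp
  qed
  finally show ?thesis .
qed

section \<open>Regular functions\<close>

lemma ga_add: "f \<in> generated_algebra G \<Longrightarrow> g \<in> generated_algebra G \<Longrightarrow> (\<lambda>x. f x + g x) \<in> generated_algebra G"
  using generated_algebra.add[of f G g] by (simp add: plus_fun_def)

lemma ga_mult: "f \<in> generated_algebra G \<Longrightarrow> g \<in> generated_algebra G \<Longrightarrow> (\<lambda>x. f x * g x) \<in> generated_algebra G"
  using generated_algebra.mult[of f G g] by (simp add: times_fun_def)

lemma ga_sum: "(\<And>i. i \<in> I \<Longrightarrow> f i \<in> generated_algebra G) \<Longrightarrow> (\<lambda>x. \<Sum>i\<in>I. f i x) \<in> generated_algebra G"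
  by (induction I rule: infinite_finite_induct) (auto intro: generated_algebra.const ga_add)

lemma ga_prod: "(\<And>i. i \<in> I \<Longrightarrow> f i \<in> generated_algebra G) \<Longrightarrow> (\<lambda>x. \<Prod>i\<in>I. f i x) \<in> generated_algebra G"
  by (induction I rule: infinite_finite_induct) (auto intro: generated_algebra.const ga_mult)

lemma ga_det:
  fixes M :: "'x \<Rightarrow> complex^'n^'n"
  assumes "\<And>i j. (\<lambda>x. M x $ i $ j) \<in> generated_algebra G"
  shows "(\<lambda>x. det (M x)) \<in> generated_algebra G"
  unfolding det_def by (intro ga_sum ga_mult generated_algebra.const ga_prod assms)

lemma sum_fun_apply: "(\<Sum>i\<in>I. f i) x = (\<Sum>i\<in>I. f i x)"
  by (induction I rule: infinite_finite_induct) auto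

section \<open>Polynomial functions of one complex variable\<close>

definition polyf :: "(complex \<Rightarrow> complex) \<Rightarrow> bool" where
  "polyf h \<longleftrightarrow> (\<exists>p. \<forall>t. h t = poly p t)"

lemma polyf_const: "polyf (\<lambda>_. c)"
  unfolding polyf_def by (intro exI[of _ "[:c:]"]) simp

lemma polyf_id: "polyf (\<lambda>t. t)"
  unfolding polyf_def by (intro exI[of _ "[:0,1:]"]) simp

lemma polyf_add: "polyf f \<Longrightarrow> polyf g \<Longrightarrow> polyf (\<lambda>t. f t + g t)"
  unfolding polyf_def by (metis poly_add)

lemma polyf_mult: "polyf f \<Longrightarrow> polyf g \<Longrightarrow> polyf (\<lambda>t. f t * g t)"
  unfolding polyf_def by (metis poly_mult)

lemma polyf_power: "polyf f \<Longrightarrow> polyf (\<lambda>t. f t ^ k)"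
  by (induction k) (auto intro: polyf_const polyf_mult)

lemma polyf_sum: "(\<And>i. i \<in> I \<Longrightarrow> polyf (f i)) \<Longrightarrow> polyf (\<lambda>t. \<Sum>i\<in>I. f i t)"
  by (induction I rule: infinite_finite_induct) (auto intro: polyf_const polyf_add)

lemma polyf_prod: "(\<And>i. i \<in> I \<Longrightarrow> polyf (f i)) \<Longrightarrow> polyf (\<lambda>t. \<Prod>i\<in>I. f i t)"
  by (induction I rule: infinite_finite_induct) (auto intro: polyf_const polyf_mult)

lemma polyf_det:
  fixes M :: "complex \<Rightarrow> complex^'n^'n"
  assumes "\<And>i j. polyf (\<lambda>x. M x $ i $ j)"
  shows "polyf (\<lambda>x. det (M x))"
  unfolding det_def by (intro polyf_sum polyf_mult polyf_const polyf_prod assms)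

lemma polyf_generated_algebra:
  assumes "f \<in> generated_algebra G" "\<And>g. g \<in> G \<Longrightarrow> polyf (\<lambda>t. g (c t))"
  shows "polyf (\<lambda>t. f (c t))"
  using assms(1) by induction (auto intro: polyf_const polyf_add polyf_mult assms(2))

lemma polyf_zero:
  assumes "polyf h" "\<And>t. t \<in> S \<Longrightarrow> h t = 0" "infinite S"
  shows "h t = 0"
proof -
  obtain p where p: "\<And>t. h t = poly p t" using assms(1) polyf_def by blast
  have "p = 0"
  proof (rule ccontr)
    assume "p \<noteq> 0"
    then have "finite {t. poly p t = 0}" by (rule poly_roots_finite)
    then show False using assms(2,3) p by (metis (mono_tags, lifting) finite_subset mem_Collect_eq subsetI)
  qed
  then show ?thesis using p by simp
qed

lemma polyf_nonvanishing:
  assumes "polyf h" "\<And>t. h t \<noteq> 0"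
  shows "h t = h 0"
proof -
  obtain p where p: "\<And>t. h t = poly p t" using assms(1) polyf_def by blast
  have "constant (poly p)"
    using fundamental_theorem_of_algebra assms(2) p by fastforce
  then show ?thesis using p by (simp add: constant_def)
qed

lemma polyf_differentiable: "polyf h \<Longrightarrow> h field_differentiable at t"
  unfolding polyf_def by (metis (no_types) ext poly_DERIV field_differentiable_def)

text \<open>Differentiation lowers the degree of a nonconstant polynomial, so it can have polynomial
  eigenvectors only for the eigenvalue 0. This is how exp(c t) with c \<noteq> 0 is recognised as
  not algebraic.\<close>

lemma polyf_eigen:
  assumes "polyf h" "\<And>t. deriv h t = c * h t" "h 0 \<noteq> 0"
  shows "c = 0"
proof -
  obtain p where "\<And>t. h t = poly p t" using assms(1) polyf_def by blast
  then have p: "h = poly p" by auto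
  have "poly (pderiv p) t = poly (Polynomial.smult c p) t" for t
    using assms(2)[of t] DERIV_imp_deriv[OF poly_DERIV[of p t]] by (simp add: p)
  then have eq: "pderiv p = Polynomial.smult c p" by (simp add: poly_eq_poly_eq_iff fun_eq_iff flip: poly_eq_poly_eq_iff)
  show ?thesis
  proof (cases "degree p = 0")
    case True
    then have "pderiv p = 0" by (simp add: pderiv_eq_0_iff)
    then show ?thesis using eq assms(3) p by auto
  next
    case False
    then have "degree (pderiv p) < degree p" by (simp add: degree_pderiv)
    then show ?thesis using eq by (cases "c = 0") auto
  qed
qed

lemma matrix_inv_mult:
  fixes A :: "complex^'n^'n"
  assumes "invertible A"
  shows "A ** matrix_inv A = mat 1" "matrix_inv A ** A = mat 1"
  using assms someI_ex[of "\<lambda>A'. A ** A' = mat 1 \<and> A' ** A = mat 1"]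
  by (auto simp: invertible_def matrix_inv_def)

lemma matrix_inv_eqI:
  fixes A :: "complex^'n^'n"
  assumes "A ** B = mat 1" "B ** A = mat 1"
  shows "matrix_inv A = B"
proof -
  have "matrix_inv A ** (A ** B) = B"
    using matrix_inv_mult(2)[of A] assms by (metis invertible_def matrix_mul_assoc matrix_mul_lid)
  then show ?thesis by (simp add: assms)
qed

text \<open>Cramer's rule. It shows that inversion is regular: the entries of the inverse are
  polynomials in the entries of A and in the inverse of the determinant.\<close>

lemma matrix_inv_entry:
  fixes A :: "complex^'n^'n"
  assumes "invertible A"
  shows "matrix_inv A $ i $ j =
    det (\<chi> a b. if b = i then (if a = j then 1 else 0) else A $ a $ b) * inverse (det A)"
proof -
  have "det A \<noteq> 0" using assms invertible_det_nz by blast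
  moreover have "A *v (column j (matrix_inv A)) = axis j 1"
    using matrix_inv_mult(1)[OF assms]
    by (simp add: vec_eq_iff matrix_matrix_mult_def matrix_vector_mult_def column_def mat_def axis_def)
  ultimately have "column j (matrix_inv A) =
      (\<chi> k. det (\<chi> a b. if b = k then axis j 1 $ a else A $ a $ b) / det A)"
    by (subst (asm) cramer) auto
  then show ?thesis
    by (simp add: vec_eq_iff column_def axis_def divide_inverse cong: if_cong)
qed

section \<open>The coordinate ring of a linear algebraic group\<close>

locale linear_group =
  fixes U :: "(complex^'m::finite^'m) set"
  assumes linear_algebraic_group: "linear_algebraic_group U"
begin

lemma one_in: "mat 1 \<in> U" and mult_in: "g \<in> U \<Longrightarrow> h \<in> U \<Longrightarrow> g ** h \<in> U"
  and inv_in: "g \<in> U \<Longrightarrow> matrix_inv g \<in> U"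
  using linear_algebraic_group by (auto simp: linear_algebraic_group_def)

lemma invertible_in: "g \<in> U \<Longrightarrow> invertible g"
  using linear_algebraic_group by (auto simp: linear_algebraic_group_def)

lemma mult_in_iff: "g \<in> U \<Longrightarrow> g ** h \<in> U \<longleftrightarrow> h \<in> U"
  by (metis inv_in invertible_in matrix_inv_mult(2) matrix_mul_assoc matrix_mul_lid mult_in)

abbreviation "RF \<equiv> regular_functions U"

abbreviation "reg f \<equiv> on_set U f \<in> RF"

lemma rf_outside: "f \<in> RF \<Longrightarrow> x \<notin> U \<Longrightarrow> f x = 0"
  by (auto simp: regular_functions_def on_set_def)

lemma on_set_rf [simp]: "f \<in> RF \<Longrightarrow> on_set U f = f"
  by (auto simp: on_set_def rf_outside)

lemma on_set_in [simp]: "x \<in> U \<Longrightarrow> on_set U f x = f x"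
  by (simp add: on_set_def)

lemma on_set_out [simp]: "x \<notin> U \<Longrightarrow> on_set U f x = 0"
  by (simp add: on_set_def)

lemma on_set_cong: "(\<And>x. x \<in> U \<Longrightarrow> f x = g x) \<Longrightarrow> on_set U f = on_set U g"
  by (auto simp: on_set_def)

lemma reg_cong: "reg f \<Longrightarrow> (\<And>x. x \<in> U \<Longrightarrow> f x = g x) \<Longrightarrow> reg g"
  using on_set_cong[of f g] by simp

lemma rf_eqI:
  assumes "f \<in> RF" "g \<in> RF" "\<And>x. x \<in> U \<Longrightarrow> f x = g x"
  shows "f = g"
proof
  show "f x = g x" for x by (cases "x \<in> U") (simp_all add: assms rf_outside)
qed

lemma reg_ga: "p \<in> generated_algebra (entry_functions \<union> {\<lambda>A. inverse (det A)}) \<Longrightarrow> reg p"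
  unfolding regular_functions_def by (rule imageI)

lemma regE:
  assumes "reg f"
  obtains p where "p \<in> generated_algebra (entry_functions \<union> {\<lambda>A. inverse (det A)})"
    "\<And>x. x \<in> U \<Longrightarrow> f x = p x"
proof -
  from assms obtain p where p: "p \<in> generated_algebra (entry_functions \<union> {\<lambda>A. inverse (det A)})" "on_set U f = on_set U p"
    unfolding regular_functions_def by (elim imageE)
  show thesis
  proof
    show "f x = p x" if "x \<in> U" for x using that p(2) on_set_in by metis
  qed fact
qed

lemma reg_const: "reg (\<lambda>_. c)"
  by (intro reg_ga generated_algebra.const)

lemma reg_entry: "reg (\<lambda>A. A $ i $ j)"
  by (intro reg_ga generated_algebra.gen) (auto simp: entry_functions_def)

lemma reg_inverse_det: "reg (\<lambda>A. inverse (det A))"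
  by (intro reg_ga generated_algebra.gen) auto

lemma reg_add: "reg f \<Longrightarrow> reg g \<Longrightarrow> reg (\<lambda>x. f x + g x)"
  by (elim regE) (rule reg_cong[OF reg_ga], erule (1) ga_add, simp)

lemma reg_mult: "reg f \<Longrightarrow> reg g \<Longrightarrow> reg (\<lambda>x. f x * g x)"
  by (elim regE) (rule reg_cong[OF reg_ga], erule (1) ga_mult, simp)

lemma reg_uminus: "reg f \<Longrightarrow> reg (\<lambda>x. - f x)"
  using reg_mult[OF reg_const[of "-1"], of f] by simp

lemma reg_diff: "reg f \<Longrightarrow> reg g \<Longrightarrow> reg (\<lambda>x. f x - g x)"
  using reg_add[OF _ reg_uminus, of f g] by simp

lemma reg_sum: "(\<And>i. i \<in> I \<Longrightarrow> reg (f i)) \<Longrightarrow> reg (\<lambda>x. \<Sum>i\<in>I. f i x)"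
  by (induction I rule: infinite_finite_induct) (auto intro: reg_const reg_add)

lemma reg_prod: "(\<And>i. i \<in> I \<Longrightarrow> reg (f i)) \<Longrightarrow> reg (\<lambda>x. \<Prod>i\<in>I. f i x)"
  by (induction I rule: infinite_finite_induct) (auto intro: reg_const reg_mult)

lemma reg_det: "(\<And>i j. reg (\<lambda>x. M x $ i $ j)) \<Longrightarrow> reg (\<lambda>x. det (M x :: complex^'k^'k))"
  unfolding det_def by (intro reg_sum reg_mult reg_const reg_prod) auto

lemma reg_matrix_inv: "reg (\<lambda>x. matrix_inv x $ i $ j)"
proof (rule reg_cong)
  show "reg (\<lambda>A. det (\<chi> a b. if b = i then (if a = j then 1 else 0) else A $ a $ b) * inverse (det A))"
  proof (intro reg_mult reg_inverse_det reg_det)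
    show "reg (\<lambda>A. (\<chi> a b. if b = i then (if a = j then 1 else 0) else A $ a $ b) $ k $ l)" for k l
      by (cases "l = i"; cases "k = j") (simp_all add: reg_const reg_entry)
  qed
qed (simp add: matrix_inv_entry invertible_in)

lemma rf_I:
  assumes "reg f" "\<And>x. x \<notin> U \<Longrightarrow> f x = 0"
  shows "f \<in> RF"
proof -
  have "on_set U f = f"
  proof
    show "on_set U f x = f x" for x by (cases "x \<in> U") (simp_all add: assms(2))
  qed
  then show ?thesis using assms(1) by (simp only:)
qed

lemma rf_add: "f \<in> RF \<Longrightarrow> g \<in> RF \<Longrightarrow> f + g \<in> RF"
  unfolding plus_fun_def by (rule rf_I, rule reg_add) (simp_all add: rf_outside[of f] rf_outside[of g])

lemma rf_mult: "f \<in> RF \<Longrightarrow> g \<in> RF \<Longrightarrow> f * g \<in> RF"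
  unfolding times_fun_def by (rule rf_I, rule reg_mult) (simp_all add: rf_outside[of f] rf_outside[of g])

lemma rf_diff: "f \<in> RF \<Longrightarrow> g \<in> RF \<Longrightarrow> f - g \<in> RF"
  unfolding fun_diff_def by (rule rf_I, rule reg_diff) (simp_all add: rf_outside[of f] rf_outside[of g])

lemma rf_uminus: "f \<in> RF \<Longrightarrow> - f \<in> RF"
  unfolding fun_Compl_def by (rule rf_I, rule reg_uminus) (simp_all add: rf_outside[of f])

lemma rf_scale: "f \<in> RF \<Longrightarrow> (\<lambda>x. c * f x) \<in> RF"
  by (rule rf_I, rule reg_mult, rule reg_const) (simp_all add: rf_outside[of f])

lemma rf_0: "0 \<in> RF"
  using reg_const[of 0] by (simp add: on_set_def zero_fun_def)

lemma rf_sum: "(\<And>i. i \<in> I \<Longrightarrow> f i \<in> RF) \<Longrightarrow> (\<Sum>i\<in>I. f i) \<in> RF"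
  by (induction I rule: infinite_finite_induct) (auto intro: rf_0 rf_add)

lemma rf_induct [consumes 1, case_names const entry inverse_det add mult]:
  assumes "f \<in> RF" and const: "\<And>c. P (on_set U (\<lambda>_. c))" and "\<And>i j. P (on_set U (\<lambda>A. A $ i $ j))"
    and "P (on_set U (\<lambda>A. inverse (det A)))"
    and add: "\<And>f g. f \<in> RF \<Longrightarrow> g \<in> RF \<Longrightarrow> P f \<Longrightarrow> P g \<Longrightarrow> P (f + g)"
    and mult: "\<And>f g. f \<in> RF \<Longrightarrow> g \<in> RF \<Longrightarrow> P f \<Longrightarrow> P g \<Longrightarrow> P (f * g)"
  shows "P f"
proof -
  obtain p where p: "p \<in> generated_algebra (entry_functions \<union> {\<lambda>A. inverse (det A)})" and f: "f = on_set U p"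
    using assms(1) unfolding regular_functions_def by (elim imageE)
  from p show ?thesis unfolding f
  proof (induction p)
    case (add f g)
    have "on_set U (f + g) = on_set U f + on_set U g" by (auto simp: on_set_def)
    then show ?case using assms(5)[OF reg_ga[OF add.hyps(1)] reg_ga[OF add.hyps(2)] add.IH] by (simp only:)
  next
    case (mult f g)
    have "on_set U (f * g) = on_set U f * on_set U g" by (auto simp: on_set_def)
    then show ?case using assms(6)[OF reg_ga[OF mult.hyps(1)] reg_ga[OF mult.hyps(2)] mult.IH] by (simp only:)
  qed (auto simp: entry_functions_def assms)
qed

lemma reg_left_translate: "reg f \<Longrightarrow> g \<in> U \<Longrightarrow> reg (\<lambda>x. f (g ** x))"
proof -
  assume "reg f" and g: "g \<in> U"
  then obtain p where p: "p \<in> generated_algebra (entry_functions \<union> {\<lambda>A. inverse (det A)})"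
    and f: "\<And>x. x \<in> U \<Longrightarrow> f x = p x" using regE by blast
  from p have "reg (\<lambda>x. p (g ** x))"
  proof (induction p)
    case (gen f)
    have "reg (\<lambda>x. (g ** x) $ i $ j)" for i j
      unfolding matrix_matrix_mult_def by (simp add: reg_sum reg_mult reg_const reg_entry)
    moreover have "reg (\<lambda>x. inverse (det (g ** x)))"
      unfolding det_mul inverse_mult_distrib by (intro reg_mult reg_const reg_inverse_det)
    ultimately show ?case using gen by (auto simp: entry_functions_def)
  qed (auto intro: reg_const reg_add reg_mult)
  then show ?thesis by (rule reg_cong) (simp add: f g mult_in)
qed

lemma pullback_rf: "g \<in> U \<Longrightarrow> f \<in> RF \<Longrightarrow> pullback g f \<in> RF"
  unfolding pullback_def
  by (rule rf_I, rule reg_left_translate) (auto simp: rf_outside[of f] mult_in_iff)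

lemma pullback_pullback_inv: "g \<in> U \<Longrightarrow> pullback (matrix_inv g) (pullback g f) = f"
  and pullback_inv_pullback: "g \<in> U \<Longrightarrow> pullback g (pullback (matrix_inv g) f) = f"
  by (simp_all add: pullback_def matrix_mul_assoc matrix_inv_mult invertible_in)

lemma pullback_rf_iff: "g \<in> U \<Longrightarrow> pullback g f \<in> RF \<longleftrightarrow> f \<in> RF"
  by (metis pullback_rf pullback_pullback_inv inv_in)

lemma pullback_simps: "pullback g (f + h) = pullback g f + pullback g h"
  "pullback g (f * h) = pullback g f * pullback g h"
  "pullback g (\<lambda>x. c * f x) = (\<lambda>x. c * pullback g f x)" "pullback g 0 = 0"
  by (auto simp: pullback_def)

text \<open>The functions on \<open>U \<times> U\<close> that come from \<open>\<complex>[U] \<otimes> \<complex>[U]\<close>.\<close>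

inductive tensor :: "(complex^'m^'m \<Rightarrow> 'm fn) \<Rightarrow> bool" where
  zero: "tensor (\<lambda>x. 0)"
| step: "tensor F \<Longrightarrow> a \<in> RF \<Longrightarrow> b \<in> RF \<Longrightarrow> tensor (\<lambda>x. F x + (\<lambda>y. a x * b y))"

lemma tensor_add: "tensor G \<Longrightarrow> tensor F \<Longrightarrow> tensor (\<lambda>x. F x + G x)"
proof (induction rule: tensor.induct)
  case (step G a b)
  then show ?case using tensor.step[of "\<lambda>x. F x + G x" a b] by (simp only: add.assoc)
qed auto

lemma tensor_pure: "a \<in> RF \<Longrightarrow> b \<in> RF \<Longrightarrow> tensor (\<lambda>x y. a x * b y)"
  using tensor.step[OF tensor.zero, of a b] by simp

lemma tensor_mult_pure: "tensor F \<Longrightarrow> a \<in> RF \<Longrightarrow> b \<in> RF \<Longrightarrow> tensor (\<lambda>x y. F x y * (a x * b y))"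
proof (induction rule: tensor.induct)
  case (step F a' b')
  then have "tensor (\<lambda>x. (\<lambda>y. F x y * (a x * b y)) + (\<lambda>y. (a' * a) x * (b' * b) y))"
    by (intro tensor.step rf_mult)
  then show ?case by (rule back_subst[of tensor]) (auto simp: fun_eq_iff algebra_simps)
qed (use tensor.zero in \<open>simp add: zero_fun_def\<close>)

lemma tensor_mult: "tensor G \<Longrightarrow> tensor F \<Longrightarrow> tensor (\<lambda>x. F x * G x)"
proof (induction rule: tensor.induct)
  case (step G a b)
  then have "tensor (\<lambda>x. F x * G x + (\<lambda>y. F x y * (a x * b y)))"
    by (intro tensor_add tensor_mult_pure)
  then show ?case by (rule back_subst[of tensor]) (auto simp: fun_eq_iff algebra_simps)
qed (use tensor.zero in \<open>auto simp add: zero_fun_def times_fun_def\<close>)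

lemma tensor_sum: "(\<And>i. i \<in> I \<Longrightarrow> tensor (F i)) \<Longrightarrow> tensor (\<lambda>x. \<Sum>i\<in>I. F i x)"
  by (induction I rule: infinite_finite_induct) (auto intro: tensor.zero tensor_add)

text \<open>Entries of a matrix product are sums of products, the inverse determinant is
  multiplicative, and tensors are closed under sums and products. This splitting of f(x y) is what
  makes functions of the form x \<mapsto> D(f(x y)), with D acting in y, regular.\<close>

lemma comultiplication:
  assumes "f \<in> RF"
  shows "\<exists>F. tensor F \<and> (\<forall>x\<in>U. pullback x f = F x)"
  using assms
proof (induction rule: rf_induct)
  case (const c)
  let ?F = "\<lambda>x y. on_set U (\<lambda>_. c) x * on_set U (\<lambda>_. 1) y"
  have "tensor ?F" by (intro tensor_pure reg_const)
  moreover have "pullback x (on_set U (\<lambda>_. c)) = ?F x" if "x \<in> U" for x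
    using that by (auto simp: pullback_def on_set_def mult_in_iff)
  ultimately show ?case by blast
next
  case (entry i j)
  let ?F = "\<lambda>x. \<Sum>k\<in>UNIV. (\<lambda>y. on_set U (\<lambda>A. A $ i $ k) x * on_set U (\<lambda>A. A $ k $ j) y)"
  have "tensor ?F" by (intro tensor_sum tensor_pure reg_entry)
  moreover have "pullback x (on_set U (\<lambda>A. A $ i $ j)) = ?F x" if "x \<in> U" for x
  proof
    fix y
    have "(x ** y) $ i $ j = (\<Sum>k\<in>UNIV. x $ i $ k * y $ k $ j)"
      by (simp add: matrix_matrix_mult_def)
    then show "pullback x (on_set U (\<lambda>A. A $ i $ j)) y = ?F x y"
      using that by (cases "y \<in> U") (simp_all add: pullback_def mult_in_iff sum_fun_apply mult_in)
  qed
  ultimately show ?case by blast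
next
  case inverse_det
  let ?F = "\<lambda>x y. on_set U (\<lambda>A. inverse (det A)) x * on_set U (\<lambda>A. inverse (det A)) y"
  have "tensor ?F" by (intro tensor_pure reg_inverse_det)
  moreover have "pullback x (on_set U (\<lambda>A. inverse (det A))) = ?F x" if "x \<in> U" for x
    using that by (auto simp: pullback_def on_set_def mult_in_iff det_mul)
  ultimately show ?case by blast
next
  case (add f g)
  then obtain F G where "tensor F" "\<forall>x\<in>U. pullback x f = F x" "tensor G" "\<forall>x\<in>U. pullback x g = G x"
    by blast
  then show ?case by (intro exI[of _ "\<lambda>x. F x + G x"] conjI tensor_add ballI) (simp_all only: pullback_simps)
next
  case (mult f g)
  then obtain F G where "tensor F" "\<forall>x\<in>U. pullback x f = F x" "tensor G" "\<forall>x\<in>U. pullback x g = G x"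
    by blast
  then show ?case by (intro exI[of _ "\<lambda>x. F x * G x"] conjI tensor_mult ballI) (simp_all only: pullback_simps)
qed

end

context linear_group
begin

subsection \<open>Derivations\<close>

lemma der_closed: "v \<in> derivations U \<Longrightarrow> f \<in> RF \<Longrightarrow> v f \<in> RF"
  and der_outside: "v \<in> derivations U \<Longrightarrow> f \<notin> RF \<Longrightarrow> v f = 0"
  and der_add: "v \<in> derivations U \<Longrightarrow> f \<in> RF \<Longrightarrow> g \<in> RF \<Longrightarrow> v (f + g) = v f + v g"
  and der_scale: "v \<in> derivations U \<Longrightarrow> f \<in> RF \<Longrightarrow> v (\<lambda>x. c * f x) = (\<lambda>x. c * v f x)"
  and der_mult: "v \<in> derivations U \<Longrightarrow> f \<in> RF \<Longrightarrow> g \<in> RF \<Longrightarrow> v (f * g) = f * v g + v f * g"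
  by (simp_all only: derivations_def mem_Collect_eq simp_thms)

lemma der_add': "v \<in> derivations U \<Longrightarrow> reg f \<Longrightarrow> reg g \<Longrightarrow>
    v (on_set U (\<lambda>x. f x + g x)) = v (on_set U f) + v (on_set U g)"
  by (subst der_add[symmetric]) (auto simp: on_set_def intro!: arg_cong[of _ _ v])

lemma der_scale': "v \<in> derivations U \<Longrightarrow> reg f \<Longrightarrow>
    v (on_set U (\<lambda>x. c * f x)) = (\<lambda>x. c * v (on_set U f) x)"
  by (subst der_scale[symmetric]) (auto simp: on_set_def intro!: arg_cong[of _ _ v])

lemma der_mult': "v \<in> derivations U \<Longrightarrow> reg f \<Longrightarrow> reg g \<Longrightarrow> u \<in> U \<Longrightarrow>
    v (on_set U (\<lambda>x. f x * g x)) u = f u * v (on_set U g) u + v (on_set U f) u * g u"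
proof -
  assume a: "v \<in> derivations U" "reg f" "reg g" "u \<in> U"
  have "on_set U (\<lambda>x. f x * g x) = on_set U f * on_set U g" by (auto simp: on_set_def)
  then show ?thesis using der_mult[OF a(1-3)] a(4) by simp
qed

lemma der_const: assumes "v \<in> derivations U" shows "v (on_set U (\<lambda>_. c)) = 0"
proof -
  let ?e = "on_set U (\<lambda>_. 1)"
  have e: "?e \<in> RF" by (rule reg_const)
  have "?e * ?e = ?e" by (auto simp: on_set_def)
  then have eq: "v ?e = ?e * v ?e + v ?e * ?e" using der_mult[OF assms e e] by simp
  have "v ?e x = 0" for x
    using fun_cong[OF eq, of x] rf_outside[OF der_closed[OF assms e], of x]
    by (cases "x \<in> U") auto
  moreover have "v (on_set U (\<lambda>_. c)) = (\<lambda>x. c * v ?e x)"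
    using der_scale'[OF assms e, of c] by simp
  ultimately show ?thesis by (simp add: zero_fun_def)
qed

lemma der_0: "v \<in> derivations U \<Longrightarrow> v 0 = 0"
  using der_const[of v 0] by (simp add: on_set_def zero_fun_def)

lemma der_sum':
  assumes "v \<in> derivations U" "\<And>i. i \<in> I \<Longrightarrow> reg (f i)"
  shows "v (on_set U (\<lambda>x. \<Sum>i\<in>I. f i x)) = (\<Sum>i\<in>I. v (on_set U (f i)))"
  using assms(2)
  by (induction I rule: infinite_finite_induct)
    (simp_all add: der_const[OF assms(1)] der_add'[OF assms(1)] reg_sum del: plus_fun_apply)

lemma derI:
  assumes "\<And>f. f \<notin> RF \<Longrightarrow> v f = 0" "\<And>f. f \<in> RF \<Longrightarrow> v f \<in> RF"
    "\<And>f g. f \<in> RF \<Longrightarrow> g \<in> RF \<Longrightarrow> v (f + g) = v f + v g"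
    "\<And>c f. f \<in> RF \<Longrightarrow> v (\<lambda>x. c * f x) = (\<lambda>x. c * v f x)"
    "\<And>f g. f \<in> RF \<Longrightarrow> g \<in> RF \<Longrightarrow> v (f * g) = f * v g + v f * g"
  shows "v \<in> derivations U"
  using assms by (simp only: derivations_def mem_Collect_eq) blast

lemma commutator_der:
  assumes v: "v \<in> derivations U" and w: "w \<in> derivations U"
  shows "commutator v w \<in> derivations U"
proof (rule derI)
  fix f g c assume f: "f \<in> RF"
  note c = der_closed[OF v] der_closed[OF w]
  show "commutator v w (\<lambda>x. c * f x) = (\<lambda>x. c * commutator v w f x)"
    by (simp only: commutator_def der_scale[OF v] der_scale[OF w] c f) (auto simp: algebra_simps)
  show "commutator v w f \<in> RF"
    by (simp add: commutator_def rf_diff c f)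
  assume g: "g \<in> RF"
  show "commutator v w (f + g) = commutator v w f + commutator v w g"
    by (simp only: commutator_def der_add[OF v] der_add[OF w] c f g) (simp add: algebra_simps)
  show "commutator v w (f * g) = f * commutator v w g + commutator v w f * g"
    by (simp only: commutator_def der_add[OF v] der_add[OF w] der_mult[OF v] der_mult[OF w] c f g rf_mult)
      (simp add: algebra_simps)
qed (simp add: commutator_def der_outside[OF v] der_outside[OF w] der_0[OF v] der_0[OF w])

lemma pushforward_der:
  assumes g: "g \<in> U" and v: "v \<in> derivations U"
  shows "pushforward g v \<in> derivations U"
proof (rule derI)
  fix f h c
  show "f \<notin> RF \<Longrightarrow> pushforward g v f = 0"
    by (simp only: pushforward_def der_outside[OF v] pullback_rf_iff[OF g] pullback_simps not_False_eq_True)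
  assume f: "f \<in> RF"
  note p = pullback_rf[OF g] pullback_rf[OF inv_in[OF g]]
  show "pushforward g v f \<in> RF"
    unfolding pushforward_def by (intro p der_closed[OF v] f)
  show "pushforward g v (\<lambda>x. c * f x) = (\<lambda>x. c * pushforward g v f x)"
    by (simp only: pushforward_def der_scale[OF v] p pullback_simps f)
  assume h: "h \<in> RF"
  show "pushforward g v (f + h) = pushforward g v f + pushforward g v h"
    by (simp only: pushforward_def der_add[OF v] p pullback_simps f h)
  show "pushforward g v (f * h) = f * pushforward g v h + pushforward g v f * h"
    by (simp only: pushforward_def der_mult[OF v] p pullback_simps f h pullback_pullback_inv[OF g])
qed

lemma pushforward_apply:
  assumes "g \<in> U" "u \<in> U"
  shows "pushforward g v f (g ** u) = v (pullback g f) u"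
  using assms by (simp add: pushforward_def pullback_def[of "matrix_inv g"] matrix_mul_assoc matrix_inv_mult invertible_in)


subsection \<open>Left invariant fields and point derivations\<close>

definition point_derivation :: "('m fn \<Rightarrow> complex) \<Rightarrow> bool" where
  "point_derivation D \<longleftrightarrow>
     (\<forall>f\<in>RF. \<forall>g\<in>RF. D (f + g) = D f + D g \<and> D (f * g) = f (mat 1) * D g + D f * g (mat 1)) \<and>
     (\<forall>c. \<forall>f\<in>RF. D (\<lambda>x. c * f x) = c * D f)"

text \<open>The vector field whose value at u is the tangent vector D moved from the identity to u
  by left translation.\<close>

definition left_field :: "('m fn \<Rightarrow> complex) \<Rightarrow> 'm operator" where
  "left_field D f = (if f \<in> RF then on_set U (\<lambda>u. D (pullback u f)) else 0)"

lemma tensor_left_slice: "tensor F \<Longrightarrow> F u \<in> RF"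
  by (induction rule: tensor.induct) (auto intro!: rf_0 rf_add rf_scale simp del: plus_fun_apply zero_fun_apply)

lemma point_derivation_tensor:
  assumes D: "point_derivation D" and "tensor F"
  shows "(\<lambda>u. D (F u)) \<in> RF"
  using assms(2)
proof induction
  case zero
  have "D 0 = 0" using D rf_0 unfolding point_derivation_def by force
  then show ?case using rf_0 by (simp add: zero_fun_def)
next
  case (step F a b)
  have "D (F u + (\<lambda>y. a u * b y)) = D (F u) + D b * a u" for u
    using D step tensor_left_slice[of F u] rf_scale[of b "a u"] unfolding point_derivation_def by (simp del: plus_fun_apply)
  then show ?case
    using rf_add[OF step.IH rf_scale[OF step.hyps(2), of "D b"]] by (simp add: plus_fun_def)
qed

text \<open>The point to check is that regular functions are mapped to regular functions. If f(u y)
  is the sum of the products a(u) b(y), then the field sends f to the sum of the D(b) a, by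
  \<open>comultiplication\<close>.\<close>

lemma left_field_invariant:
  assumes D: "point_derivation D"
  shows "left_field D \<in> left_invariant_fields U"
proof -
  have cl: "left_field D f \<in> RF" if f: "f \<in> RF" for f
  proof -
    obtain F where F: "tensor F" "\<And>x. x \<in> U \<Longrightarrow> pullback x f = F x" using comultiplication[OF f] by blast
    have "reg (\<lambda>u. D (F u))" using point_derivation_tensor[OF D F(1)] by simp
    then have "reg (\<lambda>u. D (pullback u f))" by (rule reg_cong) (simp add: F)
    then show ?thesis using f by (simp add: left_field_def)
  qed
  have der: "left_field D \<in> derivations U"
  proof (rule derI)
    fix f g c assume f: "f \<in> RF"
    show "left_field D (\<lambda>x. c * f x) = (\<lambda>x. c * left_field D f x)"
      using D f pullback_rf[of _ f] rf_scale[OF f]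
      by (auto simp: left_field_def point_derivation_def on_set_def pullback_simps)
    assume g: "g \<in> RF"
    show "left_field D (f + g) = left_field D f + left_field D g"
    proof
      show "left_field D (f + g) x = (left_field D f + left_field D g) x" for x
        using D f g pullback_rf[of x f] pullback_rf[of x g] rf_add[OF f g]
        by (cases "x \<in> U") (simp_all only: left_field_def point_derivation_def on_set_in on_set_out pullback_simps plus_fun_apply if_True, simp)
    qed
    show "left_field D (f * g) = f * left_field D g + left_field D f * g"
    proof
      show "left_field D (f * g) x = (f * left_field D g + left_field D f * g) x" for x
        using D f g pullback_rf[of x f] pullback_rf[of x g] rf_mult[OF f g]
        by (cases "x \<in> U") (simp_all only: left_field_def point_derivation_def on_set_in on_set_out pullback_simps plus_fun_apply times_fun_apply if_True,
            simp_all add: pullback_def)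
    qed
  qed (use cl in \<open>auto simp: left_field_def\<close>)
  moreover have "pushforward g (left_field D) f = left_field D f" if g: "g \<in> U" for g f
  proof (cases "f \<in> RF")
    case True
    have *: "pullback (matrix_inv g ** x) (pullback g f) = pullback x f" for x
      using g by (simp add: pullback_def matrix_mul_assoc[symmetric])
        (simp add: matrix_mul_assoc matrix_inv_mult invertible_in)
    show ?thesis
    proof
      fix x
      have "pushforward g (left_field D) f x = on_set U (\<lambda>u. D (pullback u (pullback g f))) (matrix_inv g ** x)"
        by (simp add: pushforward_def left_field_def pullback_rf[OF g True] pullback_def[of "matrix_inv g"])
      also have "\<dots> = left_field D f x"
        using True by (simp add: left_field_def on_set_def mult_in_iff[OF inv_in[OF g]] *)
      finally show "pushforward g (left_field D) f x = left_field D f x" .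
    qed
  next
    case False
    then show ?thesis using pullback_rf_iff[OF g] by (simp add: pushforward_def left_field_def pullback_simps)
  qed
  ultimately show ?thesis by (auto simp: left_invariant_fields_def)
qed

lemma left_field_at_one: "f \<in> RF \<Longrightarrow> left_field D f (mat 1) = D f"
  by (simp add: left_field_def one_in pullback_def)

lemma left_invariant_der: "v \<in> left_invariant_fields U \<Longrightarrow> v \<in> derivations U"
  by (simp add: left_invariant_fields_def)

lemma left_invariant_pullback:
  assumes "v \<in> left_invariant_fields U" "g \<in> U"
  shows "v (pullback g f) = pullback g (v f)"
proof -
  have "pushforward g v f = v f" using assms by (simp add: left_invariant_fields_def)
  then have "pullback g (v f) = pullback g (pullback (matrix_inv g) (v (pullback g f)))"
    by (simp add: pushforward_def)
  then show ?thesis by (simp add: pullback_inv_pullback assms)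
qed

lemma left_invariant_apply:
  assumes "v \<in> left_invariant_fields U" "g \<in> U"
  shows "v f g = v (pullback g f) (mat 1)"
  using left_invariant_pullback[OF assms, of f] by (simp add: pullback_def)

lemma point_derivation_der:
  assumes "v \<in> derivations U" shows "point_derivation (\<lambda>f. v f (mat 1))"
  unfolding point_derivation_def
  by (auto simp: der_add[OF assms] der_mult[OF assms] der_scale[OF assms] simp del: plus_fun_apply times_fun_apply)
    (simp_all)

text \<open>The entries and the inverse determinant generate the ring. A difference of point
  derivations that vanishes on the entries vanishes on the determinant, and then on its inverse
  because the product of the two is the unit.\<close>

lemma point_derivation_eqI:
  assumes D: "point_derivation D" and D': "point_derivation D'"
    and eq: "\<And>i j. D (on_set U (\<lambda>A. A $ i $ j)) = D' (on_set U (\<lambda>A. A $ i $ j))" and "f \<in> RF"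
  shows "D f = D' f"
proof -
  define E where "E f = D f - D' f" for f
  have add: "E (f + g) = E f + E g" and mult: "E (f * g) = f (mat 1) * E g + E f * g (mat 1)"
    and scale: "E (\<lambda>x. c * f x) = c * E f" if "f \<in> RF" "g \<in> RF" for f g c
    using that D D' unfolding E_def point_derivation_def by (simp_all add: algebra_simps del: plus_fun_apply times_fun_apply)
  let ?e = "on_set U (\<lambda>_. 1)"
  have "?e * ?e = ?e" by (auto simp: on_set_def)
  then have E1: "E ?e = 0" using mult[OF reg_const reg_const, of 1 1] by (simp add: one_in)
  have c: "E (on_set U (\<lambda>_. c)) = 0" for c
  proof -
    have "on_set U (\<lambda>_. c) = (\<lambda>x. c * ?e x)" by (auto simp: on_set_def)
    then show ?thesis using scale[OF reg_const reg_const, of c 1] E1 by simp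
  qed
  have sum: "E (on_set U (\<lambda>x. \<Sum>i\<in>I. f i x)) = (\<Sum>i\<in>I. E (on_set U (f i)))"
    if "\<And>i. i \<in> I \<Longrightarrow> reg (f i)" for f :: "'q \<Rightarrow> 'm fn" and I
    using that
  proof (induction I rule: infinite_finite_induct)
    case (insert i I)
    have "on_set U (\<lambda>x. f i x + (\<Sum>i\<in>I. f i x)) = on_set U (f i) + on_set U (\<lambda>x. \<Sum>i\<in>I. f i x)"
      by (auto simp: on_set_def)
    then show ?case using insert add[of "on_set U (f i)" "on_set U (\<lambda>x. \<Sum>i\<in>I. f i x)"] reg_sum[of I f] by (simp del: plus_fun_apply)
  qed (use c[of 0] in simp_all)
  have mult0: "E (on_set U (\<lambda>x. f x * g x)) = 0" if "reg f" "reg g" "E (on_set U f) = 0" "E (on_set U g) = 0" for f g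
  proof -
    have "on_set U (\<lambda>x. f x * g x) = on_set U f * on_set U g" by (auto simp: on_set_def)
    then show ?thesis using mult[of "on_set U f" "on_set U g"] that by simp
  qed
  have entry: "E (on_set U (\<lambda>A. A $ i $ j)) = 0" for i j using eq by (simp add: E_def)
  have prod: "E (on_set U (\<lambda>A. \<Prod>i\<in>I. A $ i $ p i)) = 0" for p I
  proof (induction I rule: infinite_finite_induct)
    case (insert i I)
    then show ?case
      using mult0[of "\<lambda>A. A $ i $ p i" "\<lambda>A. \<Prod>i\<in>I. A $ i $ p i"] by (simp add: entry reg_entry reg_prod)
  qed (use c in simp_all)
  have Edet: "E (on_set U det) = 0"
    unfolding det_def
    by (subst sum) (auto intro!: sum.neutral mult0 reg_mult reg_const reg_prod reg_entry c prod)
  have "on_set U det * on_set U (\<lambda>A. inverse (det A)) = ?e"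
    by (auto simp: on_set_def fun_eq_iff invertible_det_nz dest!: invertible_in)
  then have Einv: "E (on_set U (\<lambda>A. inverse (det A))) = 0"
    using mult[OF _ reg_inverse_det, of "on_set U det"] reg_det[of "\<lambda>A. A"] Edet E1 by (simp add: reg_entry one_in)
  from \<open>f \<in> RF\<close> have "E f = 0"
  proof (induction rule: rf_induct)
    case (add f g)
    then show ?case using \<open>\<And>g f. \<lbrakk>f \<in> RF; g \<in> RF\<rbrakk> \<Longrightarrow> E (f + g) = E f + E g\<close>[OF add(1,2)] by (simp del: plus_fun_apply)
  next
    case (mult f g)
    then show ?case using \<open>\<And>g f. \<lbrakk>f \<in> RF; g \<in> RF\<rbrakk> \<Longrightarrow> E (f * g) = f (mat 1) * E g + E f * g (mat 1)\<close>[OF mult(1,2)] by (simp del: times_fun_apply)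
  qed (simp_all add: c entry Einv)
  then show ?thesis by (simp add: E_def)
qed

end

section \<open>Integration of nilpotent representations\<close>

context linear_group
begin

definition regm :: "(complex^'m^'m \<Rightarrow> 'n::finite cmat) \<Rightarrow> bool" where
  "regm W \<longleftrightarrow> (\<forall>i j. reg (\<lambda>g. vec_of (W g) $ i $ j))"

lemma regm_const: "regm (\<lambda>_. A)"
  by (simp add: regm_def reg_const)

lemma regm_add: "regm W \<Longrightarrow> regm V \<Longrightarrow> regm (\<lambda>g. W g + V g)"
  by (simp add: regm_def reg_add)

lemma regm_diff: "regm W \<Longrightarrow> regm V \<Longrightarrow> regm (\<lambda>g. W g - V g)"
  by (simp add: regm_def reg_diff)

lemma regm_uminus: "regm W \<Longrightarrow> regm (\<lambda>g. - W g)"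
  by (simp add: regm_def reg_uminus)

lemma regm_mult: "regm W \<Longrightarrow> regm V \<Longrightarrow> regm (\<lambda>g. W g * V g)"
  by (simp add: regm_def matrix_matrix_mult_def reg_sum reg_mult)

lemma regm_sum: "(\<And>i. i \<in> I \<Longrightarrow> regm (W i)) \<Longrightarrow> regm (\<lambda>g. \<Sum>i\<in>I. W i g)"
  by (induction I rule: infinite_finite_induct) (auto intro: regm_const regm_add)

lemma regm_power: "regm W \<Longrightarrow> regm (\<lambda>g. W g ^ k)"
  by (induction k) (auto intro: regm_const regm_mult)

lemma regm_ev: "regm W \<Longrightarrow> regm (\<lambda>g. ev K (W g) f)"
  unfolding ev_def by (intro regm_sum regm_mult regm_const regm_power)

lemma regm_nexp: "regm W \<Longrightarrow> regm (\<lambda>g. nexp (W g))"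
  unfolding nexp_def by (rule regm_ev)

text \<open>Entrywise derivative along v, at the point g, of a function with matrix values; only the
  values on U enter.\<close>

definition dm :: "'m operator \<Rightarrow> (complex^'m^'m \<Rightarrow> 'n::finite cmat) \<Rightarrow> complex^'m^'m \<Rightarrow> 'n cmat" where
  "dm v W g = mat_of (\<chi> i j. v (on_set U (\<lambda>h. vec_of (W h) $ i $ j)) g)"

lemma dm_cong: "(\<And>h. h \<in> U \<Longrightarrow> W h = V h) \<Longrightarrow> dm v W g = dm v V g"
  by (simp add: dm_def cong: on_set_cong)

lemma dm_const: "v \<in> derivations U \<Longrightarrow> dm v (\<lambda>_. A) g = 0"
  by (simp add: dm_def der_const zero_cmat_def zero_vec_def)

lemma dm_add: "v \<in> derivations U \<Longrightarrow> regm W \<Longrightarrow> regm V \<Longrightarrow> dm v (\<lambda>h. W h + V h) g = dm v W g + dm v V g"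
  unfolding regm_def
proof (rule cmat_eqI, simp add: dm_def vec_eq_iff, intro allI)
  fix i j
  assume *: "v \<in> derivations U" "\<forall>i j. reg (\<lambda>g. vec_of (W g) $ i $ j)" "\<forall>i j. reg (\<lambda>g. vec_of (V g) $ i $ j)"
  show "v (on_set U (\<lambda>h. vec_of (W h) $ i $ j + vec_of (V h) $ i $ j)) g =
     v (on_set U (\<lambda>h. vec_of (W h) $ i $ j)) g + v (on_set U (\<lambda>h. vec_of (V h) $ i $ j)) g"
    using fun_cong[OF der_add'[OF *(1) *(2)[rule_format] *(3)[rule_format]], of i j i j g] by simp
qed

lemma dm_mult:
  assumes "v \<in> derivations U" "regm W" "regm V" "g \<in> U"
  shows "dm v (\<lambda>h. W h * V h) g = dm v W g * V g + W g * dm v V g"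
proof (rule cmat_eqI, simp add: dm_def vec_eq_iff, intro allI)
  fix i j
  have "v (on_set U (\<lambda>h. \<Sum>k\<in>UNIV. vec_of (W h) $ i $ k * vec_of (V h) $ k $ j)) g =
    (\<Sum>k\<in>UNIV. v (on_set U (\<lambda>h. vec_of (W h) $ i $ k * vec_of (V h) $ k $ j)) g)"
    using assms by (subst der_sum') (auto simp: regm_def reg_mult sum_fun_apply)
  also have "\<dots> = (\<Sum>k\<in>UNIV. vec_of (W g) $ i $ k * v (on_set U (\<lambda>h. vec_of (V h) $ k $ j)) g +
      v (on_set U (\<lambda>h. vec_of (W h) $ i $ k)) g * vec_of (V g) $ k $ j)"
    using assms by (intro sum.cong refl der_mult') (auto simp: regm_def)
  finally show "v (on_set U (\<lambda>h. (vec_of (W h) ** vec_of (V h)) $ i $ j)) g =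
    ((\<chi> i j. v (on_set U (\<lambda>h. vec_of (W h) $ i $ j)) g) ** vec_of (V g)) $ i $ j +
    (vec_of (W g) ** (\<chi> i j. v (on_set U (\<lambda>h. vec_of (V h) $ i $ j)) g)) $ i $ j"
    by (simp add: matrix_matrix_mult_def sum.distrib add.commute)
qed

lemma dm_const_mult: "v \<in> derivations U \<Longrightarrow> regm W \<Longrightarrow> g \<in> U \<Longrightarrow> dm v (\<lambda>h. A * W h) g = A * dm v W g"
  by (simp add: dm_mult regm_const dm_const)

lemma dm_sum: "v \<in> derivations U \<Longrightarrow> (\<And>i. i \<in> I \<Longrightarrow> regm (W i)) \<Longrightarrow>
    dm v (\<lambda>h. \<Sum>i\<in>I. W i h) g = (\<Sum>i\<in>I. dm v (W i) g)"
  by (induction I rule: infinite_finite_induct) (auto simp: dm_const dm_add regm_sum)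

lemma power_derivation_dm:
  assumes "v \<in> derivations U" "regm W" "g \<in> U"
  shows "power_derivation (W g) (dm v W g) (\<lambda>j. dm v (\<lambda>h. W h ^ j) g)"
proof
  show "dm v (\<lambda>h. W h ^ Suc j) g = dm v (\<lambda>h. W h ^ j) g * W g + W g ^ j * dm v W g" for j
    unfolding power_Suc2 by (rule dm_mult) (auto intro: assms regm_power)
qed (simp add: dm_const assms)

text \<open>The bound K is left free because two such series, one for matrices of the size of the
  group and one for those of a representation, are later compared with the same number of
  terms.\<close>

lemma exp_derivative:
  fixes W :: "complex^'m^'m \<Rightarrow> 'n::finite cmat"
  assumes v: "v \<in> derivations U" and W: "regm W" and g: "g \<in> U" and nilp: "\<And>h. h \<in> U \<Longrightarrow> nilp (W h)"
    and K: "CARD('n) \<le> K"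
  shows "nexp (- W g) * dm v (\<lambda>h. nexp (W h)) g =
    (\<Sum>k<2*K. sc (1 / fact k) * power_derivation.b (W g) (\<lambda>j. dm v (\<lambda>h. W h ^ j) g) k)"
proof -
  let ?e = "\<lambda>j. dm v (\<lambda>h. W h ^ j) g"
  have W0: "W h ^ j = 0" if "h \<in> U" "CARD('n) \<le> j" for h j
    using nilp[OF that(1)] that(2) unfolding nilp_def by (rule power_eq_0_mono)
  \<comment> \<open>The power vanishes on all of U and not only at g, so its derivative at g
    vanishes as well.\<close>
  have e0: "?e j = 0" if "CARD('n) \<le> j" for j
    using dm_cong[of "\<lambda>h. W h ^ j" "\<lambda>_. 0" v g] W0 that dm_const[OF v] by simp
  have "dm v (\<lambda>h. nexp (W h)) g = (\<Sum>j<CARD('n). sc (1 / fact j) * ?e j)"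
    unfolding nexp_def ev_def
    by (subst dm_sum) (auto intro!: v W regm_mult regm_const regm_power sum.cong dm_const_mult g)
  also have "\<dots> = (\<Sum>j<K. sc (1 / fact j) * ?e j)"
    using K e0 by (intro sum.mono_neutral_left) auto
  finally have "dm v (\<lambda>h. nexp (W h)) g = \<dots>" .
  moreover have "nexp (- W g) = ev K (- W g) (fps_exp 1)"
    unfolding nexp_def using nilp_uminus[OF nilp[OF g]] K by (intro ev_mono[symmetric]) (auto simp: nilp_def)
  ultimately show ?thesis
    using exp_times_derivative[OF power_derivation_dm[OF v W g] W0[OF g K] e0[OF K]] by simp
qed

end

section \<open>The unipotent group, its Lie algebra and the logarithm\<close>

lemma unipotent_nilp:
  assumes "unipotent_group U" "g \<in> U"
  shows "nilp (mat_of g - 1)"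
proof -
  have "((\<lambda>A. (g - mat 1) ** A) ^^ k) (mat 1) = vec_of ((mat_of g - 1) ^ k)" for k
    by (induction k) simp_all
  then obtain k where "vec_of ((mat_of g - 1) ^ k) = 0"
    using assms unfolding unipotent_group_def by metis
  then show ?thesis unfolding nilp_iff by (metis cmat_eqI vec_of_simps(1))
qed

lemma vec_of_nexp_sc:
  "vec_of (nexp (sc t * N)) $ i $ j = (\<Sum>k<CARD('n). t ^ k / fact k * vec_of (N ^ k) $ i $ j)"
  for N :: "'n::finite cmat"
  by (simp add: nexp_sc ev_def vec_of_sum vec_of_sc_mult del: vec_of_simps(6))

locale lie_setting = nilpotent_lie_algebra smul B bracket
  for smul :: "complex \<Rightarrow> 'a::ab_group_add \<Rightarrow> 'a" and B and bracket :: "'a \<Rightarrow> 'a \<Rightarrow> 'a" +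
  fixes U :: "(complex^'m::finite^'m) set" and \<theta> :: "'a \<Rightarrow> 'm operator"
  assumes unipotent: "unipotent_group U"
    and identification: "lie_algebra_identification smul bracket U \<theta>"
begin

sublocale linear_group U
  using unipotent by unfold_locales (simp add: unipotent_group_def)

lemma theta_left_invariant: "\<theta> x \<in> left_invariant_fields U"
  using identification by (auto simp: lie_algebra_identification_def bij_betw_def)

lemma theta_der: "\<theta> x \<in> derivations U"
  by (rule left_invariant_der[OF theta_left_invariant])

lemma theta_inj: "\<theta> x = \<theta> y \<Longrightarrow> x = y"
  using identification by (auto simp: lie_algebra_identification_def bij_betw_def inj_on_def)

lemma theta_surj: "v \<in> left_invariant_fields U \<Longrightarrow> \<exists>x. v = \<theta> x"
  using identification unfolding lie_algebra_identification_def bij_betw_def by blast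

lemma theta_add: "\<theta> (x + y) = \<theta> x + \<theta> y"
  and theta_smul: "\<theta> (smul c x) = (\<lambda>f u. c * \<theta> x f u)"
  and theta_bracket: "\<theta> (bracket x y) = commutator (\<theta> x) (\<theta> y)"
  using identification unfolding lie_algebra_identification_def by blast+

text \<open>The tangent vector at the identity, as a matrix.\<close>

definition X :: "'a \<Rightarrow> complex^'m^'m" where
  "X x = (\<chi> i j. \<theta> x (on_set U (\<lambda>A. A $ i $ j)) (mat 1))"

lemma X_add: "X (x + y) = X x + X y"
  by (simp add: X_def theta_add vec_eq_iff)

lemma X_smul: "X (smul c x) = (\<chi> i j. c * X x $ i $ j)"
  by (simp add: X_def theta_smul)

text \<open>Left invariance moves the evaluation to the identity, where the field acts on the
  entries of g A as functions of A. These are linear in the entries of A, so the field at g is the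
  matrix g X.\<close>

lemma theta_entry:
  assumes "g \<in> U"
  shows "\<theta> x (on_set U (\<lambda>A. A $ i $ j)) g = (g ** X x) $ i $ j"
proof -
  have "pullback g (on_set U (\<lambda>A. A $ i $ j)) = on_set U (\<lambda>A. \<Sum>k\<in>UNIV. g $ i $ k * A $ k $ j)"
  proof
    fix A
    show "pullback g (on_set U (\<lambda>A. A $ i $ j)) A = on_set U (\<lambda>A. \<Sum>k\<in>UNIV. g $ i $ k * A $ k $ j) A"
      by (simp add: pullback_def on_set_def mult_in_iff assms) (simp add: matrix_matrix_mult_def)
  qed
  then have "\<theta> x (on_set U (\<lambda>A. A $ i $ j)) g =
      \<theta> x (on_set U (\<lambda>A. \<Sum>k\<in>UNIV. g $ i $ k * A $ k $ j)) (mat 1)"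
    using left_invariant_apply[OF theta_left_invariant assms] by simp
  also have "\<dots> = (\<Sum>k\<in>UNIV. g $ i $ k * X x $ k $ j)"
    by (subst der_sum'[OF theta_der])
      (auto simp: X_def sum_fun_apply der_scale'[OF theta_der] reg_entry reg_mult reg_const)
  finally show ?thesis by (simp add: matrix_matrix_mult_def)
qed

lemma dm_theta_id: "g \<in> U \<Longrightarrow> dm (\<theta> x) mat_of g = mat_of (g ** X x)"
  by (rule cmat_eqI) (simp add: dm_def vec_eq_iff theta_entry)

lemma theta_apply_eqI:
  assumes D: "point_derivation D" and eq: "\<And>i j. D (on_set U (\<lambda>A. A $ i $ j)) = X x $ i $ j"
    and f: "f \<in> RF" and u: "u \<in> U"
  shows "\<theta> x f u = D (pullback u f)"
proof -
  have "\<theta> x f u = \<theta> x (pullback u f) (mat 1)"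
    by (rule left_invariant_apply[OF theta_left_invariant u])
  also have "\<dots> = D (pullback u f)"
    by (rule point_derivation_eqI[OF point_derivation_der[OF theta_der] D])
      (simp_all add: eq X_def pullback_rf u f)
  finally show ?thesis .
qed

lemma X_inj: assumes "X x = X y" shows "x = y"
proof (rule theta_inj, rule ext)
  fix f
  show "\<theta> x f = \<theta> y f"
  proof (cases "f \<in> RF")
    case True
    show ?thesis
    proof (rule rf_eqI)
      fix u assume u: "u \<in> U"
      have "\<theta> x f u = \<theta> y (pullback u f) (mat 1)"
        by (rule theta_apply_eqI[OF point_derivation_der[OF theta_der] _ True u]) (simp add: assms, simp add: X_def)
      then show "\<theta> x f u = \<theta> y f u"
        using left_invariant_apply[OF theta_left_invariant u] by simp
    qed (auto intro: der_closed[OF theta_der] True)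
  qed (simp add: der_outside[OF theta_der])
qed

text \<open>By \<open>theta_entry\<close> a second derivative of the entries at the identity is the
  product of the two matrices. Together with \<open>X_inj\<close> this makes \<open>X\<close> a
  faithful representation of the Lie algebra inside matrices.\<close>

lemma X_bracket: "X (bracket x y) = X x ** X y - X y ** X x"
proof -
  have *: "\<theta> x (\<theta> y (on_set U (\<lambda>A. A $ i $ j))) (mat 1) = (X x ** X y) $ i $ j" for x y i j
  proof -
    have "\<theta> y (on_set U (\<lambda>A. A $ i $ j)) = on_set U (\<lambda>g. \<Sum>k\<in>UNIV. X y $ k $ j * g $ i $ k)"
      by (rule rf_eqI) (auto intro!: der_closed[OF theta_der] reg_sum reg_mult reg_const reg_entry
          simp: theta_entry, simp add: matrix_matrix_mult_def mult.commute)
    then have "\<theta> x (\<theta> y (on_set U (\<lambda>A. A $ i $ j))) (mat 1) = (\<Sum>k\<in>UNIV. X y $ k $ j * X x $ i $ k)"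
      by simp (subst der_sum'[OF theta_der],
        auto simp: X_def sum_fun_apply der_scale'[OF theta_der] reg_entry reg_mult reg_const)
    then show ?thesis by (simp add: matrix_matrix_mult_def mult.commute)
  qed
  show ?thesis
    by (simp add: vec_eq_iff X_def[of "bracket x y"] theta_bracket commutator_def *)
qed

text \<open>The value of v at g, translated back to the identity, is a point derivation and
  therefore extends to a left-invariant field. The element x depends on g; still, every pointwise
  identity reduces in this way to left-invariant fields.\<close>

lemma theta_local:
  assumes v: "v \<in> derivations U" and g: "g \<in> U"
  shows "\<exists>x. \<forall>f\<in>RF. v f g = \<theta> x f g"
proof -
  define D where "D f = v (pullback (matrix_inv g) f) g" for f
  have "point_derivation D"
    unfolding point_derivation_def D_def
  proof (intro conjI ballI allI)
    fix f h c assume f: "f \<in> RF"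
    note p = pullback_rf[OF inv_in[OF g]]
    show "v (pullback (matrix_inv g) (\<lambda>x. c * f x)) g = c * v (pullback (matrix_inv g) f) g"
      by (simp only: pullback_simps der_scale[OF v] p f)
    assume h: "h \<in> RF"
    show "v (pullback (matrix_inv g) (f + h)) g = v (pullback (matrix_inv g) f) g + v (pullback (matrix_inv g) h) g"
      by (simp only: pullback_simps der_add[OF v] p f h plus_fun_apply)
    show "v (pullback (matrix_inv g) (f * h)) g =
        f (mat 1) * v (pullback (matrix_inv g) h) g + v (pullback (matrix_inv g) f) g * h (mat 1)"
      by (simp only: pullback_simps der_mult[OF v] p f h plus_fun_apply times_fun_apply)
        (simp add: pullback_def matrix_inv_mult invertible_in g)
  qed
  from theta_surj[OF left_field_invariant[OF this]] obtain x where x: "\<theta> x = left_field D" by metis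
  have "v f g = \<theta> x f g" if "f \<in> RF" for f
    using that g by (simp add: x left_field_def D_def pullback_pullback_inv)
  then show ?thesis by blast
qed


subsection \<open>The logarithm\<close>

definition Y :: "complex^'m^'m \<Rightarrow> 'm cmat" where
  "Y g = nlog (mat_of g)"

lemma nilp_Y: "g \<in> U \<Longrightarrow> nilp (Y g)" and nexp_Y: "g \<in> U \<Longrightarrow> nexp (Y g) = mat_of g"
  unfolding Y_def by (intro nlog unipotent_nilp[OF unipotent]; assumption)+

lemma regm_Y: "regm Y"
  unfolding Y_def nlog_def
  by (intro regm_ev regm_diff regm_const) (simp add: regm_def reg_entry)

text \<open>The one-parameter group t \<mapsto> exp(t log g), which for g in U passes through g at t
  = 1 and has polynomial entries.\<close>

definition path :: "complex^'m^'m \<Rightarrow> complex \<Rightarrow> complex^'m^'m" where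
  "path g t = vec_of (nexp (sc t * Y g))"

lemma path_0 [simp]: "path g 0 = mat 1"
  by (simp add: path_def)

lemma path_add: "g \<in> U \<Longrightarrow> path g (s + t) = path g s ** path g t"
  by (simp add: path_def nexp_sc_add nilp_Y)

lemma polyf_path: "polyf (\<lambda>t. path g t $ i $ j)"
  unfolding path_def vec_of_nexp_sc divide_inverse
  by (intro polyf_sum polyf_mult polyf_const polyf_power polyf_id)

text \<open>At natural numbers the path runs through the powers of g. A defining equation of U,
  restricted to the path, is a polynomial in t with infinitely many zeros.\<close>

lemma path_in: assumes g: "g \<in> U" shows "path g t \<in> U"
proof -
  obtain P where P: "P \<subseteq> generated_algebra entry_functions" "U = {g. invertible g \<and> (\<forall>p\<in>P. p g = 0)}"
    using linear_algebraic_group by (auto simp: linear_algebraic_group_def)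
  have nat: "path g (of_nat k) \<in> U" for k
  proof -
    have "vec_of (mat_of g ^ k) \<in> U"
      by (induction k) (auto simp: one_in mult_in g)
    then show ?thesis by (simp add: path_def nexp_of_nat nilp_Y nexp_Y g)
  qed
  have "p (path g t) = 0" if "p \<in> P" for p
  proof (rule polyf_zero[where h = "\<lambda>t. p (path g t)" and S = "range of_nat"])
    show "polyf (\<lambda>t. p (path g t))"
      using P(1) that by (rule polyf_generated_algebra[OF subsetD]) (auto simp: entry_functions_def polyf_path)
    show "p (path g t) = 0" if "t \<in> range of_nat" for t
      using that nat P(2) \<open>p \<in> P\<close> by auto
    show "infinite (range (of_nat :: nat \<Rightarrow> complex))"
      by (simp add: range_inj_infinite)
  qed
  moreover have "invertible (path g t)"
    unfolding invertible_def
    using path_add[OF g, of t "-t"] path_add[OF g, of "-t" t] by (metis add.right_inverse add.left_inverse path_0)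
  ultimately show ?thesis using P(2) by auto
qed

text \<open>The only possible denominator is the determinant. It is a polynomial in t without zeros,
  hence constant along the path.\<close>

lemma polyf_along_path:
  assumes f: "f \<in> RF" and g: "g \<in> U" and u: "u \<in> U"
  shows "polyf (\<lambda>t. f (u ** path g t))"
proof -
  have in_U: "u ** path g t \<in> U" for t by (intro mult_in u path_in g)
  have entry: "polyf (\<lambda>t. (u ** path g t) $ i $ j)" for i j
    unfolding matrix_matrix_mult_def by (simp add: polyf_sum polyf_mult polyf_const polyf_path)
  have "det (u ** path g t) \<noteq> 0" for t
    using invertible_in[OF in_U] invertible_det_nz by blast
  then have "det (u ** path g t) = det u" for t
    using polyf_nonvanishing[OF polyf_det[OF entry], of t] by simp
  then have det: "inverse (det (u ** path g t)) = inverse (det u)" for t by simp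
  from f show ?thesis
    by (induction rule: rf_induct) (simp_all add: in_U polyf_const entry det polyf_add polyf_mult del: det_mul)
qed

definition path_derivative :: "complex^'m^'m \<Rightarrow> complex^'m^'m \<Rightarrow> 'm fn \<Rightarrow> complex" where
  "path_derivative u g f = deriv (\<lambda>t. f (u ** path g t)) 0"

lemma point_derivation_path: assumes g: "g \<in> U" shows "point_derivation (path_derivative (mat 1) g)"
proof -
  have d: "(\<lambda>t. f (path g t)) field_differentiable at 0" if "f \<in> RF" for f
    using polyf_differentiable[OF polyf_along_path[OF that g one_in]] by simp
  show ?thesis
    unfolding point_derivation_def path_derivative_def
    by (auto simp: d deriv_add deriv_mult deriv_cmult)
qed

lemma path_derivative_entry:
  assumes "g \<in> U"
  shows "path_derivative (mat 1) g (on_set U (\<lambda>A. A $ i $ j)) = vec_of (Y g) $ i $ j"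
proof -
  let ?c = "\<lambda>k. vec_of (Y g ^ k) $ i $ j"
  have "((\<lambda>t. \<Sum>k<CARD('m). t ^ k / fact k * ?c k) has_field_derivative
      (\<Sum>k<CARD('m). (if k = 1 then ?c 1 else 0))) (at 0)"
  proof (rule DERIV_sum)
    fix k
    have "((\<lambda>t::complex. t ^ k / fact k * ?c k) has_field_derivative (of_nat k * 0 ^ (k - 1)) / fact k * ?c k) (at 0)"
      by (auto intro!: derivative_eq_intros)
    moreover have "(of_nat k * 0 ^ (k - 1)) / fact k * ?c k = (if k = 1 then ?c 1 else 0)"
      by (cases "k = 0 \<or> k = 1") (auto simp: power_0_left)
    ultimately show "((\<lambda>t::complex. t ^ k / fact k * ?c k) has_field_derivative (if k = 1 then ?c 1 else 0)) (at 0)"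
      by simp
  qed
  moreover have "(\<Sum>k<CARD('m). (if k = 1 then ?c 1 else 0)) = vec_of (Y g) $ i $ j"
  proof (cases "CARD('m) = 1")
    \<comment> \<open>The truncated exponential has no linear term here, but then the nilpotent
      matrix \<open>Y g\<close> is 0.\<close>
    case True
    then show ?thesis using nilp_Y[OF assms] by (simp add: nilp_def)
  next
    case False
    then have "1 < CARD('m)" using zero_less_card_finite[where 'a='m] by linarith
    then show ?thesis by simp
  qed
  ultimately show ?thesis
    unfolding path_derivative_def
    by (simp add: path_in[OF assms]) (simp add: path_def vec_of_nexp_sc DERIV_imp_deriv)
qed

text \<open>The velocity of the path at t = 0 is a point derivation with matrix log g. Its
  left-invariant extension comes from an element of the Lie algebra by the identification
  \<theta>.\<close>

lemma log_in_lie_algebra: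
  assumes g: "g \<in> U"
  shows "\<exists>x. X x = vec_of (Y g)"
proof -
  from theta_surj[OF left_field_invariant[OF point_derivation_path[OF g]]]
  obtain x where x: "\<theta> x = left_field (path_derivative (mat 1) g)" by metis
  have "X x = vec_of (Y g)"
    by (simp add: X_def x left_field_at_one reg_entry path_derivative_entry g)
  then show ?thesis ..
qed

lemma theta_path:
  assumes g: "g \<in> U" and x: "X x = vec_of (Y g)" and f: "f \<in> RF" and u: "u \<in> U"
  shows "\<theta> x f u = path_derivative u g f"
proof -
  have "\<theta> x f u = path_derivative (mat 1) g (pullback u f)"
    by (rule theta_apply_eqI[OF point_derivation_path[OF g] _ f u]) (simp add: path_derivative_entry g x)
  then show ?thesis by (simp add: path_derivative_def pullback_def)
qed

text \<open>An injective linear map has a linear left inverse; here it is given by its values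
  \<open>l p\<close> on the matrix units. The explicit coordinates show that a functional applied to
  it is a linear combination of matrix entries, hence regular along the logarithm.\<close>

lemma ex_left_inverse_X: "\<exists>l. \<forall>x. x = (\<Sum>p\<in>UNIV. smul (X x $ fst p $ snd p) (l p))"
proof -
  interpret vp: vector_space_pair smul "(*s) :: complex \<Rightarrow> complex^('m \<times> 'm) \<Rightarrow> _" by unfold_locales
  define T :: "'a \<Rightarrow> complex^('m \<times> 'm)" where "T x = (\<chi> p. X x $ fst p $ snd p)" for x
  have "Vector_Spaces.linear smul (*s) T"
    by unfold_locales (simp_all add: T_def X_add X_smul vec_eq_iff)
  moreover have "inj T"
  proof (rule injI)
    fix x y assume "T x = T y"
    then have "X x $ i $ j = X y $ i $ j" for i j
      by (auto simp: T_def dest: fun_cong[where x = "(i, j)"])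
    then show "x = y" by (intro X_inj) (simp add: vec_eq_iff)
  qed
  ultimately obtain G where G: "Vector_Spaces.linear (*s) smul G" "G \<circ> T = id"
    using vp.linear_injective_left_inverse by blast
  interpret G: Vector_Spaces.linear "(*s)" smul G by fact
  have "x = (\<Sum>p\<in>UNIV. smul (X x $ fst p $ snd p) (G (axis p 1)))" for x
  proof -
    have "x = G (T x)" using G(2) by (metis comp_apply id_apply)
    also have "T x = (\<Sum>p\<in>UNIV. T x $ p *s axis p 1)" by (simp add: basis_expansion)
    also have "G \<dots> = (\<Sum>p\<in>UNIV. smul (T x $ p) (G (axis p 1)))"
      by (simp add: G.sum G.scale)
    finally show ?thesis by (simp add: T_def)
  qed
  then show ?thesis by (intro exI[of _ "\<lambda>p. G (axis p 1)"]) blast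
qed

definition l :: "'m \<times> 'm \<Rightarrow> 'a" where
  "l = (SOME l. \<forall>x. x = (\<Sum>p\<in>UNIV. smul (X x $ fst p $ snd p) (l p)))"

text \<open>A linear retraction of the embedding \<open>X\<close>. Only its values on the image of
  \<open>X\<close> are canonical.\<close>

definition L :: "complex^'m^'m \<Rightarrow> 'a" where
  "L A = (\<Sum>p\<in>UNIV. smul (A $ fst p $ snd p) (l p))"

lemma L_X [simp]: "L (X x) = x"
  using someI_ex[OF ex_left_inverse_X] unfolding L_def l_def by metis

definition lie_log :: "complex^'m^'m \<Rightarrow> 'a" where
  "lie_log g = L (vec_of (Y g))"

lemma X_lie_log: "g \<in> U \<Longrightarrow> X (lie_log g) = vec_of (Y g)"
  using log_in_lie_algebra[of g] unfolding lie_log_def by (metis L_X)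

lemma lie_log_one: "lie_log (mat 1) = 0"
proof -
  have "Y (mat 1) = 0"
    unfolding Y_def nlog_def ev_def one_cmat_def[symmetric]
    by (auto intro!: sum.neutral simp: power_0_left)
  then show ?thesis by (simp add: lie_log_def L_def)
qed

section \<open>Integration of characters and of nilpotent representations\<close>

definition additive_functional :: "('a \<Rightarrow> complex) \<Rightarrow> bool" where
  "additive_functional \<phi> \<longleftrightarrow> (\<forall>x y. \<phi> (x + y) = \<phi> x + \<phi> y) \<and> (\<forall>c x. \<phi> (smul c x) = c * \<phi> x)"

lemma functional_sum:
  assumes "additive_functional \<phi>"
  shows "\<phi> (\<Sum>i\<in>I. smul (c i) (x i)) = (\<Sum>i\<in>I. c i * \<phi> (x i))"
proof (induction I rule: infinite_finite_induct)
  have "\<phi> (0 + 0) = \<phi> 0 + \<phi> 0" using assms unfolding additive_functional_def by blast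
  then have "\<phi> 0 = 0" by simp
  then show "\<phi> (\<Sum>i\<in>{}. smul (c i) (x i)) = (\<Sum>i\<in>{}. c i * \<phi> (x i))"
    "infinite I \<Longrightarrow> \<phi> (\<Sum>i\<in>I. smul (c i) (x i)) = (\<Sum>i\<in>I. c i * \<phi> (x i))" for I by simp_all
qed (use assms in \<open>simp add: additive_functional_def\<close>)

lemma reg_functional_lie_log: "additive_functional \<phi> \<Longrightarrow> reg (\<lambda>g. \<phi> (lie_log g))"
  unfolding lie_log_def L_def
  using regm_Y by (simp add: functional_sum[of \<phi>] regm_def reg_sum reg_mult reg_const)

lemma theta_functional_lie_log:
  assumes "additive_functional \<phi>" "g \<in> U"
  shows "\<theta> x (on_set U (\<lambda>h. \<phi> (lie_log h))) g = \<phi> (L (vec_of (dm (\<theta> x) Y g)))"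
proof -
  have "\<theta> x (on_set U (\<lambda>h. \<phi> (lie_log h))) g = \<theta> x (on_set U (\<lambda>h. \<Sum>p\<in>UNIV. \<phi> (l p) * vec_of (Y h) $ fst p $ snd p)) g"
    by (simp add: lie_log_def L_def functional_sum[OF assms(1)] mult.commute)
  also have "\<dots> = (\<Sum>p\<in>UNIV. \<phi> (l p) * \<theta> x (on_set U (\<lambda>h. vec_of (Y h) $ fst p $ snd p)) g)"
    using regm_Y
    by (subst der_sum'[OF theta_der]) (auto simp: sum_fun_apply regm_def der_scale'[OF theta_der] reg_mult reg_const)
  finally show ?thesis
    by (simp add: L_def functional_sum[OF assms(1)] mult.commute dm_def)
qed

lemma functional_X: "additive_functional (\<lambda>x. X x $ i $ j)"
  by (simp add: additive_functional_def X_add X_smul)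

text \<open>The logarithm takes values in the linear subspace that is the image of \<open>X\<close>.
  Its derivative stays there, so the retraction \<open>L\<close> loses nothing.\<close>

lemma X_L_dm_Y:
  assumes "g \<in> U"
  shows "X (L (vec_of (dm (\<theta> x) Y g))) = vec_of (dm (\<theta> x) Y g)"
proof -
  have "on_set U (\<lambda>h. X (lie_log h) $ i $ j) = on_set U (\<lambda>h. vec_of (Y h) $ i $ j)" for i j
    by (rule on_set_cong) (simp add: X_lie_log)
  then have "X (L (vec_of (dm (\<theta> x) Y g))) $ i $ j = vec_of (dm (\<theta> x) Y g) $ i $ j" for i j
    using theta_functional_lie_log[OF functional_X[of i j] assms, of x] by (simp add: dm_def[of _ Y])
  then show ?thesis by (simp add: vec_eq_iff)
qed

lemma X_0: "X 0 = 0"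
  using X_add[of 0 0] by simp

lemma X_sum: "X (\<Sum>i\<in>I. f i) = (\<Sum>i\<in>I. X (f i))"
  by (induction I rule: infinite_finite_induct) (simp_all add: X_add X_0)

text \<open>The Maurer--Cartan form in logarithmic coordinates: \<open>z (Suc k) = (- ad (log g))\<^sup>k (z 1)\<close> with
  \<open>z 1 = d (log g) (x)\<close>, and \<open>\<Sum>\<^sub>k z k / k! = g\<inverse> dg (x) = x\<close>.\<close>

lemma maurer_cartan:
  assumes g: "g \<in> U"
  obtains z where "z 0 = 0" "z 1 = L (vec_of (dm (\<theta> x) Y g))"
    "\<And>k. k \<ge> 1 \<Longrightarrow> z (Suc k) = bracket (z k) (lie_log g)"
    "\<And>K. K \<ge> CARD('m) \<Longrightarrow> (\<Sum>k<2*K. smul (1 / fact k) (z k)) = x"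
proof
  define z where "z k = (case k of 0 \<Rightarrow> 0 | Suc k \<Rightarrow> ((\<lambda>w. bracket w (lie_log g)) ^^ k) (L (vec_of (dm (\<theta> x) Y g))))" for k
  show "z 0 = 0" "z 1 = L (vec_of (dm (\<theta> x) Y g))" by (simp_all add: z_def)
  show z_Suc: "z (Suc k) = bracket (z k) (lie_log g)" if "k \<ge> 1" for k
    using that by (cases k) (simp_all add: z_def)
  fix K assume K: "K \<ge> CARD('m)"
  let ?e = "\<lambda>j. dm (\<theta> x) (\<lambda>h. Y h ^ j) g"
  interpret power_derivation "Y g" "dm (\<theta> x) Y g" ?e
    by (rule power_derivation_dm[OF theta_der regm_Y g])
  have b: "b k = mat_of (X (z k))" for k
  proof (induction k)
    case 0
    then show ?case by (simp add: b_0 z_def X_0 zero_cmat_def)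
  next
    case (Suc k)
    show ?case
    proof (cases "k = 0")
      case True
      then show ?thesis using b_1 by (simp add: z_def X_L_dm_Y g)
    next
      case False
      then show ?thesis
        using Suc by (intro cmat_eqI) (simp add: b_Suc z_Suc X_bracket X_lie_log g)
    qed
  qed
  \<comment> \<open>The same derivative is known directly, because the exponential of log h is
    h.\<close>
  have "dm (\<theta> x) (\<lambda>h. nexp (Y h)) g = mat_of (g ** X x)"
    using dm_cong[of "\<lambda>h. nexp (Y h)" mat_of "\<theta> x" g] by (simp add: nexp_Y dm_theta_id g)
  also have "\<dots> = nexp (Y g) * mat_of (X x)"
    by (rule cmat_eqI) (simp add: nexp_Y g)
  finally have "nexp (- Y g) * dm (\<theta> x) (\<lambda>h. nexp (Y h)) g = mat_of (X x)"
    by (simp add: nexp_minus nilp_Y g flip: mult.assoc)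
  with exp_derivative[OF theta_der regm_Y g nilp_Y K, of x]
  have "mat_of (X x) = (\<Sum>k<2*K. sc (1 / fact k) * mat_of (X (z k)))"
    by (simp add: b)
  then have "X x = vec_of (\<Sum>k<2*K. sc (1 / fact k) * mat_of (X (z k)))"
    by (metis mat_of_inverse UNIV_I)
  also have "\<dots> = X (\<Sum>k<2*K. smul (1 / fact k) (z k))"
    by (simp add: vec_of_sum vec_of_sc_mult X_sum X_smul del: vec_of_simps(6))
  finally show "(\<Sum>k<2*K. smul (1 / fact k) (z k)) = x" using X_inj by metis
qed

lemma one_less_two_card: "Suc 0 < 2 * CARD('m)"
  using zero_less_card_finite[where 'a='m] by linarith

definition character :: "('a \<Rightarrow> complex) \<Rightarrow> bool" where
  "character \<phi> \<longleftrightarrow> additive_functional \<phi> \<and> (\<forall>x y. \<phi> (bracket x y) = 0)"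

text \<open>A character annihilates brackets, so only the linear term of the series in
  \<open>maurer_cartan\<close> survives. Thus \<phi> composed with the logarithm is a primitive of
  the invariant form \<phi>.\<close>

lemma theta_character:
  assumes "character \<phi>" "g \<in> U"
  shows "\<theta> x (on_set U (\<lambda>h. \<phi> (lie_log h))) g = \<phi> x"
proof -
  have \<phi>: "additive_functional \<phi>" "\<And>x y. \<phi> (bracket x y) = 0" using assms by (auto simp: character_def)
  obtain z where z: "z 0 = 0" "z 1 = L (vec_of (dm (\<theta> x) Y g))"
    "\<And>k. k \<ge> 1 \<Longrightarrow> z (Suc k) = bracket (z k) (lie_log g)"
    "\<And>K. K \<ge> CARD('m) \<Longrightarrow> (\<Sum>k<2*K. smul (1 / fact k) (z k)) = x"
    using maurer_cartan[OF assms(2)] by metis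
  have z0: "\<phi> (z k) = 0" if "k \<noteq> 1" for k
  proof (cases k)
    case 0
    then show ?thesis using functional_sum[OF \<phi>(1), of "\<lambda>_. 0" "\<lambda>_. 0" "{}"] z(1) by simp
  next
    case (Suc k')
    then show ?thesis using that z(3)[of k'] \<phi>(2) by (cases k') auto
  qed
  have "\<phi> x = \<phi> (\<Sum>k<2*CARD('m). smul (1 / fact k) (z k))" using z(4)[of "CARD('m)"] by simp
  also have "\<dots> = (\<Sum>k<2*CARD('m). 1 / fact k * \<phi> (z k))" by (rule functional_sum[OF \<phi>(1)])
  also have "\<dots> = (\<Sum>k<2*CARD('m). if k = 1 then \<phi> (z 1) else 0)"
    by (intro sum.cong) (auto simp: z0)
  also have "\<dots> = \<phi> (z 1)"
    using one_less_two_card by simp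
  finally show ?thesis using theta_functional_lie_log[OF \<phi>(1) assms(2)] z(2) by simp
qed

definition nilpotent_rep :: "('a \<Rightarrow> 'n::finite cmat) \<Rightarrow> bool" where
  "nilpotent_rep \<eta> \<longleftrightarrow> (\<forall>x y. \<eta> (x + y) = \<eta> x + \<eta> y) \<and> (\<forall>c x. \<eta> (smul c x) = sc c * \<eta> x) \<and>
     (\<forall>x y. \<eta> (bracket x y) = \<eta> x * \<eta> y - \<eta> y * \<eta> x) \<and> (\<forall>x. nilp (\<eta> x))"

lemma nilpotent_rep_functional: "nilpotent_rep \<eta> \<Longrightarrow> additive_functional (\<lambda>x. vec_of (\<eta> x) $ i $ j)"
  by (simp add: additive_functional_def nilpotent_rep_def vec_of_sc_mult del: vec_of_simps(6))

lemma regm_rep_lie_log: "nilpotent_rep \<eta> \<Longrightarrow> regm (\<lambda>g. \<eta> (lie_log g))"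
  unfolding regm_def by (intro allI reg_functional_lie_log nilpotent_rep_functional)

text \<open>A homomorphism \<eta> maps the series of iterated brackets with value x, from
  \<open>maurer_cartan\<close>, to the series for the differential of the exponential of \<eta>(log
  h). So this exponential solves dF = F \<eta> without any use of the Campbell-Hausdorff
  formula.\<close>

lemma dm_nexp_rep:
  fixes \<eta> :: "'a \<Rightarrow> 'n::finite cmat"
  assumes \<eta>: "nilpotent_rep \<eta>" and g: "g \<in> U"
  shows "dm (\<theta> x) (\<lambda>h. nexp (\<eta> (lie_log h))) g = nexp (\<eta> (lie_log g)) * \<eta> x"
proof -
  let ?W = "\<lambda>h. \<eta> (lie_log h)"
  \<comment> \<open>At least the size of both kinds of matrices, so that the two series have the
    same range of summation.\<close>
  let ?K = "CARD('m) + CARD('n)"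
  note [simp] = \<eta>[unfolded nilpotent_rep_def, THEN conjunct1, rule_format]
    \<eta>[unfolded nilpotent_rep_def, THEN conjunct2, THEN conjunct1, rule_format]
    \<eta>[unfolded nilpotent_rep_def, THEN conjunct2, THEN conjunct2, THEN conjunct1, rule_format]
  have nilp: "nilp (\<eta> x)" for x using \<eta> by (simp add: nilpotent_rep_def)
  have [simp]: "\<eta> 0 = 0"
  proof -
    have "\<eta> (0 + 0) = \<eta> 0 + \<eta> 0" using \<eta> unfolding nilpotent_rep_def by blast
    then show ?thesis by simp
  qed
  have \<eta>_sum: "\<eta> (\<Sum>i\<in>I. f i) = (\<Sum>i\<in>I. \<eta> (f i))" for f :: "nat \<Rightarrow> 'a" and I
    by (induction I rule: infinite_finite_induct) auto
  obtain z where z: "z 0 = 0" "z 1 = L (vec_of (dm (\<theta> x) Y g))"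
    "\<And>k. k \<ge> 1 \<Longrightarrow> z (Suc k) = bracket (z k) (lie_log g)"
    "\<And>K. K \<ge> CARD('m) \<Longrightarrow> (\<Sum>k<2*K. smul (1 / fact k) (z k)) = x"
    using maurer_cartan[OF g] by metis
  let ?e = "\<lambda>j. dm (\<theta> x) (\<lambda>h. ?W h ^ j) g"
  interpret power_derivation "?W g" "dm (\<theta> x) ?W g" ?e
    by (rule power_derivation_dm[OF theta_der regm_rep_lie_log[OF \<eta>] g])
  have b: "b k = \<eta> (z k)" for k
  proof (induction k)
    case 0
    then show ?case by (simp add: b_0 z)
  next
    case (Suc k)
    show ?case
    proof (cases "k = 0")
      case True
      have "dm (\<theta> x) ?W g = \<eta> (z 1)"
        unfolding z(2) dm_def[of _ ?W]
        by (rule cmat_eqI) (simp add: vec_eq_iff theta_functional_lie_log[OF nilpotent_rep_functional[OF \<eta>] g])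
      then show ?thesis using b_1 True by simp
    next
      case False
      then show ?thesis
        using Suc by (simp add: b_Suc z(3))
    qed
  qed
  have "nexp (- ?W g) * dm (\<theta> x) (\<lambda>h. nexp (?W h)) g = (\<Sum>k<2*?K. sc (1 / fact k) * b k)"
    by (rule exp_derivative[OF theta_der regm_rep_lie_log[OF \<eta>] g nilp]) simp
  also have "\<dots> = \<eta> (\<Sum>k<2*?K. smul (1 / fact k) (z k))"
    by (simp add: b \<eta>_sum)
  also have "\<dots> = \<eta> x" by (subst z(4)) simp_all
  finally have "nexp (?W g) * (nexp (- ?W g) * dm (\<theta> x) (\<lambda>h. nexp (?W h)) g) = nexp (?W g) * \<eta> x" by simp
  then show ?thesis by (simp add: nexp_minus nilp flip: mult.assoc)
qed

text \<open>Differentiation of the constant product of the exponential and its inverse.\<close>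

lemma dm_nexp_uminus_rep:
  assumes \<eta>: "nilpotent_rep \<eta>" and g: "g \<in> U"
  shows "dm (\<theta> x) (\<lambda>h. nexp (- \<eta> (lie_log h))) g = - \<eta> x * nexp (- \<eta> (lie_log g))"
proof -
  let ?F = "\<lambda>h. nexp (\<eta> (lie_log h))" and ?E = "\<lambda>h. nexp (- \<eta> (lie_log h))"
  have nilp: "nilp (\<eta> x)" for x using \<eta> by (simp add: nilpotent_rep_def)
  have reg: "regm ?F" "regm ?E"
    by (intro regm_nexp regm_uminus regm_rep_lie_log \<eta>)+
  have "0 = dm (\<theta> x) (\<lambda>h. ?F h * ?E h) g"
    by (simp add: nexp_minus nilp dm_const theta_der)
  also have "\<dots> = dm (\<theta> x) ?F g * ?E g + ?F g * dm (\<theta> x) ?E g"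
    by (rule dm_mult[OF theta_der reg g])
  finally have "?F g * dm (\<theta> x) ?E g = - (?F g * \<eta> x * ?E g)"
    by (simp add: dm_nexp_rep[OF \<eta> g] eq_neg_iff_add_eq_0 add.commute)
  then have "?E g * (?F g * dm (\<theta> x) ?E g) = ?E g * (- (?F g * \<eta> x * ?E g))" by simp
  then show ?thesis
    by (simp add: nexp_minus nilp flip: mult.assoc)
qed

text \<open>Starting where f does not vanish, f restricted to a translated path of g is a polynomial
  h with h' = \<phi>(log g) h, so \<phi> vanishes at all logarithms. At the identity, where the
  logarithm is 0, the series in \<open>maurer_cartan\<close> reduces to its linear term: every x is
  a derivative of the logarithm, and \<phi> vanishes at x.\<close>

lemma eigenfunction:
  assumes f: "f \<in> RF" and \<phi>: "additive_functional \<phi>" and eq: "\<And>x u. u \<in> U \<Longrightarrow> \<theta> x f u = \<phi> x * f u"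
    and nz: "f \<noteq> 0"
  shows "\<phi> x = 0"
proof -
  obtain u where u: "u \<in> U" "f u \<noteq> 0"
    using nz rf_outside[OF f] by (auto simp: fun_eq_iff)
  have log: "\<phi> (lie_log g) = 0" if g: "g \<in> U" for g
  proof (rule polyf_eigen)
    let ?h = "\<lambda>t. f (u ** path g t)"
    show "polyf ?h" by (rule polyf_along_path[OF f g u(1)])
    show "?h 0 \<noteq> 0" using u by simp
    fix t
    have ut: "u ** path g t \<in> U" by (intro mult_in u path_in g)
    have "deriv ?h t = deriv (?h \<circ> (+) t) 0"
      by (rule deriv_shift_0)
    also have "\<dots> = path_derivative (u ** path g t) g f"
      by (simp add: path_derivative_def path_add[OF g] matrix_mul_assoc comp_def)
    also have "\<dots> = \<phi> (lie_log g) * f (u ** path g t)"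
      using theta_path[OF g X_lie_log[OF g] f ut] eq[OF ut] by simp
    finally show "deriv ?h t = \<phi> (lie_log g) * ?h t" .
  qed
  obtain z where z: "z 0 = 0" "z 1 = L (vec_of (dm (\<theta> x) Y (mat 1)))"
    "\<And>k. k \<ge> 1 \<Longrightarrow> z (Suc k) = bracket (z k) (lie_log (mat 1))"
    "\<And>K. K \<ge> CARD('m) \<Longrightarrow> (\<Sum>k<2*K. smul (1 / fact k) (z k)) = x"
    using maurer_cartan[OF one_in] by metis
  have b0: "bracket w 0 = 0" for w using bracket_scale_right[of w 0 0] by simp
  have z0: "smul (1 / fact k) (z k) = 0" if "k \<noteq> 1" for k
  proof (cases k)
    case (Suc k')
    then show ?thesis using that z(3)[of k'] by (cases k') (auto simp: lie_log_one b0)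
  qed (simp add: z)
  have "x = (\<Sum>k<2*CARD('m). smul (1 / fact k) (z k))" using z(4)[of "CARD('m)"] by simp
  also have "\<dots> = (\<Sum>k<2*CARD('m). if k = 1 then z 1 else 0)"
    by (intro sum.cong) (auto simp: z0)
  also have "\<dots> = z 1"
    using one_less_two_card by simp
  finally have "\<phi> x = \<theta> x (on_set U (\<lambda>h. \<phi> (lie_log h))) (mat 1)"
    using theta_functional_lie_log[OF \<phi> one_in] z(2) by simp
  also have "on_set U (\<lambda>h. \<phi> (lie_log h)) = on_set U (\<lambda>_. 0)"
    by (rule on_set_cong) (simp add: log)
  finally show ?thesis by (simp add: der_const[OF theta_der])
qed

end

section \<open>Invariant forms\<close>

context linear_group
begin

lemma differential_der: "v \<in> derivations U \<Longrightarrow> differential U h v = v h"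
  by (simp add: differential_def)

lemma differential_outside: "v \<notin> derivations U \<Longrightarrow> differential U h v = 0"
  by (simp add: differential_def)

lemma form_closed: "\<omega> \<in> one_forms U \<Longrightarrow> \<omega> v \<in> RF"
proof (induction rule: one_forms.induct)
  case (add_term \<omega> f h)
  have "differential U h v \<in> RF"
    using add_term der_closed by (cases "v \<in> derivations U") (simp_all only: differential_der differential_outside rf_0 simp_thms)
  then show ?case using add_term by (simp only: plus_fun_apply[of \<omega>] rf_add rf_mult)
qed (simp only: zero_fun_apply[of v] rf_0)

lemma form_outside: "\<omega> \<in> one_forms U \<Longrightarrow> v \<notin> derivations U \<Longrightarrow> \<omega> v = 0"
  by (induction rule: one_forms.induct) (simp_all add: differential_outside[of v])

lemma form_local:
  assumes "\<omega> \<in> one_forms U" "v \<in> derivations U" "w \<in> derivations U" "\<And>f. f \<in> RF \<Longrightarrow> v f g = w f g"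
  shows "\<omega> v g = \<omega> w g"
  using assms(1) by (induction rule: one_forms.induct) (simp_all add: differential_der assms)

lemma one_forms_add: "\<omega>' \<in> one_forms U \<Longrightarrow> \<omega> \<in> one_forms U \<Longrightarrow> \<omega> + \<omega>' \<in> one_forms U"
proof (induction rule: one_forms.induct)
  case (add_term \<omega>' f h)
  then show ?case
    using one_forms.add_term[of "\<omega> + \<omega>'" U f h] by (simp only: add.assoc)
qed simp

lemma one_forms_scale: "\<omega> \<in> one_forms U \<Longrightarrow> (\<lambda>v u. c * \<omega> v u) \<in> one_forms U"
proof (induction rule: one_forms.induct)
  case (add_term \<omega> f h)
  have "(\<lambda>v u. c * (\<omega> + (\<lambda>v. f * differential U h v)) v u) =
      (\<lambda>v u. c * \<omega> v u) + (\<lambda>v. (\<lambda>x. c * f x) * differential U h v)"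
    by (auto simp: fun_eq_iff algebra_simps)
  then show ?case
    using one_forms.add_term[OF add_term.IH rf_scale[OF add_term.hyps(2), of c] add_term.hyps(3)] by (simp only:)
qed (use one_forms.zero in \<open>simp add: zero_fun_def\<close>)

lemma one_forms_sum: "(\<And>i. i \<in> I \<Longrightarrow> \<omega> i \<in> one_forms U) \<Longrightarrow> (\<Sum>i\<in>I. \<omega> i) \<in> one_forms U"
  by (induction I rule: infinite_finite_induct) (auto intro: one_forms.zero one_forms_add simp del: plus_fun_apply zero_fun_apply)

lemma one_forms_term: "f \<in> RF \<Longrightarrow> h \<in> RF \<Longrightarrow> (\<lambda>v. f * differential U h v) \<in> one_forms U"
  using one_forms.add_term[OF one_forms.zero, of f U h] by (simp only: add_0)

definition cartan_d :: "('m operator \<Rightarrow> 'm fn) \<Rightarrow> 'm operator \<Rightarrow> 'm operator \<Rightarrow> 'm fn" where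
  "cartan_d \<omega> v w = v (\<omega> w) - w (\<omega> v) - \<omega> (commutator v w)"

text \<open>The rule d(f dh) = df \<and> dh: the second derivatives of h cancel against the
  commutator term of Cartan's formula.\<close>

lemma cartan_d_add_term:
  assumes "\<omega> \<in> one_forms U" "f \<in> RF" "h \<in> RF" and v: "v \<in> derivations U" and w: "w \<in> derivations U"
  shows "cartan_d (\<omega> + (\<lambda>v. f * differential U h v)) v w = cartan_d \<omega> v w + (v f * w h - w f * v h)"
proof -
  note r = assms form_closed[OF assms(1)] der_closed[OF v] der_closed[OF w] rf_mult
  show ?thesis
    unfolding cartan_d_def plus_fun_apply[of \<omega>] differential_der[OF v] differential_der[OF w]
      differential_der[OF commutator_der[OF v w]]
    by (simp only: der_add[OF v] der_add[OF w] der_mult[OF v] der_mult[OF w] r)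
      (simp only: commutator_def, simp add: algebra_simps)
qed

lemma cartan_d_closed:
  assumes "\<omega> \<in> one_forms U" "v \<in> derivations U" "w \<in> derivations U"
  shows "cartan_d \<omega> v w \<in> RF"
  unfolding cartan_d_def
  by (intro rf_diff der_closed[OF assms(2)] der_closed[OF assms(3)] form_closed[OF assms(1)])

text \<open>Although Cartan's formula differentiates the coefficients, on the generators it yields
  df \<and> dh, whose value at g involves the two fields only at g.\<close>

lemma cartan_d_local:
  assumes "\<omega> \<in> one_forms U" and v: "v \<in> derivations U" "v' \<in> derivations U" and w: "w \<in> derivations U" "w' \<in> derivations U"
    and "\<And>f. f \<in> RF \<Longrightarrow> v f g = v' f g" "\<And>f. f \<in> RF \<Longrightarrow> w f g = w' f g"
  shows "cartan_d \<omega> v w g = cartan_d \<omega> v' w' g"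
  using assms(1)
proof (induction rule: one_forms.induct)
  case zero
  then show ?case by (simp add: cartan_d_def der_0 v w del: zero_fun_apply) (simp add: der_0 v w)
next
  case (add_term \<omega> f h)
  then show ?case
    by (simp only: cartan_d_add_term v w) (simp add: assms)
qed

end

section \<open>Left-invariant forms and flatness\<close>

context lie_setting
begin

lemma form_eqI:
  assumes \<omega>: "\<omega> \<in> one_forms U" "\<omega>' \<in> one_forms U" and eq: "\<And>x. \<omega> (\<theta> x) = \<omega>' (\<theta> x)"
  shows "\<omega> = \<omega>'"
proof
  fix v
  show "\<omega> v = \<omega>' v"
  proof (cases "v \<in> derivations U")
    case True
    show ?thesis
    proof (rule rf_eqI[OF form_closed[OF \<omega>(1)] form_closed[OF \<omega>(2)]])
      fix g assume g: "g \<in> U"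
      obtain x where x: "\<And>f. f \<in> RF \<Longrightarrow> v f g = \<theta> x f g" using theta_local[OF True g] by blast
      show "\<omega> v g = \<omega>' v g"
        using form_local[OF \<omega>(1) True theta_der x] form_local[OF \<omega>(2) True theta_der x]
        by (simp add: eq)
    qed
  qed (simp add: form_outside[OF \<omega>(1)] form_outside[OF \<omega>(2)])
qed

text \<open>The entries of g^(-1) dg take the constant values \<open>X x\<close> on \<theta> x, and
  \<phi> is a linear combination of these entries with coefficients \<open>\<phi> (l p)\<close>. The
  index q consists of the position p and the summation index of the matrix product.\<close>

lemma ex_form:
  assumes \<phi>: "additive_functional \<phi>"
  shows "\<exists>\<omega>\<in>one_forms U. \<forall>x. \<omega> (\<theta> x) = on_set U (\<lambda>_. \<phi> x)"
proof -
  define a where "a q = on_set U (\<lambda>g. \<phi> (l (fst q)) * matrix_inv g $ fst (fst q) $ snd q)" for q :: "('m \<times> 'm) \<times> 'm"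
  define h :: "('m \<times> 'm) \<times> 'm \<Rightarrow> 'm fn" where "h q = on_set U (\<lambda>A. A $ snd q $ snd (fst q))" for q
  define \<omega> where "\<omega> = (\<Sum>q\<in>UNIV. (\<lambda>v. a q * differential U (h q) v))"
  have rf: "a q \<in> RF" "h q \<in> RF" for q
    unfolding a_def h_def by (intro reg_mult reg_const reg_matrix_inv reg_entry)+
  have "\<omega> \<in> one_forms U"
    unfolding \<omega>_def by (intro one_forms_sum one_forms_term rf)
  moreover have "\<omega> (\<theta> x) = on_set U (\<lambda>_. \<phi> x)" for x
  proof (rule rf_eqI)
    fix g assume g: "g \<in> U"
    have "\<omega> (\<theta> x) g = (\<Sum>q\<in>UNIV. \<phi> (l (fst q)) * matrix_inv g $ fst (fst q) $ snd q * (g ** X x) $ snd q $ snd (fst q))"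
      by (simp add: \<omega>_def sum_fun_apply a_def h_def differential_der theta_der g theta_entry)
    also have "\<dots> = (\<Sum>p\<in>UNIV. \<Sum>k\<in>UNIV. \<phi> (l p) * matrix_inv g $ fst p $ k * (g ** X x) $ k $ snd p)"
      by (simp add: sum.cartesian_product case_prod_beta)
    also have "\<dots> = (\<Sum>p\<in>UNIV. \<phi> (l p) * (matrix_inv g ** (g ** X x)) $ fst p $ snd p)"
      by (simp add: matrix_matrix_mult_def[of "matrix_inv g"] sum_distrib_left mult.assoc)
    also have "\<dots> = (\<Sum>p\<in>UNIV. X x $ fst p $ snd p * \<phi> (l p))"
      by (simp add: matrix_mul_assoc matrix_inv_mult invertible_in g mult.commute)
    also have "\<dots> = \<phi> (L (X x))"
      by (simp only: L_def functional_sum[OF \<phi>])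
    finally show "\<omega> (\<theta> x) g = on_set U (\<lambda>_. \<phi> x) g" using g by simp
  qed (rule form_closed[OF \<open>\<omega> \<in> one_forms U\<close>] reg_const)+
  ultimately show ?thesis by blast
qed

text \<open>Pushforward fixes the left-invariant fields, so invariance makes the values on them
  constant. Conversely, a field that agrees with \<theta> x at u has a pushforward that agrees with
  the same \<theta> x at g u, and the constant does not see the difference between u and g
  u.\<close>

lemma left_invariant_form_iff:
  assumes \<omega>: "\<omega> \<in> one_forms U"
  shows "left_invariant_form U \<omega> \<longleftrightarrow> (\<forall>x. \<omega> (\<theta> x) = on_set U (\<lambda>_. \<omega> (\<theta> x) (mat 1)))"
proof
  assume inv: "left_invariant_form U \<omega>"
  show "\<forall>x. \<omega> (\<theta> x) = on_set U (\<lambda>_. \<omega> (\<theta> x) (mat 1))"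
  proof (intro allI rf_eqI)
    fix x g assume g: "g \<in> U"
    have "pullback g (\<omega> (pushforward g (\<theta> x))) = \<omega> (\<theta> x)"
      using inv g theta_der unfolding left_invariant_form_def by blast
    moreover have "pushforward g (\<theta> x) = \<theta> x"
      using theta_left_invariant[of x] g unfolding left_invariant_fields_def by blast
    ultimately have "pullback g (\<omega> (\<theta> x)) = \<omega> (\<theta> x)" by simp
    then have "pullback g (\<omega> (\<theta> x)) (mat 1) = \<omega> (\<theta> x) (mat 1)" by simp
    then show "\<omega> (\<theta> x) g = on_set U (\<lambda>_. \<omega> (\<theta> x) (mat 1)) g"
      using g by (simp add: pullback_def)
  qed (rule form_closed[OF \<omega>] reg_const)+
next
  assume const: "\<forall>x. \<omega> (\<theta> x) = on_set U (\<lambda>_. \<omega> (\<theta> x) (mat 1))"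
  show "left_invariant_form U \<omega>"
    unfolding left_invariant_form_def
  proof (intro ballI, rule rf_eqI)
    show "pullback g (\<omega> (pushforward g v)) \<in> RF" if "g \<in> U" for g v
      using that by (rule pullback_rf) (rule form_closed[OF \<omega>])
    show "\<omega> v \<in> RF" for v by (rule form_closed[OF \<omega>])
    fix g v u assume g: "g \<in> U" and v: "v \<in> derivations U" and u: "u \<in> U"
    obtain x where x: "\<And>f. f \<in> RF \<Longrightarrow> v f u = \<theta> x f u" using theta_local[OF v u] by blast
    have "pushforward g v f (g ** u) = \<theta> x f (g ** u)" if f: "f \<in> RF" for f
    proof -
      have "pushforward g v f (g ** u) = \<theta> x (pullback g f) u"
        by (simp add: pushforward_apply g u x pullback_rf f)
      also have "\<dots> = \<theta> x f (g ** u)"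
        using left_invariant_pullback[OF theta_left_invariant g] by (simp add: pullback_def)
      finally show ?thesis .
    qed
    then have "\<omega> (pushforward g v) (g ** u) = \<omega> (\<theta> x) (g ** u)"
      by (intro form_local[OF \<omega> pushforward_der[OF g v] theta_der])
    also have "\<dots> = on_set U (\<lambda>_. \<omega> (\<theta> x) (mat 1)) (g ** u)"
      using const by metis
    also have "\<dots> = on_set U (\<lambda>_. \<omega> (\<theta> x) (mat 1)) u"
      using g u by (simp add: mult_in)
    also have "\<dots> = \<omega> (\<theta> x) u"
      using const by metis
    also have "\<dots> = \<omega> v u"
      by (rule form_local[OF \<omega> v theta_der x, symmetric])
    finally show "pullback g (\<omega> (pushforward g v)) u = \<omega> v u"
      by (simp add: pullback_def)
  qed
qed

lemma form_of_functional:
  assumes \<phi>: "additive_functional \<phi>"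
  shows "form_of_functional U \<theta> \<phi> \<in> one_forms U" "form_of_functional U \<theta> \<phi> (\<theta> x) = on_set U (\<lambda>_. \<phi> x)"
proof -
  obtain \<omega> where \<omega>: "\<omega> \<in> one_forms U" "\<And>x. \<omega> (\<theta> x) = on_set U (\<lambda>_. \<phi> x)"
    using ex_form[OF \<phi>] by blast
  have "left_invariant_form U \<omega>"
    unfolding left_invariant_form_iff[OF \<omega>(1)] by (simp add: \<omega>(2) one_in)
  then have "\<exists>!\<omega>. \<omega> \<in> one_forms U \<and> left_invariant_form U \<omega> \<and> (\<forall>x. \<omega> (\<theta> x) = on_set U (\<lambda>_. \<phi> x))"
    using \<omega> by (intro ex1I[of _ \<omega>]) (auto intro: form_eqI)
  from theI'[OF this, folded form_of_functional_def]
  show "form_of_functional U \<theta> \<phi> \<in> one_forms U" "form_of_functional U \<theta> \<phi> (\<theta> x) = on_set U (\<lambda>_. \<phi> x)"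
    by blast+
qed

lemma coordinate_functional: "additive_functional (\<lambda>x. representation B x b)"
  unfolding additive_functional_def
  by (simp add: representation_add representation_scale independent_Basis span_Basis)

text \<open>The relation between an invariant matrix form and its values on the Lie algebra. That
  \<rho> respects brackets is kept out of it, since by \<open>flat_iff\<close> this is flatness of
  \<alpha>.\<close>

definition invariant_value :: "('m, 'n::finite) matrix_form \<Rightarrow> ('a \<Rightarrow> complex^'n^'n) \<Rightarrow> bool" where
  "invariant_value \<alpha> \<rho> \<longleftrightarrow> \<alpha> \<in> matrix_forms U \<and> (\<forall>x i j. (\<alpha> $ i $ j) (\<theta> x) = on_set U (\<lambda>_. \<rho> x $ i $ j))"

lemma invariant_value_unique: "invariant_value \<alpha> \<rho> \<Longrightarrow> invariant_value \<beta> \<rho> \<Longrightarrow> \<alpha> = \<beta>"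
  unfolding invariant_value_def matrix_forms_def vec_eq_iff by (auto intro!: form_eqI)

lemma invariant_value_left_invariant: "invariant_value \<alpha> \<rho> \<Longrightarrow> left_invariant_form U (\<alpha> $ i $ j)"
  by (subst left_invariant_form_iff) (auto simp: invariant_value_def matrix_forms_def one_in)

lemma lie_hom_coordinates:
  assumes "\<rho> \<in> lie_homs smul bracket"
  shows "(\<rho> x :: complex^'n^'n) $ i $ j = (\<Sum>b\<in>B. representation B x b * \<rho> b $ i $ j)"
proof -
  have "additive_functional (\<lambda>x. \<rho> x $ i $ j)"
    using assms by (simp add: additive_functional_def lie_homs_def)
  from functional_sum[OF this, of "representation B x" "\<lambda>b. b" B] show ?thesis
    using sum_representation_eq[OF independent_Basis, of x B] by (simp add: span_Basis finite_Basis)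
qed

lemma rep_form_value:
  assumes "\<rho> \<in> lie_homs smul bracket"
  shows "invariant_value (rep_form smul B U \<theta> \<rho>) \<rho>"
proof -
  let ?w = "\<lambda>b. form_of_functional U \<theta> (\<lambda>x. representation B x b)"
  have "(\<Sum>b\<in>B. (\<lambda>v u. \<rho> b $ i $ j * ?w b v u)) \<in> one_forms U" for i j
    by (intro one_forms_sum one_forms_scale form_of_functional coordinate_functional)
  moreover have "(\<Sum>b\<in>B. (\<lambda>v u. \<rho> b $ i $ j * ?w b v u)) (\<theta> x) = on_set U (\<lambda>_. \<rho> x $ i $ j)" for i j x
    by (auto simp: fun_eq_iff sum_fun_apply form_of_functional[OF coordinate_functional] on_set_def
        lie_hom_coordinates[OF assms, of x] mult.commute)
  ultimately show ?thesis
    by (simp add: invariant_value_def matrix_forms_def rep_form_def)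
qed

text \<open>On left-invariant fields the coefficients are constants, so Cartan's formula leaves only
  the value on the bracket and the wedge product is a commutator of matrices. Both terms are local
  in the fields, so arbitrary fields can be replaced by left-invariant ones at each point.\<close>

lemma flat_iff:
  assumes val: "invariant_value \<alpha> \<rho>"
  shows "flat U \<alpha> \<longleftrightarrow> (\<forall>x y. \<rho> (bracket x y) = \<rho> x ** \<rho> y - \<rho> y ** \<rho> x)"
proof -
  have forms: "\<alpha> $ i $ j \<in> one_forms U" for i j using val by (simp add: invariant_value_def matrix_forms_def)
  have \<alpha>: "(\<alpha> $ i $ j) (\<theta> x) = on_set U (\<lambda>_. \<rho> x $ i $ j)" for i j x
    using val by (simp add: invariant_value_def)
  define c where "c v w i j = cartan_d (\<alpha> $ i $ j) v w +
      ((\<Sum>k\<in>UNIV. (\<alpha> $ i $ k) v * (\<alpha> $ k $ j) w) - (\<Sum>k\<in>UNIV. (\<alpha> $ i $ k) w * (\<alpha> $ k $ j) v))" for v w i j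
  have flat: "flat U \<alpha> \<longleftrightarrow> (\<forall>v\<in>derivations U. \<forall>w\<in>derivations U. \<forall>i j. c v w i j = 0)"
    unfolding flat_def c_def vec_eq_iff
    by (simp add: exterior_derivative_def wedge_def form_value_def matrix_matrix_mult_def cartan_d_def
        del: plus_fun_apply zero_fun_apply minus_apply)
  have c_theta: "c (\<theta> x) (\<theta> y) i j g = (\<rho> x ** \<rho> y - \<rho> y ** \<rho> x - \<rho> (bracket x y)) $ i $ j"
    if "g \<in> U" for x y i j g
    using that
    by (simp add: c_def cartan_d_def \<alpha> der_const theta_der theta_bracket[symmetric] sum_fun_apply matrix_matrix_mult_def)
  show ?thesis
  proof
    assume "flat U \<alpha>"
    then have "c (\<theta> x) (\<theta> y) i j (mat 1) = 0" for x y i j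
      using theta_der unfolding flat by (metis zero_fun_apply)
    then show "\<forall>x y. \<rho> (bracket x y) = \<rho> x ** \<rho> y - \<rho> y ** \<rho> x"
      by (simp add: c_theta one_in vec_eq_iff)
  next
    assume hom: "\<forall>x y. \<rho> (bracket x y) = \<rho> x ** \<rho> y - \<rho> y ** \<rho> x"
    show "flat U \<alpha>"
      unfolding flat
    proof (intro ballI allI rf_eqI)
      fix v w i j g assume v: "v \<in> derivations U" and w: "w \<in> derivations U"
      show "c v w i j \<in> RF"
        unfolding c_def by (intro rf_add rf_diff rf_sum rf_mult form_closed[OF forms] cartan_d_closed[OF forms v w])
      assume g: "g \<in> U"
      obtain x where x: "\<And>f. f \<in> RF \<Longrightarrow> v f g = \<theta> x f g" using theta_local[OF v g] by blast
      obtain y where y: "\<And>f. f \<in> RF \<Longrightarrow> w f g = \<theta> y f g" using theta_local[OF w g] by blast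
      have "c v w i j g = c (\<theta> x) (\<theta> y) i j g"
        using form_local[OF forms v theta_der x] form_local[OF forms w theta_der y]
          cartan_d_local[OF forms v theta_der w theta_der x y]
        by (simp add: c_def sum_fun_apply)
      then show "c v w i j g = 0 g"
        by (simp add: c_theta g hom)
    qed (rule rf_0)
  qed
qed

lemma form_theta_linear:
  assumes "\<omega> \<in> one_forms U"
  shows "\<omega> (\<theta> (x + y)) = \<omega> (\<theta> x) + \<omega> (\<theta> y)" "\<omega> (\<theta> (smul c x)) = (\<lambda>u. c * \<omega> (\<theta> x) u)"
proof -
  have "\<forall>u. \<omega> (\<theta> (x + y)) u = \<omega> (\<theta> x) u + \<omega> (\<theta> y) u"
    using assms by induction (simp_all add: differential_der theta_der, simp add: theta_add algebra_simps)
  then show "\<omega> (\<theta> (x + y)) = \<omega> (\<theta> x) + \<omega> (\<theta> y)" by (simp add: fun_eq_iff)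
  have "\<forall>u. \<omega> (\<theta> (smul c x)) u = c * \<omega> (\<theta> x) u"
    using assms by induction (simp_all add: differential_der theta_der, simp add: theta_smul algebra_simps)
  then show "\<omega> (\<theta> (smul c x)) = (\<lambda>u. c * \<omega> (\<theta> x) u)" by (simp add: fun_eq_iff)
qed

lemma invariant_flat_form:
  fixes \<alpha> :: "('m, 'n::finite) matrix_form"
  assumes "\<alpha> \<in> matrix_forms U" "flat U \<alpha>" "\<And>i j. left_invariant_form U (\<alpha> $ i $ j)"
  shows "\<exists>\<rho>\<in>lie_homs smul bracket. \<alpha> = rep_form smul B U \<theta> \<rho>"
proof -
  have forms: "\<alpha> $ i $ j \<in> one_forms U" for i j using assms(1) by (simp add: matrix_forms_def)
  define \<rho> where "\<rho> x = (\<chi> i j. (\<alpha> $ i $ j) (\<theta> x) (mat 1))" for x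
  have "(\<alpha> $ i $ j) (\<theta> x) = on_set U (\<lambda>_. (\<alpha> $ i $ j) (\<theta> x) (mat 1))" for i j x
    using assms(3)[of i j] left_invariant_form_iff[OF forms] by blast
  then have val: "invariant_value \<alpha> \<rho>"
    using assms(1) unfolding invariant_value_def \<rho>_def vec_lambda_beta by blast
  have "\<rho> \<in> lie_homs smul bracket"
    using assms(2) unfolding flat_iff[OF val] lie_homs_def
    by (simp add: \<rho>_def form_theta_linear[OF forms] vec_eq_iff)
  then show ?thesis using invariant_value_unique[OF val rep_form_value] by blast
qed

lemma rep_form_invariant_flat:
  assumes "\<rho> \<in> lie_homs smul bracket"
  shows "rep_form smul B U \<theta> \<rho> \<in> matrix_forms U" "flat U (rep_form smul B U \<theta> \<rho>)"
    "left_invariant_form U (rep_form smul B U \<theta> \<rho> $ i $ j)"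
  using rep_form_value[OF assms] flat_iff[OF rep_form_value[OF assms]]
    invariant_value_left_invariant[OF rep_form_value[OF assms]] assms
  by (simp_all add: invariant_value_def lie_homs_def)

lemma invariant_D_modules_eq:
  "invariant_D_modules U = (\<lambda>\<rho>. connection_module U (rep_form smul B U \<theta> \<rho>)) ` lie_homs smul bracket"
  unfolding invariant_D_modules_def
  using invariant_flat_form rep_form_invariant_flat by blast

end

section \<open>Twisting differential operators\<close>

definition hat :: "'m::finite operator \<Rightarrow> 'm fn fps \<Rightarrow> 'm fn fps" where
  "hat P F = Abs_fps (\<lambda>k. P (fps_nth F k))"

lemma hat_nth [simp]: "fps_nth (hat P F) k = P (fps_nth F k)"
  by (simp add: hat_def)

definition fps_finite :: "'r::zero fps \<Rightarrow> nat \<Rightarrow> bool" where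
  "fps_finite F N \<longleftrightarrow> (\<forall>k\<ge>N. fps_nth F k = 0)"

text \<open>Sensible only for finitely many nonzero coefficients, otherwise \<open>0\<close>.\<close>

definition value_at_1 :: "'r::comm_ring_1 fps \<Rightarrow> 'r" where
  "value_at_1 F = (\<Sum>k | fps_nth F k \<noteq> 0. fps_nth F k)"

lemma value_at_1_eq:
  assumes "fps_finite F N" shows "value_at_1 F = (\<Sum>k<N. fps_nth F k)"
  unfolding value_at_1_def
  by (rule sum.mono_neutral_left) (use assms in \<open>auto simp: fps_finite_def not_less[symmetric]\<close>)

lemma fps_finite_mono: "fps_finite F N \<Longrightarrow> N \<le> M \<Longrightarrow> fps_finite F M"
  by (simp add: fps_finite_def)

lemma fps_finite_add: "fps_finite F N \<Longrightarrow> fps_finite G M \<Longrightarrow> fps_finite (F + G) (max N M)"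
  for F :: "'r::comm_ring_1 fps"
  by (simp add: fps_finite_def)

lemma value_at_1_add:
  assumes "fps_finite F N" "fps_finite G M"
  shows "value_at_1 (F + G) = value_at_1 F + value_at_1 G"
  using value_at_1_eq[OF fps_finite_add[OF assms]] value_at_1_eq[OF fps_finite_mono[OF assms(1), of "max N M"]]
    value_at_1_eq[OF fps_finite_mono[OF assms(2), of "max N M"]]
  by (simp add: sum.distrib)

lemma fps_finite_X: "fps_finite F N \<Longrightarrow> fps_finite (fps_X * F) (Suc N)"
  for F :: "'r::comm_ring_1 fps"
  by (auto simp: fps_finite_def)

lemma value_at_1_X:
  assumes "fps_finite F N" shows "value_at_1 (fps_X * F) = value_at_1 F"
  unfolding value_at_1_eq[OF assms] value_at_1_eq[OF fps_finite_X[OF assms]]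
  by (subst sum.lessThan_Suc_shift) simp

lemma fps_finite_const: "fps_finite (fps_const c) 1"
  by (simp add: fps_finite_def)

lemma value_at_1_const: "value_at_1 (fps_const c) = c"
  using value_at_1_eq[OF fps_finite_const, of c] by simp

lemma fps_decompose: "F = fps_const (fps_nth F 0) + fps_X * fps_shift 1 F"
  for F :: "'r::comm_ring_1 fps"
  by (rule fps_ext) simp

section \<open>Differential operators and their conjugates by exponentials\<close>

context linear_group
begin

abbreviation "DO \<equiv> differential_operators U"

lemma der_comp_mult: assumes "v \<in> derivations U" "a \<in> RF"
  shows "v \<circ> multiplication U a = multiplication U (v a) + (multiplication U a \<circ> v)"
proof
  fix f
  show "(v \<circ> multiplication U a) f = (multiplication U (v a) + (multiplication U a \<circ> v)) f"
    unfolding plus_fun_apply[of "multiplication U (v a)"] o_apply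
    using assms der_closed[OF assms(1)]
    by (cases "f \<in> RF") (simp_all add: multiplication_def der_mult der_outside der_0 rf_0 add.commute
        del: times_fun_apply plus_fun_apply zero_fun_apply)
qed

lemma DO_outside: "P \<in> DO \<Longrightarrow> f \<notin> RF \<Longrightarrow> P f = 0"
  and DO_closed: "P \<in> DO \<Longrightarrow> g \<in> RF \<Longrightarrow> P g \<in> RF"
  and DO_add: "P \<in> DO \<Longrightarrow> g \<in> RF \<Longrightarrow> h \<in> RF \<Longrightarrow> P (g + h) = P g + P h"
proof -
  have "P \<in> DO \<Longrightarrow> (\<forall>f. f \<notin> RF \<longrightarrow> P f = 0) \<and> (\<forall>g\<in>RF. P g \<in> RF) \<and> (\<forall>g\<in>RF. \<forall>h\<in>RF. P (g + h) = P g + P h)"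
  proof (induction rule: differential_operators.induct)
    case (mult f)
    then show ?case by (auto simp: multiplication_def rf_mult rf_add distrib_left simp del: plus_fun_apply times_fun_apply)
  next
    case (deriv v)
    then show ?case using der_closed der_outside der_add by blast
  next
    case (add P Q)
    then show ?case
      unfolding plus_fun_apply[of P Q]
      by (intro conjI allI ballI impI) (simp_all only: rf_add simp_thms add.commute add.left_commute add.assoc add_0)
  next
    case (comp P Q)
    then have "P 0 = 0" using rf_0 by (metis add_cancel_right_right)
    then show ?case using comp by (simp del: plus_fun_apply zero_fun_apply)
  qed
  then show "P \<in> DO \<Longrightarrow> f \<notin> RF \<Longrightarrow> P f = 0" "P \<in> DO \<Longrightarrow> g \<in> RF \<Longrightarrow> P g \<in> RF"
    "P \<in> DO \<Longrightarrow> g \<in> RF \<Longrightarrow> h \<in> RF \<Longrightarrow> P (g + h) = P g + P h" by blast+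
qed

lemma DO_0: "P \<in> DO \<Longrightarrow> P 0 = 0"
  using DO_add[of P 0 0] rf_0 by simp

lemma DO_sum: "P \<in> DO \<Longrightarrow> (\<And>i. i \<in> I \<Longrightarrow> f i \<in> RF) \<Longrightarrow> P (\<Sum>i\<in>I. f i) = (\<Sum>i\<in>I. P (f i))"
  by (induction I rule: infinite_finite_induct) (simp_all add: DO_0 DO_add rf_sum del: plus_fun_apply zero_fun_apply)

definition rfs :: "'m fn fps \<Rightarrow> bool" where
  "rfs F \<longleftrightarrow> (\<forall>k. fps_nth F k \<in> RF)"

lemma rfs_mult: "rfs F \<Longrightarrow> rfs G \<Longrightarrow> rfs (F * G)"
  unfolding rfs_def fps_mult_nth by (intro allI rf_sum rf_mult) auto

lemma rfs_const: "f \<in> RF \<Longrightarrow> rfs (fps_const f)"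
  by (simp add: rfs_def rf_0 del: zero_fun_apply)

lemma rfs_hat: "P \<in> DO \<Longrightarrow> rfs F \<Longrightarrow> rfs (hat P F)"
  by (simp add: rfs_def DO_closed)

lemma rfs_X: "rfs F \<Longrightarrow> rfs (fps_X * F)"
  by (simp add: rfs_def rf_0 del: zero_fun_apply)

text \<open>The series exp(t \<kappa>) in a formal parameter t. The powers are taken pointwise on U,
  so that the constant coefficient is the indicator function, the unit of C[U].\<close>

definition exp_series :: "'m fn \<Rightarrow> 'm fn fps" where
  "exp_series \<kappa> = Abs_fps (\<lambda>k. on_set U (\<lambda>u. \<kappa> u ^ k / fact k))"

lemma rfs_exp_series: "\<kappa> \<in> RF \<Longrightarrow> rfs (exp_series \<kappa>)"
proof -
  assume "\<kappa> \<in> RF"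
  then have "reg (\<lambda>u. \<kappa> u ^ k)" for k by (induction k) (auto intro: reg_const reg_mult)
  then have "reg (\<lambda>u. \<kappa> u ^ k * (1 / fact k))" for k by (intro reg_mult reg_const)
  then show ?thesis by (simp add: rfs_def exp_series_def)
qed

lemma one_mult_rfs: "rfs F \<Longrightarrow> fps_const (on_set U (\<lambda>_. 1)) * F = F"
proof (rule fps_ext)
  fix n assume "rfs F"
  then have "fps_nth F n \<in> RF" by (simp add: rfs_def)
  then show "fps_nth (fps_const (on_set U (\<lambda>_. 1)) * F) n = fps_nth F n"
    using rf_outside[of "fps_nth F n"] by (auto simp: fun_eq_iff on_set_def)
qed

lemma exp_series_uminus: "exp_series (- \<kappa>) * exp_series \<kappa> = fps_const (on_set U (\<lambda>_. 1))"
proof (rule fps_ext, rule ext)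
  fix n u
  show "fps_nth (exp_series (- \<kappa>) * exp_series \<kappa>) n u = fps_nth (fps_const (on_set U (\<lambda>_. 1))) n u"
  proof (cases "u \<in> U")
    case True
    have "fps_nth (exp_series (- \<kappa>) * exp_series \<kappa>) n u = fps_nth (fps_exp (- \<kappa> u) * fps_exp (\<kappa> u)) n"
      using True by (simp add: fps_mult_nth exp_series_def sum_fun_apply)
    also have "\<dots> = fps_nth (fps_exp 0) n"
      by (simp flip: fps_exp_add_mult)
    finally show ?thesis using True by simp
  qed (simp add: fps_mult_nth exp_series_def sum_fun_apply)
qed

lemma exp_series_uminus': "exp_series \<kappa> * exp_series (- \<kappa>) = fps_const (on_set U (\<lambda>_. 1))"
  by (metis exp_series_uminus mult.commute)

text \<open>The conjugate exp(- t \<kappa>) P exp(t \<kappa>), acting on power series in t.\<close>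

definition twist_series :: "'m fn \<Rightarrow> 'm operator \<Rightarrow> 'm fn fps \<Rightarrow> 'm fn fps" where
  "twist_series \<kappa> P F = exp_series (- \<kappa>) * hat P (exp_series \<kappa> * F)"

lemma rfs_twist_series: "\<kappa> \<in> RF \<Longrightarrow> P \<in> DO \<Longrightarrow> rfs F \<Longrightarrow> rfs (twist_series \<kappa> P F)"
  unfolding twist_series_def by (intro rfs_mult rfs_hat rfs_exp_series rf_uminus)

lemma hat_add: "P \<in> DO \<Longrightarrow> rfs F \<Longrightarrow> rfs G \<Longrightarrow> hat P (F + G) = hat P F + hat P G"
  by (rule fps_ext) (simp add: rfs_def DO_add del: plus_fun_apply)

lemma twist_series_add: "\<kappa> \<in> RF \<Longrightarrow> P \<in> DO \<Longrightarrow> rfs F \<Longrightarrow> rfs G \<Longrightarrow> twist_series \<kappa> P (F + G) = twist_series \<kappa> P F + twist_series \<kappa> P G"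
  by (simp add: twist_series_def distrib_left hat_add rfs_mult rfs_exp_series)

lemma twist_series_X: "P \<in> DO \<Longrightarrow> twist_series \<kappa> P (fps_X * F) = fps_X * twist_series \<kappa> P F"
proof -
  assume "P \<in> DO"
  then have "hat P (fps_X * G) = fps_X * hat P G" for G
    by (intro fps_ext) (simp add: DO_0 del: zero_fun_apply)
  then show ?thesis by (simp add: twist_series_def mult.left_commute)
qed

lemma twist_series_comp:
  assumes "\<kappa> \<in> RF" "P \<in> DO" "Q \<in> DO" "rfs F"
  shows "twist_series \<kappa> (P \<circ> Q) F = twist_series \<kappa> P (twist_series \<kappa> Q F)"
proof -
  have "exp_series \<kappa> * twist_series \<kappa> Q F = hat Q (exp_series \<kappa> * F)"
    unfolding twist_series_def mult.assoc[symmetric] exp_series_uminus'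
    by (intro one_mult_rfs rfs_hat rfs_mult rfs_exp_series assms)
  then show ?thesis
    by (simp add: twist_series_def hat_def fps_eq_iff)
qed

lemma twist_series_plus: "twist_series \<kappa> (P + Q) F = twist_series \<kappa> P F + twist_series \<kappa> Q F"
proof -
  have "hat (P + Q) G = hat P G + hat Q G" for G
    by (rule fps_ext) (simp add: plus_fun_apply[of P Q] del: plus_fun_apply)
  then show ?thesis by (simp add: twist_series_def distrib_left)
qed

lemma twist_series_multiplication:
  assumes "\<kappa> \<in> RF" "a \<in> RF" "rfs F"
  shows "twist_series \<kappa> (multiplication U a) F = fps_const a * F"
proof -
  have "hat (multiplication U a) (exp_series \<kappa> * F) = fps_const a * (exp_series \<kappa> * F)"
    using rfs_mult[OF rfs_exp_series[OF assms(1)] assms(3)]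
    by (intro fps_ext) (simp add: multiplication_def rfs_def del: times_fun_apply)
  then have "twist_series \<kappa> (multiplication U a) F = (exp_series (- \<kappa>) * exp_series \<kappa>) * (fps_const a * F)"
    by (simp add: twist_series_def ac_simps)
  also have "\<dots> = fps_const a * F"
    unfolding exp_series_uminus by (intro one_mult_rfs rfs_mult rfs_const assms)
  finally show ?thesis .
qed

lemma der_exp_series:
  assumes v: "v \<in> derivations U" and l: "\<kappa> \<in> RF"
  shows "v (fps_nth (exp_series \<kappa>) k) = (if k = 0 then 0 else fps_nth (exp_series \<kappa>) (k - 1) * v \<kappa>)"
proof (induction k)
  case 0
  then show ?case using der_const[OF v, of 1] by (simp add: exp_series_def)
next
  case (Suc k)
  let ?e = "fps_nth (exp_series \<kappa>)"
  have e: "?e k \<in> RF" for k using rfs_exp_series[OF l] by (simp add: rfs_def)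
  have Suc_e: "?e (Suc k) = (\<lambda>x. (1 / of_nat (Suc k)) * (\<kappa> * ?e k) x)" for k
    by (auto simp: exp_series_def on_set_def fun_eq_iff field_simps simp del: of_nat_Suc)
  have "v (?e (Suc k)) = (\<lambda>x. (1 / of_nat (Suc k)) * (\<kappa> * v (?e k) + v \<kappa> * ?e k) x)"
    unfolding Suc_e der_scale[OF v rf_mult[OF l e]] der_mult[OF v l e] ..
  also have "\<dots> = ?e k * v \<kappa>"
  proof (cases k)
    case 0
    then show ?thesis using Suc by (simp add: fun_eq_iff)
  next
    case (Suc j)
    show ?thesis
      unfolding Suc.IH
      by (simp add: \<open>k = Suc j\<close> Suc_e[of j] fun_eq_iff field_simps del: of_nat_Suc) (simp add: algebra_simps)
  qed
  finally show ?case by simp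
qed

text \<open>Conjugation turns a field v into v + t v(\<kappa>), of degree one in t.\<close>

lemma twist_series_der:
  assumes v: "v \<in> derivations U" and l: "\<kappa> \<in> RF" and f: "f \<in> RF"
  shows "twist_series \<kappa> v (fps_const f) = fps_const (v f) + fps_X * fps_const (v \<kappa> * f)"
proof -
  let ?e = "fps_nth (exp_series \<kappa>)"
  have e: "?e k \<in> RF" for k using rfs_exp_series[OF l] by (simp add: rfs_def)
  have "hat v (exp_series \<kappa> * fps_const f) = exp_series \<kappa> * fps_const (v f) + fps_X * (exp_series \<kappa> * fps_const (v \<kappa> * f))"
  proof (rule fps_ext)
    fix k
    show "fps_nth (hat v (exp_series \<kappa> * fps_const f)) k =
        fps_nth (exp_series \<kappa> * fps_const (v f) + fps_X * (exp_series \<kappa> * fps_const (v \<kappa> * f))) k"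
      by (simp add: der_mult[OF v e f] der_exp_series[OF v l] mult.assoc del: times_fun_apply plus_fun_apply)
  qed
  then have "twist_series \<kappa> v (fps_const f) = (exp_series (- \<kappa>) * exp_series \<kappa>) * fps_const (v f) + fps_X * ((exp_series (- \<kappa>) * exp_series \<kappa>) * fps_const (v \<kappa> * f))"
    by (simp add: twist_series_def distrib_left ac_simps del: fps_const_mult)
  then show ?thesis
    unfolding exp_series_uminus using v l f by (simp add: one_mult_rfs rfs_const der_closed rf_mult del: fps_const_mult)
qed

text \<open>\<open>twist \<kappa> P\<close> is \<open>exp (- \<kappa>) P exp \<kappa>\<close>. Since \<open>exp \<kappa>\<close> is not algebraic, it is replaced by a power
  series in a parameter; for a differential operator \<open>P\<close> the conjugate is a polynomial in the
  parameter, which can be set to 1.\<close>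

definition twist :: "'m fn \<Rightarrow> 'm operator \<Rightarrow> 'm fn \<Rightarrow> 'm fn" where
  "twist \<kappa> P f = value_at_1 (twist_series \<kappa> P (fps_const f))"

lemma value_at_1_rf: "rfs F \<Longrightarrow> value_at_1 F \<in> RF"
  unfolding value_at_1_def rfs_def by (intro rf_sum) auto

text \<open>The conjugate of P is additive and commutes with multiplication by t. Splitting F into
  its constant term and t times a shorter polynomial carries finiteness from constants to
  polynomials, and shows that P may be conjugated before or after setting t = 1 in F.\<close>

lemma twist_series_finite_extend:
  assumes l: "\<kappa> \<in> RF" and P: "P \<in> DO" and fin: "\<And>f. f \<in> RF \<Longrightarrow> \<exists>N. fps_finite (twist_series \<kappa> P (fps_const f)) N"
    and F: "rfs F" "fps_finite F N"
  shows "(\<exists>M. fps_finite (twist_series \<kappa> P F) M) \<and> value_at_1 (twist_series \<kappa> P F) = twist \<kappa> P (value_at_1 F)"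
  using F
proof (induction N arbitrary: F)
  case 0
  then have "F = fps_const 0" by (auto simp: fps_finite_def fps_eq_iff)
  then show ?case using fin[OF rf_0] by (simp only: twist_def value_at_1_const)
next
  case (Suc N)
  let ?c = "fps_const (fps_nth F 0)" and ?G = "fps_shift 1 F"
  have rf: "fps_nth F 0 \<in> RF" "rfs ?G" using Suc.prems(1) by (auto simp: rfs_def)
  have G: "fps_finite ?G N" using Suc.prems(2) by (simp add: fps_finite_def)
  obtain M where M: "fps_finite (twist_series \<kappa> P ?G) M" and IH: "value_at_1 (twist_series \<kappa> P ?G) = twist \<kappa> P (value_at_1 ?G)"
    using Suc.IH[OF rf(2) G] by blast
  obtain K where K: "fps_finite (twist_series \<kappa> P ?c) K" using fin[OF rf(1)] by blast
  have twist_series: "twist_series \<kappa> P F = twist_series \<kappa> P ?c + fps_X * twist_series \<kappa> P ?G"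
    using twist_series_add[OF l P rfs_const[OF rf(1)] rfs_X[OF rf(2)]] fps_decompose[of F] by (simp add: twist_series_X P)
  have cG: "value_at_1 F = fps_nth F 0 + value_at_1 ?G"
    using fps_decompose[of F] value_at_1_add[OF fps_finite_const fps_finite_X[OF G]] value_at_1_X[OF G] by (metis value_at_1_const)
  obtain K' where K': "fps_finite (twist_series \<kappa> P (fps_const (value_at_1 ?G))) K'" using fin[OF value_at_1_rf[OF rf(2)]] by blast
  have "twist \<kappa> P (value_at_1 F) = twist \<kappa> P (fps_nth F 0) + twist \<kappa> P (value_at_1 ?G)"
    unfolding twist_def cG fps_const_add[symmetric]
    by (subst twist_series_add[OF l P rfs_const[OF rf(1)] rfs_const[OF value_at_1_rf[OF rf(2)]]]) (rule value_at_1_add[OF K K'])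
  moreover have "value_at_1 (twist_series \<kappa> P F) = value_at_1 (twist_series \<kappa> P ?c) + value_at_1 (twist_series \<kappa> P ?G)"
    unfolding twist_series using value_at_1_add[OF K fps_finite_X[OF M]] value_at_1_X[OF M] by simp
  ultimately show ?case
    using fps_finite_add[OF K fps_finite_X[OF M]] IH unfolding twist_series[symmetric] twist_def by auto
qed

text \<open>On the generators the degree in t is at most one. For a composition the inner operator
  produces a polynomial in t, to which the outer one is extended by the preceding lemma.\<close>

lemma twist_series_finite:
  assumes l: "\<kappa> \<in> RF" and "P \<in> DO" "f \<in> RF"
  shows "\<exists>N. fps_finite (twist_series \<kappa> P (fps_const f)) N"
  using assms(2,3)
proof (induction arbitrary: f rule: differential_operators.induct)
  case (mult a)
  then show ?case using fps_finite_const[of "a * f"] by (auto simp: twist_series_multiplication l rfs_const)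
next
  case (deriv v)
  then show ?case
    using fps_finite_add[OF fps_finite_const fps_finite_X[OF fps_finite_const]] by (auto simp only: twist_series_der l)
next
  case (add P Q)
  then show ?case unfolding twist_series_plus using fps_finite_add by blast
next
  case (comp P Q)
  obtain N where "fps_finite (twist_series \<kappa> Q (fps_const f)) N" using comp by blast
  with twist_series_finite_extend[OF l comp.hyps(1) comp.IH(1) rfs_twist_series[OF l comp.hyps(2) rfs_const[OF comp.prems]]]
  show ?case using twist_series_comp[OF l comp.hyps rfs_const[OF comp.prems]] by (simp only:)
qed

lemma twist_closed: "\<kappa> \<in> RF \<Longrightarrow> P \<in> DO \<Longrightarrow> f \<in> RF \<Longrightarrow> twist \<kappa> P f \<in> RF"
  unfolding twist_def by (intro value_at_1_rf rfs_twist_series rfs_const)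

lemma twist_add_arg:
  assumes "\<kappa> \<in> RF" "P \<in> DO" "f \<in> RF" "g \<in> RF"
  shows "twist \<kappa> P (f + g) = twist \<kappa> P f + twist \<kappa> P g"
proof -
  obtain N M where "fps_finite (twist_series \<kappa> P (fps_const f)) N" "fps_finite (twist_series \<kappa> P (fps_const g)) M"
    using twist_series_finite[OF assms(1,2)] assms(3,4) by metis
  from value_at_1_add[OF this] show ?thesis
    unfolding twist_def fps_const_add[symmetric] by (simp only: twist_series_add assms rfs_const)
qed

lemma twist_add:
  assumes "\<kappa> \<in> RF" "P \<in> DO" "Q \<in> DO" "f \<in> RF"
  shows "twist \<kappa> (P + Q) f = twist \<kappa> P f + twist \<kappa> Q f"
proof -
  obtain N M where "fps_finite (twist_series \<kappa> P (fps_const f)) N" "fps_finite (twist_series \<kappa> Q (fps_const f)) M"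
    using twist_series_finite[OF assms(1)] assms(2-4) by metis
  from value_at_1_add[OF this] show ?thesis
    unfolding twist_def by (simp only: twist_series_plus)
qed

text \<open>The reason for the detour through power series: the conjugates compose as operators on
  C[U], although exp \<kappa> need not be a regular function.\<close>

lemma twist_comp:
  assumes l: "\<kappa> \<in> RF" and P: "P \<in> DO" and Q: "Q \<in> DO" and f: "f \<in> RF"
  shows "twist \<kappa> (P \<circ> Q) f = twist \<kappa> P (twist \<kappa> Q f)"
proof -
  obtain N where "fps_finite (twist_series \<kappa> Q (fps_const f)) N" using twist_series_finite[OF l Q f] by blast
  from twist_series_finite_extend[OF l P twist_series_finite[OF l P] rfs_twist_series[OF l Q rfs_const[OF f]] this]
  show ?thesis unfolding twist_def twist_series_comp[OF l P Q rfs_const[OF f]] by blast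
qed

lemma twist_multiplication: "\<kappa> \<in> RF \<Longrightarrow> a \<in> RF \<Longrightarrow> f \<in> RF \<Longrightarrow> twist \<kappa> (multiplication U a) f = a * f"
  by (simp add: twist_def twist_series_multiplication rfs_const value_at_1_const)

lemma twist_der:
  assumes "v \<in> derivations U" "\<kappa> \<in> RF" "f \<in> RF"
  shows "twist \<kappa> v f = v f + v \<kappa> * f"
  unfolding twist_def twist_series_der[OF assms]
  by (subst value_at_1_add[OF fps_finite_const fps_finite_X[OF fps_finite_const]])
    (simp only: value_at_1_const value_at_1_X[OF fps_finite_const])

end

section \<open>Connections with a triangularising gauge\<close>

context linear_group
begin

abbreviation "RV \<equiv> {x :: 'm fn^'n::finite. \<forall>i. x $ i \<in> RF}"

text \<open>The identity matrix over C[U]. Its diagonal is the indicator function of U, so it acts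
  as the identity only on vectors of functions that vanish outside U.\<close>

definition IU :: "'m fn^'n::finite^'n" where
  "IU = (\<chi> i j. if i = j then on_set U (\<lambda>_. 1) else 0)"

lemma unit_mult: "f \<in> RF \<Longrightarrow> on_set U (\<lambda>_. 1) * f = f"
  using rf_outside[of f] by (auto simp: fun_eq_iff on_set_def)

lemma IU_mult: "x \<in> RV \<Longrightarrow> IU *v x = x"
proof -
  assume x: "x \<in> RV"
  have "(\<Sum>j\<in>UNIV. (if i = j then on_set U (\<lambda>_. 1) else 0) * x $ j) = x $ i" for i
  proof -
    have "(\<Sum>j\<in>UNIV. (if i = j then on_set U (\<lambda>_. 1) else 0) * x $ j) = (\<Sum>j\<in>UNIV. if i = j then x $ j else 0)"
      using x by (intro sum.cong) (auto simp: unit_mult simp del: times_fun_apply)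
    then show ?thesis by simp
  qed
  then show ?thesis by (simp add: vec_eq_iff matrix_vector_mult_def IU_def)
qed

lemma RV_add: "x \<in> RV \<Longrightarrow> y \<in> RV \<Longrightarrow> x + y \<in> RV"
  by (simp add: rf_add del: plus_fun_apply)

lemma RV_mult: "(\<And>i j. A $ i $ j \<in> RF) \<Longrightarrow> x \<in> RV \<Longrightarrow> A *v x \<in> RV"
  unfolding matrix_vector_mult_def by (auto intro!: rf_sum rf_mult simp del: times_fun_apply)

lemma multiplication_apply: "f \<in> RF \<Longrightarrow> multiplication U a f = a * f"
  by (simp add: multiplication_def)

lemma DO_uminus:
  assumes "P \<in> DO" shows "- P \<in> DO"
proof -
  have "multiplication U (on_set U (\<lambda>_. -1)) \<circ> P = - P"
  proof
    fix f
    have "P f \<in> RF" using DO_closed[OF assms] DO_outside[OF assms] rf_0 by (cases "f \<in> RF") auto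
    then show "(multiplication U (on_set U (\<lambda>_. -1)) \<circ> P) f = (- P) f"
      using rf_outside[of "P f"] by (auto simp: multiplication_apply fun_eq_iff on_set_def)
  qed
  moreover have "multiplication U (on_set U (\<lambda>_. -1)) \<circ> P \<in> DO"
    by (intro differential_operators.comp differential_operators.mult reg_const assms)
  ultimately show ?thesis by simp
qed

lemma DO_zero: "0 \<in> DO"
proof -
  have "multiplication U 0 = 0" by (auto simp: multiplication_def fun_eq_iff)
  then show ?thesis using differential_operators.mult[OF rf_0] by simp
qed

lemma DO_eqI:
  assumes "P \<in> DO" "Q \<in> DO" "\<And>f. f \<in> RF \<Longrightarrow> P f = Q f"
  shows "P = Q"
proof
  show "P f = Q f" for f
    by (cases "f \<in> RF") (simp_all add: assms(3) DO_outside[OF assms(1)] DO_outside[OF assms(2)])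
qed

section \<open>Modules over the ring of differential operators\<close>

lemma diff_op_ring: "ring (diff_op_ring U)"
proof (rule ringI)
  let ?e = "multiplication U (on_set U (\<lambda>_. 1))"
  note op = differential_operators.intros
  have e: "?e \<in> DO" by (intro op reg_const)
  show "abelian_group (diff_op_ring U)"
  proof (rule abelian_groupI)
    fix P assume "P \<in> carrier (diff_op_ring U)"
    then show "\<exists>Q\<in>carrier (diff_op_ring U). Q \<oplus>\<^bsub>diff_op_ring U\<^esub> P = \<zero>\<^bsub>diff_op_ring U\<^esub>"
      by (intro bexI[of _ "- P"]) (simp_all add: diff_op_ring_def DO_uminus del: plus_fun_apply uminus_apply)
  qed (auto simp: diff_op_ring_def DO_zero op add.assoc add.commute simp del: plus_fun_apply)
  show "Group.monoid (diff_op_ring U)"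
  proof (rule monoidI)
    fix P assume "P \<in> carrier (diff_op_ring U)"
    then have P: "P \<in> DO" by (simp add: diff_op_ring_def)
    have "?e \<circ> P = P"
      by (rule DO_eqI[OF op(4)[OF e P] P])
        (simp add: multiplication_apply DO_closed[OF P] unit_mult del: times_fun_apply)
    moreover have "P \<circ> ?e = P"
      by (rule DO_eqI[OF op(4)[OF P e] P])
        (simp add: multiplication_apply unit_mult del: times_fun_apply)
    ultimately show "\<one>\<^bsub>diff_op_ring U\<^esub> \<otimes>\<^bsub>diff_op_ring U\<^esub> P = P" "P \<otimes>\<^bsub>diff_op_ring U\<^esub> \<one>\<^bsub>diff_op_ring U\<^esub> = P"
      by (simp_all add: diff_op_ring_def)
  qed (auto simp: diff_op_ring_def op e comp_assoc)
  fix P Q R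
  assume "P \<in> carrier (diff_op_ring U)" "Q \<in> carrier (diff_op_ring U)" "R \<in> carrier (diff_op_ring U)"
  then have P: "P \<in> DO" and Q: "Q \<in> DO" and R: "R \<in> DO" by (simp_all add: diff_op_ring_def)
  have "(P + Q) \<circ> R = (P \<circ> R) + (Q \<circ> R)"
    by (simp add: fun_eq_iff)
  then show "(P \<oplus>\<^bsub>diff_op_ring U\<^esub> Q) \<otimes>\<^bsub>diff_op_ring U\<^esub> R =
      P \<otimes>\<^bsub>diff_op_ring U\<^esub> R \<oplus>\<^bsub>diff_op_ring U\<^esub> Q \<otimes>\<^bsub>diff_op_ring U\<^esub> R"
    by (simp add: diff_op_ring_def)
  have "R \<circ> (P + Q) = (R \<circ> P) + (R \<circ> Q)"
  proof (rule DO_eqI)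
    fix f assume f: "f \<in> RF"
    show "(R \<circ> (P + Q)) f = ((R \<circ> P) + (R \<circ> Q)) f"
      unfolding o_apply plus_fun_apply[of P Q] plus_fun_apply[of "R \<circ> P" "R \<circ> Q"]
      by (rule DO_add[OF R DO_closed[OF P f] DO_closed[OF Q f]])
  qed (intro op P Q R)+
  then show "R \<otimes>\<^bsub>diff_op_ring U\<^esub> (P \<oplus>\<^bsub>diff_op_ring U\<^esub> Q) =
      R \<otimes>\<^bsub>diff_op_ring U\<^esub> P \<oplus>\<^bsub>diff_op_ring U\<^esub> R \<otimes>\<^bsub>diff_op_ring U\<^esub> Q"
    by (simp add: diff_op_ring_def)
qed

lemma free_module_group: "abelian_group (free_module U act)"
proof (rule abelian_groupI)
  fix x assume "x \<in> carrier (free_module U act)"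
  then show "\<exists>y\<in>carrier (free_module U act). y \<oplus>\<^bsub>free_module U act\<^esub> x = \<zero>\<^bsub>free_module U act\<^esub>"
    by (intro bexI[of _ "- x"]) (auto simp: free_module_def rf_uminus simp del: uminus_apply)
qed (auto simp: free_module_def rf_add rf_0 add.assoc add.commute simp del: plus_fun_apply zero_fun_apply)

lemma left_module_freeI:
  assumes "\<And>P x. P \<in> DO \<Longrightarrow> x \<in> RV \<Longrightarrow> act P x \<in> RV"
    and "\<And>P Q x. P \<in> DO \<Longrightarrow> Q \<in> DO \<Longrightarrow> x \<in> RV \<Longrightarrow> act (P + Q) x = act P x + act Q x"
    and "\<And>P x y. P \<in> DO \<Longrightarrow> x \<in> RV \<Longrightarrow> y \<in> RV \<Longrightarrow> act P (x + y) = act P x + act P y"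
    and "\<And>P Q x. P \<in> DO \<Longrightarrow> Q \<in> DO \<Longrightarrow> x \<in> RV \<Longrightarrow> act (P \<circ> Q) x = act P (act Q x)"
    and "\<And>x. x \<in> RV \<Longrightarrow> act (multiplication U (on_set U (\<lambda>_. 1))) x = x"
  shows "left_module (diff_op_ring U) (free_module U act)"
proof -
  interpret R: ring "diff_op_ring U" by (rule diff_op_ring)
  interpret M: abelian_group "free_module U act" by (rule free_module_group)
  show ?thesis
    by unfold_locales (use assms in \<open>simp_all only: diff_op_ring_def free_module_def ring.simps monoid.simps partial_object.simps module.simps\<close>)
qed

lemma left_module_freeD:
  assumes "left_module (diff_op_ring U) (free_module U act)"
  shows "P \<in> DO \<Longrightarrow> x \<in> RV \<Longrightarrow> act P x \<in> RV"
    and "P \<in> DO \<Longrightarrow> Q \<in> DO \<Longrightarrow> x \<in> RV \<Longrightarrow> act (P + Q) x = act P x + act Q x"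
    and "P \<in> DO \<Longrightarrow> x \<in> RV \<Longrightarrow> y \<in> RV \<Longrightarrow> act P (x + y) = act P x + act P y"
    and "P \<in> DO \<Longrightarrow> Q \<in> DO \<Longrightarrow> x \<in> RV \<Longrightarrow> act (P \<circ> Q) x = act P (act Q x)"
proof -
  interpret left_module "diff_op_ring U" "free_module U act" by fact
  show "P \<in> DO \<Longrightarrow> x \<in> RV \<Longrightarrow> act P x \<in> RV"
    using smult_closed[of P x] by (simp only: diff_op_ring_def free_module_def ring.simps monoid.simps partial_object.simps module.simps)
  show "P \<in> DO \<Longrightarrow> Q \<in> DO \<Longrightarrow> x \<in> RV \<Longrightarrow> act (P + Q) x = act P x + act Q x"
    using smult_l_distr[of P Q x] by (simp only: diff_op_ring_def free_module_def ring.simps monoid.simps partial_object.simps module.simps)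
  show "P \<in> DO \<Longrightarrow> x \<in> RV \<Longrightarrow> y \<in> RV \<Longrightarrow> act P (x + y) = act P x + act P y"
    using smult_r_distr[of P x y] by (simp only: diff_op_ring_def free_module_def ring.simps monoid.simps partial_object.simps module.simps)
  show "P \<in> DO \<Longrightarrow> Q \<in> DO \<Longrightarrow> x \<in> RV \<Longrightarrow> act (P \<circ> Q) x = act P (act Q x)"
    using smult_assoc[of P Q x] by (simp only: diff_op_ring_def free_module_def ring.simps monoid.simps partial_object.simps module.simps)
qed

lemma basis_vector_RV: "basis_vector U j \<in> RV"
  by (simp add: basis_vector_def rf_0 reg_const del: zero_fun_apply)

lemma basis_vector_decompose:
  assumes "x \<in> RV"
  shows "x = (\<Sum>j\<in>UNIV. \<chi> i. x $ j * basis_vector U j $ i)"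
proof -
  have "(\<Sum>j\<in>UNIV. x $ j * basis_vector U j $ i) = x $ i" for i
  proof -
    have "(\<Sum>j\<in>UNIV. x $ j * basis_vector U j $ i) = (\<Sum>j\<in>UNIV. if j = i then x $ j else 0)"
      using assms by (intro sum.cong) (auto simp: basis_vector_def mult.commute[of _ "on_set U _"] unit_mult simp del: times_fun_apply)
    then show ?thesis by simp
  qed
  then show ?thesis by (simp add: vec_eq_iff)
qed

text \<open>Functions act by multiplication, fields are determined by the basis vectors and the
  Leibniz rule, and the module laws propagate agreement to sums and compositions. The junk values
  agree by the last clause of \<open>connection_action\<close>.\<close>

lemma connection_action_unique:
  fixes \<alpha> :: "('m, 'n::finite) matrix_form"
  assumes a: "connection_action U \<alpha> act" and b: "connection_action U \<alpha> act'"
  shows "act = act'"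
proof -
  have carrier: "carrier (free_module U act) = RV" "carrier (diff_op_ring U) = DO" for act
    by (simp_all add: free_module_def diff_op_ring_def)
  have 1: "act P x = act' P x" if "P \<in> DO" "x \<in> RV" for P x
    using that
  proof (induction arbitrary: x rule: differential_operators.induct)
    case (mult f)
    then show ?case using a b by (simp add: connection_action_def carrier)
  next
    case (deriv v)
    have *: "act v x = (\<Sum>j\<in>UNIV. (\<chi> i. v (x $ j) * basis_vector U j $ i) + (\<chi> i. x $ j * column j (form_value \<alpha> v) $ i))"
      if a: "connection_action U \<alpha> act" for act
    proof -
      have mod: "left_module (diff_op_ring U) (free_module U act)" using a by (simp add: connection_action_def)
      note m = left_module_freeD[OF mod]
      have mult: "act (multiplication U f) y = (\<chi> i. f * y $ i)" if "f \<in> RF" "y \<in> RV" for f y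
        using a that by (simp add: connection_action_def carrier)
      have v: "v \<in> DO" by (rule differential_operators.deriv) fact
      have x: "x $ j \<in> RF" for j using deriv by simp
      have RVj: "(\<chi> i. x $ j * basis_vector U j $ i) \<in> RV" for j
        using basis_vector_RV[of j] x by (simp add: rf_mult del: times_fun_apply)
      have zero: "act v 0 = 0"
        using m(3)[OF v, of 0 0] by (simp add: rf_0 del: zero_fun_apply)
      have "act v (\<Sum>j\<in>J. \<chi> i. x $ j * basis_vector U j $ i) = (\<Sum>j\<in>J. act v (\<chi> i. x $ j * basis_vector U j $ i))" for J :: "'n set"
      proof (induction J rule: infinite_finite_induct)
        case (insert j J)
        have "(\<Sum>j\<in>J. \<chi> i. x $ j * basis_vector U j $ i) \<in> RV"
          using RVj by (auto simp: rf_sum)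
        then show ?case using insert m(3)[OF v RVj] by (simp del: times_fun_apply plus_fun_apply)
      qed (simp_all add: zero)
      then have "act v x = (\<Sum>j\<in>UNIV. act v (\<chi> i. x $ j * basis_vector U j $ i))"
        using basis_vector_decompose[OF deriv(2)] by metis
      also have "\<dots> = (\<Sum>j\<in>UNIV. (\<chi> i. v (x $ j) * basis_vector U j $ i) + (\<chi> i. x $ j * column j (form_value \<alpha> v) $ i))"
      proof (rule sum.cong[OF refl])
        fix j
        have e: "act v (basis_vector U j) = column j (form_value \<alpha> v)"
          using a deriv by (simp add: connection_action_def)
        \<comment> \<open>The vector is the image of a basis vector under a multiplication operator.
          In D(U) the field v composed with multiplication by f is v(f) plus multiplication by f
          after v, and both summands are known on basis vectors.\<close>
        have "act v (\<chi> i. x $ j * basis_vector U j $ i) = act (v \<circ> multiplication U (x $ j)) (basis_vector U j)"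
          using m(4)[OF v differential_operators.mult[OF x] basis_vector_RV] mult[OF x basis_vector_RV] by simp
        also have "\<dots> = act (multiplication U (v (x $ j))) (basis_vector U j) +
            act (multiplication U (x $ j)) (act v (basis_vector U j))"
          unfolding der_comp_mult[OF deriv(1) x]
          by (subst m(2)[OF differential_operators.mult[OF der_closed[OF deriv(1) x]] _ basis_vector_RV])
            (simp_all only: m(4)[OF differential_operators.mult[OF x] v basis_vector_RV] differential_operators.comp differential_operators.mult x v)
        also have "\<dots> = (\<chi> i. v (x $ j) * basis_vector U j $ i) + (\<chi> i. x $ j * act v (basis_vector U j) $ i)"
          by (simp only: mult der_closed[OF deriv(1) x] basis_vector_RV m(1)[OF v basis_vector_RV] x)
        finally show "act v (\<chi> i. x $ j * basis_vector U j $ i) =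
            (\<chi> i. v (x $ j) * basis_vector U j $ i) + (\<chi> i. x $ j * column j (form_value \<alpha> v) $ i)"
          unfolding e .
      qed
      finally show ?thesis .
    qed
    show ?case unfolding *[OF a] *[OF b] ..
  next
    case (add P Q)
    then show ?case
      using left_module_freeD(2)[of act P Q x] left_module_freeD(2)[of act' P Q x] a b
      by (simp add: connection_action_def del: plus_fun_apply)
  next
    case (comp P Q)
    have mod: "left_module (diff_op_ring U) (free_module U act)" "left_module (diff_op_ring U) (free_module U act')"
      using a b by (simp_all only: connection_action_def)
    have "act (P \<circ> Q) x = act P (act Q x)" "act' (P \<circ> Q) x = act' P (act' Q x)"
      by (rule left_module_freeD(4)[OF mod(1) comp.hyps comp.prems] left_module_freeD(4)[OF mod(2) comp.hyps comp.prems])+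
    then show ?case
      using comp.IH(1)[OF left_module_freeD(1)[OF mod(1) comp.hyps(2) comp.prems]] comp.IH(2)[OF comp.prems] by (simp only:)
  qed
  show ?thesis
  proof (intro ext)
    fix P x
    show "act P x = act' P x"
    proof (cases "P \<in> DO \<and> x \<in> RV")
      case False
      have "act P x = 0"
        using a False unfolding connection_action_def carrier by blast
      moreover have "act' P x = 0"
        using b False unfolding connection_action_def carrier by blast
      ultimately show ?thesis by simp
    qed (simp only: 1)
  qed
qed

text \<open>The columns of \<open>G\<close> form a basis of the module in which the connection is diagonal with entries
  \<open>d \<kappa>\<^sub>j\<close>; \<open>H\<close> is the inverse of \<open>G\<close>.\<close>

definition gauge :: "('m, 'n::finite) matrix_form \<Rightarrow> 'm fn^'n^'n \<Rightarrow> 'm fn^'n^'n \<Rightarrow> ('n \<Rightarrow> 'm fn) \<Rightarrow> bool" where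
  "gauge \<alpha> G H \<kappa> \<longleftrightarrow> (\<forall>i j. G $ i $ j \<in> RF) \<and> (\<forall>i j. H $ i $ j \<in> RF) \<and> (\<forall>j. \<kappa> j \<in> RF) \<and>
     G ** H = IU \<and> H ** G = IU \<and> \<alpha> \<in> matrix_forms U \<and>
     (\<forall>v\<in>derivations U. \<forall>i j. v (G $ i $ j) + (form_value \<alpha> v ** G) $ i $ j = G $ i $ j * v (\<kappa> j))"

definition twists :: "('n::finite \<Rightarrow> 'm fn) \<Rightarrow> 'm operator \<Rightarrow> 'm fn^'n \<Rightarrow> 'm fn^'n" where
  "twists \<kappa> P y = (\<chi> j. twist (\<kappa> j) P (y $ j))"

text \<open>The action of the diagonal connection, transported from the coordinates
  \<open>H *v x\<close>. The default 0 is the one that \<open>connection_action\<close>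
  prescribes.\<close>

definition gauge_act :: "'m fn^'n^'n \<Rightarrow> 'm fn^'n^'n \<Rightarrow> ('n::finite \<Rightarrow> 'm fn) \<Rightarrow> 'm operator \<Rightarrow> 'm fn^'n \<Rightarrow> 'm fn^'n" where
  "gauge_act G H \<kappa> P x = (if P \<in> DO \<and> x \<in> RV then G *v twists \<kappa> P (H *v x) else 0)"

context
  fixes \<kappa> :: "'n::finite \<Rightarrow> 'm fn"
  assumes \<kappa>: "\<And>j. \<kappa> j \<in> RF"
begin

lemma twists_RV: "P \<in> DO \<Longrightarrow> y \<in> RV \<Longrightarrow> twists \<kappa> P y \<in> RV"
  by (simp add: twists_def twist_closed \<kappa>)

lemma twists_add: "P \<in> DO \<Longrightarrow> Q \<in> DO \<Longrightarrow> y \<in> RV \<Longrightarrow> twists \<kappa> (P + Q) y = twists \<kappa> P y + twists \<kappa> Q y"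
  by (simp add: twists_def vec_eq_iff twist_add \<kappa> del: plus_fun_apply)

lemma twists_add_arg: "P \<in> DO \<Longrightarrow> x \<in> RV \<Longrightarrow> y \<in> RV \<Longrightarrow> twists \<kappa> P (x + y) = twists \<kappa> P x + twists \<kappa> P y"
  by (simp add: twists_def vec_eq_iff twist_add_arg \<kappa> del: plus_fun_apply)

lemma twists_comp: "P \<in> DO \<Longrightarrow> Q \<in> DO \<Longrightarrow> y \<in> RV \<Longrightarrow> twists \<kappa> (P \<circ> Q) y = twists \<kappa> P (twists \<kappa> Q y)"
  by (simp add: twists_def vec_eq_iff twist_comp \<kappa>)

lemma twists_mult: "a \<in> RF \<Longrightarrow> y \<in> RV \<Longrightarrow> twists \<kappa> (multiplication U a) y = (\<chi> i. a * y $ i)"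
  by (simp add: twists_def vec_eq_iff twist_multiplication \<kappa> del: times_fun_apply)

lemma twists_der: "v \<in> derivations U \<Longrightarrow> y \<in> RV \<Longrightarrow> twists \<kappa> v y = (\<chi> i. v (y $ i) + v (\<kappa> i) * y $ i)"
  by (simp add: twists_def vec_eq_iff twist_der \<kappa> del: times_fun_apply plus_fun_apply)

end

lemma matrix_vector_scale: "A *v (\<chi> i. a * x $ i) = (\<chi> i. a * (A *v x) $ i)"
  for A :: "'r::comm_ring_1^'n^'k"
  by (simp add: matrix_vector_mult_def vec_eq_iff sum_distrib_left mult.left_commute)

text \<open>Transport of structure: H G = 1 makes compositions act correctly and G H = 1 makes
  functions act by multiplication. The columns of \<alpha> result from the gauge equation and the
  vanishing of v(G H).\<close>

lemma gauge_action:
  fixes \<alpha> :: "('m, 'n::finite) matrix_form"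
  assumes "gauge \<alpha> G H \<kappa>"
  shows "connection_action U \<alpha> (gauge_act G H \<kappa>)"
proof -
  have G: "\<And>i j. G $ i $ j \<in> RF" and H: "\<And>i j. H $ i $ j \<in> RF" and \<kappa>: "\<And>j. \<kappa> j \<in> RF"
    and GH: "G ** H = IU" and HG: "H ** G = IU" and \<alpha>: "\<alpha> \<in> matrix_forms U"
    and eq: "\<And>v i j. v \<in> derivations U \<Longrightarrow> v (G $ i $ j) + (form_value \<alpha> v ** G) $ i $ j = G $ i $ j * v (\<kappa> j)"
    using assms by (simp_all only: gauge_def)
  let ?act = "gauge_act G H \<kappa>"
  note twist_series = twists_RV[of \<kappa>, OF \<kappa>] twists_add[of \<kappa>, OF \<kappa>] twists_add_arg[of \<kappa>, OF \<kappa>] twists_comp[of \<kappa>, OF \<kappa>]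
  have act: "?act P x = G *v twists \<kappa> P (H *v x)" if "P \<in> DO" "x \<in> RV" for P x
    using that by (simp add: gauge_act_def)
  have act_RV: "?act P x \<in> RV" if "P \<in> DO" "x \<in> RV" for P x
    unfolding act[OF that] by (intro RV_mult[OF G] twist_series(1) RV_mult[OF H] that)
  have act_mult: "?act (multiplication U a) x = (\<chi> i. a * x $ i)" if a: "a \<in> RF" and x: "x \<in> RV" for a x
    unfolding act[OF differential_operators.mult[OF a] x] twists_mult[of \<kappa>, OF \<kappa> a RV_mult[OF H x]]
      matrix_vector_scale matrix_vector_mul_assoc GH IU_mult[OF x] ..
  have "left_module (diff_op_ring U) (free_module U ?act)"
  proof (rule left_module_freeI)
    fix P Q and x y :: "'m fn^'n"
    assume P: "P \<in> DO" and x: "x \<in> RV"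
    show "?act P x \<in> RV" by (rule act_RV[OF P x])
    note Hx = RV_mult[OF H x]
    { assume y: "y \<in> RV"
      show "?act P (x + y) = ?act P x + ?act P y"
        unfolding act[OF P x] act[OF P y] act[OF P RV_add[OF x y]] matrix_vector_right_distrib
          twist_series(3)[OF P Hx RV_mult[OF H y]] .. }
    assume Q: "Q \<in> DO"
    show "?act (P + Q) x = ?act P x + ?act Q x"
      unfolding act[OF P x] act[OF Q x] act[OF differential_operators.add[OF P Q] x] twist_series(2)[OF P Q Hx]
        matrix_vector_right_distrib ..
    have "?act P (?act Q x) = G *v twists \<kappa> P (H *v (G *v twists \<kappa> Q (H *v x)))"
      using act[OF P act_RV[OF Q x]] by (simp only: act[OF Q x])
    also have "H *v (G *v twists \<kappa> Q (H *v x)) = twists \<kappa> Q (H *v x)"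
      unfolding matrix_vector_mul_assoc HG by (rule IU_mult[OF twist_series(1)[OF Q Hx]])
    finally show "?act (P \<circ> Q) x = ?act P (?act Q x)"
      unfolding act[OF differential_operators.comp[OF P Q] x] twist_series(4)[OF P Q Hx] ..
  next
    fix x :: "'m fn^'n" assume x: "x \<in> RV"
    show "?act (multiplication U (on_set U (\<lambda>_. 1))) x = x"
      unfolding act_mult[OF reg_const x] using x by (simp add: vec_eq_iff unit_mult del: times_fun_apply)
  qed
  moreover have "?act v (basis_vector U j) = column j (form_value \<alpha> v)" if v: "v \<in> derivations U" for v j
  proof -
    have "H *v basis_vector U j = column j H"
    proof -
      have "(\<Sum>k\<in>UNIV. H $ i $ k * basis_vector U j $ k) = H $ i $ j" for i
      proof -
        have "(\<Sum>k\<in>UNIV. H $ i $ k * basis_vector U j $ k) = (\<Sum>k\<in>UNIV. if k = j then H $ i $ k else 0)"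
          using H by (intro sum.cong)
            (auto simp: basis_vector_def mult.commute[of _ "on_set U _"] unit_mult simp del: times_fun_apply)
        then show ?thesis by simp
      qed
      then show ?thesis by (simp add: vec_eq_iff matrix_vector_mult_def column_def)
    qed
    then have 1: "?act v (basis_vector U j) = G *v (\<chi> k. v (H $ k $ j) + v (\<kappa> k) * H $ k $ j)"
      using twists_der[of \<kappa>, OF \<kappa> v RV_mult[OF H basis_vector_RV[of j]]]
      unfolding act[OF differential_operators.deriv[OF v] basis_vector_RV]
      by (simp add: column_def del: times_fun_apply plus_fun_apply)
    have \<alpha>RF: "form_value \<alpha> v $ i $ j \<in> RF" for i j
      using form_closed \<alpha> by (simp add: form_value_def matrix_forms_def)
    have "(G *v (\<chi> k. v (H $ k $ j) + v (\<kappa> k) * H $ k $ j)) $ i = form_value \<alpha> v $ i $ j" for i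
    proof -
      have "(G *v (\<chi> k. v (H $ k $ j) + v (\<kappa> k) * H $ k $ j)) $ i =
          (\<Sum>k\<in>UNIV. G $ i $ k * v (H $ k $ j) + G $ i $ k * v (\<kappa> k) * H $ k $ j)"
        by (simp add: matrix_vector_mult_def distrib_left mult.assoc del: times_fun_apply plus_fun_apply)
      \<comment> \<open>The gauge equation replaces G v(\<kappa>) by v(G) + \<alpha>(v) G. The first
        two summands are then the derivative of the constant G H, and the last one is \<alpha>(v) G
        H.\<close>
      also have "\<dots> = (\<Sum>k\<in>UNIV. (G $ i $ k * v (H $ k $ j) + v (G $ i $ k) * H $ k $ j) + (form_value \<alpha> v ** G) $ i $ k * H $ k $ j)"
        unfolding eq[OF v, symmetric] by (intro sum.cong) (simp_all add: distrib_right add.assoc del: times_fun_apply plus_fun_apply)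
      also have "\<dots> = (\<Sum>k\<in>UNIV. v (G $ i $ k * H $ k $ j)) + (\<Sum>k\<in>UNIV. (form_value \<alpha> v ** G) $ i $ k * H $ k $ j)"
        unfolding sum.distrib[symmetric] by (simp only: der_mult[OF v G H])
      also have "(\<Sum>k\<in>UNIV. (form_value \<alpha> v ** G) $ i $ k * H $ k $ j) = (form_value \<alpha> v ** (G ** H)) $ i $ j"
        unfolding matrix_mul_assoc by (simp add: matrix_matrix_mult_def[of _ H] del: times_fun_apply)
      also have "\<dots> = (\<Sum>k\<in>UNIV. if k = j then form_value \<alpha> v $ i $ k else 0)"
        unfolding GH unfolding matrix_matrix_mult_def IU_def vec_lambda_beta
        by (intro sum.cong refl) (simp add: \<alpha>RF mult.commute[of _ "on_set U _"] unit_mult del: times_fun_apply)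
      also have "(\<Sum>k\<in>UNIV. v (G $ i $ k * H $ k $ j)) = v (\<Sum>k\<in>UNIV. G $ i $ k * H $ k $ j)"
        by (rule DO_sum[OF differential_operators.deriv[OF v], symmetric]) (intro rf_mult G H)
      also have "(\<Sum>k\<in>UNIV. G $ i $ k * H $ k $ j) = (G ** H) $ i $ j"
        by (simp add: matrix_matrix_mult_def del: times_fun_apply)
      also have "v ((G ** H) $ i $ j) = 0"
        unfolding GH using der_const[OF v, of 1] der_0[OF v] by (simp add: IU_def del: zero_fun_apply)
      finally show ?thesis by (simp del: times_fun_apply plus_fun_apply zero_fun_apply)
    qed
    then show ?thesis unfolding 1 vec_eq_iff column_def vec_lambda_beta by blast
  qed
  ultimately show ?thesis
    unfolding connection_action_def
    using act_mult by (auto simp: free_module_def diff_op_ring_def gauge_act_def)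
qed

lemma connection_module_gauge:
  assumes "gauge \<alpha> G H \<kappa>"
  shows "connection_module U \<alpha> = free_module U (gauge_act G H \<kappa>)"
proof -
  have "(THE act. connection_action U \<alpha> act) = gauge_act G H \<kappa>"
    using gauge_action[OF assms] connection_action_unique by blast
  then show ?thesis by (simp add: connection_module_def)
qed

end

section \<open>The gauge of a representation in normal form\<close>

lemma ev_commute: "A * N = N * A \<Longrightarrow> A * ev K N f = ev K N f * A"
proof -
  assume *: "A * N = N * A"
  have "A * N ^ k = N ^ k * A" for k
    by (induction k) (simp_all add: mult.assoc, metis * mult.assoc)
  then have "A * (sc c * N ^ k) = sc c * N ^ k * A" for k c
    by (simp add: mult.assoc sc_left_commute)
  then show ?thesis by (simp add: ev_def sum_distrib_left sum_distrib_right)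
qed

text \<open>A nonzero entry of the k-th power at (i, j) forces r i + k \<le> r j, and r is
  bounded.\<close>

lemma strictly_triangular_nilp:
  fixes A :: "'n::finite cmat" and r :: "'n \<Rightarrow> nat"
  assumes "\<And>i j. vec_of A $ i $ j \<noteq> 0 \<Longrightarrow> r i < r j"
  shows "nilp A"
proof -
  have pow: "vec_of (A ^ k) $ i $ j \<noteq> 0 \<Longrightarrow> r i + k \<le> r j" for k i j
  proof (induction k arbitrary: i)
    case (Suc k)
    then have "(\<Sum>l\<in>UNIV. vec_of A $ i $ l * vec_of (A ^ k) $ l $ j) \<noteq> 0"
      by (simp add: matrix_matrix_mult_def)
    then obtain l where "vec_of A $ i $ l \<noteq> 0" "vec_of (A ^ k) $ l $ j \<noteq> 0"
      by (metis (no_types, lifting) mult_eq_0_iff sum.neutral)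
    then show ?case using assms[of i l] Suc.IH[of l] by linarith
  qed (auto simp: mat_def split: if_splits)
  have "A ^ Suc (Max (range r)) = 0"
  proof (rule cmat_eqI, unfold vec_of_simps(1) vec_eq_iff, intro allI)
    fix i j
    have "r j \<le> Max (range r)" by (rule Max_ge) auto
    then have "\<not> r i + Suc (Max (range r)) \<le> r j" by linarith
    then have "vec_of (A ^ Suc (Max (range r))) $ i $ j = 0" using pow by blast
    then show "vec_of (A ^ Suc (Max (range r))) $ i $ j = (0 :: complex^'n^'n) $ i $ j"
      by (simp only: zero_index)
  qed
  then show ?thesis unfolding nilp_iff by blast
qed

text \<open>The function \<open>r\<close> orders the basis: the representation is upper triangular with respect to it.\<close>

definition normal_form :: "('a \<Rightarrow> complex^'n^'n) \<Rightarrow> complex^'n^'n \<Rightarrow> ('n::finite \<Rightarrow> 'a \<Rightarrow> complex) \<Rightarrow> ('n \<Rightarrow> nat) \<Rightarrow> bool" where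
  "normal_form \<rho> S w r \<longleftrightarrow> invertible S \<and>
     (\<forall>x i. (matrix_inv S ** \<rho> x ** S) $ i $ i = w i x) \<and>
     (\<forall>x i j. i \<noteq> j \<longrightarrow> (matrix_inv S ** \<rho> x ** S) $ i $ j \<noteq> 0 \<longrightarrow> r i < r j \<and> w i = w j)"

context lie_setting
begin

definition logs :: "('n \<Rightarrow> 'a \<Rightarrow> complex) \<Rightarrow> 'n \<Rightarrow> 'm fn" where
  "logs w j = on_set U (\<lambda>g. w j (lie_log g))"

text \<open>In the basis S the representation is a diagonal part D plus a strictly triangular part
  \<eta>. Since nonzero entries connect equal weights only, D commutes with everything, and \<eta>
  is a nilpotent representation. Then G = S exp(- \<eta>(log g)) satisfies dG + \<rho> G = G D, and
  the entries of D have the primitives \<open>logs w\<close>.\<close>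

lemma normal_form_gauge:
  fixes \<rho> :: "'a \<Rightarrow> complex^'n::finite^'n"
  assumes \<rho>: "\<rho> \<in> lie_homs smul bracket" and nf: "normal_form \<rho> S w r"
  shows "\<forall>j. character (w j)" and "\<exists>G H. gauge (rep_form smul B U \<theta> \<rho>) G H (logs w)"
proof -
  have S: "invertible S" using nf by (simp add: normal_form_def)
  define Mm where "Mm x = mat_of (matrix_inv S) * mat_of (\<rho> x) * mat_of S" for x
  define Dm where "Dm x = mat_of (\<chi> i j. if i = j then w i x else 0)" for x
  have SS: "mat_of S * mat_of (matrix_inv S) = 1" "mat_of (matrix_inv S) * mat_of S = 1"
    by (rule cmat_eqI, simp add: matrix_inv_mult[OF S])+
  have SS': "mat_of S * (mat_of (matrix_inv S) * A) = A" for A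
    by (simp add: SS flip: mult.assoc)
  have diag: "vec_of (Mm x) $ i $ i = w i x" for x i
    using nf by (simp add: normal_form_def Mm_def)
  have off: "r i < r j \<and> w i = w j" if "i \<noteq> j" "vec_of (Mm x) $ i $ j \<noteq> 0" for x i j
    using nf that by (simp add: normal_form_def Mm_def)
  have \<rho>_add: "mat_of (\<rho> (x + y)) = mat_of (\<rho> x) + mat_of (\<rho> y)" for x y
    by (rule cmat_eqI) (use \<rho> in \<open>simp add: lie_homs_def\<close>)
  have \<rho>_smul: "mat_of (\<rho> (smul c x)) = sc c * mat_of (\<rho> x)" for c x
    by (rule cmat_eqI) (use \<rho> in \<open>simp add: lie_homs_def vec_of_sc_mult del: vec_of_simps(6)\<close>)
  have \<rho>_bracket: "mat_of (\<rho> (bracket x y)) = mat_of (\<rho> x) * mat_of (\<rho> y) - mat_of (\<rho> y) * mat_of (\<rho> x)" for x y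
    by (rule cmat_eqI) (use \<rho> in \<open>simp add: lie_homs_def\<close>)
  have M_add: "Mm (x + y) = Mm x + Mm y" for x y
    by (simp add: Mm_def \<rho>_add distrib_left distrib_right)
  have M_smul: "Mm (smul c x) = sc c * Mm x" for c x
    by (simp add: Mm_def \<rho>_smul sc_left_commute mult.assoc)
  have M_bracket: "Mm (bracket x y) = Mm x * Mm y - Mm y * Mm x" for x y
    by (simp add: Mm_def \<rho>_bracket left_diff_distrib right_diff_distrib mult.assoc SS')
  have char: "character (w j)" for j
    unfolding character_def additive_functional_def
  proof (intro conjI allI)
    show "w j (x + y) = w j x + w j y" for x y by (simp flip: diag add: M_add)
    show "w j (smul c x) = c * w j x" for c x
      by (simp flip: diag add: M_smul vec_of_sc_mult del: vec_of_simps(6))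
    fix x y
    \<comment> \<open>A contribution of an index k \<noteq> j would require both r j < r k and r k <
      r j.\<close>
    have prod: "vec_of (Mm x * Mm y) $ j $ j = w j x * w j y" for x y
    proof -
      have "vec_of (Mm x) $ j $ k * vec_of (Mm y) $ k $ j = 0" if "k \<noteq> j" for k
        using off[of j k x] off[of k j y] that by fastforce
      then have "(\<Sum>k\<in>UNIV. vec_of (Mm x) $ j $ k * vec_of (Mm y) $ k $ j) =
          (\<Sum>k\<in>UNIV. if k = j then w j x * w j y else 0)"
        by (intro sum.cong) (auto simp: diag)
      then show ?thesis by (simp add: matrix_matrix_mult_def)
    qed
    have "w j (bracket x y) = vec_of (Mm x * Mm y - Mm y * Mm x) $ j $ j"
      by (simp only: M_bracket[symmetric] diag)
    also have "\<dots> = w j x * w j y - w j y * w j x"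
      using prod[of x y] prod[of y x] by simp
    finally show "w j (bracket x y) = 0" by simp
  qed
  then show "\<forall>j. character (w j)" ..
  \<comment> \<open>At a nonzero entry (i, j) the weights i and j coincide.\<close>
  have D_commute: "Dm x * Mm y = Mm y * Dm x" for x y
  proof (rule cmat_eqI, unfold vec_eq_iff, intro allI)
    fix i j
    have "vec_of (Dm x * Mm y) $ i $ j = (\<Sum>k\<in>UNIV. if k = i then w i x * vec_of (Mm y) $ i $ j else 0)"
      unfolding Dm_def by (simp add: matrix_matrix_mult_def if_distrib[of "\<lambda>c. c * _"] cong: if_cong) 
    moreover have "vec_of (Mm y * Dm x) $ i $ j = (\<Sum>k\<in>UNIV. if k = j then vec_of (Mm y) $ i $ j * w j x else 0)"
      unfolding Dm_def by (simp add: matrix_matrix_mult_def if_distrib[of "\<lambda>c. _ * c"] cong: if_cong)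
    moreover have "w i x * vec_of (Mm y) $ i $ j = vec_of (Mm y) $ i $ j * w j x"
      using off[of i j y] by (cases "i = j \<or> vec_of (Mm y) $ i $ j = 0") (auto simp: mult.commute)
    ultimately show "vec_of (Dm x * Mm y) $ i $ j = vec_of (Mm y * Dm x) $ i $ j" by simp
  qed
  have DD: "Dm x * Dm y = Dm y * Dm x" for x y
  proof (rule cmat_eqI, unfold vec_eq_iff, intro allI)
    show "vec_of (Dm x * Dm y) $ i $ j = vec_of (Dm y * Dm x) $ i $ j" for i j
      unfolding Dm_def
      by (simp add: matrix_matrix_mult_def if_distrib[of "\<lambda>c. c * _"] if_distrib[of "\<lambda>c. _ * c"] cong: if_cong)
  qed
  define \<eta> where "\<eta> x = Mm x - Dm x" for x
  have nrep: "nilpotent_rep \<eta>"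
    unfolding nilpotent_rep_def
  proof (intro conjI allI)
    have c: "w i (x + y) = w i x + w i y" "w i (smul c x) = c * w i x" "w i (bracket x y) = 0" for i x y c
      using char[of i] by (simp_all add: character_def additive_functional_def)
    have "Dm (x + y) = Dm x + Dm y" for x y
      by (rule cmat_eqI) (simp add: Dm_def c vec_eq_iff)
    then show "\<eta> (x + y) = \<eta> x + \<eta> y" for x y by (simp add: \<eta>_def M_add)
    have "Dm (smul c x) = sc c * Dm x" for c x
      by (rule cmat_eqI) (simp add: Dm_def c vec_eq_iff vec_of_sc_mult del: vec_of_simps(6))
    then show "\<eta> (smul c x) = sc c * \<eta> x" for c x by (simp add: \<eta>_def M_smul right_diff_distrib)
    have "Dm (bracket x y) = 0" for x y
      by (rule cmat_eqI) (simp add: Dm_def c vec_eq_iff)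
    then show "\<eta> (bracket x y) = \<eta> x * \<eta> y - \<eta> y * \<eta> x" for x y
      by (simp add: \<eta>_def M_bracket left_diff_distrib right_diff_distrib DD[of y x] D_commute)
    show "nilp (\<eta> x)" for x
    proof (rule strictly_triangular_nilp)
      fix i j assume "vec_of (\<eta> x) $ i $ j \<noteq> 0"
      then show "r i < r j"
        using off[of i j x] diag[of x i] by (cases "i = j") (auto simp: \<eta>_def Dm_def)
    qed
  qed
  let ?W = "\<lambda>g. \<eta> (lie_log g)"
  define Gc where "Gc g = mat_of S * nexp (- ?W g)" for g
  define Hc where "Hc g = nexp (?W g) * mat_of (matrix_inv S)" for g
  have nilp: "nilp (\<eta> x)" for x using nrep by (simp add: nilpotent_rep_def)
  have regG: "regm Gc" and regH: "regm Hc"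
    unfolding Gc_def Hc_def by (intro regm_mult regm_const regm_nexp regm_uminus regm_rep_lie_log[OF nrep])+
  have GHc: "Gc g * Hc g = 1" "Hc g * Gc g = 1" for g
  proof -
    have "Gc g * Hc g = mat_of S * (nexp (- ?W g) * nexp (?W g)) * mat_of (matrix_inv S)"
      by (simp add: Gc_def Hc_def mult.assoc)
    then show "Gc g * Hc g = 1" by (simp add: nexp_minus nilp SS)
    have "Hc g * Gc g = nexp (?W g) * (mat_of (matrix_inv S) * mat_of S) * nexp (- ?W g)"
      by (simp add: Gc_def Hc_def mult.assoc)
    then show "Hc g * Gc g = 1" by (simp add: nexp_minus nilp SS)
  qed
  have dG: "dm (\<theta> x) Gc g + mat_of (\<rho> x) * Gc g = Gc g * Dm x" if g: "g \<in> U" for x g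
  proof -
    have "regm (\<lambda>g. nexp (- ?W g))"
      by (intro regm_nexp regm_uminus regm_rep_lie_log[OF nrep])
    then have "dm (\<theta> x) Gc g = mat_of S * (- \<eta> x * nexp (- ?W g))"
      unfolding Gc_def dm_nexp_uminus_rep[OF nrep g, symmetric] by (rule dm_const_mult[OF theta_der _ g])
    moreover have "mat_of (\<rho> x) * Gc g = mat_of S * (Mm x * nexp (- ?W g))"
      by (simp add: Gc_def Mm_def mult.assoc SS')
    moreover have "Dm x * nexp (- ?W g) = nexp (- ?W g) * Dm x"
      unfolding nexp_def by (rule ev_commute) (simp add: \<eta>_def left_diff_distrib right_diff_distrib D_commute DD)
    ultimately have "dm (\<theta> x) Gc g + mat_of (\<rho> x) * Gc g = mat_of S * ((Mm x - \<eta> x) * nexp (- ?W g))"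
      by (simp add: left_diff_distrib right_diff_distrib)
    also have "Mm x - \<eta> x = Dm x" by (simp add: \<eta>_def)
    also have "mat_of S * (Dm x * nexp (- ?W g)) = Gc g * Dm x"
      by (simp add: Gc_def mult.assoc \<open>Dm x * nexp (- ?W g) = nexp (- ?W g) * Dm x\<close>)
    finally show ?thesis .
  qed
  define G where "G = (\<chi> i j. on_set U (\<lambda>g. vec_of (Gc g) $ i $ j))"
  define H where "H = (\<chi> i j. on_set U (\<lambda>g. vec_of (Hc g) $ i $ j))"
  let ?\<alpha> = "rep_form smul B U \<theta> \<rho>"
  have val: "(?\<alpha> $ i $ j) (\<theta> x) = on_set U (\<lambda>_. \<rho> x $ i $ j)" for i j x
    using rep_form_value[OF \<rho>] by (simp add: invariant_value_def)
  have \<alpha>: "?\<alpha> \<in> matrix_forms U" by (rule rep_form_invariant_flat(1)[OF \<rho>])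
  then have forms: "?\<alpha> $ i $ j \<in> one_forms U" for i j by (simp add: matrix_forms_def)
  have G: "G $ i $ j \<in> RF" and H: "H $ i $ j \<in> RF" for i j
    using regG regH by (simp_all add: G_def H_def regm_def)
  have logs: "logs w j \<in> RF" for j
    using char[of j] reg_functional_lie_log[of "w j"] by (simp add: logs_def character_def)
  have pointwise: "((\<chi> i j. on_set U (\<lambda>g. vec_of (A g) $ i $ j)) ** (\<chi> i j. on_set U (\<lambda>g. vec_of (A' g) $ i $ j))) = IU"
    if "\<And>g. A g * A' g = 1" for A A' :: "complex^'m^'m \<Rightarrow> 'n cmat"
  proof -
    have "(\<Sum>k\<in>UNIV. on_set U (\<lambda>g. vec_of (A g) $ i $ k) * on_set U (\<lambda>g. vec_of (A' g) $ k $ j)) =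
       (if i = j then on_set U (\<lambda>_. 1) else 0)" for i j
    proof
      fix u
      have "(vec_of (A u) ** vec_of (A' u)) $ i $ j = mat 1 $ i $ j"
        using that[of u] by (metis vec_of_simps(2,6))
      then have "(\<Sum>k\<in>UNIV. vec_of (A u) $ i $ k * vec_of (A' u) $ k $ j) = (if i = j then 1 else 0)"
        by (simp add: matrix_matrix_mult_def mat_def)
      then show "(\<Sum>k\<in>UNIV. on_set U (\<lambda>g. vec_of (A g) $ i $ k) * on_set U (\<lambda>g. vec_of (A' g) $ k $ j)) u =
         (if i = j then on_set U (\<lambda>_. 1) else 0) u"
        by (cases "u \<in> U") (simp_all add: sum_fun_apply)
    qed
    then show ?thesis
      unfolding matrix_matrix_mult_def IU_def by (simp add: vec_eq_iff del: times_fun_apply)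
  qed
  have eq: "v (G $ i $ j) + (form_value ?\<alpha> v ** G) $ i $ j = G $ i $ j * v (logs w j)"
    if v: "v \<in> derivations U" for v i j
  proof (rule rf_eqI)
    have fv: "form_value ?\<alpha> v $ i $ j \<in> RF" for i j
      using form_closed[OF forms] by (simp add: form_value_def)
    show "v (G $ i $ j) + (form_value ?\<alpha> v ** G) $ i $ j \<in> RF"
      unfolding matrix_matrix_mult_def vec_lambda_beta by (intro rf_add der_closed[OF v] G rf_sum rf_mult fv)
    show "G $ i $ j * v (logs w j) \<in> RF"
      by (intro rf_mult G der_closed[OF v] logs)
    fix g assume g: "g \<in> U"
    obtain x where x: "\<And>f. f \<in> RF \<Longrightarrow> v f g = \<theta> x f g" using theta_local[OF v g] by blast
    have fvg: "(form_value ?\<alpha> v $ i $ k) g = \<rho> x $ i $ k" for k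
      using form_local[OF forms v theta_der x, of i k] g by (simp add: form_value_def val)
    show "(v (G $ i $ j) + (form_value ?\<alpha> v ** G) $ i $ j) g = (G $ i $ j * v (logs w j)) g"
    proof -
      have "(form_value ?\<alpha> v ** G) $ i $ j = (\<Sum>k\<in>UNIV. form_value ?\<alpha> v $ i $ k * G $ k $ j)"
        by (simp add: matrix_matrix_mult_def del: times_fun_apply)
      then have "((form_value ?\<alpha> v ** G) $ i $ j) g = (\<Sum>k\<in>UNIV. \<rho> x $ i $ k * vec_of (Gc g) $ k $ j)"
        using g by (simp add: sum_fun_apply fvg G_def)
      also have "\<dots> = vec_of (mat_of (\<rho> x) * Gc g) $ i $ j"
        by (simp add: matrix_matrix_mult_def)
      finally have 1: "((form_value ?\<alpha> v ** G) $ i $ j) g = \<dots>" .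
      have 2: "v (G $ i $ j) g = vec_of (dm (\<theta> x) Gc g) $ i $ j"
        unfolding x[OF G] by (simp add: dm_def G_def)
      have "v (logs w j) g = w j x"
        unfolding x[OF logs] unfolding logs_def by (rule theta_character[OF char g])
      then have "(G $ i $ j * v (logs w j)) g = vec_of (Gc g) $ i $ j * w j x"
        using g by (simp add: G_def)
      also have "\<dots> = vec_of (Gc g * Dm x) $ i $ j"
        unfolding Dm_def by (simp add: matrix_matrix_mult_def if_distrib[of "\<lambda>c. _ * c"] cong: if_cong)
      also have "\<dots> = vec_of (dm (\<theta> x) Gc g + mat_of (\<rho> x) * Gc g) $ i $ j"
        unfolding dG[OF g] ..
      also have "\<dots> = v (G $ i $ j) g + ((form_value ?\<alpha> v ** G) $ i $ j) g"
        unfolding 1 2 by simp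
      finally show ?thesis by simp
    qed
  qed
  have "gauge ?\<alpha> G H (logs w)"
    unfolding gauge_def
    using G H logs \<alpha> eq pointwise[of Gc Hc, OF GHc(1)] pointwise[of Hc Gc, OF GHc(2)]
    by (simp only: G_def[symmetric] H_def[symmetric] simp_thms) blast
  then show "\<exists>G H. gauge ?\<alpha> G H (logs w)" by blast
qed

text \<open>In gauge coordinates both modules are sums of the same rank one modules up to order, so
  the isomorphism passes to these coordinates, permutes them and returns.\<close>

lemma iso_if_weights:
  fixes \<alpha> \<beta> :: "('m, 'n::finite) matrix_form"
  assumes g1: "gauge \<alpha> G H \<kappa>" and g2: "gauge \<beta> G' H' \<kappa>'" and \<sigma>: "bij \<sigma>" and eq: "\<And>i. \<kappa>' i = \<kappa> (\<sigma> i)"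
  shows "left_module_iso (diff_op_ring U) (connection_module U \<alpha>) (connection_module U \<beta>)"
proof -
  have G: "\<And>i j. G $ i $ j \<in> RF" and H: "\<And>i j. H $ i $ j \<in> RF" and \<kappa>: "\<And>j. \<kappa> j \<in> RF"
    and GH: "G ** H = IU" and HG: "H ** G = IU"
    using g1 by (simp_all only: gauge_def)
  have G': "\<And>i j. G' $ i $ j \<in> RF" and H': "\<And>i j. H' $ i $ j \<in> RF" and \<kappa>': "\<And>j. \<kappa>' j \<in> RF"
    and GH': "G' ** H' = IU" and HG': "H' ** G' = IU"
    using g2 by (simp_all only: gauge_def)
  define perm :: "('n \<Rightarrow> 'n) \<Rightarrow> 'm fn^'n \<Rightarrow> 'm fn^'n" where "perm p y = (\<chi> i. y $ p i)" for p y
  have perm_RV: "perm p y \<in> RV" if "y \<in> RV" for p y using that by (simp add: perm_def)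
  have perm_add: "perm p (x + y) = perm p x + perm p y" for p x y by (simp add: perm_def vec_eq_iff)
  define \<phi> where "\<phi> x = G' *v perm \<sigma> (H *v x)" for x
  define \<psi> where "\<psi> y = G *v perm (inv_into UNIV \<sigma>) (H' *v y)" for y
  have RV: "\<phi> x \<in> RV" "\<psi> x \<in> RV" if "x \<in> RV" for x
    unfolding \<phi>_def \<psi>_def by (intro RV_mult[OF G] RV_mult[OF G'] perm_RV RV_mult[OF H] RV_mult[OF H'] that)+
  have cancel: "G *v (H *v x) = x" "H *v (G *v x) = x" "G' *v (H' *v x) = x" "H' *v (G' *v x) = x" if "x \<in> RV" for x
    unfolding matrix_vector_mul_assoc GH HG GH' HG' by (rule IU_mult[OF that])+
  have inv: "perm (inv_into UNIV \<sigma>) (perm \<sigma> y) = y" "perm \<sigma> (perm (inv_into UNIV \<sigma>) y) = y" for y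
    using \<sigma> by (simp_all add: perm_def vec_eq_iff bij_inv_eq_iff bij_is_inj bij_is_surj surj_f_inv_f)
  have "bij_betw \<phi> RV RV"
  proof (rule bij_betw_byWitness[of _ \<psi>])
    show "\<forall>x\<in>RV. \<psi> (\<phi> x) = x"
      unfolding \<phi>_def \<psi>_def by (intro ballI) (simp only: cancel perm_RV RV_mult[OF H] inv)
    show "\<forall>x\<in>RV. \<phi> (\<psi> x) = x"
      unfolding \<phi>_def \<psi>_def by (intro ballI) (simp only: cancel perm_RV RV_mult[OF H'] inv)
  qed (use RV in blast)+
  moreover have "\<phi> (x + y) = \<phi> x + \<phi> y" for x y
    by (simp add: \<phi>_def perm_add matrix_vector_right_distrib)
  moreover have "\<phi> (gauge_act G H \<kappa> P x) = gauge_act G' H' \<kappa>' P (\<phi> x)" if P: "P \<in> DO" and x: "x \<in> RV" for P x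
  proof -
    have "\<phi> (gauge_act G H \<kappa> P x) = G' *v perm \<sigma> (twists \<kappa> P (H *v x))"
      unfolding gauge_act_def \<phi>_def using P x by (simp only: cancel twists_RV[of \<kappa>, OF \<kappa> P] RV_mult[OF H] simp_thms if_True)
    also have "perm \<sigma> (twists \<kappa> P (H *v x)) = twists \<kappa>' P (perm \<sigma> (H *v x))"
      by (simp add: perm_def twists_def eq)
    also have "G' *v \<dots> = gauge_act G' H' \<kappa>' P (\<phi> x)"
      using P x RV(1)[OF x] cancel(4)[OF perm_RV[OF RV_mult[OF H x]]]
      by (simp only: gauge_act_def simp_thms if_True) (simp only: \<phi>_def)
    finally show ?thesis .
  qed
  ultimately show ?thesis
    unfolding left_module_iso_def connection_module_gauge[OF g1] connection_module_gauge[OF g2]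
    by (intro exI[of _ \<phi>]) (simp add: free_module_def diff_op_ring_def)
qed

text \<open>In gauge coordinates an isomorphism is a matrix \<Psi> over C[U]. Comparison of the
  actions of \<theta> x makes the entry (i, j) an eigenfunction with eigenvalue w j x - w' i x, so
  by \<open>eigenfunction\<close> it vanishes unless the two characters agree. At the identity the
  matrix is invertible, and a nonzero term of its determinant selects a permutation along which all
  entries are nonzero.\<close>

lemma weights_if_iso:
  fixes \<alpha> \<beta> :: "('m, 'n::finite) matrix_form"
  assumes g1: "gauge \<alpha> G H (logs w)" and g2: "gauge \<beta> G' H' (logs w')"
    and w: "\<And>j. character (w j)" and w': "\<And>j. character (w' j)"
    and iso: "left_module_iso (diff_op_ring U) (connection_module U \<alpha>) (connection_module U \<beta>)"
  shows "\<exists>\<sigma>. bij \<sigma> \<and> (\<forall>i. w' i = w (\<sigma> i))"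
proof -
  have G: "\<And>i j. G $ i $ j \<in> RF" and H: "\<And>i j. H $ i $ j \<in> RF" and \<kappa>: "\<And>j. logs w j \<in> RF"
    and GH: "G ** H = IU" and HG: "H ** G = IU"
    using g1 by (simp_all only: gauge_def)
  have G': "\<And>i j. G' $ i $ j \<in> RF" and H': "\<And>i j. H' $ i $ j \<in> RF" and \<kappa>': "\<And>j. logs w' j \<in> RF"
    and GH': "G' ** H' = IU" and HG': "H' ** G' = IU"
    using g2 by (simp_all only: gauge_def)
  have cancel: "G *v (H *v x) = x" "H *v (G *v x) = x" "G' *v (H' *v x) = x" "H' *v (G' *v x) = x" if "x \<in> RV" for x
    unfolding matrix_vector_mul_assoc GH HG GH' HG' by (rule IU_mult[OF that])+
  obtain \<phi> where bij: "bij_betw \<phi> RV RV" and \<phi>_add: "\<And>x y. x \<in> RV \<Longrightarrow> y \<in> RV \<Longrightarrow> \<phi> (x + y) = \<phi> x + \<phi> y"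
    and \<phi>_act: "\<And>P x. P \<in> DO \<Longrightarrow> x \<in> RV \<Longrightarrow> \<phi> (gauge_act G H (logs w) P x) = gauge_act G' H' (logs w') P (\<phi> x)"
    using iso unfolding left_module_iso_def connection_module_gauge[OF g1] connection_module_gauge[OF g2]
    by (auto simp: free_module_def diff_op_ring_def)
  have \<phi>_RV: "\<phi> x \<in> RV" if "x \<in> RV" for x using bij that by (rule bij_betwE[THEN bspec])
  define \<psi> where "\<psi> y = H' *v \<phi> (G *v y)" for y
  have \<psi>_RV: "\<psi> y \<in> RV" if "y \<in> RV" for y
    unfolding \<psi>_def by (intro RV_mult[OF H'] \<phi>_RV RV_mult[OF G] that)
  have \<psi>_add: "\<psi> (x + y) = \<psi> x + \<psi> y" if "x \<in> RV" "y \<in> RV" for x y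
    unfolding \<psi>_def matrix_vector_right_distrib \<phi>_add[OF RV_mult[OF G that(1)] RV_mult[OF G that(2)]] ..
  have \<psi>_act: "\<psi> (twists (logs w) P y) = twists (logs w') P (\<psi> y)" if P: "P \<in> DO" and y: "y \<in> RV" for P y
  proof -
    note Gy = RV_mult[OF G y]
    have "gauge_act G H (logs w) P (G *v y) = G *v twists (logs w) P y"
      using P Gy by (simp only: gauge_act_def cancel[OF y] simp_thms if_True)
    then have "\<phi> (G *v twists (logs w) P y) = gauge_act G' H' (logs w') P (\<phi> (G *v y))"
      using \<phi>_act[OF P Gy] by (simp only:)
    also have "\<dots> = G' *v twists (logs w') P (\<psi> y)"
      using P \<phi>_RV[OF Gy] by (simp only: gauge_act_def simp_thms if_True) (simp only: \<psi>_def)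
    finally have "\<psi> (twists (logs w) P y) = H' *v (G' *v twists (logs w') P (\<psi> y))"
      unfolding \<psi>_def by (rule arg_cong)
    also have "\<dots> = twists (logs w') P (\<psi> y)"
      by (rule cancel(4)[OF twists_RV[of "logs w'", OF \<kappa>' P \<psi>_RV[OF y]]])
    finally show ?thesis .
  qed
  define e :: "'n \<Rightarrow> 'm fn^'n" where "e = basis_vector U"
  have e: "e j \<in> RV" for j unfolding e_def by (rule basis_vector_RV)
  define \<Psi> where "\<Psi> = (\<chi> i j. \<psi> (e j) $ i)"
  have \<Psi>: "\<Psi> $ i $ j \<in> RF" for i j using \<psi>_RV[OF e[of j]] by (simp add: \<Psi>_def)
  \<comment> \<open>Multiplications by functions belong to D(U), so \<psi> is linear over C[U] and
    is given by a matrix.\<close>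
  have scale: "\<psi> (\<chi> i. a * y $ i) = (\<chi> i. a * \<psi> y $ i)" if a: "a \<in> RF" and y: "y \<in> RV" for a y
    using \<psi>_act[OF differential_operators.mult[OF a] y]
    unfolding twists_mult[of "logs w", OF \<kappa> a y] twists_mult[of "logs w'", OF \<kappa>' a \<psi>_RV[OF y]] .
  have zero: "\<psi> 0 = 0"
    using \<psi>_add[of 0 0] by (simp add: rf_0 del: zero_fun_apply)
  have expand: "\<psi> y $ i = (\<Sum>j\<in>UNIV. y $ j * \<Psi> $ i $ j)" if y: "y \<in> RV" for y i
  proof -
    have yj: "y $ j \<in> RF" for j using y by simp
    have term_RV: "(\<chi> i. y $ j * e j $ i) \<in> RV" for j
      using e[of j] yj by (simp add: rf_mult del: times_fun_apply)
    have "\<psi> (\<Sum>j\<in>J. \<chi> i. y $ j * e j $ i) = (\<Sum>j\<in>J. \<psi> (\<chi> i. y $ j * e j $ i))" for J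
    proof (induction J rule: infinite_finite_induct)
      case (insert j J)
      have "(\<Sum>j\<in>J. \<chi> i. y $ j * e j $ i) \<in> RV"
        using term_RV by (auto simp: rf_sum simp del: times_fun_apply)
      then show ?case using insert \<psi>_add[OF term_RV] by (simp del: times_fun_apply plus_fun_apply)
    qed (simp_all add: zero)
    then have "\<psi> y = (\<Sum>j\<in>UNIV. \<psi> (\<chi> i. y $ j * e j $ i))"
      using basis_vector_decompose[OF y] unfolding e_def by metis
    then show ?thesis
      unfolding scale[OF yj e] by (simp add: \<Psi>_def del: times_fun_apply)
  qed
  have nonzero: "w j = w' i" if nz: "\<Psi> $ i $ j \<noteq> 0" for i j
  proof
    fix x
    have "\<theta> x (\<Psi> $ i $ j) u = (w j x - w' i x) * (\<Psi> $ i $ j) u" if u: "u \<in> U" for x u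
    proof -
      let ?c = "on_set U (\<lambda>_. w j x)"
      have th: "\<theta> x (logs v k) = on_set U (\<lambda>_. v k x)" if "\<And>j. character (v j)" "logs v k \<in> RF" for v :: "'n \<Rightarrow> 'a \<Rightarrow> complex" and k
        by (rule rf_eqI[OF der_closed[OF theta_der that(2)] reg_const]) (simp add: logs_def theta_character[OF that(1)])
      have "twists (logs w) (\<theta> x) (e j) = (\<chi> i. ?c * e j $ i)"
        unfolding twists_der[of "logs w", OF \<kappa> theta_der e]
        using der_const[OF theta_der, of x 1] der_0[OF theta_der, of x]
        by (simp add: vec_eq_iff e_def basis_vector_def th[OF w \<kappa>] del: times_fun_apply plus_fun_apply zero_fun_apply)
      then have "(\<chi> i. ?c * \<psi> (e j) $ i) = twists (logs w') (\<theta> x) (\<psi> (e j))"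
        using \<psi>_act[OF differential_operators.deriv[OF theta_der] e, of x j] scale[OF reg_const e] by (simp only:)
      then have "?c * \<Psi> $ i $ j = \<theta> x (\<Psi> $ i $ j) + on_set U (\<lambda>_. w' i x) * \<Psi> $ i $ j"
        unfolding twists_der[of "logs w'", OF \<kappa>' theta_der \<psi>_RV[OF e]] th[OF w' \<kappa>'] \<Psi>_def vec_eq_iff vec_lambda_beta by blast
      from fun_cong[OF this, of u] show ?thesis using u by (simp add: algebra_simps)
    qed
    moreover have "additive_functional (\<lambda>x. w j x - w' i x)"
      using w[of j] w'[of i] by (simp add: character_def additive_functional_def algebra_simps)
    ultimately have "w j x - w' i x = 0" by (intro eigenfunction[OF \<Psi> _ _ nz])
    then show "w j x = w' i x" by simp
  qed
  \<comment> \<open>Surjectivity provides a right inverse of \<Psi> over C[U], which can be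
    evaluated at the identity.\<close>
  have "\<forall>k. \<exists>y. y \<in> RV \<and> \<psi> y = e k"
  proof
    fix k
    have "G' *v e k \<in> RV" by (rule RV_mult[OF G' e])
    then have "G' *v e k \<in> \<phi> ` RV"
      using bij_betw_imp_surj_on[OF bij] by (simp only:)
    then obtain x where x: "x \<in> RV" "\<phi> x = G' *v e k"
      by (elim imageE) (erule (1) that[OF _ sym])
    have "\<psi> (H *v x) = e k"
      unfolding \<psi>_def by (simp only: cancel x e)
    then show "\<exists>y. y \<in> RV \<and> \<psi> y = e k" using RV_mult[OF H x(1)] by blast
  qed
  from choice[OF this] obtain y where "\<forall>k. y k \<in> RV \<and> \<psi> (y k) = e k" by (rule exE)
  then have y: "y k \<in> RV" "\<psi> (y k) = e k" for k by blast+
  define A where "A = (\<chi> i j. (\<Psi> $ i $ j) (mat 1))"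
  have "A ** (\<chi> j k. (y k $ j) (mat 1)) = mat 1"
  proof -
    have "(\<Sum>j\<in>UNIV. (\<Psi> $ i $ j) (mat 1) * (y k $ j) (mat 1)) = (if i = k then 1 else 0)" for i k
    proof -
      have "(\<psi> (y k) $ i) (mat 1) = (e k $ i) (mat 1)" by (simp only: y)
      then show ?thesis
        unfolding expand[OF y(1)] e_def basis_vector_def by (simp add: sum_fun_apply mult.commute one_in split: if_splits)
    qed
    then show ?thesis by (simp add: A_def matrix_matrix_mult_def mat_def vec_eq_iff)
  qed
  then have "det A \<noteq> 0"
    by (metis det_I det_mul mult_zero_left zero_neq_one)
  then obtain p where p: "p permutes (UNIV :: 'n set)" "(\<Prod>i\<in>UNIV. A $ i $ p i) \<noteq> 0"
    unfolding det_def by (metis (no_types, lifting) mem_Collect_eq mult_zero_right sum.neutral)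
  have "w' i = w (p i)" for i
  proof -
    have "A $ i $ p i \<noteq> 0" using p(2) by auto
    then have "\<Psi> $ i $ p i \<noteq> 0" by (auto simp: A_def)
    then show ?thesis using nonzero by simp
  qed
  then show ?thesis using permutes_bij[OF p(1)] by blast
qed

end

section \<open>Normal form of a representation\<close>

context nilpotent_lie_algebra
begin

lemma lower_central_bracket: "y \<in> lower_central k \<Longrightarrow> bracket x y \<in> lower_central (Suc k)"
  by (auto intro: span_base)

context
  fixes \<rho> :: "'a \<Rightarrow> complex^'n::finite^'n"
  assumes \<rho>: "\<rho> \<in> lie_homs smul bracket"
begin

lemma rho_0: "\<rho> 0 = 0"
proof -
  have "\<rho> (0 + 0) = \<rho> 0 + \<rho> 0" using \<rho> unfolding lie_homs_def by blast
  then show ?thesis by simp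
qed

lemma rho_bracket: "\<rho> (bracket x y) *v v = \<rho> x *v (\<rho> y *v v) - \<rho> y *v (\<rho> x *v v)"
proof -
  have "\<rho> (bracket x y) = \<rho> x ** \<rho> y - \<rho> y ** \<rho> x" using \<rho> unfolding lie_homs_def by blast
  then show ?thesis by (simp add: matrix_vector_mul_assoc matrix_vector_mult_diff_rdistrib)
qed

definition T :: "'a \<Rightarrow> complex \<Rightarrow> complex^'n \<Rightarrow> complex^'n" where
  "T x a v = \<rho> x *v v - a *s v"

lemma T_diff: "T x a (u - v) = T x a u - T x a v"
  and T_add: "T x a (u + v) = T x a u + T x a v"
  and T_scale: "T x a (c *s v) = c *s T x a v"
  by (simp_all add: T_def matrix_vector_mult_diff_distrib matrix_vector_right_distrib
      vec.scale_right_diff_distrib vec.scale_right_distrib vector_scalar_commute mult.commute)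

lemma T_linear: "Vector_Spaces.linear (*s) (*s) (T x a)"
  by unfold_locales (simp_all add: T_add T_scale)

lemma Tk_diff: "(T x a ^^ k) (u - v) = (T x a ^^ k) u - (T x a ^^ k) v"
  and Tk_add: "(T x a ^^ k) (u + v) = (T x a ^^ k) u + (T x a ^^ k) v"
  and Tk_scale: "(T x a ^^ k) (c *s v) = c *s (T x a ^^ k) v"
  by (induction k) (simp_all add: T_diff T_add T_scale)

lemma Tk_0: "(T x a ^^ k) 0 = 0"
  using Tk_diff[of k x a 0 0] by simp

lemma Tk_linear: "Vector_Spaces.linear (*s) (*s) (T x a ^^ k)"
  by unfold_locales (simp_all add: Tk_add Tk_scale)

lemma T_rho: "T x a (\<rho> y *v v) = \<rho> y *v (T x a v) + \<rho> (bracket x y) *v v"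
  by (simp add: T_def rho_bracket matrix_vector_mult_diff_distrib vector_scalar_commute)

section \<open>Invariant subspaces and the Fitting decomposition\<close>

definition inv_sub :: "(complex^'n) set \<Rightarrow> bool" where
  "inv_sub W \<longleftrightarrow> vec.subspace W \<and> (\<forall>x. \<forall>v\<in>W. \<rho> x *v v \<in> W)"

lemma inv_subD:
  assumes "inv_sub W"
  shows "0 \<in> W" "u \<in> W \<Longrightarrow> v \<in> W \<Longrightarrow> u + v \<in> W" "u \<in> W \<Longrightarrow> v \<in> W \<Longrightarrow> u - v \<in> W" "u \<in> W \<Longrightarrow> c *s u \<in> W"
    "u \<in> W \<Longrightarrow> \<rho> x *v u \<in> W" "vec.subspace W"
  using assms by (simp_all add: inv_sub_def vec.subspace_0 vec.subspace_add vec.subspace_diff vec.subspace_scale)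

lemma T_in: "inv_sub W \<Longrightarrow> u \<in> W \<Longrightarrow> T x a u \<in> W"
  by (simp add: T_def inv_subD)

lemma Tk_in: "inv_sub W \<Longrightarrow> u \<in> W \<Longrightarrow> (T x a ^^ k) u \<in> W"
  by (induction k) (simp_all add: T_in)

text \<open>Write T for \<rho> x - a. Moving T past \<rho> y leaves an error \<rho> [x, y]. Each of
  the p + j factors is spent either on v, which T^p kills, or on a bracket that takes y one step
  down the lower central series, which ends after j steps.\<close>

lemma kernel_invariant:
  assumes K: "lower_central K = {0}" and "y \<in> lower_central (K - j)" "(T x a ^^ p) v = 0" "j \<le> K"
  shows "(T x a ^^ (p + j)) (\<rho> y *v v) = 0"
  using assms(2-4)
proof (induction "p + j" arbitrary: p j y v)
  case 0
  then show ?case by simp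
next
  case (Suc q)
  have 1: "(T x a ^^ q) (\<rho> y *v T x a v) = 0"
  proof (cases p)
    case 0
    then show ?thesis using Suc.prems(2) by (simp add: T_def Tk_0)
  next
    case (Suc p')
    then have "(T x a ^^ p') (T x a v) = 0" using Suc.prems(2) by (simp add: funpow_swap1)
    then show ?thesis using Suc.hyps(1)[of p' j y "T x a v"] Suc.hyps(2) Suc.prems \<open>p = Suc p'\<close> by simp
  qed
  have 2: "(T x a ^^ q) (\<rho> (bracket x y) *v v) = 0"
  proof (cases j)
    case 0
    then have "y = 0" using Suc.prems(1) K by simp
    then have "bracket x y = 0" using bracket_scale_right[of x 0 0] by simp
    then show ?thesis by (simp add: rho_0 Tk_0)
  next
    case (Suc j')
    then have "Suc (K - j) = K - j'" using Suc.prems(3) by simp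
    then have "bracket x y \<in> lower_central (K - j')"
      using lower_central_bracket[OF Suc.prems(1), of x] by simp
    then show ?thesis using Suc.hyps(1)[of p j' "bracket x y" v] Suc.hyps(2) Suc.prems \<open>j = Suc j'\<close> by simp
  qed
  have "(T x a ^^ Suc q) (\<rho> y *v v) = (T x a ^^ q) (T x a (\<rho> y *v v))"
    by (simp only: funpow_Suc_right o_apply)
  also have "\<dots> = 0" by (simp add: T_rho Tk_add 1 2)
  finally show ?case using Suc.hyps(2) by simp
qed

text \<open>The same count as for the kernel, with the factors moved to the left of \<rho> y: of p +
  j factors, at most j are consumed by brackets, and p remain outside.\<close>

lemma image_invariant:
  assumes K: "lower_central K = {0}" and W: "inv_sub W" and "y \<in> lower_central (K - j)" "u \<in> W" "j \<le> K"
  shows "\<rho> y *v ((T x a ^^ (p + j)) u) \<in> (T x a ^^ p) ` W"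
  using assms(3-5)
proof (induction "p + j" arbitrary: p j y)
  case 0
  then show ?case using inv_subD(5)[OF W] by simp
next
  case (Suc q)
  let ?u = "(T x a ^^ q) u"
  have sub: "vec.subspace ((T x a ^^ p) ` W)"
    using vec.linear_subspace_image[OF Tk_linear inv_subD(6)[OF W]] .
  have 1: "T x a (\<rho> y *v ?u) \<in> (T x a ^^ p) ` W"
  proof (cases p)
    case 0
    then show ?thesis by (simp add: T_in W inv_subD(5)[OF W] Tk_in Suc.prems(2))
  next
    case (Suc p')
    then have "\<rho> y *v ?u \<in> (T x a ^^ p') ` W"
      using Suc.hyps(1)[of p' j y] Suc.hyps(2) Suc.prems by simp
    then show ?thesis using Suc by auto
  qed
  have 2: "\<rho> (bracket x y) *v ?u \<in> (T x a ^^ p) ` W"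
  proof (cases j)
    case 0
    then have "y = 0" using Suc.prems(1) K by simp
    then have "bracket x y = 0" using bracket_scale_right[of x 0 0] by simp
    then show ?thesis using vec.subspace_0[OF sub] by (simp add: rho_0)
  next
    case (Suc j')
    then have "Suc (K - j) = K - j'" using Suc.prems(3) by simp
    then have "bracket x y \<in> lower_central (K - j')"
      using lower_central_bracket[OF Suc.prems(1), of x] by simp
    then show ?thesis using Suc.hyps(1)[of p j' "bracket x y"] Suc.hyps(2) Suc.prems \<open>j = Suc j'\<close> by simp
  qed
  have "\<rho> y *v ((T x a ^^ Suc q) u) = T x a (\<rho> y *v ?u) - \<rho> (bracket x y) *v ?u"
    by (simp add: T_rho)
  then show ?case using vec.subspace_diff[OF sub 1 2] Suc.hyps(2) by simp
qed

definition gen_eigenspace :: "'a \<Rightarrow> complex \<Rightarrow> (complex^'n) set \<Rightarrow> (complex^'n) set" where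
  "gen_eigenspace x a W = {w \<in> W. \<exists>p. (T x a ^^ p) w = 0}"

lemma Tk_mono: "(T x a ^^ p) w = 0 \<Longrightarrow> p \<le> q \<Longrightarrow> (T x a ^^ q) w = 0"
  by (metis Tk_0 funpow_add le_add_diff_inverse2 o_apply)

lemma gen_eigenspace_invariant:
  assumes W: "inv_sub W"
  shows "inv_sub (gen_eigenspace x a W)"
  unfolding inv_sub_def vec.subspace_def
proof (intro conjI ballI allI)
  show "0 \<in> gen_eigenspace x a W"
    using inv_subD(1)[OF W] Tk_0 by (auto simp: gen_eigenspace_def)
  fix u c y assume u: "u \<in> gen_eigenspace x a W"
  then obtain p where p: "u \<in> W" "(T x a ^^ p) u = 0" by (auto simp: gen_eigenspace_def)
  show "c *s u \<in> gen_eigenspace x a W"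
    using p inv_subD(4)[OF W] by (auto simp: gen_eigenspace_def Tk_scale intro!: exI[of _ p])
  obtain K where "lower_central K = {0}" using nilpotent by blast
  \<comment> \<open>For j = K every y lies in the required term
    \<open>lower_central 0\<close>.\<close>
  from kernel_invariant[OF this _ p(2), where j = K] have "(T x a ^^ (p + K)) (\<rho> y *v u) = 0" by simp
  then show "\<rho> y *v u \<in> gen_eigenspace x a W"
    using p inv_subD(5)[OF W] by (auto simp: gen_eigenspace_def)
  fix v assume "v \<in> gen_eigenspace x a W"
  then obtain q where q: "v \<in> W" "(T x a ^^ q) v = 0" by (auto simp: gen_eigenspace_def)
  have "(T x a ^^ max p q) (u + v) = 0"
    using Tk_mono[OF p(2), of "max p q"] Tk_mono[OF q(2), of "max p q"] by (simp add: Tk_add)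
  then show "u + v \<in> gen_eigenspace x a W"
    using p q inv_subD(2)[OF W] by (auto simp: gen_eigenspace_def)
qed

text \<open>The complement is the stable image of the powers of T = \<rho> x - a on W. The images
  decrease, so they are constant from the exponent N on at which their dimension is minimal;
  nilpotency of the Lie algebra makes the stable image invariant under all of \<rho>.\<close>

lemma fitting:
  assumes W: "inv_sub W"
  obtains W' where "inv_sub W'" "W' \<subseteq> W" "gen_eigenspace x a W \<inter> W' = {0}"
    "\<And>w. w \<in> W \<Longrightarrow> \<exists>u\<in>gen_eigenspace x a W. \<exists>v\<in>W'. w = u + v"
proof -
  let ?I = "\<lambda>k. (T x a ^^ k) ` W"
  have sub: "vec.subspace (?I k)" for k
    using vec.linear_subspace_image[OF Tk_linear inv_subD(6)[OF W]] .
  have dec: "?I k \<subseteq> ?I j" if "j \<le> k" for j k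
  proof -
    have "(T x a ^^ k) w = (T x a ^^ j) ((T x a ^^ (k - j)) w)" for w
      using that by (metis funpow_add le_add_diff_inverse o_apply)
    then show ?thesis using Tk_in[OF W] by auto
  qed
  define N where "N = arg_min (\<lambda>k. vec.dim (?I k)) (\<lambda>_. True)"
  have min: "vec.dim (?I N) \<le> vec.dim (?I k)" for k
    unfolding N_def by (rule arg_min_nat_le) simp
  have stable: "?I k = ?I N" if "N \<le> k" for k
    by (rule vec.subspace_dim_equal) (use sub dec[OF that] min in auto)
  have W': "inv_sub (?I N)"
    unfolding inv_sub_def
  proof (intro conjI sub allI ballI)
    fix y v assume v: "v \<in> ?I N"
    obtain K where K: "lower_central K = {0}" using nilpotent by blast
    \<comment> \<open>By stability v can be written with K further factors, which is what
      \<open>image_invariant\<close> consumes.\<close>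
    have "v \<in> ?I (N + K)" using v stable[of "N + K"] by simp
    then obtain u where "u \<in> W" "v = (T x a ^^ (N + K)) u" by blast
    then show "\<rho> y *v v \<in> ?I N" using image_invariant[OF K W, where p = N and j = K and y = y and u = u and x = x and a = a] by simp
  qed
  show thesis
  proof
    show "inv_sub (?I N)" by (rule W')
    show "?I N \<subseteq> W" using Tk_in[OF W] by blast
    show "gen_eigenspace x a W \<inter> ?I N = {0}"
    proof (intro equalityI subsetI)
      fix v assume v: "v \<in> gen_eigenspace x a W \<inter> ?I N"
      then obtain p where p: "(T x a ^^ p) v = 0" by (auto simp: gen_eigenspace_def)
      let ?M = "max N CARD('n)"
      have "v \<in> ?I ?M" using v stable[of ?M] by simp
      then obtain u where u: "u \<in> W" "v = (T x a ^^ ?M) u" by blast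
      have "(T x a ^^ (p + ?M)) u = 0" using p u(2) by (simp only: funpow_add o_apply)
      then have "(T x a ^^ CARD('n)) u = 0" by (rule nilpotency_bound_vector[OF T_linear])
      then have "(T x a ^^ ?M) u = 0" by (rule Tk_mono) simp
      then show "v \<in> {0}" using u by simp
    next
      fix v :: "complex^'n" assume "v \<in> {0}"
      then show "v \<in> gen_eigenspace x a W \<inter> ?I N"
        using inv_subD(1)[OF gen_eigenspace_invariant[OF W]] vec.subspace_0[OF sub] by auto
    qed
    fix w assume w: "w \<in> W"
    have "(T x a ^^ N) w \<in> ?I (N + N)" using stable[of "N + N"] w by simp
    then obtain u where u: "u \<in> W" "(T x a ^^ N) w = (T x a ^^ N) ((T x a ^^ N) u)"
      by (auto simp: funpow_add)
    have "(T x a ^^ N) (w - (T x a ^^ N) u) = 0" using u by (simp add: Tk_diff)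
    then have "w - (T x a ^^ N) u \<in> gen_eigenspace x a W"
      using inv_subD(3)[OF W w Tk_in[OF W u(1)]] by (auto simp: gen_eigenspace_def)
    then show "\<exists>u\<in>gen_eigenspace x a W. \<exists>v\<in>?I N. w = u + v"
      using u(1) by (intro bexI[of _ "w - (T x a ^^ N) u"] bexI[of _ "(T x a ^^ N) u"]) auto
  qed
qed

section \<open>Eigenvectors and common weight vectors\<close>

lemma polynomial_eigenvector:
  assumes W: "inv_sub W" and "w \<in> W" "w \<noteq> 0" "q \<noteq> 0"
    and "(\<Sum>j\<le>degree q. coeff q j *s ((*v) (\<rho> x) ^^ j) w) = 0"
  shows "\<exists>a. \<exists>u\<in>W. u \<noteq> 0 \<and> T x a u = 0"
  using assms(4,5)
proof (induction "degree q" arbitrary: q)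
  case 0
  then obtain c where "q = [:c:]" by (metis degree_eq_zeroE)
  then show ?case using 0 assms(3) by simp
next
  case (Suc d)
  let ?A = "\<lambda>j. ((*v) (\<rho> x) ^^ j) w"
  have AW: "?A j \<in> W" for j by (induction j) (simp_all add: assms(2) inv_subD(5)[OF W])
  obtain a where a: "poly q a = 0"
    using Suc.hyps(2) fundamental_theorem_of_algebra_alt[of q] by (metis degree_pCons_0 nat.distinct(1))
  then obtain q' where q': "q = [:- a, 1:] * q'" by (metis dvdE poly_eq_0_iff_dvd)
  then have "q' \<noteq> 0" using Suc.prems(1) by auto
  then have deg: "degree q = Suc (degree q')" unfolding q' by (subst degree_mult_eq) auto
  \<comment> \<open>With the root a split off, q(\<rho> x) w is T applied to u = q'(\<rho> x) w.
    Either u is the eigenvector or q' annihilates w and has smaller degree.\<close>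
  define u where "u = (\<Sum>j\<le>degree q'. coeff q' j *s ?A j)"
  have "coeff q j = coeff (pCons 0 q') j - a * coeff q' j" for j
    unfolding q' by simp
  then have "(\<Sum>j\<le>degree q. coeff q j *s ?A j) =
      (\<Sum>j\<le>Suc (degree q'). coeff (pCons 0 q') j *s ?A j) - (\<Sum>j\<le>Suc (degree q'). (a * coeff q' j) *s ?A j)"
    by (simp only: deg sum_subtractf vec.scale_left_diff_distrib)
  also have "(\<Sum>j\<le>Suc (degree q'). coeff (pCons 0 q') j *s ?A j) = \<rho> x *v u"
    unfolding u_def by (subst sum.atMost_Suc_shift) (simp add: vec.linear_sum[OF matrix_vector_mul_linear_gen] vector_scalar_commute)
  also have "(\<Sum>j\<le>Suc (degree q'). (a * coeff q' j) *s ?A j) = a *s u"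
    unfolding u_def by (simp add: coeff_eq_0 vec.scale_sum_right)
  finally have eq: "(\<Sum>j\<le>degree q. coeff q j *s ?A j) = T x a u" by (simp add: T_def)
  show ?case
  proof (cases "u = 0")
    case True
    then show ?thesis using Suc.hyps(1)[of q'] Suc.hyps(2) deg \<open>q' \<noteq> 0\<close> unfolding u_def by simp
  next
    case False
    have "u \<in> W" unfolding u_def by (intro vec.subspace_sum inv_subD(6)[OF W] vec.subspace_scale AW)
    then show ?thesis using False eq Suc.prems(2) by auto
  qed
qed

text \<open>The n + 1 vectors obtained from w by powers of \<rho> x are dependent, which is a
  nonzero polynomial annihilating w. Using the orbit of w keeps the eigenvector inside W.\<close>

lemma ex_eigenvector:
  assumes W: "inv_sub W" and w: "w \<in> W" "w \<noteq> 0"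
  shows "\<exists>a. \<exists>u\<in>W. u \<noteq> 0 \<and> T x a u = 0"
proof -
  obtain c where c: "\<exists>j<Suc CARD('n). c j \<noteq> 0" "(\<Sum>j<Suc CARD('n). c j *s ((*v) (\<rho> x) ^^ j) w) = 0"
    using linear_dependence[of "Suc CARD('n)" "\<lambda>j. ((*v) (\<rho> x) ^^ j) w"] by auto
  define q where "q = (\<Sum>j<Suc CARD('n). monom (c j) j)"
  have coeff: "coeff q j = (if j < Suc CARD('n) then c j else 0)" for j
    unfolding q_def coeff_sum by (simp add: if_distrib cong: if_cong)
  have "q \<noteq> 0" using c(1) coeff by (metis coeff_0)
  have "degree q \<le> CARD('n)" by (rule degree_le) (simp add: coeff)
  then have "(\<Sum>j\<le>degree q. coeff q j *s ((*v) (\<rho> x) ^^ j) w) = (\<Sum>j<Suc CARD('n). coeff q j *s ((*v) (\<rho> x) ^^ j) w)"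
    by (intro sum.mono_neutral_left) (auto simp: coeff_eq_0)
  moreover have "(\<Sum>j<Suc CARD('n). coeff q j *s ((*v) (\<rho> x) ^^ j) w) = (\<Sum>j<Suc CARD('n). c j *s ((*v) (\<rho> x) ^^ j) w)"
    by (intro sum.cong) (simp_all add: coeff)
  ultimately have "(\<Sum>j\<le>degree q. coeff q j *s ((*v) (\<rho> x) ^^ j) w) = 0"
    using c(2) by (simp only:)
  then show ?thesis using polynomial_eigenvector[OF W w \<open>q \<noteq> 0\<close>] by blast
qed

text \<open>A commutator of operators that is a scalar \<open>c\<close> modulo \<open>K\<close> forces \<open>(T y b)\<^sup>j A\<^sup>j w \<equiv> (- c)\<^sup>j j! w\<close>
  for an eigenvector \<open>w\<close>; as \<open>T y b\<close> is nilpotent, \<open>c = 0\<close>.\<close>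

lemma scalar_commutator:
  assumes K: "inv_sub K" and W: "inv_sub W" and w: "w \<in> W" "w \<notin> K" "T y b w \<in> K"
    and nil: "\<And>v. v \<in> W \<Longrightarrow> \<exists>p. (T y b ^^ p) v = 0"
    and comm: "\<And>v. v \<in> W \<Longrightarrow> \<rho> (bracket x y) *v v - c *s v \<in> K"
  shows "c = 0"
proof -
  let ?A = "\<lambda>j. ((*v) (\<rho> x) ^^ j) w"
  have AW: "?A j \<in> W" for j by (induction j) (simp_all add: w inv_subD(5)[OF W])
  have group: "a = p - q \<Longrightarrow> d = p - r \<Longrightarrow> s = r - u \<Longrightarrow> a - s = d - (q - u)" for a p q d r s u :: "complex^'n"
    by simp
  have step: "T y b (?A (Suc j)) - (- (of_nat (Suc j) * c)) *s ?A j \<in> K" for j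
  proof (induction j)
    case 0
    have "T y b (?A (Suc 0)) - (- (of_nat (Suc 0) * c)) *s ?A 0 = \<rho> x *v (T y b w) - (\<rho> (bracket x y) *v w - c *s w)"
      by (simp add: T_rho[of y b x] rho_bracket)
    then show ?case using inv_subD(3)[OF K inv_subD(5)[OF K w(3)] comm[OF w(1)]] by (simp only:)
  next
    case (Suc j)
    let ?D = "T y b (?A (Suc j)) - (- (of_nat (Suc j) * c)) *s ?A j"
    let ?E = "\<rho> (bracket x y) *v ?A (Suc j) - c *s ?A (Suc j)"
    have "T y b (?A (Suc (Suc j))) = \<rho> x *v T y b (?A (Suc j)) - \<rho> (bracket x y) *v ?A (Suc j)"
      by (simp add: T_rho[of y b x] rho_bracket)
    moreover have "\<rho> x *v ?D = \<rho> x *v T y b (?A (Suc j)) - (- (of_nat (Suc j) * c)) *s ?A (Suc j)"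
      unfolding matrix_vector_mult_diff_distrib vector_scalar_commute by simp
    moreover have "- (of_nat (Suc (Suc j)) * c) = - (of_nat (Suc j) * c) - c"
      by (simp add: algebra_simps)
    then have "(- (of_nat (Suc (Suc j)) * c)) *s ?A (Suc j) = (- (of_nat (Suc j) * c)) *s ?A (Suc j) - c *s ?A (Suc j)"
      by (simp only: vec.scale_left_diff_distrib)
    ultimately have "T y b (?A (Suc (Suc j))) - (- (of_nat (Suc (Suc j)) * c)) *s ?A (Suc j) = \<rho> x *v ?D - ?E"
      by (rule group)
    moreover have "\<rho> x *v ?D - ?E \<in> K"
      by (rule inv_subD(3)[OF K inv_subD(5)[OF K Suc] comm[OF AW]])
    ultimately show ?case by (simp only:)
  qed
  have pow: "(T y b ^^ j) (?A j) - ((- c) ^ j * fact j) *s w \<in> K" for j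
  proof (induction j)
    case 0
    then show ?case using inv_subD(1)[OF K] by simp
  next
    case (Suc j)
    let ?s = "- (of_nat (Suc j) * c)"
    have "(T y b ^^ j) (T y b (?A (Suc j)) - ?s *s ?A j) \<in> K"
      by (rule Tk_in[OF K step])
    moreover have "?s *s ((T y b ^^ j) (?A j) - ((- c) ^ j * fact j) *s w) \<in> K"
      by (rule inv_subD(4)[OF K Suc])
    ultimately have "(T y b ^^ j) (T y b (?A (Suc j)) - ?s *s ?A j) +
        ?s *s ((T y b ^^ j) (?A j) - ((- c) ^ j * fact j) *s w) \<in> K"
      by (rule inv_subD(2)[OF K])
    moreover have "(T y b ^^ Suc j) (?A (Suc j)) = (T y b ^^ j) (T y b (?A (Suc j)))"
      by (simp only: funpow_Suc_right o_apply)
    moreover have "?s * ((- c) ^ j * fact j) = (- c) ^ Suc j * fact (Suc j)"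
      by (simp add: algebra_simps)
    ultimately show ?case
      by (simp only: Tk_diff Tk_scale vec.scale_right_diff_distrib vec.scale_scale diff_add_cancel add_diff_eq)
  qed
  let ?q = "CARD('n)"
  obtain p where "(T y b ^^ p) (?A ?q) = 0" using nil[OF AW] by blast
  then have "(T y b ^^ ?q) (?A ?q) = 0" by (rule nilpotency_bound_vector[OF T_linear])
  then have *: "((- c) ^ ?q * fact ?q) *s w \<in> K"
    using pow[of ?q] inv_subD(4)[OF K, of _ "-1"] by fastforce
  show ?thesis
  proof (rule ccontr)
    assume "c \<noteq> 0"
    then have "(- c) ^ ?q * fact ?q \<noteq> 0" by simp
    then have "(inverse ((- c) ^ ?q * fact ?q) * ((- c) ^ ?q * fact ?q)) *s w = w"
      by (simp only: left_inverse vec.scale_one simp_thms)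
    then show False using inv_subD(4)[OF K *, of "inverse ((- c) ^ ?q * fact ?q)"] w(2) by (simp only: vec.scale_scale)
  qed
qed

text \<open>Choose V of minimal dimension among the invariant subspaces of W above K and different
  from K, so V / K is irreducible. Going up the lower central series from its end, every y acts on V
  / K by the scalar \<mu> y: brackets with y already act by scalars, these scalars are 0, and the
  kernel of \<rho> y - \<mu> y on V / K is then a nonzero invariant subspace.\<close>

lemma ex_weight_vector:
  assumes K: "inv_sub K" and W: "inv_sub W" and KW: "K \<subset> W"
    and nil: "\<And>x v. v \<in> W \<Longrightarrow> \<exists>p. (T x (\<mu> x) ^^ p) v = 0"
  shows "\<exists>v\<in>W - K. \<forall>x. T x (\<mu> x) v \<in> K"
proof -
  let ?P = "\<lambda>V. inv_sub V \<and> K \<subset> V \<and> V \<subseteq> W"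
  define V where "V = arg_min vec.dim ?P"
  have "?P W" using W KW by blast
  then have V: "?P V" and min: "?P V' \<Longrightarrow> vec.dim V \<le> vec.dim V'" for V'
    unfolding V_def by (rule arg_min_natI, intro arg_min_nat_le)
  then have VV: "inv_sub V" "K \<subset> V" "V \<subseteq> W" by blast+
  have minimal: "V' = V" if "inv_sub V'" "K \<subset> V'" "V' \<subseteq> V" for V'
    by (rule vec.subspace_dim_equal) (use that VV min[of V'] inv_subD(6) in auto)
  obtain k0 where k0: "lower_central k0 = {0}" using nilpotent by blast
  have kernel: "\<exists>v\<in>V - K. T y (\<mu> y) v \<in> K" for y
  proof -
    obtain v where v: "v \<in> V" "v \<notin> K" using VV by blast
    obtain p where p: "(T y (\<mu> y) ^^ p) v = 0" using nil v VV by blast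
    define p0 where "p0 = (LEAST p. (T y (\<mu> y) ^^ p) v \<in> K)"
    have p0: "(T y (\<mu> y) ^^ p0) v \<in> K"
      unfolding p0_def by (rule LeastI[of _ p]) (simp add: p inv_subD(1)[OF K])
    have "p0 \<noteq> 0" using p0 v by (metis funpow_0)
    then obtain p1 where p1: "p0 = Suc p1" by (metis not0_implies_Suc)
    then have "(T y (\<mu> y) ^^ p1) v \<notin> K" unfolding p0_def by (metis lessI not_less_Least)
    then show ?thesis using p0 p1 Tk_in[OF VV(1) v(1)] by (intro bexI[of _ "(T y (\<mu> y) ^^ p1) v"]) auto
  qed
  have scalar: "\<forall>y\<in>lower_central (k0 - j). \<forall>v\<in>V. T y (\<mu> y) v \<in> K" if "j \<le> k0" for j
    using that
  proof (induction j)
    case 0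
    obtain v where v: "v \<in> V - K" "T 0 (\<mu> 0) v \<in> K" using kernel by blast
    \<comment> \<open>The zero element acts by 0, and by assumption some v outside K is mapped into
      K by 0 - \<mu> 0.\<close>
    have "\<mu> 0 = 0"
    proof (rule ccontr)
      assume nz: "\<mu> 0 \<noteq> 0"
      have "(- inverse (\<mu> 0)) *s T 0 (\<mu> 0) v = v"
        using nz by (simp add: T_def rho_0)
      then show False using inv_subD(4)[OF K v(2), of "- inverse (\<mu> 0)"] v(1) by simp
    qed
    then show ?case using k0 inv_subD(1)[OF K] by (simp add: T_def rho_0)
  next
    case (Suc j)
    show ?case
    proof
      fix y assume y: "y \<in> lower_central (k0 - Suc j)"
      have "Suc (k0 - Suc j) = k0 - j" using Suc.prems by simp
      then have br: "bracket x y \<in> lower_central (k0 - j)" for x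
        using lower_central_bracket[OF y, of x] by simp
      have comm: "T (bracket x y) (\<mu> (bracket x y)) v \<in> K" if "v \<in> V" for x v
        using Suc br that by auto
      \<comment> \<open>By the induction hypothesis the commutator of \<rho> x and \<rho> y is a
        scalar on V / K, while \<rho> y - \<mu> y is nilpotent on V.\<close>
      have br0: "\<mu> (bracket x y) = 0" for x
      proof -
        obtain w where w: "w \<in> V" "w \<notin> K" "T y (\<mu> y) w \<in> K" using kernel by blast
        have nilV: "\<exists>p. (T y (\<mu> y) ^^ p) v = 0" if "v \<in> V" for v using nil that VV(3) by blast
        show ?thesis
          by (rule scalar_commutator[OF K VV(1) w nilV]) (use comm[of _ x] in \<open>simp_all add: T_def\<close>)
      qed
      let ?V = "{v \<in> V. T y (\<mu> y) v \<in> K}"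
      have "inv_sub ?V"
        unfolding inv_sub_def vec.subspace_def
      proof (intro conjI allI ballI)
        fix x v assume v: "v \<in> ?V"
        have "T y (\<mu> y) (\<rho> x *v v) = \<rho> x *v T y (\<mu> y) v - \<rho> (bracket x y) *v v"
          by (simp add: T_rho[of y _ x] rho_bracket)
        moreover have "\<rho> (bracket x y) *v v \<in> K" using comm[of v x] v by (simp add: br0 T_def)
        ultimately show "\<rho> x *v v \<in> ?V"
          using v inv_subD(5)[OF VV(1)] inv_subD(3,5)[OF K] by auto
      qed (use inv_subD[OF VV(1)] inv_subD[OF K] in \<open>auto simp: T_add T_scale, simp add: T_def\<close>)
      moreover have "K \<subset> ?V"
        using kernel[of y] VV(2) T_in[OF K] by blast
      ultimately have "?V = V" by (rule minimal) blast
      then show "\<forall>v\<in>V. T y (\<mu> y) v \<in> K" by blast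
    qed
  qed
  obtain v where "v \<in> V" "v \<notin> K" using VV by blast
  then show ?thesis using scalar[of k0] VV(3) by auto
qed

text \<open>A triangularising basis of W, as a list because its order matters, in which only vectors
  of equal weight interact. Linear independence is encoded by the equality of length and
  dimension.\<close>

definition weighted_flag :: "(complex^'n) set \<Rightarrow> (complex^'n) list \<Rightarrow> ('a \<Rightarrow> complex) list \<Rightarrow> bool" where
  "weighted_flag W bs ws \<longleftrightarrow> length ws = length bs \<and> length bs = vec.dim W \<and> vec.span (set bs) = W \<and>
     (\<forall>x. \<forall>j<length bs. T x ((ws ! j) x) (bs ! j) \<in> vec.span {bs ! i | i. i < j \<and> ws ! i = ws ! j})"

lemma weighted_flag_replicate:
  "weighted_flag W bs (replicate (length bs) \<mu>) \<longleftrightarrow> length bs = vec.dim W \<and> vec.span (set bs) = W \<and>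
     (\<forall>x. \<forall>j<length bs. T x (\<mu> x) (bs ! j) \<in> vec.span ((!) bs ` {..<j}))"
proof -
  have "{bs ! i | i. i < j \<and> replicate (length bs) \<mu> ! i = replicate (length bs) \<mu> ! j} = (!) bs ` {..<j}"
    if "j < length bs" for j
    using that by auto
  then show ?thesis by (simp add: weighted_flag_def cong: conj_cong)
qed

text \<open>The flag of K is enlarged by a common weight vector modulo K. Its image under \<rho> x -
  \<mu> x lies in the span of the earlier vectors, and the difference of dimensions to W
  drops.\<close>

lemma flag_single_weight:
  assumes W: "inv_sub W" and nil: "\<And>x v. v \<in> W \<Longrightarrow> \<exists>p. (T x (\<mu> x) ^^ p) v = 0"
    and "inv_sub K" "K \<subseteq> W" "weighted_flag K bs (replicate (length bs) \<mu>)"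
  shows "\<exists>bs. weighted_flag W bs (replicate (length bs) \<mu>)"
  using assms(3-5)
proof (induction "vec.dim W - vec.dim K" arbitrary: K bs rule: less_induct)
  case less
  show ?case
  proof (cases "K = W")
    case True
    then show ?thesis using less.prems by blast
  next
    case False
    then obtain v where v: "v \<in> W" "v \<notin> K" "\<And>x. T x (\<mu> x) v \<in> K"
      using ex_weight_vector[OF less.prems(1) W _ nil] less.prems(2) by blast
    have span_K: "vec.span K = K" by (simp add: inv_subD(6)[OF less.prems(1)] vec.span_eq_iff)
    let ?K = "vec.span (insert v K)"
    have dim: "vec.dim ?K = Suc (vec.dim K)"
      using v(2) by (simp add: vec.dim_insert span_K)
    have KW: "?K \<subseteq> W"
      using less.prems(2) v(1) inv_subD(6)[OF W] by (intro vec.span_minimal) auto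
    have inv: "inv_sub ?K"
      unfolding inv_sub_def
    proof (intro conjI allI ballI)
      fix x u assume "u \<in> ?K"
      then obtain c where c: "u - c *s v \<in> K" using vec.span_breakdown_eq[of u v K] span_K by auto
      have "\<rho> x *v u = (\<rho> x *v (u - c *s v) + c *s T x (\<mu> x) v) + (c * \<mu> x) *s v"
        by (simp add: T_def matrix_vector_mult_diff_distrib vector_scalar_commute vec.scale_right_diff_distrib)
      moreover have "\<rho> x *v (u - c *s v) + c *s T x (\<mu> x) v \<in> K"
        using inv_subD(2,4,5)[OF less.prems(1)] c v(3) by blast
      ultimately show "\<rho> x *v u \<in> ?K"
        by (metis insertI1 insert_iff vec.span_add vec.span_base vec.span_scale)
    qed (rule vec.subspace_span)
    have flag: "weighted_flag ?K (bs @ [v]) (replicate (length (bs @ [v])) \<mu>)"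
      unfolding weighted_flag_replicate
    proof (intro conjI allI impI)
      have bs: "vec.span (set bs) = K" "length bs = vec.dim K"
        and T: "\<And>x j. j < length bs \<Longrightarrow> T x (\<mu> x) (bs ! j) \<in> vec.span ((!) bs ` {..<j})"
        using less.prems(3) by (simp_all only: weighted_flag_replicate)
      show "length (bs @ [v]) = vec.dim ?K" using bs dim by simp
      have "vec.span (insert v (set bs)) = vec.span (insert v (vec.span (set bs)))"
        by (simp only: vec.span_insert vec.span_span)
      then show "vec.span (set (bs @ [v])) = ?K" using bs by simp
      fix x j assume j: "j < length (bs @ [v])"
      have img: "(!) (bs @ [v]) ` {..<j} = (!) bs ` {..<j}"
        using j by (intro image_cong refl) (simp add: nth_append)
      show "T x (\<mu> x) ((bs @ [v]) ! j) \<in> vec.span ((!) (bs @ [v]) ` {..<j})"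
      proof (cases "j < length bs")
        case True
        then show ?thesis using T[OF True, of x] unfolding img by (simp add: nth_append)
      next
        case False
        then have "j = length bs" using j by simp
        moreover have "(!) bs ` {..<length bs} = set bs"
          by (auto simp: set_conv_nth)
        ultimately show ?thesis unfolding img using v(3)[of x] bs(1) by simp
      qed
    qed
    have "vec.dim ?K \<le> vec.dim W" by (rule vec.dim_subset[OF KW])
    then have "vec.dim W - vec.dim ?K < vec.dim W - vec.dim K" using dim by linarith
    then show ?thesis by (rule less.hyps[OF _ inv KW flag])
  qed
qed

text \<open>Either one function \<mu> gives the generalised eigenvalue of every x on W, or some x
  has no single one. In the second case the Fitting decomposition for an eigenvalue of x splits W
  into two smaller invariant subspaces, whose flags are concatenated; vectors of different summands
  never interact.\<close>

lemma ex_weighted_flag: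
  assumes "inv_sub W"
  shows "\<exists>bs ws. weighted_flag W bs ws"
  using assms
proof (induction "vec.dim W" arbitrary: W rule: less_induct)
  case less
  note W = less.prems
  show ?case
  proof (cases "\<exists>\<mu>. \<forall>x. \<forall>v\<in>W. \<exists>p. (T x (\<mu> x) ^^ p) v = 0")
    case True
    then obtain \<mu> where \<mu>: "\<And>x v. v \<in> W \<Longrightarrow> \<exists>p. (T x (\<mu> x) ^^ p) v = 0" by blast
    have "inv_sub {0}" by (simp add: inv_sub_def vec.subspace_0 vec.subspace_def)
    moreover have "weighted_flag {0} [] (replicate (length []) \<mu>)" by (simp add: weighted_flag_def)
    ultimately show ?thesis using flag_single_weight[OF W \<mu>, of "{0}" "[]"] inv_subD(1)[OF W] by blast
  next
    case False
    then obtain x where x: "\<And>a. \<not> (\<forall>v\<in>W. \<exists>p. (T x a ^^ p) v = 0)" by metis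
    from x[of 0] obtain w where "w \<in> W" "w \<noteq> 0" using Tk_0 by metis
    then obtain a u where u: "u \<in> W" "u \<noteq> 0" "T x a u = 0" using ex_eigenvector[OF W, of w x] by blast
    let ?W0 = "gen_eigenspace x a W"
    obtain W1 where W1: "inv_sub W1" "W1 \<subseteq> W" "?W0 \<inter> W1 = {0}"
      "\<And>w. w \<in> W \<Longrightarrow> \<exists>u\<in>?W0. \<exists>v\<in>W1. w = u + v" using fitting[OF W, of x a] by blast
    have W0: "inv_sub ?W0" "?W0 \<subseteq> W" using gen_eigenspace_invariant[OF W] by (auto simp: gen_eigenspace_def)
    \<comment> \<open>Both summands are proper: the first by the choice of x, the second because it
      meets the first in 0 and so misses the eigenvector u.\<close>
    have "?W0 \<noteq> W" using x[of a] by (auto simp: gen_eigenspace_def)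
    moreover have "u \<in> ?W0" using u by (auto simp: gen_eigenspace_def intro!: exI[of _ 1])
    then have "W1 \<noteq> W" using u W1(3) by blast
    ultimately have dims: "vec.dim ?W0 < vec.dim W" "vec.dim W1 < vec.dim W"
      using W0 W1(1,2) W by (auto intro!: vec.dim_psubset simp: inv_sub_def vec.span_eq_iff[THEN iffD2] )
    obtain bs0 ws0 where f0: "weighted_flag ?W0 bs0 ws0" using less.hyps[OF dims(1) W0(1)] by blast
    obtain bs1 ws1 where f1: "weighted_flag W1 bs1 ws1" using less.hyps[OF dims(2) W1(1)] by blast
    have sums: "W = {u + v | u v. u \<in> ?W0 \<and> v \<in> W1}"
      using W1(2,4) W0(2) inv_subD(2)[OF W] by blast
    have "vec.dim W = vec.dim ?W0 + vec.dim W1"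
      using vec.dim_sums_Int[OF inv_subD(6)[OF W0(1)] inv_subD(6)[OF W1(1)]] W1(3)
      unfolding sums[symmetric] by simp
    moreover have "vec.span (set bs0 \<union> set bs1) = W"
    proof -
      have "vec.span (set bs0) = ?W0" "vec.span (set bs1) = W1"
        using f0 f1 by (simp_all add: weighted_flag_def)
      then show ?thesis unfolding vec.span_Un by (simp only: sums[symmetric])
    qed
    moreover have "T y (((ws0 @ ws1) ! j) y) ((bs0 @ bs1) ! j) \<in>
        vec.span {(bs0 @ bs1) ! i | i. i < j \<and> (ws0 @ ws1) ! i = (ws0 @ ws1) ! j}" if j: "j < length (bs0 @ bs1)" for y j
    proof (cases "j < length bs0")
      case True
      have sub: "{bs0 ! i | i. i < j \<and> ws0 ! i = ws0 ! j} \<subseteq> {(bs0 @ bs1) ! i | i. i < j \<and> (ws0 @ ws1) ! i = (ws0 @ ws1) ! j}"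
        using True f0 by (force simp: nth_append weighted_flag_def)
      have "T y ((ws0 ! j) y) (bs0 ! j) \<in> vec.span {bs0 ! i | i. i < j \<and> ws0 ! i = ws0 ! j}"
        using f0 True by (simp add: weighted_flag_def)
      then have "T y ((ws0 ! j) y) (bs0 ! j) \<in> vec.span {(bs0 @ bs1) ! i | i. i < j \<and> (ws0 @ ws1) ! i = (ws0 @ ws1) ! j}"
        by (rule subsetD[OF vec.span_mono[OF sub]])
      moreover have "(ws0 @ ws1) ! j = ws0 ! j" "(bs0 @ bs1) ! j = bs0 ! j"
        using True f0 by (simp_all add: nth_append weighted_flag_def)
      ultimately show ?thesis by simp
    next
      case False
      let ?j = "j - length bs0"
      have j': "?j < length bs1" using False j by simp
      have len: "length ws0 = length bs0" "length ws1 = length bs1" using f0 f1 by (auto simp: weighted_flag_def)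
      have sub: "{bs1 ! i | i. i < ?j \<and> ws1 ! i = ws1 ! ?j} \<subseteq> {(bs0 @ bs1) ! i | i. i < j \<and> (ws0 @ ws1) ! i = (ws0 @ ws1) ! j}"
      proof
        fix v assume "v \<in> {bs1 ! i | i. i < ?j \<and> ws1 ! i = ws1 ! ?j}"
        then obtain i where i: "v = bs1 ! i" "i < ?j" "ws1 ! i = ws1 ! ?j" by blast
        then have "v = (bs0 @ bs1) ! (length bs0 + i) \<and> length bs0 + i < j \<and> (ws0 @ ws1) ! (length bs0 + i) = (ws0 @ ws1) ! j"
          using False len by (simp add: nth_append)
        then show "v \<in> {(bs0 @ bs1) ! i | i. i < j \<and> (ws0 @ ws1) ! i = (ws0 @ ws1) ! j}" by blast
      qed
      have "T y ((ws1 ! ?j) y) (bs1 ! ?j) \<in> vec.span {bs1 ! i | i. i < ?j \<and> ws1 ! i = ws1 ! ?j}"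
        using f1 j' by (simp add: weighted_flag_def)
      then have "T y ((ws1 ! ?j) y) (bs1 ! ?j) \<in> vec.span {(bs0 @ bs1) ! i | i. i < j \<and> (ws0 @ ws1) ! i = (ws0 @ ws1) ! j}"
        by (rule subsetD[OF vec.span_mono[OF sub]])
      then show ?thesis using False len by (simp add: nth_append)
    qed
    ultimately have "weighted_flag W (bs0 @ bs1) (ws0 @ ws1)"
      using f0 f1 by (simp add: weighted_flag_def)
    then show ?thesis by blast
  qed
qed

lemma ex_normal_form: "\<exists>S w r. normal_form \<rho> S w r"
proof -
  have "inv_sub UNIV" by (simp add: inv_sub_def)
  then obtain bs ws where flag: "weighted_flag UNIV bs ws" using ex_weighted_flag by blast
  then have len: "length bs = CARD('n)" "length ws = CARD('n)" unfolding weighted_flag_def vec_dim_card by auto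
  \<comment> \<open>The numbering carries the list over to the index type and becomes the order r of
    the normal form.\<close>
  obtain f :: "'n \<Rightarrow> nat" where f: "bij_betw f UNIV {0..<CARD('n)}"
    using ex_bij_betw_finite_nat[OF finite] by blast
  then have fi: "f i < CARD('n)" for i by (auto simp: bij_betw_def)
  have f_surj: "\<exists>i. f i = k" if "k < CARD('n)" for k
    using f that by (metis atLeast0LessThan bij_betw_imp_surj_on imageE lessThan_iff)
  have f_inj: "f i = f j \<Longrightarrow> i = j" for i j using f by (auto simp: bij_betw_def inj_on_def)
  define S where "S = (\<chi> i j. bs ! f j $ i)"
  have col: "column j S = bs ! f j" for j by (simp add: S_def column_def vec_eq_iff)
  have "columns S = set bs"
    unfolding columns_def col set_conv_nth len using fi f_surj by auto
  then have "vec.span (columns S) = UNIV" using flag by (simp add: weighted_flag_def)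
  then obtain S' where "S ** S' = mat 1" using matrix_right_invertible_span_columns[of S] by auto
  then have S: "invertible S" unfolding invertible_def using matrix_left_right_inverse by blast
  have Scol: "S *v axis j 1 = bs ! f j" for j
    by (simp add: matrix_vector_mul_component vec_eq_iff S_def matrix_vector_mult_def axis_def if_distrib cong: if_cong)
  have inv_col: "matrix_inv S *v (bs ! f j) = axis j 1" for j
    unfolding Scol[symmetric] by (simp add: matrix_vector_mul_assoc matrix_inv_mult[OF S])
  define w where "w j = ws ! f j" for j
  have entry: "(matrix_inv S ** \<rho> x ** S) $ i $ j = w j x * axis j 1 $ i + (matrix_inv S *v T x (w j x) (bs ! f j)) $ i" for x i j
  proof -
    have "(matrix_inv S ** \<rho> x ** S) $ i $ j = ((matrix_inv S ** \<rho> x ** S) *v axis j 1) $ i"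
      by (simp add: matrix_vector_mult_def axis_def if_distrib cong: if_cong)
    also have "(matrix_inv S ** \<rho> x ** S) *v axis j 1 = matrix_inv S *v (\<rho> x *v (bs ! f j))"
      by (simp add: matrix_vector_mul_assoc[symmetric] Scol)
    also have "\<rho> x *v (bs ! f j) = w j x *s (bs ! f j) + T x (w j x) (bs ! f j)"
      by (simp add: T_def)
    also have "matrix_inv S *v \<dots> = w j x *s axis j 1 + matrix_inv S *v T x (w j x) (bs ! f j)"
      by (simp add: matrix_vector_right_distrib vector_scalar_commute inv_col)
    finally show ?thesis by simp
  qed
  have tri: "f i < f j \<and> w i = w j" if nz: "(matrix_inv S *v T x (w j x) (bs ! f j)) $ i \<noteq> 0" for x i j
  proof -
    let ?V = "{v. (matrix_inv S *v v) $ i \<noteq> 0 \<longrightarrow> f i < f j \<and> w i = w j}"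
    have "vec.span {bs ! k | k. k < f j \<and> ws ! k = ws ! f j} \<subseteq> ?V"
    proof (rule vec.span_minimal)
      show "vec.subspace ?V"
        by (auto simp: vec.subspace_def matrix_vector_right_distrib vector_scalar_commute)
      show "{bs ! k | k. k < f j \<and> ws ! k = ws ! f j} \<subseteq> ?V"
      proof
        fix v assume "v \<in> {bs ! k | k. k < f j \<and> ws ! k = ws ! f j}"
        then obtain k where k: "v = bs ! k" "k < f j" "ws ! k = ws ! f j" by blast
        then obtain l where "f l = k" using f_surj[of k] fi[of j] by auto
        then show "v \<in> ?V" using k inv_col[of l] by (auto simp: w_def axis_def split: if_splits)
      qed
    qed
    moreover have "T x (w j x) (bs ! f j) \<in> vec.span {bs ! k | k. k < f j \<and> ws ! k = ws ! f j}"
      using flag fi[of j] len(1) by (simp only: weighted_flag_def w_def)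
    ultimately show ?thesis using nz by blast
  qed
  have "normal_form \<rho> S w f"
    unfolding normal_form_def entry
  proof (intro conjI allI impI S)
    fix x i j
    show "w i x * axis i 1 $ i + (matrix_inv S *v T x (w i x) (bs ! f i)) $ i = w i x"
      using tri[of x i i] by (auto simp: axis_def)
    assume "i \<noteq> j" "w j x * axis j 1 $ i + (matrix_inv S *v T x (w j x) (bs ! f j)) $ i \<noteq> 0"
    then show "f i < f j" "w i = w j" using tri[of x j i] by (auto simp: axis_def)
  qed
  then show ?thesis by blast
qed

end

end

section \<open>A Nullstellensatz\<close>

definition fscale :: "complex \<Rightarrow> ('x \<Rightarrow> complex) \<Rightarrow> 'x \<Rightarrow> complex" where
  "fscale c f = (\<lambda>x. c * f x)"

interpretation fs: vector_space "fscale :: complex \<Rightarrow> ('x \<Rightarrow> complex) \<Rightarrow> _"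
  by unfold_locales (auto simp: fscale_def fun_eq_iff algebra_simps)

text \<open>The monomials are indexed by finite lists over G, of which there are countably many, and
  their span is closed under multiplication.\<close>

lemma generated_algebra_countable_span:
  assumes "countable G"
  obtains M where "countable M" "generated_algebra G \<subseteq> fs.span M"
proof
  define mono :: "('a \<Rightarrow> complex) list \<Rightarrow> 'a \<Rightarrow> complex" where "mono l = (\<lambda>x. \<Prod>f\<leftarrow>l. f x)" for l
  let ?M = "mono ` lists G"
  show "countable ?M" using assms by (intro countable_image countable_lists)
  have mult1: "(\<lambda>x. mono l x * g x) \<in> fs.span ?M" if "l \<in> lists G" "g \<in> fs.span ?M" for l g
    using that(2)
  proof (induction rule: fs.span_induct_alt)
    case base
    then show ?case using fs.span_zero[of ?M] by (simp add: zero_fun_def)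
  next
    case (step c f g)
    then obtain l' where l': "l' \<in> lists G" "f = mono l'" by blast
    have "mono (l @ l') \<in> fs.span ?M" using that(1) l' by (intro fs.span_base) auto
    then have "fscale c (mono (l @ l')) + (\<lambda>x. mono l x * g x) \<in> fs.span ?M"
      using step.IH by (intro fs.span_add fs.span_scale)
    moreover have "fscale c (mono (l @ l')) + (\<lambda>x. mono l x * g x) = (\<lambda>x. mono l x * (fscale c f + g) x)"
      by (auto simp: fun_eq_iff fscale_def l' mono_def algebra_simps)
    ultimately show ?case by simp
  qed
  have mult_closed: "(\<lambda>x. f x * g x) \<in> fs.span ?M" if "f \<in> fs.span ?M" "g \<in> fs.span ?M" for f g
    using that(1)
  proof (induction rule: fs.span_induct_alt)
    case base
    then show ?case using fs.span_zero[of ?M] by (simp add: zero_fun_def)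
  next
    case (step c f f')
    then obtain l where l: "l \<in> lists G" "f = mono l" by blast
    have "fscale c (\<lambda>x. f x * g x) + (\<lambda>x. f' x * g x) \<in> fs.span ?M"
      unfolding l(2) using step.IH mult1[OF l(1) that(2)] by (intro fs.span_add fs.span_scale)
    moreover have "fscale c (\<lambda>x. f x * g x) + (\<lambda>x. f' x * g x) = (\<lambda>x. (fscale c f + f') x * g x)"
      by (auto simp: fun_eq_iff fscale_def algebra_simps)
    ultimately show ?case by simp
  qed
  show "generated_algebra G \<subseteq> fs.span ?M"
  proof
    fix f assume "f \<in> generated_algebra G"
    then show "f \<in> fs.span ?M"
    proof induction
      case (const c)
      have "mono [] \<in> fs.span ?M" by (intro fs.span_base) auto
      then have "fscale c (mono []) \<in> fs.span ?M" by (rule fs.span_scale)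
      moreover have "fscale c (mono []) = (\<lambda>_. c)" by (simp add: fscale_def mono_def)
      ultimately show ?case by (simp only:)
    next
      case (gen f)
      then have "mono [f] \<in> fs.span ?M" by (intro fs.span_base) auto
      then show ?case unfolding mono_def[of "[f]"] by simp
    next
      case (add f g)
      then show ?case by (intro fs.span_add)
    next
      case (mult f g)
      then show ?case using times_fun_def[of f g] mult_closed[of f g] by simp
    qed
  qed
qed

text \<open>Each member of the family lies in the span of an initial segment of an enumeration of M.
  Uncountably many indices share countably many segments, so some segment of n elements serves for n
  + 1 indices. A repetition in the family also counts as a dependence.\<close>

lemma uncountable_family_dependent:
  fixes s :: "complex \<Rightarrow> 'x \<Rightarrow> complex"
  assumes M: "countable M" and s: "\<And>c. s c \<in> fs.span M"
  obtains C u where "finite C" "\<exists>c\<in>C. u c \<noteq> 0" "\<And>x. (\<Sum>c\<in>C. u c * s c x) = 0"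
proof -
  define e where "e = from_nat_into (insert 0 M)"
  have "\<exists>n. s c \<in> fs.span (e ` {..<n})" for c
  proof -
    obtain F where F: "finite F" "F \<subseteq> M" "s c \<in> fs.span F"
    proof -
      obtain t r where t: "s c = (\<Sum>a\<in>t. fscale (r a) a)" "finite t" "t \<subseteq> M"
        using s[of c] unfolding fs.span_explicit by blast
      have "s c \<in> fs.span t"
        unfolding t(1) by (intro fs.span_sum fs.span_scale fs.span_base)
      then show thesis using t that by blast
    qed
    have "finite (to_nat_on (insert 0 M) ` F)" using F(1) by simp
    then obtain n where n: "\<And>v. v \<in> F \<Longrightarrow> to_nat_on (insert 0 M) v < n"
      unfolding finite_nat_set_iff_bounded by blast
    have "F \<subseteq> e ` {..<n}"
    proof
      fix v assume v: "v \<in> F"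
      then have "e (to_nat_on (insert 0 M) v) = v"
        unfolding e_def using F(2) M by (intro from_nat_into_to_nat_on) auto
      then show "v \<in> e ` {..<n}" using n[OF v] by (metis image_eqI lessThan_iff)
    qed
    then have "s c \<in> fs.span (e ` {..<n})" by (rule subsetD[OF fs.span_mono F(3)])
    then show ?thesis ..
  qed
  then obtain N where N: "\<And>c. s c \<in> fs.span (e ` {..<N c})" by metis
  have "\<exists>n. infinite {c. N c = n}"
  proof (rule ccontr)
    assume "\<not> ?thesis"
    then have "countable (\<Union>n. {c. N c = n})" by (intro countable_UN) (auto intro: countable_finite)
    moreover have "(\<Union>n. {c. N c = n}) = UNIV" by auto
    ultimately show False using uncountable_UNIV_complex by simp
  qed
  then obtain n where "infinite {c. N c = n}" by blast
  then obtain C where C: "card C = Suc n" "finite C" "C \<subseteq> {c. N c = n}"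
    using infinite_arbitrarily_large by metis
  have sub: "s ` C \<subseteq> fs.span (e ` {..<n})" using N C(3) by auto
  have "\<exists>u. (\<exists>c\<in>C. u c \<noteq> 0) \<and> (\<forall>x. (\<Sum>c\<in>C. u c * s c x) = 0)"
  proof (cases "inj_on s C")
    case True
    have "fs.dependent (s ` C)"
    proof (rule ccontr)
      assume "\<not> ?thesis"
      then have "card (s ` C) \<le> card (e ` {..<n})"
        using fs.independent_span_bound[OF _ _ sub] by blast
      also have "\<dots> \<le> n" using card_image_le[of "{..<n}" e] by simp
      finally show False using True C by (simp add: card_image)
    qed
    then obtain u where u: "\<exists>v\<in>s ` C. u v \<noteq> 0" "(\<Sum>v\<in>s ` C. fscale (u v) v) = 0"
      using C(2) by (subst (asm) fs.dependent_finite) auto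
    have "(\<Sum>c\<in>C. u (s c) * s c x) = 0" for x
      using fun_cong[OF u(2), of x] by (simp add: sum.reindex[OF True] sum_fun_apply fscale_def)
    then show ?thesis using u(1) by (intro exI[of _ "u \<circ> s"]) auto
  next
    case False
    then obtain c d where cd: "c \<in> C" "d \<in> C" "c \<noteq> d" "s c = s d" by (auto simp: inj_on_def)
    have "(\<Sum>k\<in>C. ((if k = c then 1 else 0) - (if k = d then 1 else 0)) * s k x) = 0" for x
      using cd C(2) by (simp add: left_diff_distrib sum_subtractf if_distrib[of "\<lambda>c. c * _"] cong: if_cong)
    then show ?thesis
      using cd by (intro exI[of _ "\<lambda>k. (if k = c then 1 else 0) - (if k = d then 1 else 0)"]) auto
  qed
  then show thesis using that[OF C(2)] by blast
qed

section \<open>Maximal ideals in algebras of functions\<close>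

definition proper_ideal :: "('x \<Rightarrow> complex) set \<Rightarrow> ('x \<Rightarrow> complex) set \<Rightarrow> bool" where
  "proper_ideal R J \<longleftrightarrow> J \<subseteq> R \<and> (\<lambda>_. 0) \<in> J \<and> (\<lambda>_. 1) \<notin> J \<and>
     (\<forall>f\<in>J. \<forall>g\<in>J. (\<lambda>x. f x + g x) \<in> J) \<and> (\<forall>f\<in>J. \<forall>r\<in>R. (\<lambda>x. r x * f x) \<in> J)"

lemma maximal_proper_ideal:
  assumes "proper_ideal R J"
  shows "\<exists>M. proper_ideal R M \<and> J \<subseteq> M \<and> (\<forall>M'. proper_ideal R M' \<longrightarrow> M \<subseteq> M' \<longrightarrow> M' = M)"
proof -
  let ?A = "{I. proper_ideal R I \<and> J \<subseteq> I}"
  have "\<exists>M\<in>?A. \<forall>I\<in>?A. M \<subseteq> I \<longrightarrow> I = M"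
  proof (rule subset_Zorn_nonempty)
    show "?A \<noteq> {}" using assms by auto
    fix C assume C: "C \<noteq> {}" "subset.chain ?A C"
    have P: "proper_ideal R I" "J \<subseteq> I" if "I \<in> C" for I
      using C(2) that by (auto simp: subset.chain_def)
    have "proper_ideal R (\<Union>C)"
      unfolding proper_ideal_def
    proof (intro conjI ballI)
      show "\<Union>C \<subseteq> R" by (rule Union_least) (use P(1) in \<open>simp add: proper_ideal_def\<close>)
      obtain I0 where "I0 \<in> C" using C(1) by blast
      moreover have "(\<lambda>_. 0) \<in> I0" using P(1)[OF \<open>I0 \<in> C\<close>] by (simp add: proper_ideal_def)
      ultimately show "(\<lambda>_. 0) \<in> \<Union>C" by blast
      show "(\<lambda>_. 1) \<notin> \<Union>C"
      proof
        assume "(\<lambda>_. 1) \<in> \<Union>C"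
        then obtain I where "I \<in> C" "(\<lambda>_. 1) \<in> I" by (rule UnionE)
        then show False using P(1)[of I] by (simp add: proper_ideal_def)
      qed
      fix f assume f: "f \<in> \<Union>C"
      show "(\<lambda>x. r x * f x) \<in> \<Union>C" if "r \<in> R" for r
      proof -
        obtain I where I: "I \<in> C" "f \<in> I" using f by (rule UnionE)
        then have "(\<lambda>x. r x * f x) \<in> I" using P(1)[OF I(1)] that by (simp add: proper_ideal_def)
        then show ?thesis using I(1) by (rule UnionI[rotated])
      qed
      fix g assume g: "g \<in> \<Union>C"
      obtain I I' where I: "I \<in> C" "f \<in> I" "I' \<in> C" "g \<in> I'" using f g by blast
      then have "I \<subseteq> I' \<or> I' \<subseteq> I" using C(2) unfolding subset_chain_def by blast
      then obtain I'' where "I'' \<in> C" "f \<in> I''" "g \<in> I''" using I by blast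
      then have "(\<lambda>x. f x + g x) \<in> I''" using P(1) by (simp add: proper_ideal_def)
      then show "(\<lambda>x. f x + g x) \<in> \<Union>C" using \<open>I'' \<in> C\<close> by (rule UnionI[rotated])
    qed
    then show "\<Union>C \<in> ?A" using P(2) C(1) by blast
  qed
  then obtain M where "M \<in> ?A" "\<forall>I\<in>?A. M \<subseteq> I \<longrightarrow> I = M" by blast
  then show ?thesis by blast
qed

lemma maximal_ideal_inverse:
  assumes M: "proper_ideal R M" and max: "\<And>M'. proper_ideal R M' \<Longrightarrow> M \<subseteq> M' \<Longrightarrow> M' = M"
    and R: "R = generated_algebra G" and r: "r \<in> R" "r \<notin> M"
  obtains s where "s \<in> R" "(\<lambda>x. 1 - r x * s x) \<in> M"
proof -
  have Md: "M \<subseteq> R" "(\<lambda>_. 0) \<in> M" "(\<lambda>_. 1) \<notin> M" "\<And>f g. f \<in> M \<Longrightarrow> g \<in> M \<Longrightarrow> (\<lambda>x. f x + g x) \<in> M"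
    "\<And>f r. f \<in> M \<Longrightarrow> r \<in> R \<Longrightarrow> (\<lambda>x. r x * f x) \<in> M"
    using M by (auto simp: proper_ideal_def)
  \<comment> \<open>The ideal generated by M and r is strictly larger than M, so by maximality it
    contains 1.\<close>
  let ?M = "{h. \<exists>m\<in>M. \<exists>s\<in>R. h = (\<lambda>x. m x + r x * s x)}"
  have sub: "M \<subseteq> ?M"
  proof
    fix m assume "m \<in> M"
    then show "m \<in> ?M"
      using generated_algebra.const[of 0 G] R by (intro CollectI bexI[of _ m] bexI[of _ "\<lambda>_. 0"]) auto
  qed
  have "r \<in> ?M"
    using generated_algebra.const[of 1 G] R Md(2) by (intro CollectI bexI[of _ "\<lambda>_. 0"] bexI[of _ "\<lambda>_. 1"]) auto
  then have 1: "\<not> proper_ideal R ?M" using max[OF _ sub] r(2) by blast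
  have 2: "?M \<subseteq> R"
  proof
    fix h assume "h \<in> ?M"
    then obtain m s where "m \<in> M" "s \<in> R" "h = (\<lambda>x. m x + r x * s x)" by blast
    then show "h \<in> R" using r(1) Md(1) ga_add ga_mult unfolding R by blast
  qed
  have 3: "(\<lambda>x. f x + g x) \<in> ?M" if fg: "f \<in> ?M" "g \<in> ?M" for f g
  proof -
    obtain m s m' s' where *: "m \<in> M" "s \<in> R" "f = (\<lambda>x. m x + r x * s x)" "m' \<in> M" "s' \<in> R" "g = (\<lambda>x. m' x + r x * s' x)"
      using fg by blast
    have "(\<lambda>x. f x + g x) = (\<lambda>x. (m x + m' x) + r x * (s x + s' x))" by (auto simp: * algebra_simps)
    moreover have "(\<lambda>x. s x + s' x) \<in> R" using * ga_add unfolding R by blast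
    ultimately show ?thesis
      using Md(4)[OF *(1,4)] by (intro CollectI bexI[of _ "\<lambda>x. m x + m' x"] bexI[of _ "\<lambda>x. s x + s' x"])
  qed
  have 4: "(\<lambda>x. t x * f x) \<in> ?M" if ft: "f \<in> ?M" "t \<in> R" for f t
  proof -
    obtain m s where *: "m \<in> M" "s \<in> R" "f = (\<lambda>x. m x + r x * s x)"
      using ft by blast
    have "(\<lambda>x. t x * f x) = (\<lambda>x. t x * m x + r x * (t x * s x))" by (auto simp: * algebra_simps)
    moreover have "(\<lambda>x. t x * s x) \<in> R" using * ft(2) ga_mult unfolding R by blast
    ultimately show ?thesis
      using Md(5)[OF *(1) ft(2)] by (intro CollectI bexI[of _ "\<lambda>x. t x * m x"] bexI[of _ "\<lambda>x. t x * s x"])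
  qed
  have 5: "(\<lambda>_. 0) \<in> ?M" using sub Md(2) by (rule subsetD)
  have "(\<lambda>_. 1) \<in> ?M"
  proof (rule ccontr)
    assume "(\<lambda>_. 1) \<notin> ?M"
    then have "proper_ideal R ?M"
      unfolding proper_ideal_def using 2 3 4 5 by (intro conjI ballI)
    then show False using 1 by (rule notE[rotated])
  qed
  then obtain m s where m: "m \<in> M" "s \<in> R" "(\<lambda>_. 1) = (\<lambda>x. m x + r x * s x)" by blast
  have "m = (\<lambda>x. 1 - r x * s x)"
  proof
    show "m x = 1 - r x * s x" for x using fun_cong[OF m(3), of x] by (simp add: algebra_simps)
  qed
  then show thesis using that m by blast
qed

text \<open>The residue field is C. Otherwise all r - c are invertible modulo M, and their inverses
  s c are an uncountable family in a space of countable dimension. Clearing denominators in a linear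
  relation between them yields a nonzero polynomial q with q(r) in M; but q(r) is modulo M a product
  of a constant and invertible linear factors.\<close>

lemma maximal_ideal_residue:
  assumes "countable G" and R: "R = generated_algebra G"
    and M: "proper_ideal R M" and max: "\<And>M'. proper_ideal R M' \<Longrightarrow> M \<subseteq> M' \<Longrightarrow> M' = M"
    and r: "r \<in> R"
  shows "\<exists>c. (\<lambda>x. r x - c) \<in> M"
proof (rule ccontr)
  assume no: "\<not> ?thesis"
  have Md: "M \<subseteq> R" "(\<lambda>_. 0) \<in> M" "(\<lambda>_. 1) \<notin> M" "\<And>f g. f \<in> M \<Longrightarrow> g \<in> M \<Longrightarrow> (\<lambda>x. f x + g x) \<in> M"
    "\<And>f r. f \<in> M \<Longrightarrow> r \<in> R \<Longrightarrow> (\<lambda>x. r x * f x) \<in> M"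
    using M by (auto simp: proper_ideal_def)
  have Rd: "\<And>c. (\<lambda>_. c) \<in> R" "\<And>f g. f \<in> R \<Longrightarrow> g \<in> R \<Longrightarrow> (\<lambda>x. f x + g x) \<in> R" "\<And>f g. f \<in> R \<Longrightarrow> g \<in> R \<Longrightarrow> (\<lambda>x. f x * g x) \<in> R"
    unfolding R by (rule generated_algebra.const, erule (1) ga_add, erule (1) ga_mult)
  have lin: "(\<lambda>x. r x - c) \<in> R" for c using Rd(2)[OF r Rd(1)[of "-c"]] by simp
  have Rprod: "(\<lambda>x. \<Prod>c\<in>C. r x - c) \<in> R" for C
    by (induction C rule: infinite_finite_induct) (auto intro: Rd(1) Rd(3)[OF lin])
  have "\<exists>s\<in>R. (\<lambda>x. 1 - (r x - c) * s x) \<in> M" for c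
    using maximal_ideal_inverse[OF M max R lin] no by metis
  then obtain s where s: "\<And>c. s c \<in> R" "\<And>c. (\<lambda>x. 1 - (r x - c) * s c x) \<in> M" by metis
  obtain B where B: "countable B" "R \<subseteq> fs.span B"
    using generated_algebra_countable_span[OF assms(1)] R by metis
  obtain C u where C: "finite C" "\<exists>c\<in>C. u c \<noteq> 0" "\<And>x. (\<Sum>c\<in>C. u c * s c x) = 0"
    using uncountable_family_dependent[OF B(1), of s] s(1) B(2) by blast
  have Msum: "(\<lambda>x. \<Sum>c\<in>D. h c x) \<in> M" if "\<And>c. c \<in> D \<Longrightarrow> h c \<in> M" for D :: "complex set" and h
    using that by (induction D rule: infinite_finite_induct) (auto intro: Md(2,4))
  \<comment> \<open>The numerator of the sum of the fractions u c / (t - c) over their common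
    denominator. It is nonzero because its value at c is nonzero whenever u c is.\<close>
  define q where "q = (\<Sum>c\<in>C. Polynomial.smult (u c) (\<Prod>d\<in>C - {c}. [:- d, 1:]))"
  have q_poly: "poly q t = (\<Sum>c\<in>C. u c * (\<Prod>d\<in>C - {c}. t - d))" for t
    by (simp add: q_def poly_sum poly_prod)
  obtain c where c: "c \<in> C" "u c \<noteq> 0" using C(2) by blast
  have "poly q c = (\<Sum>c'\<in>C. if c' = c then u c * (\<Prod>d\<in>C - {c}. c - d) else 0)"
    unfolding q_poly using C(1) c(1) by (intro sum.cong) (auto intro!: prod_zero)
  then have "poly q c = u c * (\<Prod>d\<in>C - {c}. c - d)" using C(1) c(1) by simp
  moreover have "(\<Prod>d\<in>C - {c}. c - d) \<noteq> 0" using C(1) by simp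
  ultimately have "q \<noteq> 0" using c(2) by auto
  moreover have "(\<lambda>x. poly q (r x)) \<in> M"
  proof -
    have "(\<lambda>x. \<Sum>c\<in>C. (u c * (\<Prod>d\<in>C - {c}. r x - d)) * (1 - (r x - c) * s c x)) \<in> M"
      by (intro Msum Md(5) s Rd(3)[OF Rd(1)] Rprod)
    moreover have "(\<Sum>c\<in>C. (u c * (\<Prod>d\<in>C - {c}. r x - d)) * (1 - (r x - c) * s c x)) = poly q (r x)" for x
    proof -
      have "(\<Sum>c\<in>C. (u c * (\<Prod>d\<in>C - {c}. r x - d)) * (1 - (r x - c) * s c x)) =
        poly q (r x) - (\<Sum>c\<in>C. ((r x - c) * (\<Prod>d\<in>C - {c}. r x - d)) * (u c * s c x))"
        unfolding q_poly sum_subtractf[symmetric] by (intro sum.cong) (simp_all add: algebra_simps)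
      also have "(\<Sum>c\<in>C. ((r x - c) * (\<Prod>d\<in>C - {c}. r x - d)) * (u c * s c x)) =
          (\<Prod>d\<in>C. r x - d) * (\<Sum>c\<in>C. u c * s c x)"
        unfolding sum_distrib_left using C(1) by (intro sum.cong refl) (simp add: prod.remove)
      finally show ?thesis by (simp add: C(3))
    qed
    ultimately show ?thesis by simp
  qed
  moreover have "(\<lambda>x. poly q (r x)) \<notin> M" if "q \<noteq> 0" for q
    using that
  proof (induction "degree q" arbitrary: q)
    case 0
    then obtain a where a: "q = [:a:]" by (metis degree_eq_zeroE)
    then have "a \<noteq> 0" using 0 by auto
    show ?case
    proof
      assume "(\<lambda>x. poly q (r x)) \<in> M"
      then have "(\<lambda>x. inverse a * poly q (r x)) \<in> M" by (rule Md(5)[OF _ Rd(1)])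
      then show False using Md(3) \<open>a \<noteq> 0\<close> by (simp add: a)
    qed
  next
    case (Suc d)
    obtain a where a: "poly q a = 0"
      using Suc.hyps(2) fundamental_theorem_of_algebra_alt[of q] by (metis degree_pCons_0 nat.distinct(1))
    then obtain q' where q': "q = [:- a, 1:] * q'" by (metis dvdE poly_eq_0_iff_dvd)
    then have "q' \<noteq> 0" using Suc.prems(1) by auto
    then have deg: "degree q = Suc (degree q')" unfolding q' by (subst degree_mult_eq) auto
    have IH: "(\<lambda>x. poly q' (r x)) \<notin> M" using Suc.hyps(1)[of q'] Suc.hyps(2) deg \<open>q' \<noteq> 0\<close> by simp
    have q'R: "(\<lambda>x. poly p (r x)) \<in> R" for p
      by (induction p) (simp_all add: Rd r)
    show ?case
    proof
      assume "(\<lambda>x. poly q (r x)) \<in> M"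
      then have "(\<lambda>x. s a x * poly q (r x)) \<in> M" by (rule Md(5)[OF _ s(1)])
      moreover have "(\<lambda>x. poly q' (r x) * (1 - (r x - a) * s a x)) \<in> M"
        by (rule Md(5)[OF s(2) q'R])
      ultimately have "(\<lambda>x. s a x * poly q (r x) + poly q' (r x) * (1 - (r x - a) * s a x)) \<in> M"
        by (rule Md(4))
      moreover have "s a x * poly q (r x) + poly q' (r x) * (1 - (r x - a) * s a x) = poly q' (r x)" for x
        by (simp add: q' algebra_simps)
      ultimately show False using IH by simp
    qed
  qed
  ultimately show False by blast
qed

text \<open>Each coordinate is congruent to a constant modulo a maximal ideal M that contains J.
  These constants form a point p0, every polynomial is congruent to its value at p0, and an element
  of J cannot have a nonzero value there because M is proper.\<close>

theorem nullstellensatz: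
  assumes "finite K" and J: "proper_ideal (generated_algebra {\<lambda>p. p k | k. k \<in> K}) J"
  shows "\<exists>p :: 'k \<Rightarrow> complex. \<forall>f\<in>J. f p = 0"
proof -
  let ?G = "{\<lambda>p :: 'k \<Rightarrow> complex. p k | k. k \<in> K}"
  let ?R = "generated_algebra ?G"
  have G: "countable ?G"
  proof -
    have "?G = (\<lambda>k p. p k) ` K" by auto
    then show ?thesis using assms(1) by (simp add: countable_finite)
  qed
  from maximal_proper_ideal[OF J] obtain M
    where "proper_ideal ?R M \<and> J \<subseteq> M \<and> (\<forall>M'. proper_ideal ?R M' \<longrightarrow> M \<subseteq> M' \<longrightarrow> M' = M)"
    by (rule exE)
  then have M: "proper_ideal ?R M" "J \<subseteq> M" "\<And>M'. proper_ideal ?R M' \<Longrightarrow> M \<subseteq> M' \<Longrightarrow> M' = M"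
    by simp_all
  have Md: "M \<subseteq> ?R" "(\<lambda>_. 0) \<in> M" "(\<lambda>_. 1) \<notin> M" "\<And>f g. f \<in> M \<Longrightarrow> g \<in> M \<Longrightarrow> (\<lambda>x. f x + g x) \<in> M"
    "\<And>f r. f \<in> M \<Longrightarrow> r \<in> ?R \<Longrightarrow> (\<lambda>x. r x * f x) \<in> M"
    using M(1) by (auto simp: proper_ideal_def)
  have "\<forall>k\<in>K. \<exists>c. (\<lambda>p. p k - c) \<in> M"
  proof
    fix k assume "k \<in> K"
    then have k: "(\<lambda>p. p k) \<in> ?R" by (intro generated_algebra.gen) blast
    show "\<exists>c. (\<lambda>p. p k - c) \<in> M"
      by (rule maximal_ideal_residue[OF G refl M(1) _ k]) (rule M(3))
  qed
  from bchoice[OF this] obtain p0 where "\<forall>k\<in>K. (\<lambda>p. p k - p0 k) \<in> M" by (rule exE)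
  then have p0: "\<And>k. k \<in> K \<Longrightarrow> (\<lambda>p. p k - p0 k) \<in> M" by (rule bspec)
  have "(\<lambda>p. f p - f p0) \<in> M" if "f \<in> ?R" for f
    using that
  proof induction
    case (const c)
    then show ?case using Md(2) by simp
  next
    case (gen f)
    then show ?case using p0 by auto
  next
    case (add f g)
    from Md(4)[OF add.IH] show ?case by (simp add: algebra_simps)
  next
    case (mult f g)
    have "(\<lambda>p. f p * (g p - g p0) + g p0 * (f p - f p0)) \<in> M"
      by (intro Md(4) Md(5) mult generated_algebra.const)
    then show ?case by (simp add: algebra_simps)
  qed
  then have *: "(\<lambda>p. f p - f p0) \<in> M" if "f \<in> J" for f using that M(2) Md(1) by blast
  have "f p0 = 0" if f: "f \<in> J" for f
  proof (rule ccontr)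
    assume nz: "f p0 \<noteq> 0"
    have "(\<lambda>p. inverse (f p0) * f p + (- inverse (f p0)) * (f p - f p0)) \<in> M"
      using f M(2) *[OF f] by (intro Md(4) Md(5) generated_algebra.const) auto
    moreover have "inverse (f p0) * f p + (- inverse (f p0)) * (f p - f p0) = 1" for p
      using nz by (simp add: algebra_simps)
    ultimately show False using Md(3) by simp
  qed
  then show ?thesis by blast
qed

section \<open>Invariants of the representation variety\<close>

definition dmat :: "('n \<Rightarrow> complex) \<Rightarrow> complex^'n^'n::finite" where
  "dmat d = (\<chi> i j. if i = j then d i else 0)"

definition diagrep :: "('n \<Rightarrow> 'a \<Rightarrow> complex) \<Rightarrow> 'a \<Rightarrow> complex^'n^'n::finite" where
  "diagrep w = (\<lambda>x. dmat (\<lambda>i. w i x))"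

lemma dmat_mult_left: "(dmat d ** M) $ i $ j = d i * M $ i $ j"
  by (simp add: dmat_def matrix_matrix_mult_def if_distrib[of "\<lambda>c. c * _"] cong: if_cong)

lemma dmat_mult_right: "(M ** dmat d) $ i $ j = M $ i $ j * d j"
  by (simp add: dmat_def matrix_matrix_mult_def if_distrib[of "\<lambda>c. _ * c"] cong: if_cong)

lemma dmat_mult: "dmat d ** dmat e = dmat (\<lambda>i. d i * e i)"
  by (simp add: vec_eq_iff dmat_mult_left) (simp add: dmat_def)

lemma dmat_one: "dmat (\<lambda>_. 1) = mat 1"
  by (simp add: dmat_def mat_def)

lemma det_dmat: "det (dmat d) = (\<Prod>i\<in>UNIV. d i)"
  by (subst det_diagonal) (simp_all add: dmat_def)

lemma matrix_mult_scale:
  fixes A B :: "complex^'n^'n"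
  shows "A ** (\<chi> i j. c * B $ i $ j) = (\<chi> i j. c * (A ** B) $ i $ j)"
    and "(\<chi> i j. c * B $ i $ j) ** A = (\<chi> i j. c * (B ** A) $ i $ j)"
  by (simp_all add: matrix_matrix_mult_def vec_eq_iff sum_distrib_left mult_ac)

lemma matrix_mult_diff:
  fixes A B C :: "complex^'n^'n"
  shows "A ** (B - C) = A ** B - A ** C" and "(B - C) ** A = B ** A - C ** A"
  by (simp_all add: matrix_matrix_mult_def vec_eq_iff algebra_simps sum_subtractf)

lemma conjugation_mult:
  fixes g A B :: "complex^'n^'n"
  assumes "invertible g"
  shows "(g ** A ** matrix_inv g) ** (g ** B ** matrix_inv g) = g ** (A ** B) ** matrix_inv g"
proof -
  have "(g ** A ** matrix_inv g) ** (g ** B ** matrix_inv g) = g ** A ** (matrix_inv g ** g) ** B ** matrix_inv g"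
    by (simp only: matrix_mul_assoc)
  then show ?thesis using matrix_inv_mult(2)[OF assms] by (simp add: matrix_mul_assoc)
qed

lemma det_conjugation:
  fixes g A :: "complex^'n^'n"
  assumes "invertible g"
  shows "det (g ** A ** matrix_inv g) = det A"
proof -
  have "det g * det (matrix_inv g) = 1"
    using matrix_inv_mult(1)[OF assms] by (metis det_I det_mul)
  then show ?thesis by (simp add: det_mul)
qed

lemma diagrep_permutation:
  fixes \<sigma> :: "'n::finite \<Rightarrow> 'n"
  assumes \<sigma>: "bij \<sigma>"
  obtains g where "invertible g" "\<And>w :: 'n \<Rightarrow> 'a \<Rightarrow> complex. conjugate g (diagrep w) = diagrep (\<lambda>i. w (\<sigma> i))"
proof -
  let ?P = "\<chi> i j. if j = \<sigma> i then 1 else 0 :: complex^'n^'n"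
  let ?Q = "\<chi> i j. if i = \<sigma> j then 1 else 0 :: complex^'n^'n"
  have left: "(?P ** M) $ i $ j = M $ (\<sigma> i) $ j" for M :: "complex^'n^'n" and i j
    by (simp add: matrix_matrix_mult_def if_distrib[of "\<lambda>c. c * _"] cong: if_cong)
  have right: "(M ** ?Q) $ i $ j = M $ i $ (\<sigma> j)" for M :: "complex^'n^'n" and i j
    by (simp add: matrix_matrix_mult_def if_distrib[of "\<lambda>c. _ * c"] cong: if_cong)
  have PQ: "?P ** ?Q = mat 1"
    by (simp only: vec_eq_iff left) (use bij_is_inj[OF \<sigma>] in \<open>auto simp: mat_def inj_def\<close>)
  then have QP: "?Q ** ?P = mat 1" by (simp only: matrix_left_right_inverse)
  have "invertible ?P" unfolding invertible_def using PQ QP by blast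
  moreover have "conjugate ?P (diagrep w) = diagrep (\<lambda>i. w (\<sigma> i))" for w :: "'n \<Rightarrow> 'a \<Rightarrow> complex"
  proof
    fix x
    show "conjugate ?P (diagrep w) x = diagrep (\<lambda>i. w (\<sigma> i)) x"
      unfolding conjugate_def matrix_inv_eqI[OF PQ QP] vec_eq_iff right left
      using bij_is_inj[OF \<sigma>] by (simp add: diagrep_def dmat_def inj_eq)
  qed
  ultimately show thesis by (rule that)
qed

text \<open>Interpolation: each point of F contributes a linear factor in a coordinate that
  distinguishes it from u, scaled to take the value 1 at u.\<close>

lemma ex_separating_polynomial:
  fixes u :: "'b \<Rightarrow> complex"
  assumes "finite F" "\<And>v. v \<in> F \<Longrightarrow> \<exists>b\<in>B. v b \<noteq> u b"
  shows "\<exists>g\<in>generated_algebra {\<lambda>p. p b | b. b \<in> B}. g u = 1 \<and> (\<forall>v\<in>F. g v = 0)"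
proof -
  have "\<forall>v\<in>F. \<exists>b. b \<in> B \<and> v b \<noteq> u b" using assms(2) by blast
  from bchoice[OF this] obtain b where b: "\<forall>v\<in>F. b v \<in> B \<and> v (b v) \<noteq> u (b v)" by (rule exE)
  let ?g = "\<lambda>p. \<Prod>v\<in>F. (p (b v) + (- v (b v))) * inverse (u (b v) - v (b v))"
  have "?g \<in> generated_algebra {\<lambda>p. p b | b. b \<in> B}"
    by (intro ga_prod ga_mult ga_add generated_algebra.const generated_algebra.gen) (use b in blast)
  moreover have "?g u = 1" by (rule prod.neutral) (use b in auto)
  moreover have "\<forall>v\<in>F. ?g v = 0" using assms(1) by (auto simp: prod_zero_iff)
  ultimately show ?thesis by (intro bexI[of _ ?g] conjI)
qed

section \<open>Invariant polynomials and their values at diagonal representations\<close>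

context lie_setting
begin

lemma conjugate_lie_homs:
  assumes "\<rho> \<in> lie_homs smul bracket" "invertible g"
  shows "conjugate g \<rho> \<in> lie_homs smul bracket"
  using assms(1) unfolding lie_homs_def conjugate_def
  by (simp add: conjugation_mult[OF assms(2)] matrix_add_ldistrib matrix_add_rdistrib matrix_mult_diff matrix_mult_scale)

lemma diagrep_lie_homs:
  assumes "\<And>i. character (w i)"
  shows "diagrep w \<in> lie_homs smul bracket"
  using assms
  by (simp add: lie_homs_def diagrep_def dmat_mult mult.commute character_def additive_functional_def)
    (simp add: dmat_def vec_eq_iff)

text \<open>Polynomial representatives of invariants. Invariance is demanded at homomorphisms only,
  as the ring of functions on the representation variety sees nothing else.\<close>

definition invariant_poly :: "(('a \<Rightarrow> complex^'n^'n::finite) \<Rightarrow> complex) \<Rightarrow> bool" where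
  "invariant_poly q \<longleftrightarrow> q \<in> generated_algebra hom_coordinates \<and>
     (\<forall>g. invertible g \<longrightarrow> (\<forall>\<rho>\<in>lie_homs smul bracket. q (conjugate g \<rho>) = q \<rho>))"

lemma invariants_eq: "invariants (lie_homs smul bracket) = on_set (lie_homs smul bracket) ` Collect invariant_poly"
proof (intro equalityI subsetI)
  fix f assume f: "f \<in> invariants (lie_homs smul bracket :: ('a \<Rightarrow> complex^'n^'n) set)"
  then obtain q where q: "q \<in> generated_algebra hom_coordinates" "f = on_set (lie_homs smul bracket) q"
    unfolding invariants_def by blast
  have "q (conjugate g \<rho>) = q \<rho>" if "invertible g" "\<rho> \<in> lie_homs smul bracket" for g \<rho>
  proof -
    have "f (conjugate g \<rho>) = f \<rho>" using f that unfolding invariants_def by blast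
    then show ?thesis using conjugate_lie_homs[OF that(2,1)] that(2) by (simp add: q(2) on_set_def)
  qed
  then have "invariant_poly q" using q(1) by (simp add: invariant_poly_def)
  then show "f \<in> on_set (lie_homs smul bracket) ` Collect invariant_poly" using q(2) by blast
next
  fix f assume "f \<in> on_set (lie_homs smul bracket :: ('a \<Rightarrow> complex^'n^'n) set) ` Collect invariant_poly"
  then obtain q where q: "invariant_poly q" "f = on_set (lie_homs smul bracket) q" by blast
  have "f (conjugate g \<rho>) = f \<rho>" if "invertible g" "\<rho> \<in> lie_homs smul bracket" for g \<rho>
  proof -
    have "q (conjugate g \<rho>) = q \<rho>" using q(1) that by (simp add: invariant_poly_def)
    then show ?thesis using conjugate_lie_homs[OF that(2,1)] that(2) by (simp add: q(2) on_set_def)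
  qed
  then show "f \<in> invariants (lie_homs smul bracket)"
    using q unfolding invariants_def invariant_poly_def by blast
qed

lemma invariant_poly_const: "invariant_poly (\<lambda>_. c)"
  by (simp add: invariant_poly_def generated_algebra.const)

lemma invariant_poly_add: "invariant_poly q \<Longrightarrow> invariant_poly q' \<Longrightarrow> invariant_poly (\<lambda>\<rho>. q \<rho> + q' \<rho>)"
  by (simp add: invariant_poly_def ga_add)

lemma invariant_poly_mult: "invariant_poly q \<Longrightarrow> invariant_poly q' \<Longrightarrow> invariant_poly (\<lambda>\<rho>. q \<rho> * q' \<rho>)"
  by (simp add: invariant_poly_def ga_mult)

lemma invariant_poly_sum: "(\<And>i. i \<in> I \<Longrightarrow> invariant_poly (q i)) \<Longrightarrow> invariant_poly (\<lambda>\<rho>. \<Sum>i\<in>I. q i \<rho>)"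
  by (induction I rule: infinite_finite_induct) (auto intro: invariant_poly_const invariant_poly_add)

lemma invariant_poly_permutation:
  fixes w :: "'n::finite \<Rightarrow> 'a \<Rightarrow> complex"
  assumes "invariant_poly q" "bij \<sigma>" "\<And>i. character (w i)"
  shows "q (diagrep (\<lambda>i. w (\<sigma> i))) = q (diagrep w)"
proof -
  obtain g where g: "invertible g" "\<And>w :: 'n \<Rightarrow> 'a \<Rightarrow> complex. conjugate g (diagrep w) = diagrep (\<lambda>i. w (\<sigma> i))"
    using diagrep_permutation[OF assms(2)] by blast
  have "q (conjugate g (diagrep w)) = q (diagrep w)"
    using assms(1) g(1) diagrep_lie_homs[of w, OF assms(3)] unfolding invariant_poly_def by blast
  then show ?thesis by (simp only: g(2))
qed

text \<open>In the basis of a normal form, the one-parameter group of the diagonal matrices with entries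
  \<open>t ^ r i\<close> contracts the representation to its diagonal part.\<close>

lemma invariant_poly_degeneration:
  fixes \<rho> :: "'a \<Rightarrow> complex^'n::finite^'n"
  assumes q: "invariant_poly q" and \<rho>: "\<rho> \<in> lie_homs smul bracket" and nf: "normal_form \<rho> S w r"
  shows "q \<rho> = q (diagrep w)"
proof -
  let ?M = "\<lambda>x. matrix_inv S ** \<rho> x ** S"
  have S: "invertible S" and diag: "\<And>x i. ?M x $ i $ i = w i x"
    and off: "\<And>x i j. i \<noteq> j \<Longrightarrow> ?M x $ i $ j \<noteq> 0 \<Longrightarrow> r i < r j"
    using nf by (simp_all add: normal_form_def)
  \<comment> \<open>For t \<noteq> 0 this is a conjugate of \<rho>. Off-diagonal entries vanish
    unless r i < r j, so the truncated difference of the exponents is harmless and the family is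
    polynomial in t up to t = 0.\<close>
  define c where "c t x = (\<chi> i j. if i = j then w i x else t ^ (r j - r i) * ?M x $ i $ j)" for t x
  have c0: "c 0 = diagrep w"
  proof
    show "c 0 x = diagrep w x" for x
      using off[of _ _ x] by (force simp: vec_eq_iff c_def diagrep_def dmat_def power_0_left)
  qed
  have ct: "q (c t) = q \<rho>" if t: "t \<noteq> 0" for t
  proof -
    let ?g = "dmat (\<lambda>i. inverse (t ^ r i)) ** matrix_inv S"
    let ?h = "S ** dmat (\<lambda>i. t ^ r i)"
    have d: "dmat (\<lambda>i. inverse (t ^ r i)) ** dmat (\<lambda>i. t ^ r i) = mat 1"
      using t by (simp add: dmat_mult dmat_one[symmetric])
    have "?g ** ?h = dmat (\<lambda>i. inverse (t ^ r i)) ** (matrix_inv S ** S) ** dmat (\<lambda>i. t ^ r i)"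
      by (simp only: matrix_mul_assoc)
    then have gh: "?g ** ?h = mat 1" using d matrix_inv_mult(2)[OF S] by simp
    then have hg: "?h ** ?g = mat 1" by (simp only: matrix_left_right_inverse)
    have "invertible ?g" unfolding invertible_def using gh hg by blast
    moreover have "conjugate ?g \<rho> = c t"
    proof
      fix x
      have "conjugate ?g \<rho> x = dmat (\<lambda>i. inverse (t ^ r i)) ** ?M x ** dmat (\<lambda>i. t ^ r i)"
        unfolding conjugate_def matrix_inv_eqI[OF gh hg] by (simp only: matrix_mul_assoc)
      moreover have "inverse (t ^ r i) * ?M x $ i $ j * t ^ r j = c t x $ i $ j" for i j
      proof (cases "i = j \<or> ?M x $ i $ j = 0")
        case True
        then show ?thesis using t diag[of x] by (auto simp: c_def)
      next
        case False
        then have "r i < r j" using off by blast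
        then have "t ^ r j = t ^ r i * t ^ (r j - r i)" by (simp flip: power_add)
        then show ?thesis using False t by (simp add: c_def)
      qed
      ultimately show "conjugate ?g \<rho> x = c t x"
        by (simp add: vec_eq_iff dmat_mult_right dmat_mult_left)
    qed
    ultimately show ?thesis using q \<rho> unfolding invariant_poly_def by metis
  qed
  have "polyf (\<lambda>t. q (c t))"
  proof (rule polyf_generated_algebra[where f = q and c = c])
    show "q \<in> generated_algebra hom_coordinates" using q by (simp add: invariant_poly_def)
    fix g :: "('a \<Rightarrow> complex^'n^'n) \<Rightarrow> complex" assume "g \<in> hom_coordinates"
    then obtain x i j where g: "g = (\<lambda>\<rho>. \<rho> x $ i $ j)" by (auto simp: hom_coordinates_def)
    show "polyf (\<lambda>t. g (c t))"
      by (cases "i = j") (simp_all add: g c_def polyf_const polyf_mult polyf_power polyf_id)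
  qed
  then have "polyf (\<lambda>t. q (c t) + (- q \<rho>))" by (rule polyf_add[OF _ polyf_const])
  moreover have "infinite (- {0 :: complex})"
    using infinite_UNIV_char_0[where 'a = complex] by (simp add: Compl_eq_Diff_UNIV)
  ultimately have "q (c 0) + (- q \<rho>) = 0"
    using ct polyf_zero[where h = "\<lambda>t. q (c t) + (- q \<rho>)" and S = "- {0}" and t = 0] by simp
  then show ?thesis by (simp add: c0)
qed

text \<open>F is f with the matrices \<rho> b in place of the variables. These need not commute, so
  F depends on the way in which f is built from the variables; equivariance and the values at
  diagonal representations hold for each choice.\<close>

lemma equivariant_lift:
  assumes "f \<in> generated_algebra {\<lambda>p. p b | b. b \<in> B}"
  shows "\<exists>F :: ('a \<Rightarrow> complex^'n::finite^'n) \<Rightarrow> complex^'n^'n.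
    (\<forall>i j. (\<lambda>\<rho>. F \<rho> $ i $ j) \<in> generated_algebra hom_coordinates) \<and>
    (\<forall>g \<rho>. invertible g \<longrightarrow> F (conjugate g \<rho>) = g ** F \<rho> ** matrix_inv g) \<and>
    (\<forall>w. F (diagrep w) = dmat (\<lambda>i. f (w i)))"
  using assms
proof induction
  case (const c)
  have s: "dmat (\<lambda>_. c) = (\<chi> i j. c * mat 1 $ i $ j)" by (simp add: dmat_def mat_def vec_eq_iff)
  have "g ** dmat (\<lambda>_. c) ** matrix_inv g = dmat (\<lambda>_. c)" if "invertible g" for g :: "complex^'n^'n"
    unfolding s by (simp add: matrix_mult_scale matrix_inv_mult(1)[OF that])
  then show ?case by (intro exI[of _ "\<lambda>_. dmat (\<lambda>_. c)"]) (simp add: generated_algebra.const)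
next
  case (gen f)
  then obtain b where "f = (\<lambda>p. p b)" by blast
  then show ?case
    by (intro exI[of _ "\<lambda>\<rho>. \<rho> b"]) (auto simp: conjugate_def diagrep_def hom_coordinates_def intro: generated_algebra.gen)
next
  case (add f f')
  from add.IH(1) obtain F :: "('a \<Rightarrow> complex^'n^'n) \<Rightarrow> complex^'n^'n" where
    F: "\<forall>i j. (\<lambda>\<rho>. F \<rho> $ i $ j) \<in> generated_algebra hom_coordinates"
    "\<forall>g \<rho>. invertible g \<longrightarrow> F (conjugate g \<rho>) = g ** F \<rho> ** matrix_inv g"
    "\<forall>w. F (diagrep w) = dmat (\<lambda>i. f (w i))" by (elim exE conjE)
  from add.IH(2) obtain F' :: "('a \<Rightarrow> complex^'n^'n) \<Rightarrow> complex^'n^'n" where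
    F': "\<forall>i j. (\<lambda>\<rho>. F' \<rho> $ i $ j) \<in> generated_algebra hom_coordinates"
    "\<forall>g \<rho>. invertible g \<longrightarrow> F' (conjugate g \<rho>) = g ** F' \<rho> ** matrix_inv g"
    "\<forall>w. F' (diagrep w) = dmat (\<lambda>i. f' (w i))" by (elim exE conjE)
  show ?case
    by (intro exI[of _ "\<lambda>\<rho>. F \<rho> + F' \<rho>"] conjI)
      (simp_all add: F F' ga_add matrix_add_ldistrib matrix_add_rdistrib, simp add: dmat_def vec_eq_iff)
next
  case (mult f f')
  from mult.IH(1) obtain F :: "('a \<Rightarrow> complex^'n^'n) \<Rightarrow> complex^'n^'n" where
    F: "\<forall>i j. (\<lambda>\<rho>. F \<rho> $ i $ j) \<in> generated_algebra hom_coordinates"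
    "\<forall>g \<rho>. invertible g \<longrightarrow> F (conjugate g \<rho>) = g ** F \<rho> ** matrix_inv g"
    "\<forall>w. F (diagrep w) = dmat (\<lambda>i. f (w i))" by (elim exE conjE)
  from mult.IH(2) obtain F' :: "('a \<Rightarrow> complex^'n^'n) \<Rightarrow> complex^'n^'n" where
    F': "\<forall>i j. (\<lambda>\<rho>. F' \<rho> $ i $ j) \<in> generated_algebra hom_coordinates"
    "\<forall>g \<rho>. invertible g \<longrightarrow> F' (conjugate g \<rho>) = g ** F' \<rho> ** matrix_inv g"
    "\<forall>w. F' (diagrep w) = dmat (\<lambda>i. f' (w i))" by (elim exE conjE)
  have "(\<lambda>\<rho>. (F \<rho> ** F' \<rho>) $ i $ j) \<in> generated_algebra hom_coordinates" for i j
    unfolding matrix_matrix_mult_def vec_lambda_beta using F(1) F'(1) by (intro ga_sum ga_mult) auto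
  then show ?case
    by (intro exI[of _ "\<lambda>\<rho>. F \<rho> ** F' \<rho>"]) (simp add: F F' conjugation_mult dmat_mult)
qed

lemma norm_invariant:
  assumes "f \<in> generated_algebra {\<lambda>p. p b | b. b \<in> B}"
  shows "\<exists>q :: ('a \<Rightarrow> complex^'n::finite^'n) \<Rightarrow> complex.
    invariant_poly q \<and> (\<forall>w. q (diagrep w) = (\<Prod>i\<in>UNIV. f (w i)))"
proof -
  from equivariant_lift[OF assms] obtain F :: "('a \<Rightarrow> complex^'n^'n) \<Rightarrow> complex^'n^'n" where
    F: "\<forall>i j. (\<lambda>\<rho>. F \<rho> $ i $ j) \<in> generated_algebra hom_coordinates"
    "\<forall>g \<rho>. invertible g \<longrightarrow> F (conjugate g \<rho>) = g ** F \<rho> ** matrix_inv g"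
    "\<forall>w. F (diagrep w) = dmat (\<lambda>i. f (w i))" by (elim exE conjE)
  have "(\<lambda>\<rho>. det (F \<rho>)) \<in> generated_algebra hom_coordinates" by (rule ga_det) (use F(1) in blast)
  then show ?thesis
    by (intro exI[of _ "\<lambda>\<rho>. det (F \<rho>)"]) (simp add: invariant_poly_def F(2,3) det_conjugation det_dmat)
qed

lemma functional_basis_expansion:
  assumes "additive_functional \<phi>"
  shows "(\<Sum>b\<in>B. representation B x b * \<phi> b) = \<phi> x"
  using functional_sum[OF assms, of "representation B x" "\<lambda>b. b" B]
    sum_representation_eq[OF independent_Basis, of x B] by (simp add: span_Basis finite_Basis)

lemma functional_eqI:
  assumes "additive_functional \<phi>" "additive_functional \<psi>" "\<And>b. b \<in> B \<Longrightarrow> \<phi> b = \<psi> b"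
  shows "\<phi> = \<psi>"
proof
  show "\<phi> x = \<psi> x" for x
    using functional_basis_expansion[OF assms(1), of x] functional_basis_expansion[OF assms(2), of x] assms(3) by simp
qed

text \<open>If \<open>f\<close> takes the value 2 at \<open>v\<close> and 1 at all other weights, the norm of \<open>f\<close> is 2 to the
  multiplicity of \<open>v\<close>.\<close>

lemma invariants_determine_weights:
  fixes w w' :: "'n::finite \<Rightarrow> 'a \<Rightarrow> complex"
  assumes w: "\<And>i. additive_functional (w i)" "\<And>i. additive_functional (w' i)"
    and eq: "\<And>q. invariant_poly q \<Longrightarrow> q (diagrep w) = q (diagrep w')"
  shows "\<exists>\<sigma>. bij \<sigma> \<and> (\<forall>i. w i = w' (\<sigma> i))"
proof -
  have mult: "card {i\<in>UNIV. w i = v} = card {i\<in>UNIV. w' i = v}" if v: "additive_functional v" for v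
  proof -
    let ?F = "(range w \<union> range w') - {v}"
    have "\<exists>b\<in>B. u b \<noteq> v b" if "u \<in> ?F" for u
    proof (rule ccontr)
      assume "\<not> ?thesis"
      moreover have "additive_functional u" using that w by blast
      ultimately have "u = v" using v by (intro functional_eqI) blast+
      then show False using that by blast
    qed
    moreover have "finite ?F" by simp
    ultimately obtain g where g: "g \<in> generated_algebra {\<lambda>p. p b | b. b \<in> B}" "g v = 1" "\<forall>u\<in>?F. g u = 0"
      using ex_separating_polynomial[of ?F B v] by blast
    have "(\<lambda>p. 1 + g p) \<in> generated_algebra {\<lambda>p. p b | b. b \<in> B}"
      by (intro ga_add generated_algebra.const g(1))
    from norm_invariant[OF this] obtain q :: "('a \<Rightarrow> complex^'n^'n) \<Rightarrow> complex"
      where q: "invariant_poly q" "\<forall>w. q (diagrep w) = (\<Prod>i\<in>UNIV. 1 + g (w i))" by (elim exE conjE)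
    have val: "q (diagrep u) = 2 ^ card {i\<in>UNIV. u i = v}" if "range u \<subseteq> range w \<union> range w'" for u
    proof -
      have "1 + g (u i) = (if u i = v then 2 else 1)" for i
      proof (cases "u i = v")
        case False
        then have "u i \<in> ?F" using that by blast
        then show ?thesis using g(3) False by simp
      qed (simp add: g(2))
      then have "q (diagrep u) = (\<Prod>i\<in>UNIV. if u i = v then 2 else 1)" using q(2) by simp
      also have "\<dots> = 2 ^ card {i\<in>UNIV. u i = v}" by (simp add: prod.If_cases)
      finally show ?thesis .
    qed
    have "(2::complex) ^ card {i\<in>UNIV. w i = v} = 2 ^ card {i\<in>UNIV. w' i = v}"
      using eq[OF q(1)] val[of w] val[of w'] by simp
    then have "(2::nat) ^ card {i\<in>UNIV. w i = v} = 2 ^ card {i\<in>UNIV. w' i = v}"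
      by (simp flip: of_nat_eq_iff[where 'a = complex])
    then show ?thesis by simp
  qed
  have "image_mset w (mset_set UNIV) = image_mset w' (mset_set UNIV)"
  proof (rule multiset_eqI)
    fix v
    have "card {i\<in>UNIV. w i = v} = card {i\<in>UNIV. w' i = v}"
    proof (cases "additive_functional v")
      case False
      then have "{i\<in>UNIV. w i = v} = {}" "{i\<in>UNIV. w' i = v} = {}" using w by auto
      then show ?thesis by simp
    qed (rule mult)
    then show "count (image_mset w (mset_set UNIV)) v = count (image_mset w' (mset_set UNIV)) v"
      by (simp add: count_image_mset_eq_card_vimage)
  qed
  from image_mset_eq_implies_permutes[OF _ this] obtain \<sigma> where
    "\<sigma> permutes UNIV" "\<forall>x\<in>UNIV. w x = w' (\<sigma> x)" by auto
  then show ?thesis using permutes_bij by blast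
qed

end

section \<open>The points of the quotient\<close>

text \<open>Expansion of the product over A of the factors - 1 + 1.\<close>

lemma sum_signed_subsets:
  assumes "finite A"
  shows "(\<Sum>C\<in>Pow A. (- 1) ^ card C) = (if A = {} then 1 else 0 :: complex)"
proof -
  have "(\<Prod>x\<in>A. - 1 + 1 :: complex) = (\<Sum>C\<in>Pow A. (\<Prod>x\<in>C. - 1) * (\<Prod>x\<in>A - C. 1))"
    by (rule prod_add[OF assms])
  then show ?thesis using assms by (auto simp: power_0_left)
qed

text \<open>Inclusion and exclusion over the sets C of rows that a map \<tau> misses leaves the
  surjective maps, which are the permutations. The right-hand side contains products of one and the
  same function of j, which is the shape of a norm.\<close>

lemma permanent_ryser:
  fixes a :: "'n::finite \<Rightarrow> 'n \<Rightarrow> complex"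
  shows "(\<Sum>\<sigma> | \<sigma> permutes UNIV. \<Prod>i\<in>UNIV. a i (\<sigma> i)) =
    (\<Sum>C\<in>UNIV. (- 1) ^ card C * (\<Prod>j\<in>UNIV. \<Sum>i\<in>-C. a i j))"
proof -
  have "(\<Prod>j\<in>UNIV. \<Sum>i\<in>-C. a i j) = (\<Sum>\<tau> | \<tau> \<in> UNIV \<and> C \<subseteq> - range \<tau>. \<Prod>j\<in>UNIV. a (\<tau> j) j)" for C
  proof -
    have "(\<Prod>j\<in>UNIV. \<Sum>i\<in>-C. a i j) = (\<Sum>\<tau>\<in>(\<Pi>\<^sub>E j\<in>UNIV. - C). \<Prod>j\<in>UNIV. a (\<tau> j) j)"
      by (rule prod_sum_PiE) auto
    moreover have "(\<Pi>\<^sub>E j\<in>UNIV. - C) = {\<tau> :: 'n \<Rightarrow> 'n. \<tau> \<in> UNIV \<and> C \<subseteq> - range \<tau>}"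
      by (auto simp: PiE_def)
    ultimately show ?thesis by (simp only:)
  qed
  then have "(\<Sum>C\<in>UNIV. (- 1) ^ card C * (\<Prod>j\<in>UNIV. \<Sum>i\<in>-C. a i j)) =
      (\<Sum>C\<in>UNIV. \<Sum>\<tau> | \<tau> \<in> UNIV \<and> C \<subseteq> - range \<tau>. (- 1) ^ card C * (\<Prod>j\<in>UNIV. a (\<tau> j) j))"
    by (simp add: sum_distrib_left)
  also have "\<dots> = (\<Sum>\<tau>\<in>UNIV. \<Sum>C | C \<in> UNIV \<and> C \<subseteq> - range \<tau>. (- 1) ^ card C * (\<Prod>j\<in>UNIV. a (\<tau> j) j))"
    by (rule sum.swap_restrict) simp_all
  also have "\<dots> = (\<Sum>\<tau>\<in>UNIV. (\<Sum>C\<in>Pow (- range \<tau>). (- 1) ^ card C) * (\<Prod>j\<in>UNIV. a (\<tau> j) j))"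
    by (simp add: sum_distrib_right Pow_def)
  also have "\<dots> = (\<Sum>\<tau>\<in>UNIV. if \<tau> permutes UNIV then \<Prod>j\<in>UNIV. a (\<tau> j) j else 0)"
  proof (rule sum.cong)
    fix \<tau> :: "'n \<Rightarrow> 'n"
    have "\<tau> permutes UNIV \<longleftrightarrow> - range \<tau> = {}"
    proof
      assume "- range \<tau> = {}"
      then have "bij \<tau>" using finite_UNIV_surj_inj[of \<tau>] by (auto simp: bij_def)
      then show "\<tau> permutes UNIV" by (intro bij_imp_permutes) auto
    qed (auto dest: permutes_surj)
    then show "(\<Sum>C\<in>Pow (- range \<tau>). (- 1) ^ card C) * (\<Prod>j\<in>UNIV. a (\<tau> j) j) =
        (if \<tau> permutes UNIV then \<Prod>j\<in>UNIV. a (\<tau> j) j else 0)"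
      by (subst sum_signed_subsets) simp_all
  qed simp
  also have "\<dots> = (\<Sum>\<tau> | \<tau> permutes UNIV. \<Prod>j\<in>UNIV. a (\<tau> j) j)"
    by (simp add: sum.If_cases)
  \<comment> \<open>Passing to inverse permutations exchanges rows and columns.\<close>
  also have "\<dots> = (\<Sum>\<tau> | \<tau> permutes UNIV. \<Prod>j\<in>UNIV. a (inv_into UNIV \<tau> j) j)"
    by (rule sum_permutations_inverse)
  also have "\<dots> = (\<Sum>\<tau> | \<tau> permutes UNIV. \<Prod>j\<in>UNIV. a j (\<tau> j))"
  proof (rule sum.cong)
    fix \<tau> :: "'n \<Rightarrow> 'n" assume "\<tau> \<in> {\<tau>. \<tau> permutes UNIV}"
    then have \<tau>: "\<tau> permutes UNIV" by simp
    have "(\<Prod>j\<in>UNIV. a (inv_into UNIV \<tau> j) j) = (\<Prod>j\<in>UNIV. a (inv_into UNIV \<tau> (\<tau> j)) (\<tau> j))"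
      using prod.permute[OF \<tau>, of "\<lambda>j. a (inv_into UNIV \<tau> j) j"] by (simp add: o_def)
    then show "(\<Prod>j\<in>UNIV. a (inv_into UNIV \<tau> j) j) = (\<Prod>j\<in>UNIV. a j (\<tau> j))"
      by (simp add: permutes_inverses(2)[OF \<tau>])
  qed simp
  finally show ?thesis by simp
qed

text \<open>The polynomials on n-tuples of points as the n-fold tensor power of the polynomials on
  points: each factor of a product involves the coordinates of one member of the tuple.\<close>

inductive prodsum :: "'b set \<Rightarrow> (('n::finite \<times> 'b \<Rightarrow> complex) \<Rightarrow> complex) \<Rightarrow> bool" for B where
  zero: "prodsum B (\<lambda>_. 0)"
| step: "prodsum B h \<Longrightarrow> (\<And>i. q i \<in> generated_algebra {\<lambda>p. p b | b. b \<in> B}) \<Longrightarrow>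
    prodsum B (\<lambda>p. h p + (\<Prod>i\<in>UNIV. q i (\<lambda>b. p (i, b))))"

lemma prodsum_pure:
  assumes "\<And>i. q i \<in> generated_algebra {\<lambda>p. p b | b. b \<in> B}"
  shows "prodsum B (\<lambda>p. \<Prod>i\<in>UNIV. q i (\<lambda>b. p (i, b)))"
  using prodsum.step[OF prodsum.zero, of q B] assms by simp

lemma prodsum_add: "prodsum B h' \<Longrightarrow> prodsum B h \<Longrightarrow> prodsum B (\<lambda>p. h p + h' p)"
proof (induction rule: prodsum.induct)
  case (step h' q)
  then have "prodsum B (\<lambda>p. (h p + h' p) + (\<Prod>i\<in>UNIV. q i (\<lambda>b. p (i, b))))"
    by (intro prodsum.step) simp_all
  then show ?case by (simp only: add.assoc)
qed simp

lemma prodsum_mult_pure: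
  "prodsum B h \<Longrightarrow> (\<And>i. q i \<in> generated_algebra {\<lambda>p. p b | b. b \<in> B}) \<Longrightarrow>
    prodsum B (\<lambda>p. h p * (\<Prod>i\<in>UNIV. q i (\<lambda>b. p (i, b))))"
proof (induction rule: prodsum.induct)
  case zero
  then show ?case using prodsum.zero by simp
next
  case (step h q')
  then have "prodsum B (\<lambda>p. h p * (\<Prod>i\<in>UNIV. q i (\<lambda>b. p (i, b))) + (\<Prod>i\<in>UNIV. (\<lambda>i u. q' i u * q i u) i (\<lambda>b. p (i, b))))"
    by (intro prodsum.step ga_mult) simp_all
  then show ?case by (simp add: prod.distrib distrib_right)
qed

lemma prodsum_mult: "prodsum B h' \<Longrightarrow> prodsum B h \<Longrightarrow> prodsum B (\<lambda>p. h p * h' p)"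
proof (induction rule: prodsum.induct)
  case zero
  then show ?case using prodsum.zero by simp
next
  case (step h' q)
  then have "prodsum B (\<lambda>p. h p * h' p + h p * (\<Prod>i\<in>UNIV. q i (\<lambda>b. p (i, b))))"
    by (intro prodsum_add prodsum_mult_pure) simp_all
  then show ?case by (simp add: distrib_left)
qed

lemma generated_algebra_prodsum:
  assumes "h \<in> generated_algebra {\<lambda>p :: 'n::finite \<times> 'b \<Rightarrow> complex. p k | k. k \<in> UNIV \<times> B}"
  shows "prodsum B h"
proof -
  have single: "prodsum B (\<lambda>p. f (\<lambda>b. p (i, b)))" if "f \<in> generated_algebra {\<lambda>p. p b | b. b \<in> B}" for f and i :: 'n
  proof -
    have "prodsum B (\<lambda>p. \<Prod>j\<in>UNIV. (if j = i then f else (\<lambda>_. 1)) (\<lambda>b. p (j, b)))"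
      by (rule prodsum_pure) (simp add: that generated_algebra.const)
    moreover have "(\<Prod>j\<in>UNIV. (if j = i then f else (\<lambda>_. 1)) (\<lambda>b. p (j, b))) = f (\<lambda>b. p (i, b))" for p
    proof -
      have "(\<Prod>j\<in>UNIV. (if j = i then f else (\<lambda>_. 1)) (\<lambda>b. p (j, b))) = (\<Prod>j\<in>UNIV. if j = i then f (\<lambda>b. p (j, b)) else 1)"
        by (rule prod.cong) auto
      then show ?thesis by simp
    qed
    ultimately show ?thesis by simp
  qed
  from assms show ?thesis
  proof induction
    case (const c)
    show ?case by (rule single[OF generated_algebra.const])
  next
    case (gen f)
    then obtain i b where "f = (\<lambda>p. p (i, b))" "b \<in> B" by blast
    then show ?case using single[of "\<lambda>p. p b" i] by (auto intro: generated_algebra.gen)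
  next
    case (add f g)
    then show ?case using prodsum_add[of B g f] by (simp add: plus_fun_def)
  next
    case (mult f g)
    then show ?case using prodsum_mult[of B g f] by (simp add: times_fun_def)
  qed
qed

section \<open>Averages over the symmetric group\<close>

context lie_setting
begin

text \<open>A tuple of functionals is stored by its values p (i, b) on the basis. Such tuples are
  points of an affine space, to which the Nullstellensatz applies.\<close>

definition weight_of :: "('n \<times> 'a \<Rightarrow> complex) \<Rightarrow> 'n \<Rightarrow> 'a \<Rightarrow> complex" where
  "weight_of p i x = (\<Sum>b\<in>B. representation B x b * p (i, b))"

definition weights :: "('n \<times> 'a \<Rightarrow> complex) set" where
  "weights = {p. \<forall>i. character (weight_of p i)}"

lemma weight_of_functional: "additive_functional (weight_of p i)"
  using coordinate_functional
  by (simp add: additive_functional_def weight_of_def distrib_right sum.distrib sum_distrib_left mult.assoc)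

lemma weight_of_basis: "b \<in> B \<Longrightarrow> weight_of p i b = p (i, b)"
  using finite_Basis independent_Basis
  by (simp add: weight_of_def representation_basis if_distrib[of "\<lambda>c. c * _"] cong: if_cong)

lemma weight_of_functionals:
  assumes "\<And>i. additive_functional (w i)"
  shows "weight_of (\<lambda>(i, b). w i b) = w"
  by (rule ext)+ (simp add: weight_of_def functional_basis_expansion[OF assms])

lemma weight_of_permute: "weight_of (\<lambda>(i, b). p (\<sigma> i, b)) = (\<lambda>i. weight_of p (\<sigma> i))"
  by (simp add: weight_of_def fun_eq_iff)

lemma polynomial_on_basis:
  assumes "f \<in> generated_algebra {\<lambda>p. p b | b. b \<in> B}" "\<And>b. b \<in> B \<Longrightarrow> u b = v b"
  shows "f u = f v"
  using assms(1) by induction (auto simp: assms(2))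

text \<open>By linearity h may be a product of polynomials f i in the single weights. Its sum over
  all permutations is the permanent of the values of f i at the j-th weight, and Ryser's formula
  writes it as a signed sum of norms of partial sums of the f i, each of which extends to an
  invariant. The sum is not divided by the number of permutations.\<close>

lemma reynolds:
  fixes h :: "('n::finite \<times> 'a \<Rightarrow> complex) \<Rightarrow> complex"
  assumes "h \<in> generated_algebra {\<lambda>p. p k | k. k \<in> UNIV \<times> B}"
  shows "\<exists>q. invariant_poly q \<and>
    (\<forall>p. (\<Sum>\<sigma> | \<sigma> permutes UNIV. h (\<lambda>(i, b). p (\<sigma> i, b))) = q (diagrep (weight_of p)))"
  using generated_algebra_prodsum[OF assms]
proof (induction rule: prodsum.induct)
  case zero
  then show ?case by (intro exI[of _ "\<lambda>_. 0"]) (simp add: invariant_poly_const)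
next
  case (step h f)
  from step.IH obtain q0 where q0: "invariant_poly q0"
    "\<forall>p. (\<Sum>\<sigma> | \<sigma> permutes UNIV. h (\<lambda>(i, b). p (\<sigma> i, b))) = q0 (diagrep (weight_of p))" by (elim exE conjE)
  have "\<exists>q :: ('a \<Rightarrow> complex^'n^'n) \<Rightarrow> complex. invariant_poly q \<and> (\<forall>w. q (diagrep w) = (\<Prod>j\<in>UNIV. \<Sum>i\<in>-C. f i (w j)))" for C
  proof (rule norm_invariant)
    show "(\<lambda>u. \<Sum>i\<in>-C. f i u) \<in> generated_algebra {\<lambda>p. p b | b. b \<in> B}"
      by (intro ga_sum step.hyps(2))
  qed
  then have "\<forall>C. \<exists>q :: ('a \<Rightarrow> complex^'n^'n) \<Rightarrow> complex. invariant_poly q \<and> (\<forall>w. q (diagrep w) = (\<Prod>j\<in>UNIV. \<Sum>i\<in>-C. f i (w j)))" ..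
  from choice[OF this] obtain q :: "'n set \<Rightarrow> ('a \<Rightarrow> complex^'n^'n) \<Rightarrow> complex"
    where "\<forall>C. invariant_poly (q C) \<and> (\<forall>w. q C (diagrep w) = (\<Prod>j\<in>UNIV. \<Sum>i\<in>-C. f i (w j)))" by (rule exE)
  then have q: "\<And>C. invariant_poly (q C)" "\<And>C w. q C (diagrep w) = (\<Prod>j\<in>UNIV. \<Sum>i\<in>-C. f i (w j))"
    by simp_all
  let ?q = "\<lambda>\<rho>. q0 \<rho> + (\<Sum>C\<in>UNIV. (- 1) ^ card C * q C \<rho>)"
  have "invariant_poly ?q"
    by (intro invariant_poly_add invariant_poly_sum invariant_poly_mult invariant_poly_const q0(1) q(1))
  moreover have "(\<Sum>\<sigma> | \<sigma> permutes UNIV. \<Prod>i\<in>UNIV. f i (\<lambda>b. p (\<sigma> i, b))) =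
      (\<Sum>C\<in>UNIV. (- 1) ^ card C * q C (diagrep (weight_of p)))" for p
  proof -
    have "f i (weight_of p j) = f i (\<lambda>b. p (j, b))" for i j
      by (rule polynomial_on_basis[OF step.hyps(2)]) (rule weight_of_basis)
    then show ?thesis unfolding q(2) by (simp only: permanent_ryser[of "\<lambda>i j. f i (\<lambda>b. p (j, b))"])
  qed
  ultimately show ?case by (intro exI[of _ ?q]) (simp add: sum.distrib q0(2))
qed

lemma invariant_poly_weights:
  fixes \<rho> :: "'a \<Rightarrow> complex^'n::finite^'n"
  assumes "\<rho> \<in> lie_homs smul bracket"
  shows "\<exists>p\<in>weights. \<forall>q. invariant_poly q \<longrightarrow> q \<rho> = q (diagrep (weight_of p))"
proof -
  obtain S w r where nf: "normal_form \<rho> S w r" using ex_normal_form[OF assms] by blast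
  have w: "\<forall>i. character (w i)" by (rule normal_form_gauge(1)[OF assms nf])
  then have "weight_of (\<lambda>(i, b). w i b) = w" by (intro weight_of_functionals) (simp add: character_def)
  then show ?thesis
    using w invariant_poly_degeneration[OF _ assms nf] by (intro bexI[of _ "\<lambda>(i, b). w i b"]) (simp_all add: weights_def)
qed

lemma polynomial_on_weights:
  fixes q :: "('a \<Rightarrow> complex^'n::finite^'n) \<Rightarrow> complex"
  assumes "q \<in> generated_algebra hom_coordinates"
  shows "(\<lambda>p. q (diagrep (weight_of p))) \<in> generated_algebra {\<lambda>p. p k | k. k \<in> UNIV \<times> B}"
  using assms
proof induction
  case (gen f)
  then obtain x i j where f: "f = (\<lambda>\<rho>. \<rho> x $ i $ j)" by (auto simp: hom_coordinates_def)
  have "(\<lambda>p. weight_of p i x) \<in> generated_algebra {\<lambda>p. p k | k. k \<in> UNIV \<times> B}"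
    unfolding weight_of_def by (intro ga_sum ga_mult generated_algebra.const generated_algebra.gen) blast
  then show ?case by (cases "i = j") (simp_all add: f diagrep_def dmat_def generated_algebra.const)
qed (auto intro: generated_algebra.const ga_add ga_mult)

section \<open>The ring of invariants and its maximal ideals\<close>

lemma invariants_simps:
  fixes f :: "('a \<Rightarrow> complex^'n::finite^'n) \<Rightarrow> complex"
  shows "on_set (lie_homs smul bracket) (\<lambda>_. c :: complex) \<in> invariants (lie_homs smul bracket :: ('a \<Rightarrow> complex^'n^'n) set)"
    and "f \<in> invariants (lie_homs smul bracket) \<Longrightarrow> g \<in> invariants (lie_homs smul bracket) \<Longrightarrow> f + g \<in> invariants (lie_homs smul bracket)"
    and "f \<in> invariants (lie_homs smul bracket) \<Longrightarrow> g \<in> invariants (lie_homs smul bracket) \<Longrightarrow> f * g \<in> invariants (lie_homs smul bracket)"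
proof -
  show "on_set (lie_homs smul bracket) (\<lambda>_. c :: complex) \<in> invariants (lie_homs smul bracket :: ('a \<Rightarrow> complex^'n^'n) set)"
    unfolding invariants_eq by (intro imageI CollectI invariant_poly_const)
next
  assume "f \<in> invariants (lie_homs smul bracket)" "g \<in> invariants (lie_homs smul bracket)"
  then obtain q q' where q: "invariant_poly q" "invariant_poly q'" "f = on_set (lie_homs smul bracket) q" "g = on_set (lie_homs smul bracket) q'"
    unfolding invariants_eq by blast
  have "f + g = on_set (lie_homs smul bracket) (\<lambda>\<rho>. q \<rho> + q' \<rho>)"
    "f * g = on_set (lie_homs smul bracket) (\<lambda>\<rho>. q \<rho> * q' \<rho>)" by (auto simp: q(3,4) on_set_def)
  then show "f + g \<in> invariants (lie_homs smul bracket)" "f * g \<in> invariants (lie_homs smul bracket)"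
    unfolding invariants_eq
    using invariant_poly_add[OF q(1,2)] invariant_poly_mult[OF q(1,2)] by auto
qed

lemma invariants_outside: "f \<in> invariants H \<Longrightarrow> \<rho> \<notin> H \<Longrightarrow> f \<rho> = 0"
  by (auto simp: invariants_def on_set_def)

lemma invariants_scale:
  fixes f :: "('a \<Rightarrow> complex^'n::finite^'n) \<Rightarrow> complex"
  assumes "f \<in> invariants (lie_homs smul bracket)"
  shows "(\<lambda>\<rho>. c * f \<rho>) \<in> invariants (lie_homs smul bracket)"
proof -
  have "(\<lambda>\<rho>. c * f \<rho>) = on_set (lie_homs smul bracket) (\<lambda>_. c) * f"
    using invariants_outside[OF assms] by (auto simp: on_set_def fun_eq_iff)
  then show ?thesis using invariants_simps(3)[OF invariants_simps(1) assms] by simp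
qed

lemma ring_invariants:
  "ring (fun_ring (lie_homs smul bracket) (invariants (lie_homs smul bracket :: ('a \<Rightarrow> complex^'n::finite^'n) set)))"
  (is "ring ?R")
proof (rule ringI)
  let ?A = "invariants (lie_homs smul bracket :: ('a \<Rightarrow> complex^'n^'n) set)"
  have zero: "0 \<in> ?A" using invariants_simps(1)[where c = 0] by (simp add: on_set_def zero_fun_def)
  show "abelian_group ?R"
  proof (rule abelian_groupI)
    fix f assume f: "f \<in> carrier ?R"
    then have "(\<lambda>\<rho>. - 1 * f \<rho>) \<in> ?A" by (intro invariants_scale) (simp add: fun_ring_def)
    then show "\<exists>g\<in>carrier ?R. g \<oplus>\<^bsub>?R\<^esub> f = \<zero>\<^bsub>?R\<^esub>"
      by (intro bexI[of _ "\<lambda>\<rho>. - 1 * f \<rho>"]) (simp_all add: fun_ring_def fun_eq_iff)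
  qed (simp_all add: fun_ring_def zero invariants_simps(2) add_ac del: plus_fun_apply)
  show "Group.monoid ?R"
  proof (rule Group.monoidI)
    fix f assume f: "f \<in> carrier ?R"
    then have "f \<rho> = 0" if "\<rho> \<notin> lie_homs smul bracket" for \<rho>
      using invariants_outside that by (simp add: fun_ring_def)
    then show "\<one>\<^bsub>?R\<^esub> \<otimes>\<^bsub>?R\<^esub> f = f" "f \<otimes>\<^bsub>?R\<^esub> \<one>\<^bsub>?R\<^esub> = f"
      by (auto simp: fun_ring_def on_set_def fun_eq_iff)
  qed (simp_all add: fun_ring_def invariants_simps(1,3) mult_ac del: times_fun_apply)
qed (simp_all add: fun_ring_def fun_eq_iff algebra_simps)

lemma git_quotient_map_maximal:
  fixes \<rho> :: "'a \<Rightarrow> complex^'n::finite^'n"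
  assumes \<rho>: "\<rho> \<in> lie_homs smul bracket"
  shows "git_quotient_map (lie_homs smul bracket) \<rho> \<in> git_quotient_points (lie_homs smul bracket)"
proof -
  let ?H = "lie_homs smul bracket :: ('a \<Rightarrow> complex^'n^'n) set"
  let ?R = "fun_ring ?H (invariants ?H)"
  let ?I = "git_quotient_map ?H \<rho>"
  have 1: "on_set ?H (\<lambda>_. 1) \<in> invariants ?H" "on_set ?H (\<lambda>_. 1) \<notin> ?I"
    using \<rho> invariants_simps(1) by (auto simp: git_quotient_map_def on_set_def)
  have I: "ideal ?I ?R"
  proof (rule idealI[OF ring_invariants])
    interpret R: ring ?R by (rule ring_invariants)
    show "subgroup ?I (add_monoid ?R)"
    proof (rule R.add.subgroupI)
      show "?I \<subseteq> carrier ?R" by (auto simp: fun_ring_def git_quotient_map_def)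
      have "0 \<in> ?I"
        using invariants_simps(1)[where c = 0] by (simp add: git_quotient_map_def on_set_def zero_fun_def)
      then show "?I \<noteq> {}" by blast
      show "f \<oplus>\<^bsub>?R\<^esub> g \<in> ?I" if "f \<in> ?I" "g \<in> ?I" for f g
        using that invariants_simps(2)[of f g] by (simp add: fun_ring_def git_quotient_map_def)
      show "\<ominus>\<^bsub>?R\<^esub> f \<in> ?I" if f: "f \<in> ?I" for f
      proof -
        have m: "(\<lambda>\<rho>. - 1 * f \<rho>) \<in> ?I" using f invariants_scale[of f "- 1"] by (simp add: git_quotient_map_def)
        have "\<ominus>\<^bsub>?R\<^esub> f = (\<lambda>\<rho>. - 1 * f \<rho>)"
        proof (rule R.minus_equality)
          show "(\<lambda>\<rho>. - 1 * f \<rho>) \<oplus>\<^bsub>?R\<^esub> f = \<zero>\<^bsub>?R\<^esub>" by (simp add: fun_ring_def fun_eq_iff)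
          show "f \<in> carrier ?R" "(\<lambda>\<rho>. - 1 * f \<rho>) \<in> carrier ?R"
            using f m by (simp_all add: fun_ring_def git_quotient_map_def)
        qed
        then show ?thesis using m by simp
      qed
    qed
    show "g \<otimes>\<^bsub>?R\<^esub> f \<in> ?I" "f \<otimes>\<^bsub>?R\<^esub> g \<in> ?I" if "f \<in> ?I" "g \<in> carrier ?R" for f g
      using that invariants_simps(3)[of f g] invariants_simps(3)[of g f]
      by (simp_all add: fun_ring_def git_quotient_map_def)
  qed
  have "maximalideal ?I ?R"
  proof (rule maximalidealI[OF I])
    show "carrier ?R \<noteq> ?I" using 1 by (auto simp: fun_ring_def)
    fix J assume J: "ideal J ?R" "?I \<subseteq> J" "J \<subseteq> carrier ?R"
    interpret J: ideal J ?R by (rule J(1))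
    show "J = ?I \<or> J = carrier ?R"
    proof (cases "J = ?I")
      case False
      then obtain f where f: "f \<in> J" "f \<notin> ?I" using J(2) by blast
      have fA: "f \<in> invariants ?H" using f(1) J(3) by (auto simp: fun_ring_def)
      then have nz: "f \<rho> \<noteq> 0" using f(2) by (simp add: git_quotient_map_def)
      have "carrier ?R \<subseteq> J"
      proof
        fix g assume "g \<in> carrier ?R"
        then have g: "g \<in> invariants ?H" by (simp add: fun_ring_def)
        \<comment> \<open>With this constant, g minus c f vanishes at \<rho> and so lies in the
          smaller ideal; adding c f back shows that g is in J.\<close>
        let ?c = "g \<rho> / f \<rho>"
        have c: "on_set ?H (\<lambda>_. ?c) \<in> carrier ?R" using invariants_simps(1) by (simp add: fun_ring_def)
        have "g + (\<lambda>x. - ?c * f x) \<in> ?I"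
          using invariants_simps(2)[OF g invariants_scale[OF fA, of "- ?c"]] nz by (simp add: git_quotient_map_def)
        then have "g + (\<lambda>x. - ?c * f x) \<in> J" using J(2) by blast
        from additive_subgroup.a_closed[OF J.additive_subgroup_axioms this J.I_l_closed[OF f(1) c]]
        have "(g + (\<lambda>x. - ?c * f x)) + on_set ?H (\<lambda>_. ?c) * f \<in> J" by (simp add: fun_ring_def)
        moreover have "(g + (\<lambda>x. - ?c * f x)) + on_set ?H (\<lambda>_. ?c) * f = g"
          using invariants_outside[OF fA] by (auto simp: on_set_def fun_eq_iff)
        ultimately show "g \<in> J" by (simp only:)
      qed
      then show ?thesis using J(3) by blast
    qed simp
  qed
  then show ?thesis by (simp add: git_quotient_points_def)
qed

text \<open>The ideal of polynomials in the coordinates of \<open>n\<close>-tuples of weights that is generated by the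
  pullback of \<open>I\<close> and by the equations of the variety of such tuples.\<close>

inductive pulled_back :: "(('a \<Rightarrow> complex^'n::finite^'n) \<Rightarrow> complex) set \<Rightarrow> (('n \<times> 'a \<Rightarrow> complex) \<Rightarrow> complex) \<Rightarrow> bool"
  for I where
  zero: "h \<in> generated_algebra {\<lambda>p. p k | k. k \<in> UNIV \<times> B} \<Longrightarrow> (\<And>p. p \<in> weights \<Longrightarrow> h p = 0) \<Longrightarrow> pulled_back I h"
| step: "pulled_back I h \<Longrightarrow> r \<in> generated_algebra {\<lambda>p. p k | k. k \<in> UNIV \<times> B} \<Longrightarrow>
    invariant_poly q \<Longrightarrow> on_set (lie_homs smul bracket) q \<in> I \<Longrightarrow>
    pulled_back I (\<lambda>p. h p + r p * q (diagrep (weight_of p)))"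

lemma pulled_back_polynomial:
  "pulled_back I h \<Longrightarrow> h \<in> generated_algebra {\<lambda>p. p k | k. k \<in> UNIV \<times> B}"
proof (induction rule: pulled_back.induct)
  case (step h r q)
  then have "q \<in> generated_algebra hom_coordinates" by (simp only: invariant_poly_def)
  then show ?case by (intro ga_add ga_mult polynomial_on_weights step)
qed

lemma pulled_back_add: "pulled_back I h' \<Longrightarrow> pulled_back I h \<Longrightarrow> pulled_back I (\<lambda>p. h p + h' p)"
proof (induction rule: pulled_back.induct)
  case (step h' r q)
  then have "pulled_back I (\<lambda>p. (h p + h' p) + r p * q (diagrep (weight_of p)))"
    by (intro pulled_back.step) simp_all
  then show ?case by (simp only: add.assoc)
next
  case (zero h')
  from zero(3,1,2) show ?case
  proof (induction rule: pulled_back.induct)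
    case (zero h)
    show ?case by (rule pulled_back.zero, rule ga_add[OF zero(1,3)]) (simp add: zero(2,4))
  next
    case (step h r q)
    then have "pulled_back I (\<lambda>p. (h p + h' p) + r p * q (diagrep (weight_of p)))"
      by (intro pulled_back.step) simp_all
    then show ?case by (simp only: ac_simps)
  qed
qed

lemma pulled_back_mult:
  "pulled_back I h \<Longrightarrow> s \<in> generated_algebra {\<lambda>p. p k | k. k \<in> UNIV \<times> B} \<Longrightarrow> pulled_back I (\<lambda>p. s p * h p)"
proof (induction rule: pulled_back.induct)
  case (zero h)
  show ?case by (rule pulled_back.zero, rule ga_mult[OF zero(3,1)]) (simp add: zero(2))
next
  case (step h r q)
  then have "pulled_back I (\<lambda>p. s p * h p + (s p * r p) * q (diagrep (weight_of p)))"
    by (intro pulled_back.step ga_mult) simp_all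
  then show ?case by (simp add: distrib_left mult.assoc)
qed

lemma weights_permute: "p \<in> weights \<Longrightarrow> (\<lambda>(i, b). p (\<sigma> i, b)) \<in> weights"
  by (simp add: weights_def weight_of_permute)

text \<open>The ideal of polynomials pulled back from I has a common zero p0. The equations it
  contains make p0 a tuple of characters, all of I vanishes at the corresponding diagonal
  representation, and maximality of I turns the inclusion into an equality.\<close>

lemma maximal_ideal_point:
  fixes I :: "(('a \<Rightarrow> complex^'n::finite^'n) \<Rightarrow> complex) set"
  assumes "I \<in> git_quotient_points (lie_homs smul bracket)"
  shows "I \<in> git_quotient_map (lie_homs smul bracket) ` lie_homs smul bracket"
proof -
  let ?H = "lie_homs smul bracket :: ('a \<Rightarrow> complex^'n^'n) set"
  let ?K = "fun_ring ?H (invariants ?H)"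
  let ?R0 = "generated_algebra {\<lambda>p :: 'n \<times> 'a \<Rightarrow> complex. p k | k. k \<in> UNIV \<times> B}"
  let ?av = "\<lambda>h p. \<Sum>\<sigma> | \<sigma> permutes UNIV. h (\<lambda>(i, b). p (\<sigma> i, b))"
  interpret I: maximalideal I "fun_ring ?H (invariants ?H)" using assms by (simp add: git_quotient_points_def)
  have sub: "I \<subseteq> invariants ?H" using I.a_subset by (simp add: fun_ring_def)
  have mult: "f * g \<in> I" if "f \<in> I" "g \<in> invariants ?H" for f g
    using I.I_r_closed[OF that(1), of g] that(2) by (simp add: fun_ring_def)
  \<comment> \<open>Invariants take the same value at all permutations of a tuple of weights, so an
    element of I can be taken out of the average, and the average of its coefficient is an invariant
    by \<open>reynolds\<close>. The equations of the variety of weights average to 0 because the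
    variety is stable under permutations.\<close>
  have averaged: "\<exists>f\<in>I. \<forall>p\<in>weights. ?av h p = f (diagrep (weight_of p))" if "pulled_back I h" for h
    using that
  proof (induction rule: pulled_back.induct)
    case (zero h)
    have "0 \<in> I" using additive_subgroup.zero_closed[OF I.additive_subgroup_axioms] by (simp add: fun_ring_def)
    moreover have "?av h p = 0" if "p \<in> weights" for p
      by (rule sum.neutral) (intro ballI zero(2) weights_permute that)
    ultimately show ?case by (intro bexI[of _ 0]) simp_all
  next
    case (step h r q)
    from step.IH obtain f where f: "f \<in> I" "\<forall>p\<in>weights. ?av h p = f (diagrep (weight_of p))" by (elim bexE)
    from reynolds[OF step.hyps(2)] obtain q' where
      q': "invariant_poly q'" "\<forall>p. ?av r p = q' (diagrep (weight_of p))" by (elim exE conjE)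
    let ?f = "f + on_set ?H q * on_set ?H q'"
    have "on_set ?H q' \<in> invariants ?H" using q'(1) unfolding invariants_eq by blast
    then have fI: "?f \<in> I" using additive_subgroup.a_closed[OF I.additive_subgroup_axioms f(1) mult[OF step.hyps(4)]] by (simp add: fun_ring_def)
    have "?av (\<lambda>p. h p + r p * q (diagrep (weight_of p))) p = ?f (diagrep (weight_of p))" if p: "p \<in> weights" for p
    proof -
      have c: "\<And>i. character (weight_of p i)" using p by (simp add: weights_def)
      have "q (diagrep (weight_of (\<lambda>(i, b). p (\<sigma> i, b)))) = q (diagrep (weight_of p))" if "\<sigma> permutes UNIV" for \<sigma>
        unfolding weight_of_permute by (rule invariant_poly_permutation[OF step.hyps(3) permutes_bij[OF that] c])
      then have "?av (\<lambda>p. h p + r p * q (diagrep (weight_of p))) p = ?av h p + ?av r p * q (diagrep (weight_of p))"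
        by (simp add: sum.distrib sum_distrib_right)
      also have "\<dots> = ?f (diagrep (weight_of p))"
        using f(2) p q'(2) diagrep_lie_homs[of "weight_of p", OF c] by (simp add: on_set_def)
      finally show ?thesis .
    qed
    then show ?case using fI by (intro bexI[of _ ?f]) blast+
  qed
  have not_one: "\<not> pulled_back I (\<lambda>_. 1)"
  proof
    assume "pulled_back I (\<lambda>_. 1)"
    from averaged[OF this] obtain f where f: "f \<in> I" "\<forall>p\<in>weights. ?av (\<lambda>_. 1) p = f (diagrep (weight_of p))" by (elim bexE)
    let ?N = "of_nat (card {\<sigma> :: 'n \<Rightarrow> 'n. \<sigma> permutes UNIV}) :: complex"
    obtain q where q: "invariant_poly q" "f = on_set ?H q" using f(1) sub unfolding invariants_eq by blast
    \<comment> \<open>The average of 1 counts the permutations. This determines f at diagonal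
      representations, and thereby everywhere, since an invariant depends on the weights
      only.\<close>
    have fN: "f \<rho> = ?N" if \<rho>: "\<rho> \<in> ?H" for \<rho>
    proof -
      from invariant_poly_weights[OF \<rho>] obtain p where
        p: "p \<in> weights" "\<forall>q. invariant_poly q \<longrightarrow> q \<rho> = q (diagrep (weight_of p))" by (elim bexE)
      have "diagrep (weight_of p) \<in> ?H" using p(1) by (intro diagrep_lie_homs) (simp add: weights_def)
      then have "f \<rho> = f (diagrep (weight_of p))" using p(2) q \<rho> by (simp add: on_set_def)
      then show ?thesis using bspec[OF f(2) p(1)] by simp
    qed
    have "id \<in> {\<sigma> :: 'n \<Rightarrow> 'n. \<sigma> permutes UNIV}" by (simp add: permutes_id)
    then have N: "?N \<noteq> 0" by (metis card_gt_0_iff empty_iff finite of_nat_eq_0_iff less_irrefl)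
    have "f * on_set ?H (\<lambda>_. inverse ?N) = on_set ?H (\<lambda>_. 1)"
      using fN N by (auto simp: on_set_def fun_eq_iff)
    moreover have "f * on_set ?H (\<lambda>_. inverse ?N) \<in> I" by (rule mult[OF f(1) invariants_simps(1)])
    ultimately have "\<one>\<^bsub>?K\<^esub> \<in> I" by (simp only: fun_ring_def monoid.select_convs)
    then show False using I.I_notcarr I.one_imp_carrier by blast
  qed
  have "proper_ideal ?R0 (Collect (pulled_back I))"
    unfolding proper_ideal_def
    using pulled_back_polynomial pulled_back_add pulled_back_mult not_one
      pulled_back.zero[OF generated_algebra.const, of 0 I] by blast
  from nullstellensatz[OF _ this] obtain p0 where "\<forall>f\<in>Collect (pulled_back I). f p0 = 0"
    using finite_Basis by (auto simp: finite_cartesian_product)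
  then have p0: "\<And>f. pulled_back I f \<Longrightarrow> f p0 = 0" by simp
  \<comment> \<open>Vanishing on brackets is one of the equations that the rule
    \<open>pulled_back.zero\<close> puts into the ideal.\<close>
  have "weight_of p0 i (bracket x y) = 0" for i x y
  proof (rule p0, rule pulled_back.zero)
    show "(\<lambda>p. weight_of p i (bracket x y)) \<in> ?R0"
      unfolding weight_of_def by (intro ga_sum ga_mult generated_algebra.const generated_algebra.gen) blast
    show "weight_of p i (bracket x y) = 0" if "p \<in> weights" for p
      using that by (simp add: weights_def character_def)
  qed
  then have c: "character (weight_of p0 i)" for i by (simp add: character_def weight_of_functional)
  let ?\<rho> = "diagrep (weight_of p0)"
  have \<rho>: "?\<rho> \<in> ?H" by (rule diagrep_lie_homs) (rule c)
  have le: "I \<subseteq> git_quotient_map ?H ?\<rho>"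
  proof
    fix f assume f: "f \<in> I"
    then obtain q where q: "invariant_poly q" "f = on_set ?H q" using sub unfolding invariants_eq by blast
    have "pulled_back I (\<lambda>p. 0 + 1 * q (diagrep (weight_of p)))"
      by (rule pulled_back.step[OF pulled_back.zero]) (use f q in \<open>simp_all add: generated_algebra.const\<close>)
    from p0[OF this] have "f ?\<rho> = 0" using \<rho> by (simp add: q(2) on_set_def)
    then show "f \<in> git_quotient_map ?H ?\<rho>" using f sub by (auto simp: git_quotient_map_def)
  qed
  have "maximalideal (git_quotient_map ?H ?\<rho>) ?K"
    using git_quotient_map_maximal[OF \<rho>] by (simp add: git_quotient_points_def)
  then interpret J: maximalideal "git_quotient_map ?H ?\<rho>" "fun_ring ?H (invariants ?H)" .
  have "I = git_quotient_map ?H ?\<rho>"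
    using le I.I_maximal[OF J.is_ideal] J.I_notcarr J.a_subset by auto
  then show ?thesis using \<rho> by blast
qed

lemma git_quotient_map_surj:
  "git_quotient_map (lie_homs smul bracket :: ('a \<Rightarrow> complex^'n::finite^'n) set) ` lie_homs smul bracket =
     git_quotient_points (lie_homs smul bracket)"
  using git_quotient_map_maximal maximal_ideal_point by blast

lemma git_quotient_map_eq_iff:
  fixes \<rho> \<rho>' :: "'a \<Rightarrow> complex^'n::finite^'n"
  assumes "\<rho> \<in> lie_homs smul bracket" "\<rho>' \<in> lie_homs smul bracket"
  shows "git_quotient_map (lie_homs smul bracket) \<rho> = git_quotient_map (lie_homs smul bracket) \<rho>' \<longleftrightarrow>
    (\<forall>q. invariant_poly q \<longrightarrow> q \<rho> = q \<rho>')"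
proof
  let ?H = "lie_homs smul bracket :: ('a \<Rightarrow> complex^'n^'n) set"
  assume eq: "git_quotient_map ?H \<rho> = git_quotient_map ?H \<rho>'"
  show "\<forall>q. invariant_poly q \<longrightarrow> q \<rho> = q \<rho>'"
  proof (intro allI impI)
    fix q :: "('a \<Rightarrow> complex^'n^'n) \<Rightarrow> complex" assume q: "invariant_poly q"
    let ?f = "on_set ?H (\<lambda>x. q x + (- q \<rho>))"
    have "?f \<in> invariants ?H"
      unfolding invariants_eq by (intro imageI CollectI invariant_poly_add q invariant_poly_const)
    then have "?f \<in> git_quotient_map ?H \<rho>" using assms(1) by (simp add: git_quotient_map_def on_set_def)
    then have "?f \<rho>' = 0" unfolding eq by (simp add: git_quotient_map_def)
    then show "q \<rho> = q \<rho>'" using assms(2) by (simp add: on_set_def)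
  qed
next
  assume "\<forall>q. invariant_poly q \<longrightarrow> q \<rho> = q \<rho>'"
  then have "f \<rho> = f \<rho>'" if "f \<in> invariants (lie_homs smul bracket)" for f
    using that assms unfolding invariants_eq by (auto simp: on_set_def)
  then have "f \<in> git_quotient_map (lie_homs smul bracket) \<rho> \<longleftrightarrow> f \<in> git_quotient_map (lie_homs smul bracket) \<rho>'" for f
    unfolding git_quotient_map_def mem_Collect_eq by (metis (no_types))
  then show "git_quotient_map (lie_homs smul bracket) \<rho> = git_quotient_map (lie_homs smul bracket) \<rho>'"
    by blast
qed

end

section \<open>The correspondence\<close>

text \<open>Both sides are compared with the existence of a permutation that matches the weights of
  two chosen normal forms.\<close>

lemma (in lie_setting) git_quotient_map_eq_iff_iso:
  fixes \<rho> \<rho>' :: "'a \<Rightarrow> complex^'n::finite^'n"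
  assumes \<rho>: "\<rho> \<in> lie_homs smul bracket" and \<rho>': "\<rho>' \<in> lie_homs smul bracket"
  shows "git_quotient_map (lie_homs smul bracket) \<rho> = git_quotient_map (lie_homs smul bracket) \<rho>' \<longleftrightarrow>
    left_module_iso (diff_op_ring U) (connection_module U (rep_form smul B U \<theta> \<rho>))
      (connection_module U (rep_form smul B U \<theta> \<rho>'))"
proof -
  obtain S w r where nf: "normal_form \<rho> S w r" using ex_normal_form[OF \<rho>] by blast
  obtain S' w' r' where nf': "normal_form \<rho>' S' w' r'" using ex_normal_form[OF \<rho>'] by blast
  have w: "character (w i)" and w': "character (w' i)" for i
    using normal_form_gauge(1)[OF \<rho> nf] normal_form_gauge(1)[OF \<rho>' nf'] by simp_all
  obtain G H where g: "gauge (rep_form smul B U \<theta> \<rho>) G H (logs w)"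
    using normal_form_gauge(2)[OF \<rho> nf] by blast
  obtain G' H' where g': "gauge (rep_form smul B U \<theta> \<rho>') G' H' (logs w')"
    using normal_form_gauge(2)[OF \<rho>' nf'] by blast
  have deg: "q \<rho> = q (diagrep w)" "q \<rho>' = q (diagrep w')" if "invariant_poly q" for q
    by (rule invariant_poly_degeneration[OF that \<rho> nf], rule invariant_poly_degeneration[OF that \<rho>' nf'])
  have "git_quotient_map (lie_homs smul bracket) \<rho> = git_quotient_map (lie_homs smul bracket) \<rho>' \<longleftrightarrow>
      (\<exists>\<sigma>. bij \<sigma> \<and> (\<forall>i. w' i = w (\<sigma> i)))"
    unfolding git_quotient_map_eq_iff[OF \<rho> \<rho>']
  proof
    assume *: "\<forall>q. invariant_poly q \<longrightarrow> q \<rho> = q \<rho>'"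
    show "\<exists>\<sigma>. bij \<sigma> \<and> (\<forall>i. w' i = w (\<sigma> i))"
    proof (rule invariants_determine_weights)
      show "additive_functional (w' i)" "additive_functional (w i)" for i
        using w[of i] w'[of i] by (simp_all add: character_def)
      show "q (diagrep w') = q (diagrep w)" if "invariant_poly q" for q
        using * deg[OF that] that by metis
    qed
  next
    assume "\<exists>\<sigma>. bij \<sigma> \<and> (\<forall>i. w' i = w (\<sigma> i))"
    then obtain \<sigma> where \<sigma>: "bij \<sigma>" "w' = (\<lambda>i. w (\<sigma> i))" by blast
    show "\<forall>q. invariant_poly q \<longrightarrow> q \<rho> = q \<rho>'"
    proof (intro allI impI)
      fix q :: "('a \<Rightarrow> complex^'n^'n) \<Rightarrow> complex" assume q: "invariant_poly q"
      show "q \<rho> = q \<rho>'" unfolding deg[OF q] \<sigma>(2) by (rule invariant_poly_permutation[OF q \<sigma>(1) w, symmetric])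
    qed
  qed
  also have "\<dots> \<longleftrightarrow> left_module_iso (diff_op_ring U) (connection_module U (rep_form smul B U \<theta> \<rho>))
      (connection_module U (rep_form smul B U \<theta> \<rho>'))"
  proof
    assume "\<exists>\<sigma>. bij \<sigma> \<and> (\<forall>i. w' i = w (\<sigma> i))"
    then obtain \<sigma> where \<sigma>: "bij \<sigma>" "\<And>i. w' i = w (\<sigma> i)" by blast
    have "logs w' i = logs w (\<sigma> i)" for i by (simp only: logs_def \<sigma>(2))
    from iso_if_weights[OF g g' \<sigma>(1) this]
    show "left_module_iso (diff_op_ring U) (connection_module U (rep_form smul B U \<theta> \<rho>))
      (connection_module U (rep_form smul B U \<theta> \<rho>'))" .
  next
    assume "left_module_iso (diff_op_ring U) (connection_module U (rep_form smul B U \<theta> \<rho>))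
      (connection_module U (rep_form smul B U \<theta> \<rho>'))"
    with g g' w w' show "\<exists>\<sigma>. bij \<sigma> \<and> (\<forall>i. w' i = w (\<sigma> i))" by (rule weights_if_iso)
  qed
  finally show ?thesis .
qed

text \<open>P is X modulo equality under f, and the classes of r are the images under m of the
  fibres of f. That R is an equivalence on Q is not assumed; it follows from the comparison with f
  and the surjectivity of m.\<close>

lemma induced_bijection:
  assumes f: "f ` X = P" and m: "m ` X = Q" and r: "r = {(a, b). a \<in> Q \<and> b \<in> Q \<and> R a b}"
    and iff: "\<And>x y. x \<in> X \<Longrightarrow> y \<in> X \<Longrightarrow> f x = f y \<longleftrightarrow> R (m x) (m y)"
  shows "\<exists>\<Phi>. bij_betw \<Phi> P (Q // r) \<and> (\<forall>x\<in>X. \<Phi> (f x) = r `` {m x})"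
proof -
  have img: "r `` {m x} = m ` {y\<in>X. f x = f y}" if "x \<in> X" for x
    using that iff m by (auto simp: r)
  have class_eq: "r `` {m x} = r `` {m y} \<longleftrightarrow> f x = f y" if "x \<in> X" "y \<in> X" for x y
  proof
    assume "r `` {m x} = r `` {m y}"
    moreover have "m y \<in> r `` {m y}" using that(2) img by auto
    ultimately have "m y \<in> r `` {m x}" by simp
    then have "R (m x) (m y)" by (simp add: r)
    then show "f x = f y" using that iff by simp
  qed (simp add: img that)
  define \<Phi> where "\<Phi> p = r `` {m (inv_into X f p)}" for p
  have \<Phi>: "\<Phi> (f x) = r `` {m x}" if "x \<in> X" for x
    using that class_eq[of "inv_into X f (f x)" x] by (simp add: \<Phi>_def inv_into_into f_inv_into_f)
  have "inj_on \<Phi> P"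
    using class_eq by (auto simp: inj_on_def f[symmetric] \<Phi>)
  moreover have "\<Phi> ` P = Q // r"
    unfolding quotient_def f[symmetric] m[symmetric] by (auto simp: \<Phi> image_image)
  ultimately show ?thesis using \<Phi> by (auto simp: bij_betw_def)
qed

theorem theorem0p1:
  fixes smul :: "complex \<Rightarrow> 'a::ab_group_add \<Rightarrow> 'a"
    and B :: "'a set"
    and bracket :: "'a \<Rightarrow> 'a \<Rightarrow> 'a"
    and U :: "(complex^'m^'m::finite) set"
    and \<theta> :: "'a \<Rightarrow> 'm operator"
    and H :: "('a \<Rightarrow> complex^'n^'n::finite) set"
    and \<M> :: "('a \<Rightarrow> complex^'n^'n) \<Rightarrow> ('m operator, 'm fn^'n) module"
  assumes "nilpotent_lie_algebra smul B bracket"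
    and "unipotent_group U"
    and "lie_algebra_identification smul bracket U \<theta>"
  defines "H \<equiv> lie_homs smul bracket"
    and "\<M> \<equiv> (\<lambda>\<rho>. connection_module U (rep_form smul B U \<theta> \<rho>))"
  shows "git_quotient_map H ` H = git_quotient_points H \<and>
    (\<exists>\<Phi>. bij_betw \<Phi> (git_quotient_points H) (invariant_D_modules U // D_module_iso_rel U) \<and>
         (\<forall>\<rho>\<in>H. \<M> \<rho> \<in> invariant_D_modules U \<and>
                \<Phi> (git_quotient_map H \<rho>) = D_module_iso_rel U `` {\<M> \<rho>})) \<and>
    (\<forall>\<rho>\<^sub>1\<in>H. \<forall>\<rho>\<^sub>2\<in>H. git_quotient_map H \<rho>\<^sub>1 = git_quotient_map H \<rho>\<^sub>2 \<longleftrightarrow>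
         left_module_iso (diff_op_ring U) (\<M> \<rho>\<^sub>1) (\<M> \<rho>\<^sub>2))"
proof -
  interpret lie_setting smul B bracket U \<theta>
    by (intro lie_setting.intro lie_setting_axioms.intro assms(1-3))
  have surj: "git_quotient_map H ` H = git_quotient_points H"
    unfolding H_def by (rule git_quotient_map_surj)
  have modules: "\<M> ` H = invariant_D_modules U"
    unfolding H_def \<M>_def by (rule invariant_D_modules_eq[symmetric])
  have iff: "git_quotient_map H \<rho> = git_quotient_map H \<rho>' \<longleftrightarrow> left_module_iso (diff_op_ring U) (\<M> \<rho>) (\<M> \<rho>')"
    if "\<rho> \<in> H" "\<rho>' \<in> H" for \<rho> \<rho>'
    using that unfolding H_def \<M>_def by (rule git_quotient_map_eq_iff_iso)
  have "\<exists>\<Phi>. bij_betw \<Phi> (git_quotient_points H) (invariant_D_modules U // D_module_iso_rel U) \<and>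
      (\<forall>\<rho>\<in>H. \<Phi> (git_quotient_map H \<rho>) = D_module_iso_rel U `` {\<M> \<rho>})"
    by (rule induced_bijection[OF surj modules D_module_iso_rel_def iff])
  then obtain \<Phi> where \<Phi>: "bij_betw \<Phi> (git_quotient_points H) (invariant_D_modules U // D_module_iso_rel U)"
      "\<forall>\<rho>\<in>H. \<Phi> (git_quotient_map H \<rho>) = D_module_iso_rel U `` {\<M> \<rho>}" by (elim exE conjE)
  have "\<M> \<rho> \<in> invariant_D_modules U" if "\<rho> \<in> H" for \<rho>
    using imageI[OF that, of \<M>] by (simp only: modules)
  then show ?thesis
    by (intro conjI surj exI[of _ \<Phi>] \<Phi>(1) ballI iff bspec[OF \<Phi>(2)])
qed

end
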